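(* Let $\Omega=\{x\in\mathbb{R}^2: 1/2<|x|<1\}$, let $x_0\in\mathbb{R}^2$ with $|x_0|=1/2$ (so $x_0\in\partial\Omega$), let $\beta\in(-1/2,+\infty)$, and let $a,b,c,d$ be positive real numbers. Then there exist constants $C=C(a,b,c,d,\beta,x_0,\Omega)$ and $C'=C'(a,b,c,d,\beta,x_0,\Omega)$, depending only on the indicated quantities, such that the following holds. Let $V,W:\Omega\to\mathbb{R}$ be Lipschitz functions with $$0<a\le V\le b,\qquad \|\nabla V\|_{L^\infty(\Omega)}\le A=\frac{(\beta+1)a}{2},$$ $$0<c\le W\le d,\qquad \|\nabla W\|_{L^\infty(\Omega)}\le B=\frac{c}{2}.$$ Let $u,v\in W_0^{1,1}(\Omega)$ be such that $e^u\in L^1(\Omega)$, $|x-x_0|^{2\beta}e^v\in L^1(\Omega)$, and $(u,v)$ is a solution, in the sense of distributions, of $$-\Delta u=|x-x_0|^{2\beta}\,V e^{v}\ \text{ in }\Omega,\qquad -\Delta v=W e^{u}\ \text{ in }\Omega,\qquad u=v=0\ \text{ on }\partial\Omega.$$ Then $$\int_\Omega e^u\,dx\le C\qquad\text{and}\qquad \int_\Omega |x-x_0|^{2\beta}e^v\,dx\le C'.$$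
   Context: $\Delta=\partial_{11}+\partial_{22}$ is the Laplacian on $\mathbb{R}^2$, with $\Omega$ the open annulus of radii $1$ and $1/2$ centered at the origin. The functions $u,v$ are real-valued. The equations are understood in the sense of distributions on $\Omega$ (the right-hand sides are in $L^1(\Omega)$), and the Dirichlet boundary condition is encoded by $u,v\in W_0^{1,1}(\Omega)$. *)

theory Defs
  imports "HOL-Analysis.Analysis" "HOL-Probability.Essential_Supremum"
begin

text \<open>
  Functions on an open set are represented by total functions; only their values on that set
  are ever used. All integrals and null sets refer to (completed) Lebesgue measure.
\<close>

definition partial_deriv :: "'a::euclidean_space \<Rightarrow> ('a \<Rightarrow> real) \<Rightarrow> 'a \<Rightarrow> real" where
  "partial_deriv i f x = frechet_derivative f (at x) i"

definition grad :: "('a::euclidean_space \<Rightarrow> real) \<Rightarrow> 'a \<Rightarrow> 'a" where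
  "grad f x = (\<Sum>i\<in>Basis. partial_deriv i f x *\<^sub>R i)"

definition laplacian :: "('a::euclidean_space \<Rightarrow> real) \<Rightarrow> 'a \<Rightarrow> real" where
  "laplacian f x = (\<Sum>i\<in>Basis. partial_deriv i (partial_deriv i f) x)"

primrec Ck :: "nat \<Rightarrow> ('a::euclidean_space \<Rightarrow> real) \<Rightarrow> bool" where
  "Ck 0 f \<longleftrightarrow> continuous_on UNIV f"
| "Ck (Suc k) f \<longleftrightarrow> f differentiable_on UNIV \<and> (\<forall>i\<in>Basis. Ck k (partial_deriv i f))"

text \<open>The space $C_c^\infty(S)$ for open $S$, its elements being extended by zero.\<close>

definition test_functions :: "'a::euclidean_space set \<Rightarrow> ('a \<Rightarrow> real) set" where
  "test_functions S =
     {\<phi>. (\<forall>k. Ck k \<phi>) \<and> compact (closure {x. \<phi> x \<noteq> 0}) \<and> closure {x. \<phi> x \<noteq> 0} \<subseteq> S}"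

definition locally_integrable ::
    "'a::euclidean_space set \<Rightarrow> ('a \<Rightarrow> 'b::{banach, second_countable_topology}) \<Rightarrow> bool" where
  "locally_integrable S f \<longleftrightarrow>
     (\<forall>K. compact K \<and> K \<subseteq> S \<longrightarrow> integrable (lebesgue_on K) f)"

text \<open>The gradient of \<open>u\<close> on \<open>S\<close> in the sense of distributions is the vector field \<open>G\<close>.\<close>

definition has_weak_gradient ::
    "'a::euclidean_space set \<Rightarrow> ('a \<Rightarrow> real) \<Rightarrow> ('a \<Rightarrow> 'a) \<Rightarrow> bool" where
  "has_weak_gradient S u G \<longleftrightarrow>
     locally_integrable S u \<and> locally_integrable S G \<and>
     (\<forall>\<phi>\<in>test_functions S. \<forall>i\<in>Basis.
        (LINT x|lebesgue_on S. u x * partial_deriv i \<phi> x)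
          = - (LINT x|lebesgue_on S. (G x \<bullet> i) * \<phi> x))"

text \<open>
  The essential supremum is infinite on functions that are not measurable, so a finite bound
  includes measurability of \<open>norm \<circ> F\<close>.
\<close>

definition Linfty_norm :: "'a::euclidean_space set \<Rightarrow> ('a \<Rightarrow> 'b::real_normed_vector) \<Rightarrow> ereal" where
  "Linfty_norm S F = esssup (lebesgue_on S) (\<lambda>x. ereal (norm (F x)))"

text \<open>$W_0^{1,1}(S)$: the closure of $C_c^\infty(S)$ in $W^{1,1}(S)$.\<close>

definition W11_0 :: "'a::euclidean_space set \<Rightarrow> ('a \<Rightarrow> real) set" where
  "W11_0 S =
     {u. \<exists>G. integrable (lebesgue_on S) u \<and> integrable (lebesgue_on S) G \<and>
             has_weak_gradient S u G \<and>
             (\<exists>\<phi>. (\<forall>n. \<phi> n \<in> test_functions S) \<and>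
                  (\<lambda>n. (LINT x|lebesgue_on S. \<bar>\<phi> n x - u x\<bar>)
                      + (LINT x|lebesgue_on S. norm (grad (\<phi> n) x - G x)))
                    \<longlonglongrightarrow> 0)}"

text \<open>$-\Delta u = f$ on \<open>S\<close> in the sense of distributions.\<close>

definition neg_laplacian_distr ::
    "'a::euclidean_space set \<Rightarrow> ('a \<Rightarrow> real) \<Rightarrow> ('a \<Rightarrow> real) \<Rightarrow> bool" where
  "neg_laplacian_distr S u f \<longleftrightarrow>
     locally_integrable S u \<and> locally_integrable S f \<and>
     (\<forall>\<phi>\<in>test_functions S.
        - (LINT x|lebesgue_on S. u x * laplacian \<phi> x) = (LINT x|lebesgue_on S. f x * \<phi> x))"

definition annulus :: "(real ^ 2) set" where
  "annulus = {x. 1/2 < norm x \<and> norm x < 1}"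

end

theory Submission
  imports Defs
begin

text \<open>
  Testing with the first Dirichlet eigenfunction \<open>phi\<close> of \<open>r^2\<close> times the Laplacian bounds the masses
  away from the boundary circles, so that only the mass near each circle is left to be estimated.
  There \<open>u\<close> and \<open>v\<close> are, up to bounded errors, Green potentials of the right-hand sides \<open>f\<close> of the
  first and \<open>g\<close> of the second equation, with the Green function \<open>G\<close> of the disc or of its exterior.
  Choose a radial field \<open>h(x) x\<close> that vanishes on the circle and has positive divergence there.
  The Pohozaev energy, the integral of \<open>f h (x . grad v) + g h (x . grad u)\<close>, is bounded below because the
  symmetrised kernel \<open>h(x) x . grad_x G(x,z) + h(z) z . grad_z G(x,z)\<close> is nonnegative, while an
  integration by parts turns it into minus the integral of \<open>div (h |x-x0|^(2 beta) V x) e^v\<close> plus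
  that of its counterpart for \<open>u\<close>. Since \<open>x0\<close> lies on the circle and \<open>beta > -1/2\<close>, this divergence
  is a positive multiple of \<open>|x-x0|^(2 beta)\<close> up to a term controlled by \<open>phi\<close>.
\<close>

section \<open>Smooth functions\<close>

text \<open>The solutions are only in \<open>W11_0\<close>, so neither a pointwise Green
  representation nor a pointwise gradient is at hand. Therefore both logarithms of the Green
  function carry a parameter \<open>eps\<close>: the result is smooth, minus its Laplacian is an
  approximate identity of mass \<open>kappa\<close>, and the potentials \<open>pot\<close> formed
  with it are differentiable along rays and tend to \<open>u\<close> and \<open>v\<close> almost
  everywhere near the circle, along a sequence of values of \<open>eps\<close>. The integration by
  parts is carried out on these potentials. Letting \<open>eps\<close> tend to 0 rests on the
  integrability of \<open>exp (4 * u)\<close> and \<open>exp (4 * v)\<close> near the circle, which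
  is obtained for each solution separately and without a uniform constant. All uniformity comes from
  the eigenfunction: every error term, be it from the cutoff, from the gradient of \<open>V\<close>
  or from the distance to the circle, is dominated by \<open>phi\<close>. The condition
  \<open>\<beta> > - 1/2\<close> is exactly what makes \<open>1 + min 0 (2 * \<beta>)\<close>
  positive, the lower bound for the divergence at the circle.\<close>

lemma partial_deriv_eqI:
  assumes "(f has_derivative D) (at x)"
  shows "partial_deriv i f x = D i"
  using frechet_derivative_at[OF assms] by (simp add: partial_deriv_def)

lemma partial_deriv_GDERIV: "GDERIV f x :> D ==> partial_deriv i f x = i \<bullet> D"
  unfolding gderiv_def by (rule partial_deriv_eqI)

lemma GDERIV_grad:
  assumes "f differentiable at x"
  shows "GDERIV f x :> grad f x"
proof -
  obtain D where D: "(f has_derivative D) (at x)"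
    using assms by (auto simp: differentiable_def)
  interpret linear D using D by (rule has_derivative_linear)
  have "D h = h \<bullet> grad f x" for h
  proof -
    have "D h = D (\<Sum>i\<in>Basis. (h \<bullet> i) *\<^sub>R i)" by (simp add: euclidean_representation)
    also have "\<dots> = (\<Sum>i\<in>Basis. (h \<bullet> i) * D i)" by (simp add: sum scale)
    also have "\<dots> = h \<bullet> grad f x"
      by (simp add: grad_def inner_sum_right partial_deriv_eqI[OF D] mult.commute)
    finally show ?thesis .
  qed
  then have "D = (\<lambda>h. h \<bullet> grad f x)" by blast
  then show ?thesis using D by (simp add: gderiv_def)
qed

lemma grad_eqI: "GDERIV f x :> D ==> grad f x = D"
  by (simp add: grad_def partial_deriv_GDERIV inner_commute[of _ D] euclidean_representation)

lemma partial_deriv_cong: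
  assumes "open S" "x \<in> S" "!!y. y \<in> S ==> f y = g y"
  shows "partial_deriv i f x = partial_deriv i g x"
proof -
  have "(f has_derivative D) (at x) \<longleftrightarrow> (g has_derivative D) (at x)" for D
    using has_derivative_transform_within_open[OF _ assms(1,2), of f D UNIV g]
      has_derivative_transform_within_open[OF _ assms(1,2), of g D UNIV f] assms(3) by auto
  then show ?thesis by (simp add: partial_deriv_def frechet_derivative_def)
qed

lemma laplacian_GDERIV:
  assumes "open S" "x \<in> S" "!!y. y \<in> S ==> GDERIV f y :> F y"
    and "(F has_derivative F') (at x)"
  shows "laplacian f x = (\<Sum>i\<in>Basis. i \<bullet> F' i)"
proof -
  have "partial_deriv i (partial_deriv i f) x = i \<bullet> F' i" for i
  proof -
    have "partial_deriv i (partial_deriv i f) x = partial_deriv i (\<lambda>y. i \<bullet> F y) x"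
      using assms(1-3) by (intro partial_deriv_cong) (auto simp: partial_deriv_GDERIV)
    also have "\<dots> = i \<bullet> F' i"
      by (rule partial_deriv_eqI) (auto intro!: derivative_eq_intros assms(4))
    finally show ?thesis .
  qed
  then show ?thesis by (simp add: laplacian_def)
qed

text \<open>The local form of \<open>Ck\<close>. The logarithms, \<open>phi\<close> and their
  products with test functions are smooth on an open set only and become test functions after an
  extension by zero.\<close>

primrec Ck_on :: "nat => 'a::euclidean_space set => ('a => real) => bool" where
  "Ck_on 0 S f \<longleftrightarrow> continuous_on S f"
| "Ck_on (Suc k) S f \<longleftrightarrow> (\<forall>x\<in>S. f differentiable at x) \<and> (\<forall>i\<in>Basis. Ck_on k S (partial_deriv i f))"

lemma Ck_on_UNIV: "Ck_on k UNIV f \<longleftrightarrow> Ck k f"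
  by (induction k arbitrary: f) (auto simp: differentiable_on_def)

lemma Ck_on_cong:
  assumes "open S" "!!x. x \<in> S ==> f x = g x"
  shows "Ck_on k S f \<longleftrightarrow> Ck_on k S g"
  using assms(2)
proof (induction k arbitrary: f g)
  case 0
  then show ?case by (simp cong: continuous_on_cong)
next
  case (Suc k)
  have "f differentiable at x \<longleftrightarrow> g differentiable at x" if "x \<in> S" for x
    unfolding differentiable_def
    using has_derivative_transform_within_open[OF _ assms(1) that, of f _ UNIV g]
      has_derivative_transform_within_open[OF _ assms(1) that, of g _ UNIV f] Suc.prems
    by metis
  moreover have "Ck_on k S (partial_deriv i f) \<longleftrightarrow> Ck_on k S (partial_deriv i g)" for i
    by (rule Suc.IH) (use Suc.prems assms(1) in \<open>auto intro: partial_deriv_cong\<close>)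
  ultimately show ?case by auto
qed

lemma Ck_on_lower: "Ck_on (Suc k) S f ==> Ck_on k S f"
proof (induction k arbitrary: f)
  case 0
  then show ?case
    by (auto intro!: continuous_at_imp_continuous_on differentiable_imp_continuous_within)
qed auto

lemma Ck_on_Un:
  assumes "open S" "open T" "Ck_on k S f" "Ck_on k T f"
  shows "Ck_on k (S \<union> T) f"
  using assms(3,4) by (induction k arbitrary: f) (auto intro: continuous_on_open_Un assms(1,2))

lemma Ck_on_subset: "Ck_on k T f ==> S \<subseteq> T ==> Ck_on k S f"
  by (induction k arbitrary: f) (auto intro: continuous_on_subset)

lemma Ck_on_const [simp]: "open S ==> Ck_on k S (\<lambda>x. c)"
proof (induction k arbitrary: c)
  case (Suc k)
  have "partial_deriv i (\<lambda>x. c) = (\<lambda>x. 0)" for i :: 'a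
    by (rule ext) (simp add: partial_deriv_eqI[OF has_derivative_const])
  then show ?case using Suc by auto
qed auto

lemma Ck_on_inner [simp]: "open S ==> Ck_on k S (\<lambda>x. x \<bullet> b)"
proof (cases k)
  case (Suc n)
  assume "open S"
  have "partial_deriv i (\<lambda>x. x \<bullet> b) = (\<lambda>x. i \<bullet> b)" for i :: 'a
    by (rule ext, rule partial_deriv_eqI) (auto intro!: derivative_eq_intros)
  moreover have "(\<lambda>x. x \<bullet> b) differentiable at x" for x
    by (auto simp: differentiable_def intro!: exI derivative_eq_intros)
  ultimately show ?thesis using \<open>open S\<close> Suc by simp
qed (auto intro!: continuous_intros)

lemma Ck_on_add:
  assumes "open S" "Ck_on k S f" "Ck_on k S g"
  shows "Ck_on k S (\<lambda>x. f x + g x)"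
  using assms(2,3)
proof (induction k arbitrary: f g)
  case (Suc k)
  have "partial_deriv i (\<lambda>x. f x + g x) x = partial_deriv i f x + partial_deriv i g x"
    if "x \<in> S" for x i
    using Suc.prems that
    by (subst partial_deriv_GDERIV[OF GDERIV_add[OF GDERIV_grad GDERIV_grad]])
      (auto simp: partial_deriv_GDERIV[OF GDERIV_grad] inner_add_right)
  then show ?case
    using Suc Ck_on_cong[OF assms(1), of "partial_deriv i (\<lambda>x. f x + g x)"
        "\<lambda>x. partial_deriv i f x + partial_deriv i g x" k for i]
    by (auto intro: differentiable_add)
qed (auto intro: continuous_on_add)

lemma Ck_on_mult:
  assumes "open S" "Ck_on k S f" "Ck_on k S g"
  shows "Ck_on k S (\<lambda>x. f x * g x)"
  using assms(2,3)
proof (induction k arbitrary: f g)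
  case (Suc k)
  have *: "partial_deriv i (\<lambda>x. f x * g x) x = f x * partial_deriv i g x + g x * partial_deriv i f x"
    if "x \<in> S" for x i
    using Suc.prems that
    by (subst partial_deriv_GDERIV[OF GDERIV_mult[OF GDERIV_grad GDERIV_grad]])
      (auto simp: partial_deriv_GDERIV[OF GDERIV_grad] inner_add_right)
  have "Ck_on k S (\<lambda>x. f x * partial_deriv i g x + g x * partial_deriv i f x)" if "i \<in> Basis" for i
    using Suc that Ck_on_lower[of k S f] Ck_on_lower[of k S g]
    by (intro Ck_on_add[OF assms(1)] Suc.IH) auto
  then have "Ck_on k S (partial_deriv i (\<lambda>x. f x * g x))" if "i \<in> Basis" for i
    using Ck_on_cong[OF assms(1), of "partial_deriv i (\<lambda>x. f x * g x)"] * that by auto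
  then show ?case
    using Suc.prems by (auto intro: differentiable_mult)
qed (auto intro: continuous_on_mult)

lemma Ck_on_cmult: "open S ==> Ck_on k S f ==> Ck_on k S (\<lambda>x. c * f x)"
  by (intro Ck_on_mult) auto

lemma Ck_on_diff:
  assumes "open S" "Ck_on k S f" "Ck_on k S g"
  shows "Ck_on k S (\<lambda>x. f x - g x)"
  using Ck_on_add[OF assms(1,2) Ck_on_cmult[OF assms(1,3), of "-1"]] by simp

lemma Ck_on_sum:
  assumes "open S" "!!i. i \<in> I ==> Ck_on k S (f i)"
  shows "Ck_on k S (\<lambda>x. \<Sum>i\<in>I. f i x)"
  using assms(2) by (induction I rule: infinite_finite_induct) (auto intro: Ck_on_add Ck_on_const assms(1))

lemma Ck_on_inner_self: "open S ==> Ck_on k S (\<lambda>x. x \<bullet> x)"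
  by (subst euclidean_inner) (intro Ck_on_sum Ck_on_mult; simp)

text \<open>Explicit higher derivatives of \<open>F\<close> are avoided by a family
  \<open>FF\<close> that is closed under differentiation on \<open>T\<close>: the induction passes
  from \<open>F\<close> to \<open>F'\<close> inside the family and then uses the product rule. The
  families in use are \<open>ln\<close> with multiples of powers of the inverse, combinations of
  sine and cosine, and \<open>range flat_poly\<close>.\<close>

lemma Ck_on_compose:
  fixes F :: "real => real"
  assumes "open S" and FF: "!!F. F \<in> FF ==> \<exists>F'\<in>FF. \<forall>t\<in>T. (F has_real_derivative F' t) (at t)"
    and "g ` S \<subseteq> T" "Ck_on k S g" "F \<in> FF"
  shows "Ck_on k S (\<lambda>x. F (g x))"
  using assms(4,5)
proof (induction k arbitrary: F)
  case 0
  obtain F' where F': "\<forall>t\<in>T. (F has_real_derivative F' t) (at t)" using FF[OF 0(2)] by blast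
  then have "continuous_on T F"
    by (auto intro!: continuous_at_imp_continuous_on DERIV_isCont)
  then show ?case
    using 0 assms(3) continuous_on_compose2[of T F S g] by simp
next
  case (Suc k)
  obtain F' where F': "\<forall>t\<in>T. (F has_real_derivative F' t) (at t)" "F' \<in> FF"
    using FF[OF Suc(3)] by blast
  have gd: "GDERIV (\<lambda>x. F (g x)) x :> F' (g x) *\<^sub>R grad g x" if "x \<in> S" for x
  proof (rule GDERIV_DERIV_compose[where f = g and g = F])
    show "GDERIV g x :> grad g x" using that Suc.prems by (intro GDERIV_grad) simp
    show "(F has_real_derivative F' (g x)) (at (g x))" using that F'(1) assms(3) by blast
  qed
  have *: "partial_deriv i (\<lambda>x. F (g x)) x = F' (g x) * partial_deriv i g x" if "x \<in> S" for x i
  proof -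
    have "GDERIV g x :> grad g x" using that Suc.prems by (intro GDERIV_grad) simp
    then show ?thesis using gd[OF that] by (simp add: partial_deriv_GDERIV)
  qed
  have "Ck_on k S (\<lambda>x. F' (g x))"
    using Ck_on_lower[OF Suc.prems(1)] F'(2) by (rule Suc.IH)
  then have "Ck_on k S (\<lambda>x. F' (g x) * partial_deriv i g x)" if "i \<in> Basis" for i
    using Suc.prems(1) that by (intro Ck_on_mult[OF assms(1)]) simp_all
  then have "Ck_on k S (partial_deriv i (\<lambda>x. F (g x)))" if "i \<in> Basis" for i
    using that by (intro Ck_on_cong[OF assms(1) *, THEN iffD2]) simp_all
  moreover have "\<forall>x\<in>S. (\<lambda>x. F (g x)) differentiable at x"
    using gd unfolding gderiv_def differentiable_def by metis
  ultimately show ?case by auto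
qed

lemma Ck_on_ln:
  assumes "open S" "Ck_on k S g" "!!x. x \<in> S ==> g x > 0"
  shows "Ck_on k S (\<lambda>x. ln (g x))"
proof (rule Ck_on_compose[where F = ln and T = "{0<..}" and k = k, OF assms(1) _ _ assms(2),
      of "insert ln {\<lambda>t. c * inverse t ^ n | c n. True}"])
  fix F :: "real => real" assume F: "F \<in> insert ln {\<lambda>t. c * inverse t ^ n | c n. True}"
  show "\<exists>F'\<in>insert ln {\<lambda>t. c * inverse t ^ n | c n. True}. \<forall>t\<in>{0<..}. (F has_real_derivative F' t) (at t)"
  proof (cases "F = ln")
    case True
    show ?thesis
      unfolding True
      by (rule bexI[of _ "\<lambda>t. 1 * inverse t ^ 1"])
        (auto intro!: derivative_eq_intros exI[of _ 1] simp: divide_inverse)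
  next
    case False
    then obtain c n where F: "F = (\<lambda>t. c * inverse t ^ n)" using F by auto
    have "(F has_real_derivative (- c * real n) * inverse t ^ (n + 1)) (at t)" if "t > 0" for t
    proof (cases n)
      case (Suc m)
      have "((\<lambda>t. inverse t ^ n) has_real_derivative real n * (- (inverse t * inverse t) * inverse t ^ m)) (at t)"
        using DERIV_power[OF DERIV_inverse, of t n UNIV] that
        by (simp add: Suc numeral_2_eq_2 mult.assoc)
      from DERIV_cmult[OF this, of c] show ?thesis
        unfolding F Suc by (rule DERIV_cong) simp
    qed (simp add: F)
    then show ?thesis
      by (intro bexI[of _ "\<lambda>t. (- c * real n) * inverse t ^ (n + 1)"]) (simp, blast)
  qed
qed (use assms in auto)

lemma Ck_on_sin:
  assumes "open S" "Ck_on k S g"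
  shows "Ck_on k S (\<lambda>x. sin (g x))"
proof (rule Ck_on_compose[where F = sin and T = UNIV, OF assms(1) _ _ assms(2),
      of "{\<lambda>t. a * sin t + b * cos t | a b. True}"])
  show "sin \<in> {\<lambda>t. a * sin t + b * cos t | a b. True}"
    by (rule CollectI, rule exI[of _ 1], rule exI[of _ 0]) auto
  fix F :: "real => real" assume "F \<in> {\<lambda>t. a * sin t + b * cos t | a b. True}"
  then obtain a b where F: "F = (\<lambda>t. a * sin t + b * cos t)" by auto
  have "(F has_real_derivative (-b) * sin t + a * cos t) (at t)" for t
    unfolding F by (auto intro!: derivative_eq_intros)
  then show "\<exists>F'\<in>{\<lambda>t. a * sin t + b * cos t | a b. True}. \<forall>t\<in>UNIV. (F has_real_derivative F' t) (at t)"
    by (intro bexI[of _ "\<lambda>t. (-b) * sin t + a * cos t"]) blast+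
qed auto

text \<open>The standard function \<open>exp (- (1 / t))\<close>, flat at the origin, together with
  its multiples by polynomials in \<open>1 / t\<close>, so that derivatives stay in the
  family.\<close>

definition flat_poly :: "real poly => real => real" where
  "flat_poly p t = (if t <= 0 then 0 else poly p (1 / t) * exp (- (1 / t)))"

abbreviation flat :: "real => real" where
  "flat \<equiv> flat_poly 1"

lemma flat_eq: "flat t = (if t <= 0 then 0 else exp (- (1 / t)))"
  by (simp add: flat_poly_def)

lemma poly_exp_tendsto_0: "((\<lambda>x::real. poly p x * exp (- x)) \<longlongrightarrow> 0) at_top"
proof -
  have "((\<lambda>x::real. \<Sum>i\<le>degree p. coeff p i * (x ^ i / exp x)) \<longlongrightarrow> (\<Sum>i\<le>degree p. coeff p i * 0)) at_top"
    by (intro tendsto_intros tendsto_power_div_exp_0)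
  then show ?thesis
    by (simp add: poly_altdef sum_distrib_right sum_divide_distrib exp_minus divide_inverse mult.assoc)
qed

text \<open>In the variable \<open>s = 1 / t\<close> the chain rule gives
  \<open>poly p s * exp (- s)\<close> the factor \<open>s^2\<close>, hence the polynomial
  \<open>[:0, 0, 1:] * (p - pderiv p)\<close>. At the origin the difference quotient is again a
  polynomial in \<open>s\<close> times \<open>exp (- s)\<close>, which tends to 0 for large
  \<open>s\<close>.\<close>

lemma flat_poly_has_derivative:
  "(flat_poly p has_real_derivative flat_poly ([:0, 0, 1:] * (p - pderiv p)) t) (at t)"
proof -
  consider "t > 0" | "t < 0" | "t = 0" by linarith
  then show ?thesis
  proof cases
    case 1
    have "((\<lambda>t. poly p (1 / t) * exp (- (1 / t))) has_real_derivative
        flat_poly ([:0, 0, 1:] * (p - pderiv p)) t) (at t)"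
      using 1 by (auto intro!: derivative_eq_intros poly_DERIV
          simp: flat_poly_def field_simps power2_eq_square)
    then show ?thesis
      by (rule has_field_derivative_transform_within_open[of _ _ _ "{0<..}"])
        (use 1 in \<open>auto simp: flat_poly_def\<close>)
  next
    case 2
    have "((\<lambda>t. 0) has_real_derivative 0) (at t)" by auto
    then have "(flat_poly p has_real_derivative 0) (at t)"
      by (rule has_field_derivative_transform_within_open[of _ _ _ "{..<0}"])
        (use 2 in \<open>auto simp: flat_poly_def\<close>)
    then show ?thesis using 2 by (simp add: flat_poly_def)
  next
    case 3
    have "((\<lambda>x. poly ([:0, 1:] * p) x * exp (- x)) \<longlongrightarrow> 0) at_top"
      by (rule poly_exp_tendsto_0)
    then have "((\<lambda>t. poly ([:0, 1:] * p) (inverse t) * exp (- inverse t)) \<longlongrightarrow> 0) (at_right 0)"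
      by (rule filterlim_compose[OF _ filterlim_inverse_at_top_right])
    then have "((\<lambda>t. flat_poly p t / t) \<longlongrightarrow> 0) (at_right 0)"
      by (rule Lim_transform_eventually)
        (auto simp: flat_poly_def eventually_at_filter field_simps)
    moreover have "((\<lambda>t. flat_poly p t / t) \<longlongrightarrow> 0) (at_left 0)"
      by (rule Lim_transform_eventually[OF tendsto_const])
        (auto simp: flat_poly_def eventually_at_filter field_simps)
    ultimately have "((\<lambda>t. flat_poly p t / t) \<longlongrightarrow> 0) (at 0)"
      by (simp add: filterlim_split_at)
    then show ?thesis
      using 3 by (simp add: has_field_derivative_iff flat_poly_def)
  qed
qed

lemma Ck_on_flat:
  assumes "open S" "Ck_on k S g"
  shows "Ck_on k S (\<lambda>x. flat (g x))"
proof (rule Ck_on_compose[where F = flat and T = UNIV, OF assms(1) _ _ assms(2), of "range flat_poly"])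
  fix F assume "F \<in> range flat_poly"
  then obtain p where "F = flat_poly p" by blast
  then show "\<exists>F'\<in>range flat_poly. \<forall>t\<in>UNIV. (F has_real_derivative F' t) (at t)"
    by (intro bexI[of _ "flat_poly ([:0, 0, 1:] * (p - pderiv p))"] ballI)
      (simp only: flat_poly_has_derivative, rule rangeI)
qed auto

lemma continuous_on_flat [continuous_intros]:
  "continuous_on S g ==> continuous_on S (\<lambda>x. flat_poly p (g x))"
  by (rule continuous_on_compose2[of UNIV "flat_poly p"])
    (auto intro!: continuous_at_imp_continuous_on DERIV_isCont[OF flat_poly_has_derivative])

lemma flat_nonneg: "0 <= flat t" and flat_le_1: "flat t <= 1"
  by (auto simp: flat_poly_def)

lemma flat_mono: "s <= t ==> flat s <= flat t"
  by (auto simp: flat_poly_def intro!: divide_left_mono)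

text \<open>Smoothness is local: the extension is \<open>f\<close> on the open set \<open>S\<close>
  and 0 on the open complement of \<open>K\<close>, and these two sets cover the space.\<close>

lemma test_functions_extend:
  assumes "open S" "compact K" "K \<subseteq> S" "!!k. Ck_on k S f" "!!x. x \<in> S ==> x \<notin> K ==> f x = 0"
  shows "(\<lambda>x. if x \<in> S then f x else 0) \<in> test_functions S"
proof -
  let ?g = "\<lambda>x. if x \<in> S then f x else 0"
  have "closed K" using assms(2) by (rule compact_imp_closed)
  have supp: "closure {x. ?g x ~= 0} \<subseteq> K"
    by (rule closure_minimal) (use assms(5) \<open>closed K\<close> in auto)
  have "Ck k ?g" for k
  proof -
    have "Ck_on k S ?g" using assms(4) Ck_on_cong[OF assms(1), of ?g f] by auto
    moreover have "Ck_on k (- K) ?g"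
      using Ck_on_cong[of "-K" ?g "\<lambda>x. 0" k] \<open>closed K\<close> assms(5) by (auto simp: open_Compl)
    ultimately have "Ck_on k (S \<union> -K) ?g"
      using \<open>closed K\<close> assms(1) by (intro Ck_on_Un) auto
    moreover have "S \<union> -K = UNIV" using assms(3) by auto
    ultimately show ?thesis using Ck_on_UNIV[of k ?g] by simp
  qed
  moreover have "compact (closure {x. ?g x ~= 0})"
    using compact_Int_closed[OF assms(2) closed_closure, of "{x. ?g x ~= 0}"] supp
    by (simp add: Int_absorb1)
  ultimately show ?thesis using supp assms(3) by (auto simp: test_functions_def)
qed

section \<open>Test functions that only vanish on the boundary\<close>

lemma test_functionsD:
  assumes "\<phi> \<in> test_functions S"
  shows "Ck_on k UNIV \<phi>" "continuous_on T \<phi>" "\<phi> differentiable at x"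
    "compact (closure {x. \<phi> x ~= 0})" "closure {x. \<phi> x ~= 0} \<subseteq> S"
proof -
  have *: "Ck_on k UNIV \<phi>" for k using assms by (simp add: Ck_on_UNIV test_functions_def)
  show "Ck_on k UNIV \<phi>" by (rule *)
  show "continuous_on T \<phi>" using *[of 0] continuous_on_subset by auto
  show "\<phi> differentiable at x" using *[of 1] by simp
  show "compact (closure {x. \<phi> x ~= 0})" "closure {x. \<phi> x ~= 0} \<subseteq> S"
    using assms by (auto simp: test_functions_def)
qed

lemma partial_deriv_eq_0:
  assumes "x \<notin> closure {x. f x ~= 0}"
  shows "partial_deriv i f x = 0"
proof -
  have "partial_deriv i f x = partial_deriv i (\<lambda>_. 0) x"
  proof (rule partial_deriv_cong)
    show "open (- closure {x. f x ~= 0})" by auto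
    show "f y = 0" if "y \<in> - closure {x. f x ~= 0}" for y
      using that closure_subset[of "{x. f x ~= 0}"] by blast
  qed (use assms in auto)
  then show ?thesis by (simp add: partial_deriv_eqI[OF has_derivative_const])
qed

lemma test_functions_partial:
  assumes "\<phi> \<in> test_functions S" "i \<in> Basis"
  shows "partial_deriv i \<phi> \<in> test_functions S"
proof -
  have sub: "closure {x. partial_deriv i \<phi> x ~= 0} \<subseteq> closure {x. \<phi> x ~= 0}"
    by (rule closure_minimal) (use partial_deriv_eq_0[of _ \<phi> i] in auto)
  have "Ck k (partial_deriv i \<phi>)" for k
    using test_functionsD(1)[OF assms(1), of "Suc k"] assms(2) by (simp add: Ck_on_UNIV)
  moreover have "compact (closure {x. partial_deriv i \<phi> x ~= 0})"
    using compact_Int_closed[OF test_functionsD(4)[OF assms(1)] closed_closure, of "{x. partial_deriv i \<phi> x ~= 0}"] sub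
    by (simp add: Int_absorb1)
  ultimately show ?thesis using sub test_functionsD(5)[OF assms(1)] by (auto simp: test_functions_def)
qed

lemma test_function_outside: "\<phi> \<in> test_functions S ==> x \<notin> S ==> \<phi> x = 0"
  using test_functionsD(5)[of \<phi> S] closure_subset[of "{x. \<phi> x ~= 0}"] by auto

lemma test_function_bounded:
  assumes "\<phi> \<in> test_functions S"
  obtains B where "B > 0" "!!x. \<bar>\<phi> x\<bar> <= B"
proof -
  let ?K = "closure {x. \<phi> x ~= 0}"
  have "compact (\<phi> ` ?K)"
    by (intro compact_continuous_image test_functionsD[OF assms])
  then obtain B where B: "B > 0" "!!x. x \<in> ?K ==> norm (\<phi> x) <= B"
    using compact_imp_bounded bounded_pos by (metis imageI)
  have "\<bar>\<phi> x\<bar> <= B" for x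
    using B closure_subset[of "{x. \<phi> x ~= 0}"] by (cases "\<phi> x = 0") auto
  with B(1) that show ?thesis by blast
qed

lemma test_function_integrable_lborel:
  fixes \<phi> :: "'a::euclidean_space => real"
  assumes "\<phi> \<in> test_functions S"
  shows "integrable lborel \<phi>"
proof -
  have "integrable lborel (\<lambda>x. indicator (closure {x. \<phi> x ~= 0}) x *\<^sub>R \<phi> x)"
    by (rule borel_integrable_compact) (rule test_functionsD[OF assms])+
  moreover have "(\<lambda>x. indicator (closure {x. \<phi> x ~= 0}) x *\<^sub>R \<phi> x) = \<phi>"
    using closure_subset[of "{x. \<phi> x ~= 0}"] by (auto simp: indicator_def fun_eq_iff)
  ultimately show ?thesis by simp
qed

lemma test_function_measurable:
  "\<phi> \<in> test_functions S ==> \<phi> \<in> borel_measurable borel"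
  by (intro borel_measurable_continuous_onI test_functionsD)

lemma test_function_integral_lebesgue_on:
  fixes \<phi> :: "'a::euclidean_space => real"
  assumes "\<phi> \<in> test_functions S" "S \<in> sets lebesgue"
  shows "integral\<^sup>L (lebesgue_on S) \<phi> = integral\<^sup>L lborel \<phi>"
    "integrable (lebesgue_on S) \<phi>"
proof -
  have eq: "(\<lambda>x. indicator S x *\<^sub>R \<phi> x) = \<phi>"
    using test_function_outside[OF assms(1)] by (auto simp: indicator_def fun_eq_iff)
  have m: "\<phi> \<in> borel_measurable lborel" using test_function_measurable[OF assms(1)] by simp
  show "integral\<^sup>L (lebesgue_on S) \<phi> = integral\<^sup>L lborel \<phi>"
    using assms(2) by (simp add: integral_restrict_space eq integral_completion[OF m] del: real_scaleR_def)
  show "integrable (lebesgue_on S) \<phi>"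
    using assms(2) test_function_integrable_lborel[OF assms(1)]
    by (simp add: integrable_restrict_space eq integrable_completion[OF m] del: real_scaleR_def)
qed

section \<open>Differentiation under the integral sign and integration by parts for test
  functions\<close>

lemma GDERIV_line:
  assumes "GDERIV f (x + t *\<^sub>R i) :> D"
  shows "((\<lambda>t. f (x + t *\<^sub>R i)) has_real_derivative i \<bullet> D) (at t)"
proof -
  have "((\<lambda>t. f (x + t *\<^sub>R i)) has_derivative (\<lambda>h. (h *\<^sub>R i) \<bullet> D)) (at t)"
    using assms unfolding gderiv_def
    by (rule has_derivative_compose[rotated]) (auto intro!: derivative_eq_intros)
  moreover have "(\<lambda>h. (h *\<^sub>R i) \<bullet> D) = (*) (i \<bullet> D)" by auto
  ultimately show ?thesis by (simp add: has_field_derivative_def)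
qed

text \<open>Dominated convergence for difference quotients along sequences: the mean value
  inequality turns the bound \<open>B\<close> on the derivatives into the same bound on the
  quotients. Measurability of \<open>f' s0\<close> follows because it is a pointwise limit of such
  quotients.\<close>

lemma DERIV_integral:
  fixes f f' :: "real => 'a => real"
  assumes I: "a < s0" "s0 < b"
    and f: "!!s. a < s ==> s < b ==> integrable M (f s)"
    and d: "!!s z. a < s ==> s < b ==> z \<in> space M ==> ((\<lambda>s. f s z) has_real_derivative f' s z) (at s)"
    and B: "integrable M B" "!!s z. a < s ==> s < b ==> z \<in> space M ==> \<bar>f' s z\<bar> <= B z"
  shows "((\<lambda>s. LINT z|M. f s z) has_real_derivative (LINT z|M. f' s0 z)) (at s0)"
    "integrable M (f' s0)"
proof -
  have lip: "\<bar>f s z - f s0 z\<bar> <= B z * \<bar>s - s0\<bar>" if s: "a < s" "s < b" and z: "z \<in> space M" for s z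
  proof -
    have "norm (f s z - f s0 z) <= B z * norm (s - s0)"
      by (rule field_differentiable_bound[where S = "{a<..<b}" and f' = "\<lambda>s. f' s z"])
        (use d B(2) z s I in \<open>auto intro: has_field_derivative_at_within\<close>)
    then show ?thesis by simp
  qed
  have lim: "(\<lambda>n. (f (X n) z - f s0 z) / (X n - s0)) \<longlonglongrightarrow> f' s0 z"
    if "X \<longlonglongrightarrow> s0" "!!n. X n ~= s0" "z \<in> space M" for X z
  proof -
    have "((\<lambda>s. (f s z - f s0 z) / (s - s0)) \<longlongrightarrow> f' s0 z) (at s0)"
      using d[OF I that(3)] by (simp add: has_field_derivative_iff)
    moreover have "filterlim X (at s0) sequentially" using that by (auto simp: filterlim_at)
    ultimately show ?thesis by (rule filterlim_compose)
  qed
  have fm: "f' s0 \<in> borel_measurable M"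
  proof -
    define c where "c = (b - s0) / 2"
    define X where "X n = s0 + c / real (Suc n)" for n
    have c: "c > 0" using I by (simp add: c_def)
    have X: "a < X n" "X n < b" "X n ~= s0" for n
    proof -
      have 1: "c / real (Suc n) <= c" using c by (simp add: divide_le_eq)
      have 2: "c / real (Suc n) > 0" using c by simp
      have "s0 + c < b" using I by (simp add: c_def field_simps)
      then show "a < X n" "X n < b" "X n ~= s0" using 1 2 I unfolding X_def by linarith+
    qed
    have "X \<longlonglongrightarrow> s0 + 0"
      unfolding X_def divide_inverse by (intro tendsto_intros tendsto_mult_right_zero LIMSEQ_inverse_real_of_nat)
    then have "X \<longlonglongrightarrow> s0" by simp
    from lim[OF this X(3)] show ?thesis
      by (rule borel_measurable_LIMSEQ_real[where u = "\<lambda>n z. (f (X n) z - f s0 z) / (X n - s0)"])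
        (use f[OF X(1,2)] f[OF I] in \<open>auto simp: borel_measurable_integrable\<close>)
  qed
  show "integrable M (f' s0)"
    by (rule Bochner_Integration.integrable_bound[OF B(1) fm]) (use B(2)[OF I] abs_ge_self order.trans in \<open>fastforce intro!: AE_I2\<close>)
  show "((\<lambda>s. LINT z|M. f s z) has_real_derivative (LINT z|M. f' s0 z)) (at s0)"
    unfolding has_field_derivative_iff tendsto_at_iff_sequentially
  proof (intro allI impI)
    fix X :: "nat => real" assume X0: "\<forall>i. X i \<in> UNIV - {s0}" and Xl: "X \<longlonglongrightarrow> s0"
    have "eventually (\<lambda>n. a < X n \<and> X n < b) sequentially"
      using order_tendstoD[OF Xl] I by (auto intro: eventually_conj)
    then obtain N where N: "!!n. n >= N ==> a < X n \<and> X n < b" by (auto simp: eventually_sequentially)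
    have "(\<lambda>n. LINT z|M. (f (X (n + N)) z - f s0 z) / (X (n + N) - s0)) \<longlonglongrightarrow> (LINT z|M. f' s0 z)"
    proof (rule integral_dominated_convergence[OF fm _ B(1)])
      show "(\<lambda>z. (f (X (n + N)) z - f s0 z) / (X (n + N) - s0)) \<in> borel_measurable M" for n
        using f[of "X (n + N)"] N[of "n + N"] f[OF I] by auto
      show "AE z in M. (\<lambda>n. (f (X (n + N)) z - f s0 z) / (X (n + N) - s0)) \<longlonglongrightarrow> f' s0 z"
        using X0 by (intro AE_I2 lim LIMSEQ_ignore_initial_segment Xl) auto
      show "AE z in M. norm ((f (X (n + N)) z - f s0 z) / (X (n + N) - s0)) <= B z" for n
      proof (rule AE_I2)
        fix z assume "z \<in> space M"
        from lip[of "X (n + N)" z] N[of "n + N"] this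
        have "\<bar>f (X (n + N)) z - f s0 z\<bar> <= B z * \<bar>X (n + N) - s0\<bar>" by simp
        moreover have "\<bar>X (n + N) - s0\<bar> > 0" using X0 by auto
        ultimately show "norm ((f (X (n + N)) z - f s0 z) / (X (n + N) - s0)) <= B z"
          by (simp add: abs_divide pos_divide_le_eq)
      qed
    qed
    moreover have "(LINT z|M. (f (X (n + N)) z - f s0 z) / (X (n + N) - s0))
        = ((LINT z|M. f (X (n + N)) z) - (LINT z|M. f s0 z)) / (X (n + N) - s0)" for n
      using f[of "X (n + N)"] N[of "n + N"] f[OF I] by (simp add: Bochner_Integration.integral_diff)
    ultimately have "(\<lambda>n. ((LINT z|M. f (X (n + N)) z) - (LINT z|M. f s0 z)) / (X (n + N) - s0)) \<longlonglongrightarrow> (LINT z|M. f' s0 z)"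
      by (simp only:)
    then have "(\<lambda>n. ((LINT z|M. f (X n) z) - (LINT z|M. f s0 z)) / (X n - s0)) \<longlonglongrightarrow> (LINT z|M. f' s0 z)"
      by (rule LIMSEQ_offset)
    then show "((\<lambda>y. ((LINT z|M. f y z) - (LINT z|M. f s0 z)) / (y - s0)) \<circ> X) \<longlonglongrightarrow> (LINT z|M. f' s0 z)"
      by (simp add: comp_def)
  qed
qed

lemma test_function_derivative_line:
  assumes "\<phi> \<in> test_functions S"
  shows "((\<lambda>t. \<phi> (x + t *\<^sub>R e)) has_real_derivative e \<bullet> grad \<phi> (x + t *\<^sub>R e)) (at t)"
  by (rule GDERIV_line[OF GDERIV_grad[OF test_functionsD(3)[OF assms]]])

text \<open>Translation invariance of Lebesgue measure: the integral of the translated function does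
  not depend on the translation parameter, and its derivative at 0 is the integral of the partial
  derivative.\<close>

lemma integral_partial_deriv_test_function:
  fixes \<phi> :: "'a::euclidean_space => real"
  assumes \<phi>: "\<phi> \<in> test_functions S" and i: "i \<in> Basis"
  shows "integral\<^sup>L lborel (partial_deriv i \<phi>) = 0"
proof -
  let ?D = "partial_deriv i \<phi>"
  note D = test_functions_partial[OF \<phi> i]
  obtain B where B: "B > 0" "!!x. \<bar>?D x\<bar> <= B" using test_function_bounded[OF D] by blast
  obtain R where R: "!!x. x \<in> closure {x. ?D x ~= 0} ==> norm x <= R"
    using compact_imp_bounded[OF test_functionsD(4)[OF D]] bounded_pos by metis
  have z: "?D x = 0" if "norm x > R" for x
    using that R[of x] closure_subset[of "{x. ?D x ~= 0}"] by auto
  have sh: "integrable lborel (\<lambda>x. \<phi> (x + c))" "(LINT x|lborel. \<phi> (x + c)) = integral\<^sup>L lborel \<phi>" for c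
  proof -
    have [measurable]: "\<phi> \<in> borel_measurable borel" using \<phi> by (rule test_function_measurable)
    have "integrable (distr lborel borel ((+) c)) \<phi>"
      using test_function_integrable_lborel[OF \<phi>] by (simp add: lborel_distr_plus)
    then show "integrable lborel (\<lambda>x. \<phi> (x + c))"
      by (subst (asm) integrable_distr_eq) (auto simp: add.commute)
    have "integral\<^sup>L (distr lborel borel ((+) c)) \<phi> = (LINT x|lborel. \<phi> (x + c))"
      by (subst integral_distr) (auto simp: add.commute)
    then show "(LINT x|lborel. \<phi> (x + c)) = integral\<^sup>L lborel \<phi>"
      by (simp add: lborel_distr_plus)
  qed
  have "((\<lambda>s. LINT x|lborel. \<phi> (x + s *\<^sub>R i)) has_real_derivative (LINT x|lborel. ?D (x + 0 *\<^sub>R i))) (at 0)"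
  \<comment> \<open>The derivative vanishes outside radius \<open>R\<close>; translations by less
    than 1 keep its support in the ball of radius \<open>R + 1\<close>, whose indicator provides the
    dominating function.\<close>
  proof (rule DERIV_integral(1)[where a = "- 1" and b = 1 and B = "\<lambda>x. B * indicator (cball 0 (R + 1)) x"])
    show "integrable lborel (\<lambda>x. B * indicator (cball 0 (R + 1)) x :: real)"
      using emeasure_bounded_finite[OF bounded_cball, of 0 "R + 1"]
      by (intro integrable_mult_right) (simp add: integrable_indicator_iff)
    fix s :: real and x assume s: "- 1 < s" "s < 1"
    show "((\<lambda>s. \<phi> (x + s *\<^sub>R i)) has_real_derivative ?D (x + s *\<^sub>R i)) (at s)"
      using test_function_derivative_line[OF \<phi>, of x i s]
      by (simp add: partial_deriv_GDERIV[OF GDERIV_grad[OF test_functionsD(3)[OF \<phi>]]])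
    show "\<bar>?D (x + s *\<^sub>R i)\<bar> <= B * indicator (cball 0 (R + 1)) x"
    proof (cases "x \<in> cball 0 (R + 1)")
      case False
      have "norm x <= norm (x + s *\<^sub>R i) + norm (s *\<^sub>R i)"
        using norm_triangle_ineq4[of "x + s *\<^sub>R i" "s *\<^sub>R i"] by simp
      then have "R < norm (x + s *\<^sub>R i)" using s i False by simp
      then show ?thesis using False z by simp
    qed (use B(2) in simp)
  qed (use sh in auto)
  then have "((\<lambda>s::real. integral\<^sup>L lborel \<phi>) has_real_derivative integral\<^sup>L lborel ?D) (at 0)" by (simp add: sh(2))
  then show ?thesis using DERIV_const DERIV_unique by blast
qed

lemma test_functions_mult:
  assumes "open S" "\<phi> \<in> test_functions S" "!!k. Ck_on k S \<psi>"
  shows "(\<lambda>x. if x \<in> S then \<phi> x * \<psi> x else 0) \<in> test_functions S"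
proof (rule test_functions_extend[OF assms(1) test_functionsD(4,5)[OF assms(2)]])
  show "Ck_on k S (\<lambda>x. \<phi> x * \<psi> x)" for k
    using Ck_on_subset[OF test_functionsD(1)[OF assms(2)]] assms by (intro Ck_on_mult) auto
  show "\<phi> x * \<psi> x = 0" if "x \<notin> closure {x. \<phi> x ~= 0}" for x
    using that closure_subset[of "{x. \<phi> x ~= 0}"] by auto
qed

lemma Ck_on_continuous_on: "Ck_on k S f ==> continuous_on S f"
proof (induction k)
  case (Suc k)
  then show ?case using Ck_on_lower by blast
qed simp

lemma continuous_on_partial: "(!!k. Ck_on k S f) ==> i \<in> Basis ==> continuous_on S (partial_deriv i f)"
proof -
  assume "!!k. Ck_on k S f" "i \<in> Basis"
  from this(1)[of "Suc 0"] this(2) show ?thesis by simp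
qed

lemma continuous_on_laplacian: "(!!k. Ck_on k S f) ==> continuous_on S (laplacian f)"
proof -
  assume "!!k. Ck_on k S f"
  from this[of "Suc (Suc 0)"] show ?thesis
    unfolding laplacian_def by (intro continuous_on_sum) simp
qed

lemma continuous_on_grad: "(!!k. Ck_on k S f) ==> continuous_on S (grad f)"
  unfolding grad_def by (intro continuous_intros continuous_on_partial) auto

text \<open>The divergence of the field \<open>\<phi>\<close> times \<open>grad \<psi>\<close>
  integrates to 0: each component is a test function, as \<open>\<phi>\<close> has compact support
  in \<open>S\<close> and \<open>\<psi>\<close> is smooth there.\<close>

lemma integral_test_function_laplacian:
  fixes \<phi> :: "'a::euclidean_space => real"
  assumes S: "open S" and \<phi>: "\<phi> \<in> test_functions S" and \<psi>: "!!k. Ck_on k S \<psi>"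
  shows "(LINT x|lebesgue_on S. \<phi> x * laplacian \<psi> x) = - (LINT x|lebesgue_on S. grad \<phi> x \<bullet> grad \<psi> x)"
proof -
  have Sl: "S \<in> sets lebesgue" using S by simp
  have pd: "!!k i. i \<in> Basis ==> Ck_on k S (partial_deriv i \<psi>)"
    using \<psi>[of "Suc _"] by simp
  define F where "F i = (\<lambda>x. if x \<in> S then \<phi> x * partial_deriv i \<psi> x else 0)" for i
  have F: "F i \<in> test_functions S" if "i \<in> Basis" for i
    unfolding F_def using S \<phi> pd[OF that] by (rule test_functions_mult)
  let ?A = "\<lambda>i x. partial_deriv i \<phi> x * partial_deriv i \<psi> x"
  let ?B = "\<lambda>i x. \<phi> x * partial_deriv i (partial_deriv i \<psi>) x"
  have dF: "partial_deriv i (F i) x = ?A i x + ?B i x" if "i \<in> Basis" "x \<in> S" for i x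
  proof -
    have "partial_deriv i (F i) x = partial_deriv i (\<lambda>x. \<phi> x * partial_deriv i \<psi> x) x"
      by (rule partial_deriv_cong[OF S]) (use that in \<open>auto simp: F_def\<close>)
    also have "GDERIV \<phi> x :> grad \<phi> x" "GDERIV (partial_deriv i \<psi>) x :> grad (partial_deriv i \<psi>) x"
      using test_functionsD(3)[OF \<phi>] pd[OF that(1), of 1] that by (auto intro!: GDERIV_grad)
    then have "partial_deriv i (\<lambda>x. \<phi> x * partial_deriv i \<psi> x) x = ?A i x + ?B i x"
      by (simp add: partial_deriv_GDERIV[OF GDERIV_mult] partial_deriv_GDERIV inner_add_right mult.commute)
    finally show ?thesis .
  qed
  have A: "integrable (lebesgue_on S) (?A i)" if "i \<in> Basis" for i
  proof -
    have "integrable (lebesgue_on S) (\<lambda>x. if x \<in> S then partial_deriv i \<phi> x * partial_deriv i \<psi> x else 0)"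
      by (intro test_function_integral_lebesgue_on(2) test_functions_mult test_functions_partial S \<phi> Sl pd that)
    then show ?thesis by (rule Bochner_Integration.integrable_cong[THEN iffD1, rotated -1]) auto
  qed
  have B: "integrable (lebesgue_on S) (?B i)" if "i \<in> Basis" for i
  proof -
    have "integrable (lebesgue_on S) (\<lambda>x. if x \<in> S then \<phi> x * partial_deriv i (partial_deriv i \<psi>) x else 0)"
      using pd[of _ "Suc _"] that by (intro test_function_integral_lebesgue_on(2) test_functions_mult S \<phi> Sl) auto
    then show ?thesis by (rule Bochner_Integration.integrable_cong[THEN iffD1, rotated -1]) auto
  qed
  have "0 = (\<Sum>i\<in>Basis. (LINT x|lebesgue_on S. partial_deriv i (F i) x))"
    using test_function_integral_lebesgue_on(1)[OF test_functions_partial[OF F] Sl]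
      integral_partial_deriv_test_function[OF F] by simp
  also have "\<dots> = (\<Sum>i\<in>Basis. (LINT x|lebesgue_on S. ?A i x + ?B i x))"
    by (intro sum.cong Bochner_Integration.integral_cong) (auto simp: dF)
  also have "\<dots> = (\<Sum>i\<in>Basis. (LINT x|lebesgue_on S. ?A i x)) + (\<Sum>i\<in>Basis. (LINT x|lebesgue_on S. ?B i x))"
    by (simp add: Bochner_Integration.integral_add[OF A B] sum.distrib)
  also have "(\<Sum>i\<in>Basis. (LINT x|lebesgue_on S. ?A i x)) = (LINT x|lebesgue_on S. (\<Sum>i\<in>Basis. ?A i x))"
    by (rule Bochner_Integration.integral_sum[symmetric]) (rule A)
  also have "(\<lambda>x. \<Sum>i\<in>Basis. ?A i x) = (\<lambda>x. grad \<phi> x \<bullet> grad \<psi> x)"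
    by (simp add: grad_def inner_sum_left inner_sum_right inner_Basis if_distrib mult.commute cong: if_cong)
  also have "(\<Sum>i\<in>Basis. (LINT x|lebesgue_on S. ?B i x)) = (LINT x|lebesgue_on S. (\<Sum>i\<in>Basis. ?B i x))"
    by (rule Bochner_Integration.integral_sum[symmetric]) (rule B)
  also have "(\<lambda>x. \<Sum>i\<in>Basis. ?B i x) = (\<lambda>x. \<phi> x * laplacian \<psi> x)"
    by (simp add: laplacian_def sum_distrib_left)
  finally show ?thesis by simp
qed

section \<open>From compactly supported test functions to functions that vanish on the
  boundary\<close>

lemma integrable_mult_bounded:
  fixes f g :: "'a => real"
  assumes "integrable M f" "g \<in> borel_measurable M" "!!x. x \<in> space M ==> \<bar>g x\<bar> <= B"
  shows "integrable M (\<lambda>x. f x * g x)"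
proof (rule Bochner_Integration.integrable_bound)
  show "integrable M (\<lambda>x. B * f x)" using assms(1) by simp
  have "\<bar>f x\<bar> * \<bar>g x\<bar> <= \<bar>f x\<bar> * \<bar>B\<bar>" if "x \<in> space M" for x
    using assms(3)[OF that] by (intro mult_left_mono) auto
  then show "AE x in M. norm (f x * g x) <= norm (B * f x)"
    by (intro AE_I2) (simp add: abs_mult mult.commute)
qed (use assms in measurable)

lemma integrable_inner_bounded:
  fixes F G :: "'a => 'b::euclidean_space"
  assumes "integrable M F" "G \<in> borel_measurable M" "!!x. x \<in> space M ==> norm (G x) <= B"
  shows "integrable M (\<lambda>x. F x \<bullet> G x)"
proof (rule Bochner_Integration.integrable_bound)
  show "integrable M (\<lambda>x. B * norm (F x))" using assms(1) by simp
  have "\<bar>F x \<bullet> G x\<bar> <= norm (F x) * \<bar>B\<bar>" if "x \<in> space M" for x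
    using Cauchy_Schwarz_ineq2[of "F x" "G x"] assms(3)[OF that]
      mult_left_mono[of "norm (G x)" "\<bar>B\<bar>" "norm (F x)"]
    by (smt (verit) norm_ge_zero)
  then show "AE x in M. norm (F x \<bullet> G x) <= norm (B * norm (F x))"
    by (intro AE_I2) (simp add: abs_mult mult.commute)
qed (use assms in measurable)

lemma test_functions_Ck_on: "open S ==> \<phi> \<in> test_functions S ==> Ck_on k S \<phi>"
  using Ck_on_subset[OF test_functionsD(1)] by blast

lemma test_function_grad_bounded:
  fixes \<phi> :: "'a::euclidean_space => real"
  assumes "\<phi> \<in> test_functions S"
  obtains B where "!!x. norm (grad \<phi> x) <= B" "!!x. \<bar>laplacian \<phi> x\<bar> <= B"
proof -
  have "\<exists>B. \<forall>x. \<bar>partial_deriv i \<phi> x\<bar> <= B \<and> \<bar>partial_deriv i (partial_deriv i \<phi>) x\<bar> <= B"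
    if "i \<in> Basis" for i
  proof -
    note D = test_functions_partial[OF assms that]
    obtain B1 where "!!x. \<bar>partial_deriv i \<phi> x\<bar> <= B1" using test_function_bounded[OF D] by blast
    moreover obtain B2 where "!!x. \<bar>partial_deriv i (partial_deriv i \<phi>) x\<bar> <= B2"
      using test_function_bounded[OF test_functions_partial[OF D \<open>i \<in> Basis\<close>]] by blast
    ultimately show ?thesis by (intro exI[of _ "max B1 B2"]) (auto intro: max.coboundedI1 max.coboundedI2)
  qed
  then obtain b where b: "!!i x. i \<in> Basis ==> \<bar>partial_deriv i \<phi> x\<bar> <= b i"
    "!!i x. i \<in> Basis ==> \<bar>partial_deriv i (partial_deriv i \<phi>) x\<bar> <= b i" by metis
  have "norm (grad \<phi> x) <= (\<Sum>i\<in>Basis. b i)" for x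
    unfolding grad_def by (rule order.trans[OF norm_sum], rule sum_mono) (use b(1) in auto)
  moreover have "\<bar>laplacian \<phi> x\<bar> <= (\<Sum>i\<in>Basis. b i)" for x
    unfolding laplacian_def by (rule order.trans[OF sum_abs], rule sum_mono) (use b(2) in auto)
  ultimately show ?thesis using that by blast
qed

lemma continuous_on_measurable_lebesgue_on:
  fixes f :: "'a::euclidean_space => 'b::euclidean_space"
  assumes "open S" "continuous_on S f"
  shows "f \<in> borel_measurable (lebesgue_on S)"
  by (rule continuous_imp_measurable_on_sets_lebesgue) (use assms in auto)

text \<open>Both sides are continuous in the W^{1,1} norm when \<open>grad \<psi>\<close> and
  \<open>laplacian \<psi>\<close> are bounded, so the identity passes from the approximating test
  functions to \<open>u\<close>. The boundary term disappears through the zero trace of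
  \<open>u\<close>, whatever the boundary values of \<open>\<psi>\<close>.\<close>

lemma integral_mult_laplacian_limit:
  fixes u :: "'a::euclidean_space => real"
  assumes S: "open S"
    and u: "integrable (lebesgue_on S) u" and G: "integrable (lebesgue_on S) G"
    and \<phi>: "!!n. \<phi> n \<in> test_functions S"
    and lim: "(\<lambda>n. (LINT x|lebesgue_on S. \<bar>\<phi> n x - u x\<bar>)
                  + (LINT x|lebesgue_on S. norm (grad (\<phi> n) x - G x))) \<longlonglongrightarrow> 0"
    and \<psi>: "!!k. Ck_on k S \<psi>"
    and B: "!!x. x \<in> S ==> norm (grad \<psi> x) <= B" "!!x. x \<in> S ==> \<bar>laplacian \<psi> x\<bar> <= B"
  shows "(LINT x|lebesgue_on S. u x * laplacian \<psi> x) = - (LINT x|lebesgue_on S. G x \<bullet> grad \<psi> x)"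
proof -
  let ?M = "lebesgue_on S"
  have Sl: "S \<in> sets lebesgue" using S by simp
  have mlap: "laplacian \<psi> \<in> borel_measurable ?M" and mgrad: "grad \<psi> \<in> borel_measurable ?M"
    using continuous_on_measurable_lebesgue_on[OF S] continuous_on_laplacian[OF \<psi>] continuous_on_grad[OF \<psi>]
    by auto
  have \<phi>i: "integrable ?M (\<phi> n)" for n by (rule test_function_integral_lebesgue_on[OF \<phi> Sl])
  have gi: "integrable ?M (grad (\<phi> n))" for n
    unfolding grad_def
    by (intro Bochner_Integration.integrable_sum integrable_scaleR_left test_function_integral_lebesgue_on(2)
        test_functions_partial \<phi> Sl)
  define a where "a n = (LINT x|?M. \<phi> n x * laplacian \<psi> x)" for n
  define e where "e n = (LINT x|?M. \<bar>\<phi> n x - u x\<bar>) + (LINT x|?M. norm (grad (\<phi> n) x - G x))" for n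
  have e0: "(\<lambda>n. B * e n) \<longlonglongrightarrow> 0" using tendsto_mult_right_zero[OF lim] by (simp add: e_def)
  \<comment> \<open>On the empty set the bounds say nothing about the sign of \<open>B\<close>, so
    that case is treated separately at the end.\<close>
  have B0: "B >= 0" if "S ~= {}" using B(1) that norm_ge_zero order.trans by blast
  have i1: "(LINT x|?M. \<bar>\<phi> n x - u x\<bar>) >= 0" "(LINT x|?M. norm (grad (\<phi> n) x - G x)) >= 0" for n
    by (auto intro!: Bochner_Integration.integral_nonneg)
  have 1: "\<bar>a n - (LINT x|?M. u x * laplacian \<psi> x)\<bar> <= B * e n" if "S ~= {}" for n
  proof -
    have "a n - (LINT x|?M. u x * laplacian \<psi> x) = (LINT x|?M. (\<phi> n x - u x) * laplacian \<psi> x)"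
      unfolding a_def left_diff_distrib
      by (rule Bochner_Integration.integral_diff[symmetric]; rule integrable_mult_bounded[OF _ mlap])
        (use \<phi>i u B in auto)
    also have "\<bar>\<dots>\<bar> <= (LINT x|?M. B * \<bar>\<phi> n x - u x\<bar>)"
    proof (rule order.trans[OF integral_abs_bound], rule integral_mono)
      show "integrable ?M (\<lambda>x. \<bar>(\<phi> n x - u x) * laplacian \<psi> x\<bar>)"
        by (intro integrable_abs integrable_mult_bounded[OF _ mlap, where B=B])
          (use \<phi>i u B in auto)
      show "\<bar>(\<phi> n x - u x) * laplacian \<psi> x\<bar> <= B * \<bar>\<phi> n x - u x\<bar>" if "x \<in> space ?M" for x
        using mult_right_mono[OF B(2), of x "\<bar>\<phi> n x - u x\<bar>"] that by (simp add: abs_mult mult.commute)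
    qed (use \<phi>i u in auto)
    also have "\<dots> <= B * e n" using i1[of n] B0[OF that] by (simp add: e_def mult_left_mono)
    finally show ?thesis .
  qed
  have 2: "\<bar>- a n - (LINT x|?M. G x \<bullet> grad \<psi> x)\<bar> <= B * e n" if "S ~= {}" for n
  proof -
    have "- a n - (LINT x|?M. G x \<bullet> grad \<psi> x) = (LINT x|?M. (grad (\<phi> n) x - G x) \<bullet> grad \<psi> x)"
      unfolding a_def integral_test_function_laplacian[OF S \<phi> \<psi>] inner_diff_left minus_minus
      by (rule Bochner_Integration.integral_diff[symmetric]; rule integrable_inner_bounded[OF _ mgrad])
        (use gi G B in auto)
    also have "\<bar>\<dots>\<bar> <= (LINT x|?M. B * norm (grad (\<phi> n) x - G x))"
    proof (rule order.trans[OF integral_abs_bound], rule integral_mono)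
      show "integrable ?M (\<lambda>x. \<bar>(grad (\<phi> n) x - G x) \<bullet> grad \<psi> x\<bar>)"
        by (intro integrable_abs integrable_inner_bounded[OF _ mgrad, where B=B])
          (use gi G B in auto)
      show "\<bar>(grad (\<phi> n) x - G x) \<bullet> grad \<psi> x\<bar> <= B * norm (grad (\<phi> n) x - G x)" if "x \<in> space ?M" for x
        using Cauchy_Schwarz_ineq2[of "grad (\<phi> n) x - G x" "grad \<psi> x"]
          mult_left_mono[OF B(1), of x "norm (grad (\<phi> n) x - G x)"] that by (simp add: mult.commute)
    qed (use gi G in auto)
    also have "\<dots> <= B * e n" using i1[of n] B0[OF that] by (simp add: e_def mult_left_mono)
    finally show ?thesis .
  qed
  show ?thesis
  proof (cases "S = {}")
    case True
    then show ?thesis by (simp add: integral_restrict_space)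
  next
    case False
    have "a \<longlonglongrightarrow> (LINT x|?M. u x * laplacian \<psi> x)"
      by (rule LIM_zero_cancel, rule tendsto_0_le[OF e0, of _ 1]) (use 1[OF False] abs_ge_self order.trans in \<open>fastforce intro!: always_eventually\<close>)
    moreover have "(\<lambda>n. - a n) \<longlonglongrightarrow> (LINT x|?M. G x \<bullet> grad \<psi> x)"
      by (rule LIM_zero_cancel, rule tendsto_0_le[OF e0, of _ 1]) (use 2[OF False] abs_ge_self order.trans in \<open>fastforce intro!: always_eventually\<close>)
    ultimately show ?thesis
      using LIMSEQ_unique tendsto_minus minus_minus by metis
  qed
qed

text \<open>
  The test function \<open>(\<phi> - \<delta>) exp (- \<delta> / (\<phi> - \<delta>))\<close>, cut off where \<open>\<phi> <= \<delta>\<close>, has compact support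
  and its gradient is a factor in \<open>[0, 1]\<close> times that of \<open>\<phi>\<close>, the factor tending to \<open>1\<close>.
\<close>

definition shrink :: "real => real => real" where
  "shrink \<delta> t = (t - \<delta>) * flat ((t - \<delta>) / \<delta>)"

definition shrink' :: "real => real => real" where
  "shrink' \<delta> t = (if t <= \<delta> then 0 else (1 + \<delta> / (t - \<delta>)) * exp (- (\<delta> / (t - \<delta>))))"

lemma shrink_has_derivative:
  assumes "\<delta> > 0"
  shows "(shrink \<delta> has_real_derivative shrink' \<delta> t) (at t)"
proof -
  let ?F = "flat_poly ([:0, 0, 1:] * (1 - pderiv 1))"
  have "((\<lambda>t. flat ((t - \<delta>) / \<delta>)) has_real_derivative ?F ((t - \<delta>) / \<delta>) * (1 / \<delta>)) (at t)"
    by (rule DERIV_chain2[OF flat_poly_has_derivative]) (use assms in \<open>auto intro!: derivative_eq_intros\<close>)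
  then have "(shrink \<delta> has_real_derivative 1 * flat ((t - \<delta>) / \<delta>) + ?F ((t - \<delta>) / \<delta>) * (1 / \<delta>) * (t - \<delta>)) (at t)"
    unfolding shrink_def[abs_def] by (intro DERIV_mult) (auto intro!: derivative_eq_intros)
  moreover have "1 * flat ((t - \<delta>) / \<delta>) + ?F ((t - \<delta>) / \<delta>) * (1 / \<delta>) * (t - \<delta>) = shrink' \<delta> t"
  proof (cases "t <= \<delta>")
    case False
    define r where "r = t - \<delta>"
    have r: "r > 0" "t = r + \<delta>" using False by (auto simp: r_def)
    show ?thesis
      using assms r(1) unfolding r(2)
      by (simp add: shrink'_def flat_poly_def pderiv_1 divide_le_0_iff power2_eq_square)
        (simp add: field_simps)
  qed (use assms in \<open>auto simp: shrink'_def flat_poly_def divide_le_0_iff\<close>)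
  ultimately show ?thesis by simp
qed

lemma shrink_bounds:
  assumes "\<delta> > 0"
  shows "0 <= shrink' \<delta> t" "shrink' \<delta> t <= 1" "0 <= shrink \<delta> t" "t >= 0 ==> shrink \<delta> t <= t"
    "t <= \<delta> ==> shrink \<delta> t = 0"
proof -
  show "0 <= shrink' \<delta> t" using assms by (auto simp: shrink'_def)
  have "(1 + x) * exp (- x) <= 1" for x :: real
    using exp_ge_add_one_self[of x] by (simp add: exp_minus field_simps)
  then show "shrink' \<delta> t <= 1" by (simp add: shrink'_def)
  show z: "t <= \<delta> ==> shrink \<delta> t = 0"
    using assms by (simp add: shrink_def flat_eq divide_le_0_iff)
  show "0 <= shrink \<delta> t"
    using z flat_nonneg by (cases "t <= \<delta>") (auto simp: shrink_def)
  show "shrink \<delta> t <= t" if "t >= 0"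
  proof (cases "t <= \<delta>")
    case False
    then have "shrink \<delta> t <= (t - \<delta>) * 1" unfolding shrink_def by (intro mult_left_mono flat_le_1) auto
    then show ?thesis using assms by simp
  qed (use z that in simp)
qed

lemma shrink_tendsto:
  assumes "t > 0"
  shows "(\<lambda>n. shrink (1 / real (Suc n)) t) \<longlonglongrightarrow> t" "(\<lambda>n. shrink' (1 / real (Suc n)) t) \<longlonglongrightarrow> 1"
proof -
  have d: "(\<lambda>n. 1 / real (Suc n)) \<longlonglongrightarrow> 0"
    using LIMSEQ_inverse_real_of_nat by (simp add: inverse_eq_divide)
  have ev: "eventually (\<lambda>n. 1 / real (Suc n) < t) sequentially"
    using order_tendstoD(2)[OF d assms] .
  let ?s = "\<lambda>n. (1 / real (Suc n)) / (t - 1 / real (Suc n))"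
  have s: "?s \<longlonglongrightarrow> 0 / (t - 0)" by (intro tendsto_intros d) (use assms in auto)
  have "(\<lambda>n. (t - 1 / real (Suc n)) * exp (- ?s n)) \<longlonglongrightarrow> (t - 0) * exp (- (0 / (t - 0)))"
    by (intro tendsto_intros s d)
  then have "(\<lambda>n. (t - 1 / real (Suc n)) * exp (- ?s n)) \<longlonglongrightarrow> t" by simp
  then show "(\<lambda>n. shrink (1 / real (Suc n)) t) \<longlonglongrightarrow> t"
  proof (rule Lim_transform_eventually, use ev in eventually_elim)
    fix n assume "1 / real (Suc n) < t"
    then have "\<not> (t - 1 / real (Suc n)) / (1 / real (Suc n)) <= 0"
      unfolding not_le by (intro divide_pos_pos) auto
    then show "(t - 1 / real (Suc n)) * exp (- ?s n) = shrink (1 / real (Suc n)) t"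
      by (simp add: shrink_def flat_eq)
  qed
  have "(\<lambda>n. (1 + ?s n) * exp (- ?s n)) \<longlonglongrightarrow> (1 + 0 / (t - 0)) * exp (- (0 / (t - 0)))"
    by (intro tendsto_intros s)
  then have "(\<lambda>n. (1 + ?s n) * exp (- ?s n)) \<longlonglongrightarrow> 1" by simp
  then show "(\<lambda>n. shrink' (1 / real (Suc n)) t) \<longlonglongrightarrow> 1"
    by (rule Lim_transform_eventually)
      (use ev in eventually_elim, auto simp: shrink'_def)
qed

text \<open>The truncation is supported where \<open>\<phi>\<close> is at least
  \<open>\<delta>\<close>. This set is closed in the closure of \<open>S\<close>, and it avoids the
  frontier, where \<open>\<phi>\<close> is 0, so it is a compact subset of \<open>S\<close>.\<close>

lemma test_functions_shrink:
  fixes \<phi> :: "'a::euclidean_space => real"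
  assumes S: "open S" "bounded S" and \<phi>: "!!k. Ck_on k S \<phi>"
    and cont: "continuous_on (closure S) \<phi>" and bdry: "!!x. x \<in> frontier S ==> \<phi> x = 0"
    and \<delta>: "\<delta> > 0"
  shows "(\<lambda>x. if x \<in> S then shrink \<delta> (\<phi> x) else 0) \<in> test_functions S"
proof (rule test_functions_extend[OF S(1), of "{x \<in> closure S. \<delta> <= \<phi> x}"])
  have "closed {x \<in> closure S. \<phi> x \<in> {\<delta>..}}"
    using continuous_on_closed_Collect_le[OF continuous_on_const cont] by simp
  then show "compact {x \<in> closure S. \<delta> <= \<phi> x}"
    using S(2) bounded_subset[OF bounded_closure[OF S(2)], of "{x \<in> closure S. \<delta> <= \<phi> x}"]
    by (auto simp: compact_eq_bounded_closed)
  show "{x \<in> closure S. \<delta> <= \<phi> x} \<subseteq> S"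
    using bdry \<delta> S(1) by (force simp: frontier_def interior_open)
  show "Ck_on k S (\<lambda>x. shrink \<delta> (\<phi> x))" for k
  proof -
    have "Ck_on k S (\<lambda>x. (\<phi> x - \<delta>) * flat ((1 / \<delta>) * (\<phi> x - \<delta>)))"
      using S(1) \<phi> by (intro Ck_on_mult Ck_on_flat Ck_on_diff) auto
    then show ?thesis by (simp add: shrink_def)
  qed
  show "shrink \<delta> (\<phi> x) = 0" if "x \<in> S" "x \<notin> {x \<in> closure S. \<delta> <= \<phi> x}" for x
    using that closure_subset[of S] by (intro shrink_bounds(5)[OF \<delta>]) auto
qed

text \<open>The truncations of \<open>\<phi>\<close> are admissible, but their second derivatives
  are not controlled as \<open>\<delta>\<close> tends to 0. Hence one derivative is first moved onto
  \<open>u\<close>: the gradients of the truncations are dominated by \<open>grad \<phi>\<close>,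
  the limit is taken in the weak form, and only then is the Laplacian of \<open>\<phi>\<close>
  restored.\<close>

theorem neg_laplacian_W11_0_boundary:
  fixes u f \<phi> :: "'a::euclidean_space => real"
  assumes S: "open S" "bounded S" and u: "u \<in> W11_0 S" and f: "neg_laplacian_distr S u f"
    and fi: "integrable (lebesgue_on S) f"
    and \<phi>: "!!k. Ck_on k S \<phi>" and cont: "continuous_on (closure S) \<phi>"
    and pos: "!!x. x \<in> S ==> \<phi> x >= 0" and bdry: "!!x. x \<in> frontier S ==> \<phi> x = 0"
    and B: "!!x. x \<in> S ==> norm (grad \<phi> x) <= B" "!!x. x \<in> S ==> \<bar>laplacian \<phi> x\<bar> <= B"
  shows "- (LINT x|lebesgue_on S. u x * laplacian \<phi> x) = (LINT x|lebesgue_on S. f x * \<phi> x)"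
proof -
  let ?M = "lebesgue_on S"
  obtain G \<phi>s where ui: "integrable ?M u" and G: "integrable ?M G"
    and \<phi>s: "!!n. \<phi>s n \<in> test_functions S"
    and lim: "(\<lambda>n. (LINT x|?M. \<bar>\<phi>s n x - u x\<bar>) + (LINT x|?M. norm (grad (\<phi>s n) x - G x))) \<longlonglongrightarrow> 0"
    using u unfolding W11_0_def by blast
  note parts = integral_mult_laplacian_limit[OF S(1) ui G \<phi>s lim]
  define \<delta> where "\<delta> n = 1 / real (Suc n)" for n
  have \<delta>0: "\<delta> n > 0" for n by (simp add: \<delta>_def)
  define \<psi> where "\<psi> n = (\<lambda>x. if x \<in> S then shrink (\<delta> n) (\<phi> x) else 0)" for n
  have \<psi>: "\<psi> n \<in> test_functions S" for n
    unfolding \<psi>_def by (rule test_functions_shrink[OF S \<phi> cont bdry \<delta>0])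
  have g\<phi>: "GDERIV \<phi> x :> grad \<phi> x" if "x \<in> S" for x
    using \<phi>[of 1] that by (intro GDERIV_grad) simp
  have g\<psi>: "grad (\<psi> n) x = shrink' (\<delta> n) (\<phi> x) *\<^sub>R grad \<phi> x" if "x \<in> S" for n x
  proof -
    have "grad (\<psi> n) x = grad (\<lambda>x. shrink (\<delta> n) (\<phi> x)) x"
      unfolding grad_def by (intro sum.cong refl arg_cong2[where f=scaleR] partial_deriv_cong[OF S(1) that])
        (auto simp: \<psi>_def)
    also have "\<dots> = shrink' (\<delta> n) (\<phi> x) *\<^sub>R grad \<phi> x"
      by (rule grad_eqI, rule GDERIV_DERIV_compose[where f = \<phi> and g = "shrink (\<delta> n)"])
        (rule g\<phi>[OF that], rule shrink_has_derivative[OF \<delta>0])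
    finally show ?thesis .
  qed
  have m\<phi>: "\<phi> \<in> borel_measurable ?M" and mg\<phi>: "grad \<phi> \<in> borel_measurable ?M"
    using continuous_on_measurable_lebesgue_on[OF S(1)] continuous_on_grad[OF \<phi>] Ck_on_continuous_on[OF \<phi>]
    by auto
  have eq: "(LINT x|?M. G x \<bullet> grad (\<psi> n) x) = (LINT x|?M. f x * \<psi> n x)" for n
  proof -
    obtain B' where B': "!!x. norm (grad (\<psi> n) x) <= B'" "!!x. \<bar>laplacian (\<psi> n) x\<bar> <= B'"
      using test_function_grad_bounded[OF \<psi>] by blast
    have "- (LINT x|?M. u x * laplacian (\<psi> n) x) = (LINT x|?M. f x * \<psi> n x)"
      using f \<psi> unfolding neg_laplacian_distr_def by blast
    moreover have "(LINT x|?M. u x * laplacian (\<psi> n) x) = - (LINT x|?M. G x \<bullet> grad (\<psi> n) x)"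
      by (rule parts[OF test_functions_Ck_on[OF S(1) \<psi>]]) (rule B')+
    ultimately show ?thesis by simp
  qed
  have B0: "compact (\<phi> ` closure S)"
    using cont S(2) by (intro compact_continuous_image) auto
  then obtain B1 where B1: "!!x. x \<in> S ==> \<bar>\<phi> x\<bar> <= B1"
    using compact_imp_bounded[OF B0] closure_subset[of S] unfolding bounded_iff by fastforce
  have "(\<lambda>n. LINT x|?M. f x * \<psi> n x) \<longlonglongrightarrow> (LINT x|?M. f x * \<phi> x)"
  proof (rule integral_dominated_convergence[where w = "\<lambda>x. \<bar>f x * \<phi> x\<bar>"])
    show "integrable ?M (\<lambda>x. \<bar>f x * \<phi> x\<bar>)"
      by (intro integrable_abs integrable_mult_bounded[OF fi m\<phi>, where B=B1]) (use B1 in simp)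
    show "AE x in ?M. (\<lambda>n. f x * \<psi> n x) \<longlonglongrightarrow> f x * \<phi> x"
    proof (rule AE_I2)
      fix x assume "x \<in> space ?M"
      then have x: "x \<in> S" by simp
      show "(\<lambda>n. f x * \<psi> n x) \<longlonglongrightarrow> f x * \<phi> x"
      proof (cases "\<phi> x = 0")
        case True
        then show ?thesis using shrink_bounds(5)[OF \<delta>0] \<delta>0 x by (simp add: \<psi>_def less_imp_le)
      next
        case False
        then have "\<phi> x > 0" using pos[OF x] by simp
        then show ?thesis using shrink_tendsto(1) x by (auto simp: \<psi>_def \<delta>_def intro!: tendsto_intros)
      qed
    qed
    show "AE x in ?M. norm (f x * \<psi> n x) <= \<bar>f x * \<phi> x\<bar>" for n
      using shrink_bounds(3,4)[OF \<delta>0] pos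
      by (intro AE_I2) (auto simp: \<psi>_def abs_mult intro!: mult_left_mono)
    show "(\<lambda>x. f x * \<phi> x) \<in> borel_measurable ?M" using fi m\<phi> by measurable
    show "(\<lambda>x. f x * \<psi> n x) \<in> borel_measurable ?M" for n
      using fi continuous_on_measurable_lebesgue_on[OF S(1) test_functionsD(2)[OF \<psi>]] by measurable
  qed
  moreover have "(\<lambda>n. LINT x|?M. G x \<bullet> grad (\<psi> n) x) \<longlonglongrightarrow> (LINT x|?M. G x \<bullet> grad \<phi> x)"
  proof (rule integral_dominated_convergence[where w = "\<lambda>x. \<bar>G x \<bullet> grad \<phi> x\<bar>"])
    show "integrable ?M (\<lambda>x. \<bar>G x \<bullet> grad \<phi> x\<bar>)"
      by (intro integrable_abs integrable_inner_bounded[OF G mg\<phi>, where B=B]) (use B in simp)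
    show "AE x in ?M. (\<lambda>n. G x \<bullet> grad (\<psi> n) x) \<longlonglongrightarrow> G x \<bullet> grad \<phi> x"
    proof (rule AE_I2)
      fix x assume "x \<in> space ?M"
      then have x: "x \<in> S" by simp
      show "(\<lambda>n. G x \<bullet> grad (\<psi> n) x) \<longlonglongrightarrow> G x \<bullet> grad \<phi> x"
      proof (cases "\<phi> x = 0")
        case True
        \<comment> \<open>At zeros of \<open>\<phi>\<close> the factor \<open>shrink'\<close> does
          not tend to 1. An interior zero of a nonnegative function is a minimum, so the gradient
          vanishes there and the limit is still correct.\<close>
        have "(\<lambda>h. h \<bullet> grad \<phi> x) = (\<lambda>h. 0)"
          using g\<phi>[OF x] pos True unfolding gderiv_def
          by (intro differential_zero_maxmin[OF x S(1)]) auto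
        then have "grad \<phi> x = 0" by (metis inner_eq_zero_iff)
        then show ?thesis by (simp add: g\<psi>[OF x])
      next
        case False
        then have "\<phi> x > 0" using pos[OF x] by simp
        from tendsto_mult_right[OF shrink_tendsto(2)[OF this], of "G x \<bullet> grad \<phi> x"] show ?thesis
          by (simp add: g\<psi>[OF x] \<delta>_def mult.commute)
      qed
    qed
    show "AE x in ?M. norm (G x \<bullet> grad (\<psi> n) x) <= \<bar>G x \<bullet> grad \<phi> x\<bar>" for n
      using shrink_bounds(1,2)[OF \<delta>0]
      by (intro AE_I2) (auto simp: g\<psi> abs_mult intro!: mult_left_le_one_le)
    show "(\<lambda>x. G x \<bullet> grad \<phi> x) \<in> borel_measurable ?M" using G mg\<phi> by measurable
    show "(\<lambda>x. G x \<bullet> grad (\<psi> n) x) \<in> borel_measurable ?M" for n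
      using G continuous_on_measurable_lebesgue_on[OF S(1) continuous_on_grad[OF test_functions_Ck_on[OF S(1) \<psi>]]]
      by measurable
  qed
  ultimately have "(LINT x|?M. G x \<bullet> grad \<phi> x) = (LINT x|?M. f x * \<phi> x)"
    using eq LIMSEQ_unique by simp
  then show ?thesis using parts[OF \<phi> B] by simp
qed

section \<open>The first eigenfunction of the annulus\<close>

lemma laplacian_radial:
  fixes x :: "'a::euclidean_space"
  assumes "open T" "x \<bullet> x \<in> T" "!!t. t \<in> T ==> (F has_real_derivative F' t) (at t)"
    "(F' has_real_derivative F'') (at (x \<bullet> x))"
  shows "laplacian (\<lambda>x. F (x \<bullet> x)) x = 4 * (x \<bullet> x) * F'' + 2 * real DIM('a) * F' (x \<bullet> x)"
    "!!y::'a. y \<bullet> y \<in> T ==> GDERIV (\<lambda>x. F (x \<bullet> x)) y :> (2 * F' (y \<bullet> y)) *\<^sub>R y"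
proof -
  have sq: "GDERIV (\<lambda>x::'a. x \<bullet> x) y :> 2 *\<^sub>R y" for y
    unfolding gderiv_def by (auto intro!: derivative_eq_intros simp: inner_commute)
  show g: "GDERIV (\<lambda>x. F (x \<bullet> x)) y :> (2 * F' (y \<bullet> y)) *\<^sub>R y" if "y \<bullet> y \<in> T" for y :: 'a
    using GDERIV_DERIV_compose[where f = "\<lambda>x. x \<bullet> x" and g = F, OF sq assms(3)[OF that]]
    by (simp add: mult.commute)
  have "open ((\<lambda>x::'a. x \<bullet> x) -` T)"
    by (intro open_vimage assms(1) continuous_intros)
  then have "laplacian (\<lambda>x. F (x \<bullet> x)) x
      = (\<Sum>i\<in>Basis. i \<bullet> ((2 * F' (x \<bullet> x)) *\<^sub>R i + (2 * (F'' * (i \<bullet> (2 *\<^sub>R x)))) *\<^sub>R x))"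
  proof (rule laplacian_GDERIV)
    have "GDERIV (\<lambda>x. F' (x \<bullet> x)) x :> F'' *\<^sub>R (2 *\<^sub>R x)"
      by (rule GDERIV_DERIV_compose[where f = "\<lambda>x. x \<bullet> x" and g = F', OF sq assms(4)])
    then have "((\<lambda>x. F' (x \<bullet> x)) has_derivative (\<lambda>h. F'' * (h \<bullet> (2 *\<^sub>R x)))) (at x)"
      by (simp add: gderiv_def mult.assoc)
    note [derivative_intros] = this
    show "((\<lambda>y. (2 * F' (y \<bullet> y)) *\<^sub>R y) has_derivative
        (\<lambda>i. (2 * F' (x \<bullet> x)) *\<^sub>R i + (2 * (F'' * (i \<bullet> (2 *\<^sub>R x)))) *\<^sub>R x)) (at x)"
      by (auto intro!: derivative_eq_intros)
  qed (use assms(2) g in auto)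
  also have "\<dots> = (\<Sum>i\<in>Basis. 2 * F' (x \<bullet> x) * (i \<bullet> i) + 4 * F'' * ((i \<bullet> x) * (i \<bullet> x)))"
    by (intro sum.cong) (auto simp: inner_add_right)
  also have "\<dots> = (\<Sum>i\<in>(Basis :: 'a set). 2 * F' (x \<bullet> x)) + 4 * F'' * (\<Sum>i\<in>Basis. (x \<bullet> i) * (x \<bullet> i))"
    by (simp add: sum_distrib_left sum.distrib inner_commute)
  also have "\<dots> = 2 * real DIM('a) * F' (x \<bullet> x) + 4 * F'' * (x \<bullet> x)"
    by (simp flip: euclidean_inner)
  finally show "laplacian (\<lambda>x. F (x \<bullet> x)) x = 4 * (x \<bullet> x) * F'' + 2 * real DIM('a) * F' (x \<bullet> x)"
    by simp
qed

text \<open>Dyadic decomposition: where the norm lies between \<open>R / 2 ^ Suc n\<close> and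
  \<open>R / 2 ^ n\<close> the integrand is at most \<open>c n\<close>, and the disc
  \<open>D n\<close> has an area proportional to \<open>1 / 4 ^ n\<close>. The resulting geometric
  series has ratio \<open>2 powr (s - 2)\<close>, which is below 1 for \<open>s < 2\<close>.\<close>

lemma nn_integral_norm_powr_finite:
  assumes "0 <= s" "s < 2" "R > 0"
  shows "(\<integral>\<^sup>+z. ennreal (indicator (cball 0 R) z * norm (z :: real^2) powr - s) \<partial>lborel) < \<infinity>"
proof -
  define c where "c n = (R / 2 ^ Suc n) powr - s" for n
  define D where "D n = cball (0 :: real^2) (R / 2 ^ n)" for n
  have ptw: "ennreal (indicator (cball 0 R) z * norm z powr - s) <= (\<Sum>n. ennreal (c n) * indicator (D n) z)"
    for z :: "real^2"
  proof (cases "z = 0 \<or> norm z > R")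
    case True
    then show ?thesis by (auto simp: indicator_def)
  next
    case False
    then have z: "norm z > 0" "norm z <= R" by auto
    have ex: "\<exists>n. R / 2 ^ n < norm z"
    proof -
      obtain n where "R / norm z < 2 ^ n" using real_arch_pow[of 2 "R / norm z"] by auto
      then show ?thesis using z by (intro exI[of _ n]) (auto simp: field_simps)
    qed
    define N where "N = (LEAST n. R / 2 ^ n < norm z)"
    have N: "R / 2 ^ N < norm z" unfolding N_def using ex by (rule LeastI_ex)
    then have "N ~= 0" using z by (metis div_by_1 not_le power_0)
    then obtain n where n: "N = Suc n" using not0_implies_Suc by blast
    have "norm z <= R / 2 ^ n" using not_less_Least[of n "\<lambda>n. R / 2 ^ n < norm z"] n N_def by auto
    then have zn: "z \<in> D n" by (simp add: D_def)
    have "norm z powr - s <= c n"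
      unfolding c_def using N n assms by (intro powr_mono2') auto
    then have "ennreal (indicator (cball 0 R) z * norm z powr - s) <= ennreal (c n) * indicator (D n) z"
      using z zn by (simp add: ennreal_leI)
    also have "\<dots> <= (\<Sum>n. ennreal (c n) * indicator (D n) z)"
    proof -
      define f where "f n = ennreal (c n) * indicator (D n) z" for n
      have "f n <= suminf f" using sum_le_suminf[of f "{n}"] by simp
      then show ?thesis by (simp add: f_def[abs_def])
    qed
    finally show ?thesis .
  qed
  have [measurable]: "D n \<in> sets lborel" for n by (simp add: D_def)
  define K where "K = (R / 2) powr - s * (unit_ball_vol 2 * R^2)"
  have term_eq: "ennreal (c n) * emeasure lborel (D n) = ennreal (K * (2 powr (s - 2)) ^ n)" for n
  proof -
    have e: "emeasure lborel (D n) = ennreal (unit_ball_vol 2 * (R / 2 ^ n)^2)"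
      unfolding D_def using assms by (subst emeasure_cball) auto
    have "c n = (R / 2) powr - s * (2 powr s) ^ n"
    proof -
      have "c n = ((R / 2) / 2 ^ n) powr - s" by (simp add: c_def)
      also have "\<dots> = (R / 2) powr - s / (2 ^ n) powr - s"
        using assms by (subst powr_divide) auto
      also have "((2::real) ^ n) powr - s = 1 / (2 powr s) ^ n"
        by (simp add: powr_minus powr_power powr_powr mult.commute inverse_eq_divide flip: powr_realpow)
      finally show ?thesis by simp
    qed
    moreover have "(2 powr (s - 2)) ^ n = (2 powr s) ^ n / (2 ^ n)^2"
      by (simp add: powr_diff power_divide power2_eq_square flip: power_mult_distrib)
    ultimately have "c n * (unit_ball_vol 2 * (R / 2 ^ n)^2) = K * (2 powr (s - 2)) ^ n"
      by (simp add: K_def power_divide)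
    moreover have "c n >= 0" by (simp add: c_def)
    ultimately show ?thesis unfolding e by (simp flip: ennreal_mult)
  qed
  have "(\<integral>\<^sup>+z. ennreal (indicator (cball 0 R) z * norm (z :: real^2) powr - s) \<partial>lborel)
      <= (\<integral>\<^sup>+z. (\<Sum>n. ennreal (c n) * indicator (D n) z) \<partial>lborel)"
    by (intro nn_integral_mono ptw)
  also have "\<dots> = (\<Sum>n. ennreal (c n) * emeasure lborel (D n))"
    by (subst nn_integral_suminf) (auto intro!: suminf_cong nn_integral_cmult_indicator, simp add: D_def)
  also have "\<dots> = (\<Sum>n. ennreal (K * (2 powr (s - 2)) ^ n))" by (simp add: term_eq)
  also have "\<dots> = ennreal (\<Sum>n. K * (2 powr (s - 2)) ^ n)"
  proof (rule suminf_ennreal2)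
    show "0 <= K * (2 powr (s - 2)) ^ n" for n by (simp add: K_def)
    have "2 powr (s - 2) < (1 :: real)" using assms by (simp add: powr_less_one)
    then show "summable (\<lambda>n. K * (2 powr (s - 2)) ^ n)"
      by (intro summable_mult summable_geometric) simp
  qed
  also have "\<dots> < \<infinity>" by simp
  finally show ?thesis .
qed

section \<open>The annulus as a finite measure space and singular integrals on it\<close>

lemma annulus_facts:
  shows "open annulus" "bounded annulus" "annulus \<in> sets lebesgue" "annulus \<in> sets borel"
    "closure annulus \<subseteq> {x. 1/2 <= norm x \<and> norm x <= 1}"
    "x \<in> frontier annulus ==> norm x = 1/2 \<or> norm x = 1"
    "finite_measure (lebesgue_on annulus)"
proof -
  have eq: "annulus = ball 0 1 - cball 0 (1/2)" by (auto simp: annulus_def)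
  show op: "open annulus" unfolding eq by auto
  show bd: "bounded annulus" unfolding eq by (rule bounded_diff) auto
  show "annulus \<in> sets lebesgue" "annulus \<in> sets borel" using op by auto
  have "closed ({x::real^2. norm x <= 1} \<inter> {x. 1/2 <= norm x})"
    by (intro closed_Int closed_Collect_le continuous_intros)
  then show cl: "closure annulus \<subseteq> {x. 1/2 <= norm x \<and> norm x <= 1}"
    by (intro closure_minimal) (auto simp: annulus_def Int_def conj_commute)
  show "norm x = 1/2 \<or> norm x = 1" if "x \<in> frontier annulus"
    using that cl op unfolding frontier_def by (auto simp: interior_open annulus_def)
  have "emeasure lebesgue annulus < \<infinity>"
    using emeasure_bounded_finite[OF bd] op by (simp add: emeasure_completion)
  then show "finite_measure (lebesgue_on annulus)"
    using op by (intro finite_measureI) (simp add: emeasure_restrict_space less_top)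
qed

abbreviation Om :: "(real^2) measure" where
  "Om \<equiv> lebesgue_on annulus"

interpretation Om: finite_measure "Om"
  by (rule annulus_facts)

lemma borel_measurable_lebesgue_on [measurable (raw)]:
  "f \<in> borel_measurable borel ==> f \<in> borel_measurable (lebesgue_on S)"
  by (rule measurable_restrict_space1, rule measurable_completion) simp

text \<open>Seen from a point \<open>x\<close> of the closed unit disc the annulus lies in the disc
  of radius 2 about \<open>x\<close>, so after a translation one integral bounds all of
  them.\<close>

lemma norm_powr_integrable:
  fixes x :: "real^2"
  assumes s: "0 <= s" "s < 2"
  shows "\<exists>C. \<forall>x. norm x <= 1 --> integrable Om (\<lambda>z. norm (x - z) powr - s)
    \<and> (LINT z|Om. norm (x - z) powr - s) <= C"
proof -
  let ?I = "\<integral>\<^sup>+z. ennreal (indicator (cball 0 2) z * norm (z :: real^2) powr - s) \<partial>lborel"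
  have fin: "?I < \<infinity>" by (rule nn_integral_norm_powr_finite) (use s in auto)
  have nn: "(\<integral>\<^sup>+z. ennreal (norm (x - z) powr - s) \<partial>Om) <= ?I" if "norm x <= 1" for x :: "real^2"
  proof -
    have "(\<integral>\<^sup>+z. ennreal (norm (x - z) powr - s) \<partial>Om)
        = (\<integral>\<^sup>+z. ennreal (norm (x - z) powr - s) * indicator annulus z \<partial>lebesgue)"
      using annulus_facts(3) by (simp add: nn_integral_restrict_space)
    also have "\<dots> = (\<integral>\<^sup>+z. ennreal (norm (x - z) powr - s) * indicator annulus z \<partial>lborel)"
      by (rule nn_integral_completion)
    also have "\<dots> <= (\<integral>\<^sup>+z. ennreal (indicator (cball 0 2) (z - x) * norm (z - x) powr - s) \<partial>lborel)"
    proof (rule nn_integral_mono)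
      fix z
      have "z - x \<in> cball 0 2" if "z \<in> annulus"
        using that \<open>norm x <= 1\<close> norm_triangle_ineq4[of z x] by (auto simp: annulus_def)
      then show "ennreal (norm (x - z) powr - s) * indicator annulus z
          <= ennreal (indicator (cball 0 2) (z - x) * norm (z - x) powr - s)"
        by (auto simp: indicator_def norm_minus_commute)
    qed
    also have "\<dots> = (\<integral>\<^sup>+z. ennreal (indicator (cball 0 2) z * norm z powr - s) \<partial>distr lborel borel ((+) (- x)))"
      by (subst nn_integral_distr) (auto intro!: measurable_compose[OF _ measurable_ennreal] borel_measurable_times borel_measurable_indicator)
    also have "\<dots> = ?I" by (simp add: lborel_distr_plus)
    finally show ?thesis .
  qed
  show ?thesis
  proof (intro exI[of _ "enn2real ?I"] allI impI conjI)
    fix x :: "real^2" assume x: "norm x <= 1"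
    show "integrable Om (\<lambda>z. norm (x - z) powr - s)"
    proof (rule integrableI_bounded)
      show "(\<lambda>z. norm (x - z) powr - s) \<in> borel_measurable Om"
        by (rule borel_measurable_lebesgue_on) measurable
      show "(\<integral>\<^sup>+z. ennreal (norm (norm (x - z) powr - s)) \<partial>Om) < \<infinity>"
        using nn[OF x] fin by simp
    qed
    have "(LINT z|Om. norm (x - z) powr - s)
        = enn2real (\<integral>\<^sup>+z. ennreal (norm (x - z) powr - s) \<partial>Om)"
      by (rule integral_eq_nn_integral) (auto intro!: borel_measurable_lebesgue_on)
    also have "\<dots> <= enn2real ?I"
      by (rule enn2real_mono[OF nn[OF x]]) (use fin in simp)
    finally show "(LINT z|Om. norm (x - z) powr - s) <= enn2real ?I" .
  qed
qed

lemma abs_ln_le: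
  fixes t :: real
  assumes "t > 0"
  shows "\<bar>ln t\<bar> <= t + t powr - 1"
proof -
  have "ln t <= t" using ln_le_minus_one[OF assms] by simp
  moreover have "ln (1 / t) <= 1 / t" using ln_le_minus_one[of "1 / t"] assms by simp
  ultimately show ?thesis
    using assms by (simp add: powr_minus ln_div inverse_eq_divide abs_le_iff add_increasing2)
qed

lemma annulus_norm: "x \<in> annulus ==> norm x < 1" "x \<in> annulus ==> norm x > 1/2"
  by (auto simp: annulus_def)

lemma annulus_inner: "x \<in> annulus ==> x \<bullet> x < 1" "x \<in> annulus ==> x \<bullet> x > 1/4"
  using power_strict_mono[of "norm x" 1 2] power_strict_mono[of "1/2" "norm x" 2]
  by (auto simp: annulus_def power2_norm_eq_inner power_divide)

text \<open>In the variable \<open>ln (2 * norm x)\<close>, which runs from 0 to \<open>ln 2\<close>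
  across the annulus, this is one arch of the sine. For radial functions, \<open>r^2\<close> times
  the Laplacian is the second derivative in that variable, whence the eigenvalue
  \<open>(pi / ln 2)^2\<close>.\<close>

definition phi :: "real^2 => real" where
  "phi x = sin (pi / (2 * ln 2) * ln (4 * (x \<bullet> x)))"

lemma phi_angle:
  assumes "1/2 <= norm x" "norm x <= 1"
  shows "0 <= pi / (2 * ln 2) * ln (4 * (x \<bullet> x))" "pi / (2 * ln 2) * ln (4 * (x \<bullet> x)) <= pi"
proof -
  have xx: "1/4 <= x \<bullet> x" "x \<bullet> x <= 1"
    using power_mono[of "norm x" 1 2] power_mono[of "1/2" "norm x" 2] assms
    by (auto simp: power2_norm_eq_inner power_divide)
  then have "ln (4 * (x \<bullet> x)) >= 0" by simp
  then show "0 <= pi / (2 * ln 2) * ln (4 * (x \<bullet> x))" by simp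
  have "ln (4 * (x \<bullet> x)) <= ln (2 ^ 2)" using xx by (subst ln_le_cancel_iff) auto
  also have "\<dots> = 2 * ln 2" by (subst ln_realpow) auto
  finally show "pi / (2 * ln 2) * ln (4 * (x \<bullet> x)) <= pi" by (simp add: field_simps)
qed

lemma phi_nonneg: "x \<in> annulus ==> 0 <= phi x"
  unfolding phi_def by (rule sin_ge_zero; intro phi_angle) (auto simp: annulus_def)

lemma phi_le_1: "phi x <= 1"
  by (simp add: phi_def)

lemma phi_boundary:
  assumes "norm x = 1/2 \<or> norm x = 1"
  shows "phi x = 0"
proof -
  have "x \<bullet> x = (norm x)^2" by (simp add: power2_norm_eq_inner)
  then consider "x \<bullet> x = 1/4" | "x \<bullet> x = 1" using assms by (metis one_power2 power_one_over power2_eq_square mult_2 numeral_Bit0 four_x_squared)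
  then show ?thesis
  proof cases
    case 2
    have "ln 4 = 2 * ln (2::real)" using ln_realpow[of 2 2] by simp
    then show ?thesis using 2 by (simp add: phi_def)
  next
    case 1
    then have "4 * (x \<bullet> x) = 1" by simp
    then show ?thesis by (simp only: phi_def) simp
  qed
qed

lemma
  assumes "x \<in> annulus"
  shows laplacian_phi: "laplacian phi x = - ((pi / ln 2)^2 * phi x / (x \<bullet> x))"
    and grad_phi: "norm (grad phi x) <= 4 * pi / ln 2"
proof -
  define k where "k = pi / (2 * ln 2)"
  define F where "F t = sin (k * ln (4 * t))" for t
  define F' where "F' t = cos (k * ln (4 * t)) * k / t" for t
  have phi: "phi = (\<lambda>x. F (x \<bullet> x))" by (auto simp: phi_def F_def k_def)
  have 1: "(F has_real_derivative F' t) (at t)" if "t \<in> {0<..}" for t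
    unfolding F_def[abs_def] F'_def using that by (auto intro!: derivative_eq_intros)
  have xx: "x \<bullet> x > 0" "x \<bullet> x > 1/4" using annulus_inner[OF assms] by auto
  let ?t = "x \<bullet> x"
  have 2: "(F' has_real_derivative - (k^2 * F ?t / ?t^2) - F' ?t / ?t) (at ?t)"
    unfolding F'_def[abs_def] F_def[abs_def] using xx(1)
    by (auto intro!: derivative_eq_intros simp: divide_simps power2_eq_square)
  have xT: "?t \<in> {0<..}" using xx(1) by (simp only: greaterThan_iff)
  note rad = laplacian_radial[OF open_greaterThan xT 1 2]
  have "laplacian phi x = 4 * ?t * (- (k^2 * F ?t / ?t^2) - F' ?t / ?t) + 4 * F' ?t"
    unfolding phi using rad(1) by simp
  also have "\<dots> = - ((2 * k)^2 * F ?t / ?t)"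
    using xx(1) by (simp add: field_simps power2_eq_square)
  finally show "laplacian phi x = - ((pi / ln 2)^2 * phi x / (x \<bullet> x))"
    by (simp add: phi k_def)
  have "grad phi x = (2 * F' ?t) *\<^sub>R x"
    unfolding phi by (rule grad_eqI, rule rad(2)) (use xT in simp_all)
  then have "norm (grad phi x) = 2 * (\<bar>cos (k * ln (4 * ?t))\<bar> * (\<bar>k\<bar> / ?t)) * norm x"
    using xx(1) by (simp add: F'_def abs_mult)
  also have "\<dots> <= 2 * (1 * (\<bar>k\<bar> / (1/4))) * 1"
    using xx annulus_norm[OF assms] by (intro mult_mono divide_left_mono) auto
  also have "\<dots> = 4 * pi / ln 2" by (simp add: k_def)
  finally show "norm (grad phi x) <= 4 * pi / ln 2" .
qed

lemma Ck_on_phi: "Ck_on k annulus phi"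
proof -
  have "x \<bullet> x > 0" if "x \<in> annulus" for x :: "real^2" using annulus_inner[OF that] by linarith
  then show ?thesis
    unfolding phi_def[abs_def]
    by (intro Ck_on_sin Ck_on_cmult Ck_on_ln Ck_on_inner_self annulus_facts) auto
qed

lemma continuous_on_phi: "continuous_on (closure annulus) phi"
proof -
  have "x \<bullet> x ~= 0" if "x \<in> closure annulus" for x using that annulus_facts(5) by auto
  then show ?thesis unfolding phi_def[abs_def] by (intro continuous_intros) auto
qed

lemma phi_measurable [measurable]: "phi \<in> borel_measurable borel"
  unfolding phi_def[abs_def] by measurable

text \<open>The eigenfunction vanishes on both circles and has bounded gradient and Laplacian, so it
  is admissible in \<open>neg_laplacian_W11_0_boundary\<close>. The factor
  \<open>1 / (x \<bullet> x)\<close> remains because \<open>phi\<close> belongs to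
  \<open>r^2\<close> times the Laplacian and not to the Laplacian itself.\<close>

lemma weak_eigenfunction_identity:
  assumes "u \<in> W11_0 annulus" "neg_laplacian_distr annulus u f" "integrable Om f"
  shows "(LINT x|Om. f x * phi x)
    = (pi / ln 2)^2 * (LINT x|Om. u x * (phi x / (x \<bullet> x)))"
proof -
  define B where "B = max (4 * pi / ln 2) (4 * (pi / ln 2)^2)"
  have lapB: "\<bar>laplacian phi x\<bar> <= 4 * (pi / ln 2)^2" if "x \<in> annulus" for x
  proof -
    have "\<bar>laplacian phi x\<bar> = (pi / ln 2)^2 * (phi x / (x \<bullet> x))"
      using phi_nonneg[OF that] by (simp add: laplacian_phi[OF that])
    also have "\<dots> <= (pi / ln 2)^2 * (1 / (1/4))"
      using phi_nonneg[OF that] annulus_inner[OF that] phi_le_1[of x]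
      by (intro mult_left_mono frac_le) auto
    finally show ?thesis by simp
  qed
  have "- (LINT x|Om. u x * laplacian phi x) = (LINT x|Om. f x * phi x)"
    by (rule neg_laplacian_W11_0_boundary[OF annulus_facts(1,2) assms Ck_on_phi continuous_on_phi, where B = B])
      (use phi_nonneg phi_boundary annulus_facts(6) order.trans[OF grad_phi] order.trans[OF lapB]
       in \<open>auto simp: B_def\<close>)
  also have "(LINT x|Om. u x * laplacian phi x)
      = (LINT x|Om. - ((pi / ln 2)^2 * (u x * (phi x / (x \<bullet> x)))))"
    by (intro Bochner_Integration.integral_cong) (auto simp: laplacian_phi)
  finally show ?thesis by (simp only: integral_minus integral_mult_right_zero)
qed

text \<open>
  One half of the system: the equation for \<open>u\<close>, whose right-hand side involves \<open>v\<close>. The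
  system is symmetric under exchanging its halves, with weight exponent \<open>0\<close> in the second.
\<close>

definition weight :: "real^2 => real => real^2 => real" where
  "weight x0 \<beta> x = norm (x - x0) powr (2 * \<beta>)"

definition half_system :: "real^2 => real => real => real => real => (real^2 => real) =>
    (real^2 => real) => (real^2 => real) => bool" where
  "half_system x0 \<beta> a b A V u v \<longleftrightarrow>
     (\<exists>L. L-lipschitz_on annulus V) \<and>
     (\<forall>x\<in>annulus. a <= V x \<and> V x <= b) \<and>
     (\<exists>G. has_weak_gradient annulus V G \<and> Linfty_norm annulus G <= ereal A) \<and>
     u \<in> W11_0 annulus \<and>
     integrable Om (\<lambda>x. weight x0 \<beta> x * exp (v x)) \<and>
     neg_laplacian_distr annulus u (\<lambda>x. weight x0 \<beta> x * V x * exp (v x))"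

lemma weight_measurable [measurable]: "weight x0 \<beta> \<in> borel_measurable borel"
  unfolding weight_def[abs_def] by measurable

lemma weight_nonneg: "0 <= weight x0 \<beta> x"
  by (simp add: weight_def)

lemma weight_pos: "norm x0 = 1/2 ==> x \<in> annulus ==> 0 < weight x0 \<beta> x"
  by (auto simp: weight_def annulus_def)

lemma half_systemD:
  assumes "half_system x0 \<beta> a b A V u v" "0 < a"
  shows "V \<in> borel_measurable Om"
    "x \<in> annulus ==> a <= V x" "x \<in> annulus ==> V x <= b"
    "u \<in> W11_0 annulus" "integrable Om u"
    "integrable Om (\<lambda>x. weight x0 \<beta> x * exp (v x))"
    "integrable Om (\<lambda>x. weight x0 \<beta> x * V x * exp (v x))"
    "neg_laplacian_distr annulus u (\<lambda>x. weight x0 \<beta> x * V x * exp (v x))"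
proof -
  obtain L where "L-lipschitz_on annulus V" using assms(1) by (auto simp: half_system_def)
  then show V: "V \<in> borel_measurable Om"
    by (intro continuous_on_measurable_lebesgue_on annulus_facts lipschitz_on_continuous_on)
  show bd: "x \<in> annulus ==> a <= V x" "x \<in> annulus ==> V x <= b" for x
    using assms(1) by (auto simp: half_system_def)
  show "u \<in> W11_0 annulus" using assms(1) by (auto simp: half_system_def)
  then show "integrable Om u" by (auto simp: W11_0_def)
  show i: "integrable Om (\<lambda>x. weight x0 \<beta> x * exp (v x))"
    using assms(1) by (auto simp: half_system_def)
  have "integrable Om (\<lambda>x. weight x0 \<beta> x * exp (v x) * V x)"
    by (rule integrable_mult_bounded[OF i V, where B = b]) (use bd assms(2) in \<open>force simp: abs_if\<close>)
  then show "integrable Om (\<lambda>x. weight x0 \<beta> x * V x * exp (v x))"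
    by (simp add: mult_ac)
  show "neg_laplacian_distr annulus u (\<lambda>x. weight x0 \<beta> x * V x * exp (v x))"
    using assms(1) by (auto simp: half_system_def)
qed

text \<open>The tangent of the exponential at \<open>ln M\<close>. Its slope \<open>M\<close> is
  free, so the exponential dominates every multiple of its argument up to a constant.\<close>

lemma exp_ge_affine:
  fixes M t :: real
  assumes "M > 0"
  shows "M * t + M - M * ln M <= exp t"
proof -
  have "1 + (t - ln M) <= exp (t - ln M)" by simp
  then have "M * (1 + (t - ln M)) <= M * exp (t - ln M)" using assms by (intro mult_left_mono) auto
  also have "M * exp (t - ln M) = exp t" using assms by (simp add: exp_diff)
  finally show ?thesis by (simp add: algebra_simps)
qed

lemma weight_exp_eq:
  assumes "norm x0 = 1/2" "x \<in> annulus"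
  shows "weight x0 \<beta> x * exp t = exp (t + 2 * \<beta> * ln (norm (x - x0)))"
  using assms by (auto simp: weight_def powr_def exp_add annulus_def)

lemma ln_distance_bound:
  assumes "norm x0 = 1/2" "x \<in> annulus"
  shows "\<bar>ln (norm (x - x0))\<bar> <= 2 + norm (x0 - x) powr - 1"
proof -
  have "norm (x - x0) <= 2"
    using norm_triangle_ineq4[of x x0] assms annulus_norm[OF assms(2)] by auto
  then show ?thesis
    using abs_ln_le[of "norm (x - x0)"] assms unfolding norm_minus_commute[of x0 x] annulus_def
    by (cases "x = x0") (simp, force)
qed

text \<open>The weight is moved into the exponent, where it becomes
  \<open>2 * \<beta> * ln (norm (x - x0))\<close>. Its logarithmic singularity is below the inverse
  distance, which is integrable in the plane, so the error is harmless after integration.\<close>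

lemma exp_dominates_linear:
  assumes "norm x0 = 1/2" "0 < M"
  shows "\<exists>K. \<forall>x t. x \<in> annulus -->
    M / (x \<bullet> x) * t - K * (1 + norm (x0 - x) powr - 1) <= weight x0 \<beta> x * exp t"
proof (intro exI allI impI)
  fix x :: "real^2" and t :: real
  assume x: "x \<in> annulus"
  \<comment> \<open>The slope varies with the point, to match the weight in the eigenfunction
    identity, but stays between \<open>M\<close> and \<open>4 * M\<close> on the annulus; so
    \<open>K\<close> does not depend on \<open>x\<close>.\<close>
  define N where "N = M / (x \<bullet> x)"
  have xx: "x \<bullet> x > 1/4" "x \<bullet> x < 1" using annulus_inner[OF x] by auto
  have N: "M <= N" "N <= 4 * M" "N > 0"
  proof -
    have "M / 1 <= N" "N <= M / (1/4)" unfolding N_def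
      using assms(2) xx by (intro divide_left_mono; auto)+
    then show "M <= N" "N <= 4 * M" "N > 0" using assms(2) by auto
  qed
  let ?l = "ln (norm (x - x0))" and ?q = "norm (x0 - x) powr - 1"
  have q0: "?q >= 0" by simp
  have "N * ln N <= 4 * M * \<bar>ln (4 * M)\<bar>"
  proof -
    have "N * ln N <= N * \<bar>ln (4 * M)\<bar>"
      using N by (intro mult_left_mono) (auto simp: abs_if intro: order.trans[of _ "ln (4*M)"])
    also have "\<dots> <= 4 * M * \<bar>ln (4 * M)\<bar>" using N by (intro mult_right_mono) auto
    finally show ?thesis .
  qed
  moreover have "- (N * (2 * \<beta> * ?l)) <= 4 * M * (2 * \<bar>\<beta>\<bar> * (2 + ?q))"
  proof -
    have "- (N * (2 * \<beta> * ?l)) <= \<bar>N * (2 * \<beta> * ?l)\<bar>" by simp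
    also have "\<dots> = N * (2 * \<bar>\<beta>\<bar> * \<bar>?l\<bar>)" using N(3) by (simp add: abs_mult)
    also have "\<dots> <= 4 * M * (2 * \<bar>\<beta>\<bar> * (2 + ?q))"
      using N ln_distance_bound[OF assms(1) x] by (intro mult_mono) auto
    finally show ?thesis .
  qed
  moreover have "N * (t + 2 * \<beta> * ?l) + N - N * ln N <= weight x0 \<beta> x * exp t"
    unfolding weight_exp_eq[OF assms(1) x] by (rule exp_ge_affine[OF N(3)])
  ultimately have "N * t - 4 * M * \<bar>ln (4 * M)\<bar> - 4 * M * (2 * \<bar>\<beta>\<bar> * (2 + ?q)) <= weight x0 \<beta> x * exp t"
    using N(3) by (simp add: distrib_left)
  moreover have "4 * M * \<bar>ln (4 * M)\<bar> + 4 * M * (2 * \<bar>\<beta>\<bar> * (2 + ?q))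
      <= (4 * M * \<bar>ln (4 * M)\<bar> + 16 * M * \<bar>\<beta>\<bar>) * (1 + ?q)"
  proof -
    define q where "q = ?q"
    have "M * \<bar>\<beta>\<bar> * q >= 0" "M * \<bar>ln (4 * M)\<bar> * q >= 0" using assms(2) q0 by (auto simp: q_def)
    then show ?thesis unfolding q_def[symmetric] by (simp add: algebra_simps)
  qed
  ultimately show "M / (x \<bullet> x) * t - (4 * M * \<bar>ln (4 * M)\<bar> + 16 * M * \<bar>\<beta>\<bar>) * (1 + ?q) <= weight x0 \<beta> x * exp t"
    unfolding N_def by linarith
qed

lemma phi_mult_integrable:
  assumes "integrable Om f"
  shows "integrable Om (\<lambda>x. f x * phi x)"
    "integrable Om (\<lambda>x. f x * (phi x / (x \<bullet> x)))"
proof -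
  show "integrable Om (\<lambda>x. f x * phi x)"
    by (rule integrable_mult_bounded[OF assms, where B = 1]) (auto simp: phi_nonneg phi_le_1)
  have "phi x / (x \<bullet> x) <= 4" if "x \<in> annulus" for x
  proof -
    have "phi x / (x \<bullet> x) <= 1 / (1/4)"
      using phi_nonneg[OF that] phi_le_1[of x] annulus_inner[OF that] by (intro frac_le) auto
    then show ?thesis by simp
  qed
  then show "integrable Om (\<lambda>x. f x * (phi x / (x \<bullet> x)))"
    by (intro integrable_mult_bounded[OF assms, where B = 4])
      (auto simp: phi_nonneg intro!: borel_measurable_lebesgue_on)
qed

text \<open>The slope in \<open>exp_dominates_linear\<close> is taken as
  \<open>2 * (pi / ln 2)^2 / a\<close>. After multiplication by \<open>V >= a\<close> it is twice
  the eigenvalue, and this factor 2 closes the loop between the two equations.\<close>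

lemma half_system_eigenfunction_bound:
  assumes x0: "norm x0 = 1/2" and a: "0 < a"
  shows "\<exists>C. \<forall>b A V u v. half_system x0 \<beta> a b A V u v --> integrable Om v -->
    2 * (pi / ln 2)^2 * (LINT x|Om. v x * (phi x / (x \<bullet> x))) - C
      <= (LINT x|Om. weight x0 \<beta> x * V x * exp (v x) * phi x)"
proof -
  define k where "k = 2 * (pi / ln 2)^2"
  have k: "k > 0" by (simp add: k_def)
  obtain K where K: "!!x t. x \<in> annulus ==>
      (k / a) / (x \<bullet> x) * t - K * (1 + norm (x0 - x) powr - 1) <= weight x0 \<beta> x * exp t"
    using exp_dominates_linear[OF x0, of "k / a" \<beta>] k a by auto
  have iq: "integrable Om (\<lambda>x. 1 + norm (x0 - x) powr - 1)"
    using norm_powr_integrable[of 1] x0 by auto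
  define C where "C = (LINT x|Om. a * K * ((1 + norm (x0 - x) powr - 1) * phi x))"
  show ?thesis
  proof (intro exI[of _ C] allI impI)
    fix b A V u v
    assume h: "half_system x0 \<beta> a b A V u v" and v: "integrable Om v"
    note h = half_systemD[OF h a]
    have "k * (LINT x|Om. v x * (phi x / (x \<bullet> x))) - C
        = (LINT x|Om. k * (v x * (phi x / (x \<bullet> x))) - a * K * ((1 + norm (x0 - x) powr - 1) * phi x))"
      unfolding C_def
      by (subst Bochner_Integration.integral_diff; (intro integrable_mult_right phi_mult_integrable v iq)?)
        (simp only: integral_mult_right_zero)
    also have "\<dots> <= (LINT x|Om. weight x0 \<beta> x * V x * exp (v x) * phi x)"
    proof (rule integral_mono)
      fix x assume "x \<in> space Om"
      then have x: "x \<in> annulus" by simp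
      have "a * ((k / a) / (x \<bullet> x) * v x - K * (1 + norm (x0 - x) powr - 1)) <= a * (weight x0 \<beta> x * exp (v x))"
        using K[OF x] a by (intro mult_left_mono) auto
      also have "\<dots> <= V x * (weight x0 \<beta> x * exp (v x))"
        using h(2)[OF x] weight_nonneg by (intro mult_right_mono) auto
      finally have "(a * ((k / a) / (x \<bullet> x) * v x - K * (1 + norm (x0 - x) powr - 1))) * phi x
          <= (V x * (weight x0 \<beta> x * exp (v x))) * phi x"
        using phi_nonneg[OF x] by (rule mult_right_mono)
      moreover have "(a * ((k / a) / (x \<bullet> x) * v x - K * (1 + norm (x0 - x) powr - 1))) * phi x
         = k * (v x * (phi x / (x \<bullet> x))) - a * K * ((1 + norm (x0 - x) powr - 1) * phi x)"
        using a by (simp add: field_simps)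
      ultimately show "k * (v x * (phi x / (x \<bullet> x))) - a * K * ((1 + norm (x0 - x) powr - 1) * phi x)
          <= weight x0 \<beta> x * V x * exp (v x) * phi x"
        by (simp add: mult_ac)
    qed (intro Bochner_Integration.integrable_diff integrable_mult_right phi_mult_integrable v iq h(7))+
    finally show "2 * (pi / ln 2)^2 * (LINT x|Om. v x * (phi x / (x \<bullet> x))) - C
      <= (LINT x|Om. weight x0 \<beta> x * V x * exp (v x) * phi x)" by (simp add: k_def)
  qed
qed

section \<open>Bounds for the coupled system in the weighted norm given by the eigenfunction\<close>

definition full_system where
  "full_system x0 \<beta>1 a1 b1 A1 \<beta>2 a2 b2 A2 V W u v \<longleftrightarrow>
     half_system x0 \<beta>1 a1 b1 A1 V u v \<and> half_system x0 \<beta>2 a2 b2 A2 W v u"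

lemma full_system_sym:
  "full_system x0 \<beta>1 a1 b1 A1 \<beta>2 a2 b2 A2 V W u v ==> full_system x0 \<beta>2 a2 b2 A2 \<beta>1 a1 b1 A1 W V v u"
  by (simp add: full_system_def)

text \<open>Let \<open>F\<close> and \<open>G\<close> be the masses weighted by \<open>phi\<close>.
  The eigenfunction identity expresses them through the integrals of \<open>u\<close> and
  \<open>v\<close>, and the growth of the exponential then gives \<open>2 * G - C1 <= F\<close> and
  \<open>2 * F - C2 <= G\<close>. Adding these bounds \<open>F + G\<close>.\<close>

lemma full_system_weighted_bound:
  assumes x0: "norm x0 = 1/2" and a: "0 < a1" "0 < a2"
  shows "\<exists>C. \<forall>b1 b2 A1 A2 V W u v. full_system x0 \<beta>1 a1 b1 A1 \<beta>2 a2 b2 A2 V W u v -->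
    (LINT x|Om. weight x0 \<beta>1 x * V x * exp (v x) * phi x) <= C \<and>
    (LINT x|Om. weight x0 \<beta>1 x * exp (v x) * phi x) <= C \<and>
    (LINT x|Om. \<bar>v x\<bar> * phi x) <= C"
proof -
  let ?k = "(pi / ln 2)^2"
  obtain C1 where C1: "!!b A V u v. half_system x0 \<beta>1 a1 b A V u v ==> integrable Om v ==>
      2 * ?k * (LINT x|Om. v x * (phi x / (x \<bullet> x))) - C1
      <= (LINT x|Om. weight x0 \<beta>1 x * V x * exp (v x) * phi x)"
    using half_system_eigenfunction_bound[OF x0 a(1), of \<beta>1] by blast
  obtain C2 where C2: "!!b A V u v. half_system x0 \<beta>2 a2 b A V u v ==> integrable Om v ==>
      2 * ?k * (LINT x|Om. v x * (phi x / (x \<bullet> x))) - C2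
      <= (LINT x|Om. weight x0 \<beta>2 x * V x * exp (v x) * phi x)"
    using half_system_eigenfunction_bound[OF x0 a(2), of \<beta>2] by blast
  obtain K where K: "!!x t. x \<in> annulus ==>
      1 / (x \<bullet> x) * t - K * (1 + norm (x0 - x) powr - 1) <= weight x0 \<beta>1 x * exp t"
    using exp_dominates_linear[OF x0, of 1 \<beta>1] by auto
  have iq: "integrable Om (\<lambda>x. 1 + norm (x0 - x) powr - 1)"
    using norm_powr_integrable[of 1] x0 by auto
  define C3 where "C3 = (LINT x|Om. \<bar>K\<bar> * ((1 + norm (x0 - x) powr - 1) * phi x))"
  define C where "C = \<bar>C1 + C2\<bar> + \<bar>C1 + C2\<bar> / a1 + (2 * (\<bar>C1 + C2\<bar> / a1 + C3))"
  have C3: "C3 >= 0" unfolding C3_def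
    by (rule Bochner_Integration.integral_nonneg) (auto intro!: mult_nonneg_nonneg simp: phi_nonneg)
  show ?thesis
  proof (intro exI[of _ C] allI impI)
    fix b1 b2 A1 A2 V W u v
    assume "full_system x0 \<beta>1 a1 b1 A1 \<beta>2 a2 b2 A2 V W u v"
    then have hh: "half_system x0 \<beta>1 a1 b1 A1 V u v" "half_system x0 \<beta>2 a2 b2 A2 W v u"
      by (auto simp: full_system_def)
    note h = half_systemD[OF hh(1) a(1)] and g = half_systemD[OF hh(2) a(2)]
    define F where "F = (LINT x|Om. weight x0 \<beta>1 x * V x * exp (v x) * phi x)"
    define G where "G = (LINT x|Om. weight x0 \<beta>2 x * W x * exp (u x) * phi x)"
    have Fu: "F = ?k * (LINT x|Om. u x * (phi x / (x \<bullet> x)))"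
      unfolding F_def by (rule weak_eigenfunction_identity[OF h(4,8,7)])
    have Gv: "G = ?k * (LINT x|Om. v x * (phi x / (x \<bullet> x)))"
      unfolding G_def by (rule weak_eigenfunction_identity[OF g(4,8,7)])
    have F0: "F >= 0" unfolding F_def
    proof (rule Bochner_Integration.integral_nonneg)
      fix x assume "x \<in> space Om"
      then have "x \<in> annulus" by simp
      then show "0 <= weight x0 \<beta>1 x * V x * exp (v x) * phi x"
        using h(2) a(1) phi_nonneg weight_nonneg by (intro mult_nonneg_nonneg) (auto intro: order.trans[of 0 a1])
    qed
    have G0: "G >= 0" unfolding G_def
    proof (rule Bochner_Integration.integral_nonneg)
      fix x assume "x \<in> space Om"
      then have "x \<in> annulus" by simp
      then show "0 <= weight x0 \<beta>2 x * W x * exp (u x) * phi x"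
        using g(2) a(2) phi_nonneg weight_nonneg by (intro mult_nonneg_nonneg) (auto intro: order.trans[of 0 a2])
    qed
    have "2 * G - C1 <= F" using C1[OF hh(1) g(5)] by (simp add: Gv F_def mult.assoc)
    moreover have "2 * F - C2 <= G" using C2[OF hh(2) h(5)] by (simp add: Fu G_def mult.assoc)
    ultimately have FC: "F <= \<bar>C1 + C2\<bar>" and GC: "G <= \<bar>C1 + C2\<bar>" using F0 G0 by linarith+
    define I where "I = (LINT x|Om. weight x0 \<beta>1 x * exp (v x) * phi x)"
    have "a1 * I <= F"
    proof -
      have "a1 * I = (LINT x|Om. a1 * (weight x0 \<beta>1 x * exp (v x) * phi x))" by (simp add: I_def)
      also have "\<dots> <= F" unfolding F_def
      proof (rule integral_mono)
        fix x assume "x \<in> space Om"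
        then have x: "x \<in> annulus" by simp
        show "a1 * (weight x0 \<beta>1 x * exp (v x) * phi x) <= weight x0 \<beta>1 x * V x * exp (v x) * phi x"
          using mult_right_mono[OF h(2)[OF x], of "weight x0 \<beta>1 x * exp (v x) * phi x"]
            weight_nonneg[of x0 \<beta>1 x] phi_nonneg[OF x] by (simp add: mult_ac)
      qed (use phi_mult_integrable(1)[OF h(6)] phi_mult_integrable(1)[OF h(7)] in auto)
      finally show ?thesis .
    qed
    then have "a1 * I <= \<bar>C1 + C2\<bar>" using FC by simp
    then have IC: "I <= \<bar>C1 + C2\<bar> / a1" using a(1) by (simp add: pos_le_divide_eq mult.commute)
    have I0: "I >= 0" unfolding I_def
      by (rule Bochner_Integration.integral_nonneg) (auto simp: weight_nonneg phi_nonneg)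
    \<comment> \<open>An absolute value is twice the positive part minus the function. The positive
      part of \<open>v x / (x \<bullet> x)\<close> is controlled by the exponential, and the
      integral that is subtracted is nonnegative, being a multiple of \<open>G\<close>.\<close>
    have "(LINT x|Om. \<bar>v x\<bar> * phi x) <= (LINT x|Om. 2 * (weight x0 \<beta>1 x * exp (v x) * phi x)
        + 2 * (\<bar>K\<bar> * ((1 + norm (x0 - x) powr - 1) * phi x)) - v x * (phi x / (x \<bullet> x)))"
    proof (rule integral_mono)
      fix x assume "x \<in> space Om"
      then have x: "x \<in> annulus" by simp
      let ?q = "1 + norm (x0 - x) powr - 1"
      define e where "e = weight x0 \<beta>1 x * exp (v x)"
      define t where "t = 1 / (x \<bullet> x) * v x"
      have "t - K * ?q <= e" using K[OF x] by (simp add: e_def t_def)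
      moreover have "K * ?q <= \<bar>K\<bar> * ?q" by (intro mult_right_mono) auto
      moreover have "e >= 0" "\<bar>K\<bar> * ?q >= 0" by (auto simp: e_def weight_nonneg)
      ultimately have "\<bar>t\<bar> <= 2 * e + 2 * (\<bar>K\<bar> * ?q) - t" by linarith
      moreover have "\<bar>v x\<bar> <= \<bar>t\<bar>"
      proof -
        have "1 / 1 <= 1 / (x \<bullet> x)" by (rule frac_le) (use annulus_inner[OF x] in linarith)+
        then have "1 * \<bar>v x\<bar> <= \<bar>1 / (x \<bullet> x)\<bar> * \<bar>v x\<bar>" by (intro mult_right_mono) auto
        then show ?thesis by (simp only: t_def abs_mult mult_1)
      qed
      ultimately have "\<bar>v x\<bar> <= 2 * e + 2 * (\<bar>K\<bar> * ?q) - t" by linarith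
      then have "\<bar>v x\<bar> * phi x <= (2 * e + 2 * (\<bar>K\<bar> * ?q) - t) * phi x"
        using phi_nonneg[OF x] by (rule mult_right_mono)
      also have "\<dots> = 2 * (e * phi x) + 2 * (\<bar>K\<bar> * (?q * phi x)) - v x * (phi x / (x \<bullet> x))"
        by (simp add: t_def algebra_simps)
      finally show "\<bar>v x\<bar> * phi x <= 2 * (weight x0 \<beta>1 x * exp (v x) * phi x)
        + 2 * (\<bar>K\<bar> * (?q * phi x)) - v x * (phi x / (x \<bullet> x))" by (simp add: e_def)
    qed (use phi_mult_integrable(1)[OF h(6)] phi_mult_integrable[OF g(5)] phi_mult_integrable(1)[OF iq]
          phi_mult_integrable(1)[OF integrable_abs[OF g(5)]] in \<open>auto intro!: Bochner_Integration.integrable_diff Bochner_Integration.integrable_add\<close>)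
    also have "\<dots> = 2 * I + 2 * C3 - (LINT x|Om. v x * (phi x / (x \<bullet> x)))"
      unfolding I_def C3_def
      by (subst Bochner_Integration.integral_diff, subst Bochner_Integration.integrable_add, simp_all only: integral_mult_right_zero)
        (use phi_mult_integrable(1)[OF h(6)] phi_mult_integrable[OF g(5)] phi_mult_integrable(1)[OF iq] in
          \<open>auto simp: Bochner_Integration.integral_add\<close>)
    also have "\<dots> <= 2 * I + 2 * C3"
    proof -
      have "(LINT x|Om. v x * (phi x / (x \<bullet> x))) >= 0"
        using G0 unfolding Gv by (simp add: zero_le_mult_iff)
      then show ?thesis by simp
    qed
    finally have "(LINT x|Om. \<bar>v x\<bar> * phi x) <= 2 * (\<bar>C1 + C2\<bar> / a1 + C3)" using IC by simp
    moreover have "\<bar>C1 + C2\<bar> / a1 >= 0" using a by simp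
    moreover obtain D E where D: "D = \<bar>C1 + C2\<bar>" and E: "E = \<bar>C1 + C2\<bar> / a1" by blast
    moreover have "D >= 0" by (simp add: D)
    ultimately show "F <= C \<and> I <= C \<and> (LINT x|Om. \<bar>v x\<bar> * phi x) <= C"
      using FC IC C3 unfolding C_def D[symmetric] E[symmetric] by auto
  qed
qed

section \<open>Regularised Green functions\<close>

text \<open>
  For \<open>eps = 0\<close> this is the Green function of the disc of squared radius \<open>rho\<close> or of its exterior:
  \<open>kP rho x z\<close> is the squared distance of \<open>z\<close> to the reflection of \<open>x\<close> in the circle, times \<open>x \<bullet> x / rho\<close>.
\<close>

definition kP :: "real => 'a::real_inner => 'a => real" where
  "kP rho x z = (x \<bullet> x) * (z \<bullet> z) / rho + rho - 2 * (x \<bullet> z)"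

definition kQ :: "'a::real_inner => 'a => real" where
  "kQ x z = (x - z) \<bullet> (x - z)"

definition kG :: "real => real => 'a::real_inner => 'a => real" where
  "kG rho eps x z = ln (kP rho x z + eps) - ln (kQ x z + eps)"

text \<open>The derivative of \<open>kG rho eps x z\<close> in the first argument along the radial field \<open>x\<close>.\<close>

definition kLG :: "real => real => 'a::real_inner => 'a => real" where
  "kLG rho eps x z = (kP rho x z + (x \<bullet> x) * (z \<bullet> z) / rho - rho) / (kP rho x z + eps)
     - (kQ x z + x \<bullet> x - z \<bullet> z) / (kQ x z + eps)"

lemma kQ_nonneg: "0 <= kQ x z"
  by (simp add: kQ_def)

lemma kQ_norm: "kQ x z = (norm (x - z))^2"
  by (simp add: kQ_def power2_norm_eq_inner)

lemma kQ_eq: "kQ x z = x \<bullet> x + z \<bullet> z - 2 * (x \<bullet> z)"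
  by (simp add: kQ_def inner_diff_left inner_diff_right inner_commute)

lemma kQ_ge: "(norm x - norm z)^2 <= kQ x z"
  unfolding kQ_norm by (rule power2_le_iff_abs_le[THEN iffD2]) (auto intro: norm_triangle_ineq3)

text \<open>\<open>kP\<close> is this square plus twice the defect in the Cauchy-Schwarz
  inequality.\<close>

lemma kP_ge:
  assumes "rho > 0"
  shows "(norm x * norm z - rho)^2 / rho <= kP rho x z"
proof -
  have "kP rho x z = ((norm x * norm z)^2 / rho + rho) - 2 * (x \<bullet> z)"
    by (simp add: kP_def power2_norm_eq_inner power_mult_distrib)
  moreover have "(norm x * norm z)^2 / rho + rho = (norm x * norm z - rho)^2 / rho + 2 * (norm x * norm z)"
    using assms by (simp add: field_simps power2_eq_square)
  moreover have "x \<bullet> z <= norm x * norm z" by (rule norm_cauchy_schwarz)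
  ultimately show ?thesis by linarith
qed

lemma kP_nonneg: "rho > 0 ==> 0 <= kP rho x z"
  by (rule order.trans[OF _ kP_ge]) auto

text \<open>The classical identity behind the Green function: direct and reflected distance agree
  when one of the points is on the circle, and the reflected one is larger when both points are on
  the same side.\<close>

lemma kP_minus_kQ: "rho ~= 0 ==> kP rho x z - kQ x z = (x \<bullet> x - rho) * (z \<bullet> z - rho) / rho"
  by (simp add: kP_def kQ_eq field_simps)

lemma kQ_le_kP:
  assumes "rho > 0" "(x \<bullet> x - rho) * (z \<bullet> z - rho) >= 0"
  shows "kQ x z <= kP rho x z"
proof -
  have "(x \<bullet> x - rho) * (z \<bullet> z - rho) / rho >= 0" using assms by (intro divide_nonneg_pos)
  then show ?thesis using kP_minus_kQ[of rho x z] assms(1) by linarith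
qed

lemma kP_commute: "kP rho x z = kP rho z x" and kQ_commute: "kQ x z = kQ z x"
  by (simp_all add: kP_def kQ_eq inner_commute mult.commute)

text \<open>This replaces the method of moving planes: the symmetrised derivative of the Green function is nonnegative.\<close>

lemma symmetrised_kernel_core:
  fixes x z :: "'a::real_inner"
  assumes "rho > 0" "eps > 0" and D: "(x \<bullet> x - rho) * (z \<bullet> z - rho) >= 0"
  shows "rho^2 * (x \<bullet> x - z \<bullet> z)^2 / (kQ x z + eps) <= ((x \<bullet> x) * (z \<bullet> z) - rho^2)^2 / (kP rho x z + eps)"
proof -
  define p q D where "p = x \<bullet> x" "q = z \<bullet> z" "D = (p - rho) * (q - rho)"
  define Q where "Q = kQ x z"
  define r s where "r = norm x" "s = norm z"
  have pr: "p = r^2" "q = s^2" by (simp_all add: p_q_D_def r_s_def power2_norm_eq_inner)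
  have P: "kP rho x z = Q + D / rho"
    using kP_minus_kQ[of rho x z] assms(1) by (simp add: Q_def p_q_D_def)
  have D0: "D >= 0" using D by (simp add: p_q_D_def)
  have Q0: "Q >= 0" by (simp add: Q_def kQ_nonneg)
  have "rho * (r + s)^2 <= (p + rho) * (q + rho)"
  proof -
    have "(p + rho) * (q + rho) - rho * (r + s)^2 = (r * s - rho)^2"
      by (simp add: pr power2_eq_square algebra_simps)
    then show ?thesis using zero_le_power2[of "r * s - rho"] by linarith
  qed
  then have "(rho * (r + s)^2) * (r - s)^2 <= ((p + rho) * (q + rho)) * Q"
    using assms(1) kQ_ge[of x z] by (rule_tac mult_mono) (auto simp: r_s_def Q_def pr)
  also have "\<dots> <= ((p + rho) * (q + rho)) * (Q + eps)"
    using assms by (intro mult_left_mono) (auto simp: pr)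
  finally have "(r + s)^2 * (r - s)^2 * rho <= (p + rho) * (q + rho) * (Q + eps)"
    by (simp add: mult_ac)
  moreover have "(r + s)^2 * (r - s)^2 = (p - q)^2"
    by (simp add: pr power2_eq_square algebra_simps)
  ultimately have "(p - q)^2 * rho <= (p + rho) * (q + rho) * (Q + eps)" by simp
  then have "D * ((p - q)^2 * rho) <= D * ((p + rho) * (q + rho) * (Q + eps))"
    using D0 by (rule mult_left_mono)
  \<comment> \<open>After clearing denominators this difference has to be nonnegative. The expansion
    shows that \<open>D\<close> factors out and that the cofactor is the inequality just
    proved.\<close>
  moreover have "(p * q - rho^2)^2 * (Q + eps) - rho^2 * (p - q)^2 * (Q + D / rho + eps)
      = D * ((p + rho) * (q + rho) * (Q + eps)) - D * ((p - q)^2 * rho)"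
  proof -
    have "(p * q - rho^2)^2 = rho^2 * (p - q)^2 + D * ((p + rho) * (q + rho))"
      by (simp add: p_q_D_def(3) power2_eq_square algebra_simps)
    moreover have "rho^2 * (p - q)^2 * (D / rho) = D * ((p - q)^2 * rho)"
      using assms(1) by (simp add: power2_eq_square)
    ultimately show ?thesis by (simp add: distrib_left distrib_right)
  qed
  ultimately have "rho^2 * (p - q)^2 * (kP rho x z + eps) <= (p * q - rho^2)^2 * (Q + eps)"
    unfolding P by linarith
  then have "rho^2 * (p - q)^2 / (Q + eps) <= (p * q - rho^2)^2 / (kP rho x z + eps)"
    using Q0 kP_nonneg[OF assms(1), of x z] assms by (simp add: divide_simps add_nonneg_pos split: if_splits)
  then show ?thesis by (simp add: p_q_D_def Q_def)
qed

text \<open>This profile is only once differentiable, which is enough because the radial field is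
  differentiated once. It does not increase with the distance from 1, the property that the
  symmetrised kernel needs, and it vanishes before the smooth \<open>cutoff\<close> leaves the value
  1.\<close>

definition plateau :: "real => real" where
  "plateau s = (max 0 (1 - 4 * (s - 1)^2))^2"

lemma plateau_bounds: "0 <= plateau s" "plateau s <= 1"
  by (auto simp: plateau_def max_def power_le_one)

lemma plateau_eq_0: "1/2 <= \<bar>s - 1\<bar> ==> plateau s = 0"
proof -
  assume "1/2 <= \<bar>s - 1\<bar>"
  then have "(1/2)^2 <= \<bar>s - 1\<bar>^2" by (intro power_mono) auto
  then show ?thesis by (simp add: plateau_def power_divide)
qed

lemma plateau_antimono: "\<bar>s - 1\<bar> <= \<bar>t - 1\<bar> ==> plateau t <= plateau s"
  unfolding plateau_def by (intro power_mono) (auto simp: max_def abs_le_square_iff)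

text \<open>Apart from the plateau this is the hyperbolic tangent of the logarithmic distance
  \<open>ln (sqrt (p / rho))\<close> to the circle. For it the sum and the difference of two values
  have a common denominator and numerators proportional to \<open>p * q - rho^2\<close> and
  \<open>rho * (p - q)\<close>, exactly the quantities in
  \<open>symmetrised_kernel_core\<close>.\<close>

definition rho_fun :: "real => real => real" where
  "rho_fun rho p = (p - rho) / (p + rho) * plateau (p / rho)"

text \<open>The larger plateau value is split as \<open>e1 + (e2 - e1)\<close>: the part with
  \<open>e1\<close> is the inequality without a plateau, and the excess multiplies nonnegative terms
  only.\<close>

lemma symmetrised_kernel_aux:
  fixes k1 k2 e1 e2 a b :: real
  assumes "(k1 - k2) * b <= (k1 + k2) * a" "0 <= e1" "e1 <= e2" "0 <= k2 * a" "0 <= k2 * b"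
  shows "(k1 * e1 - k2 * e2) * b <= (k1 * e1 + k2 * e2) * a"
proof -
  have "e1 * ((k1 - k2) * b) <= e1 * ((k1 + k2) * a)" using assms by (intro mult_left_mono)
  moreover have "0 <= (e2 - e1) * (k2 * a + k2 * b)" using assms by (intro mult_nonneg_nonneg) auto
  ultimately show ?thesis by (simp add: algebra_simps)
qed

text \<open>Here \<open>x\<close> is the point farther from the circle, so its plateau value is the
  smaller one and \<open>symmetrised_kernel_aux\<close> applies. The order also gives
  \<open>x \<bullet> x - z \<bullet> z\<close> the sign of \<open>z \<bullet> z - rho\<close>, which
  makes the excess terms nonnegative.\<close>

lemma symmetrised_kernel_ordered:
  fixes x z :: "'a::real_inner"
  assumes "rho > 0" "eps > 0" and c: "x \<bullet> x >= rho \<and> z \<bullet> z >= rho \<or> x \<bullet> x <= rho \<and> z \<bullet> z <= rho"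
    and ordered: "\<bar>z \<bullet> z - rho\<bar> <= \<bar>x \<bullet> x - rho\<bar>"
  shows "(rho_fun rho (x \<bullet> x) - rho_fun rho (z \<bullet> z)) * ((x \<bullet> x - z \<bullet> z) / (kQ x z + eps))
    <= (rho_fun rho (x \<bullet> x) + rho_fun rho (z \<bullet> z)) * (((x \<bullet> x) * (z \<bullet> z) / rho - rho) / (kP rho x z + eps))"
proof -
  define p q where "p = x \<bullet> x" "q = z \<bullet> z"
  note c = c[folded p_q_def] and ordered = ordered[folded p_q_def]
  have pq: "p >= 0" "q >= 0" by (auto simp: p_q_def)
  define a b where "a = (p * q / rho - rho) / (kP rho x z + eps)" "b = (p - q) / (kQ x z + eps)"
  define k1 k2 where "k1 = (p - rho) / (p + rho)" "k2 = (q - rho) / (q + rho)"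
  have den: "kP rho x z + eps > 0" "kQ x z + eps > 0"
    using kP_nonneg[OF assms(1), of x z] kQ_nonneg[of x z] assms(2) by auto
  have D: "(p - rho) * (q - rho) >= 0"
    using c by (auto intro: mult_nonneg_nonneg mult_nonpos_nonpos)
  have ord: "p >= q \<and> q >= rho \<or> p <= q \<and> q <= rho"
    using c ordered by auto
  show ?thesis
    unfolding rho_fun_def p_q_def[symmetric] a_b_def[symmetric] k1_k2_def[symmetric]
  proof (rule symmetrised_kernel_aux)
    have sums: "k1 + k2 = 2 * (p * q - rho^2) / ((p + rho) * (q + rho))"
      "k1 - k2 = 2 * rho * (p - q) / ((p + rho) * (q + rho))"
      unfolding k1_k2_def using pq assms(1)
      by (simp_all add: add_frac_eq diff_frac_eq add_nonneg_pos less_imp_neq[symmetric] power2_eq_square algebra_simps)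
    have "(k1 - k2) * b = 2 / (rho * ((p + rho) * (q + rho))) * (rho^2 * (p - q)^2 / (kQ x z + eps))"
      unfolding sums a_b_def using assms(1) by (simp add: power2_eq_square)
    also have "\<dots> <= 2 / (rho * ((p + rho) * (q + rho))) * ((p * q - rho^2)^2 / (kP rho x z + eps))"
      using symmetrised_kernel_core[OF assms(1,2), of x z] D pq assms(1) unfolding p_q_def
      by (intro mult_left_mono) auto
    also have "\<dots> = (k1 + k2) * a"
    proof -
      have "a = (p * q - rho^2) / (rho * (kP rho x z + eps))"
        unfolding a_b_def using assms(1) by (simp add: power2_eq_square diff_divide_distrib)
      then show ?thesis unfolding sums by (simp add: power2_eq_square mult_ac)
    qed
    finally show "(k1 - k2) * b <= (k1 + k2) * a" .
    show "0 <= plateau (p / rho)" by (rule plateau_bounds)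
    show "plateau (p / rho) <= plateau (q / rho)"
    proof (rule plateau_antimono)
      have "\<bar>s / rho - 1\<bar> = \<bar>s - rho\<bar> / rho" for s
        using assms(1) by (simp add: abs_if field_simps)
      then show "\<bar>q / rho - 1\<bar> <= \<bar>p / rho - 1\<bar>"
        using ordered assms(1) by (simp add: divide_right_mono)
    qed
    have "p * q / rho - rho = (p * q - rho * rho) / rho" using assms(1) by (simp add: diff_divide_distrib)
    moreover have "rho * rho <= p * q \<and> q >= rho \<or> p * q <= rho * rho \<and> q <= rho"
      using c pq assms(1) by (auto intro: mult_mono)
    ultimately show "0 <= k2 * a"
      unfolding k1_k2_def a_b_def using den assms(1) pq
      by (auto simp: zero_le_mult_iff zero_le_divide_iff divide_le_0_iff add_nonneg_nonneg)
    show "0 <= k2 * b"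
      unfolding k1_k2_def a_b_def using den ord assms(1) pq
      by (auto simp: zero_le_mult_iff zero_le_divide_iff divide_le_0_iff add_nonneg_nonneg)
  qed
qed

lemma symmetrised_kernel:
  fixes x z :: "'a::real_inner"
  assumes "rho > 0" "eps > 0" and c: "x \<bullet> x >= rho \<and> z \<bullet> z >= rho \<or> x \<bullet> x <= rho \<and> z \<bullet> z <= rho"
  shows "(rho_fun rho (x \<bullet> x) - rho_fun rho (z \<bullet> z)) * ((x \<bullet> x - z \<bullet> z) / (kQ x z + eps))
    <= (rho_fun rho (x \<bullet> x) + rho_fun rho (z \<bullet> z)) * (((x \<bullet> x) * (z \<bullet> z) / rho - rho) / (kP rho x z + eps))"
proof (cases "\<bar>z \<bullet> z - rho\<bar> <= \<bar>x \<bullet> x - rho\<bar>")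
  case True
  then show ?thesis by (rule symmetrised_kernel_ordered[OF assms])
next
  case False
  have swap: "(h1 - h2) * ((s - t) / w) = (h2 - h1) * ((t - s) / w)" for h1 h2 s t w :: real
    by (simp add: algebra_simps diff_divide_distrib)
  have "(rho_fun rho (z \<bullet> z) - rho_fun rho (x \<bullet> x)) * ((z \<bullet> z - x \<bullet> x) / (kQ z x + eps))
    <= (rho_fun rho (z \<bullet> z) + rho_fun rho (x \<bullet> x)) * (((z \<bullet> z) * (x \<bullet> x) / rho - rho) / (kP rho z x + eps))"
    by (rule symmetrised_kernel_ordered[OF assms(1,2)]) (use c False in auto)
  then show ?thesis
    unfolding swap[of "rho_fun rho (x \<bullet> x)"]
    by (simp add: kP_commute[of rho x] kQ_commute[of x] mult.commute[of "z \<bullet> z"] add.commute[of "rho_fun rho (z \<bullet> z)"])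
qed

lemma rho_fun_abs_le:
  assumes "rho > 0" "p >= 0"
  shows "\<bar>rho_fun rho p\<bar> <= \<bar>p - rho\<bar> / rho" "\<bar>rho_fun rho p\<bar> <= 1"
proof -
  have "\<bar>rho_fun rho p\<bar> = \<bar>p - rho\<bar> / (p + rho) * plateau (p / rho)"
    unfolding rho_fun_def using plateau_bounds assms by (simp add: abs_mult)
  also have "\<dots> <= \<bar>p - rho\<bar> / (p + rho) * 1"
    using plateau_bounds assms by (intro mult_left_mono) auto
  finally have *: "\<bar>rho_fun rho p\<bar> <= \<bar>p - rho\<bar> / (p + rho)" by simp
  also have "\<dots> <= \<bar>p - rho\<bar> / rho" using assms by (intro divide_left_mono) auto
  finally show "\<bar>rho_fun rho p\<bar> <= \<bar>p - rho\<bar> / rho" .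
  have "\<bar>p - rho\<bar> / (p + rho) <= 1" using assms by (auto simp: abs_if)
  then show "\<bar>rho_fun rho p\<bar> <= 1" using * by simp
qed

text \<open>Without regularisation the fractions \<open>P / (P + eps)\<close> and
  \<open>Q / (Q + eps)\<close> would both be 1 and cancel in \<open>kLG\<close>. Their difference
  lies between 0 and \<open>eps / (Q + eps)\<close>, and the two values of \<open>rho_fun\<close>
  add up to at most 2 in absolute value; this is the defect on the left.\<close>

lemma symmetrised_kLG:
  fixes x z :: "'a::real_inner"
  assumes "rho > 0" "eps > 0" and c: "x \<bullet> x >= rho \<and> z \<bullet> z >= rho \<or> x \<bullet> x <= rho \<and> z \<bullet> z <= rho"
  shows "- 2 * (eps / (kQ x z + eps))
    <= rho_fun rho (x \<bullet> x) * kLG rho eps x z + rho_fun rho (z \<bullet> z) * kLG rho eps z x"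
proof -
  define h1 h2 where "h1 = rho_fun rho (x \<bullet> x)" "h2 = rho_fun rho (z \<bullet> z)"
  define P Q where "P = kP rho x z" "Q = kQ x z"
  have D: "(x \<bullet> x - rho) * (z \<bullet> z - rho) >= 0"
    using c by (auto intro: mult_nonneg_nonneg mult_nonpos_nonpos)
  then have PQ: "Q <= P" "0 <= Q"
    using kQ_le_kP[OF assms(1)] kQ_nonneg[of x z] by (auto simp: P_Q_def)
  have e: "0 <= P / (P + eps) - Q / (Q + eps)" "P / (P + eps) - Q / (Q + eps) <= eps / (Q + eps)"
  proof -
    have "P / (P + eps) = 1 - eps / (P + eps)" "Q / (Q + eps) = 1 - eps / (Q + eps)"
      using PQ assms(2) by (simp_all add: field_simps)
    moreover have "eps / (P + eps) <= eps / (Q + eps)" "0 <= eps / (P + eps)"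
      using PQ assms(2) by (auto intro!: divide_left_mono)
    ultimately show "0 <= P / (P + eps) - Q / (Q + eps)" "P / (P + eps) - Q / (Q + eps) <= eps / (Q + eps)" by auto
  qed
  have "\<bar>h1 + h2\<bar> <= 2"
    using rho_fun_abs_le(2)[OF assms(1), of "x \<bullet> x"] rho_fun_abs_le(2)[OF assms(1), of "z \<bullet> z"]
    by (simp add: h1_h2_def)
  then have "\<bar>h1 + h2\<bar> * \<bar>P / (P + eps) - Q / (Q + eps)\<bar> <= 2 * (eps / (Q + eps))"
    using e by (intro mult_mono) auto
  then have "- 2 * (eps / (Q + eps)) <= (h1 + h2) * (P / (P + eps) - Q / (Q + eps))"
    unfolding abs_mult[symmetric] by (auto dest!: abs_le_D2 simp only: minus_le_iff mult_minus_left)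
  moreover have "(h1 - h2) * ((x \<bullet> x - z \<bullet> z) / (Q + eps)) <= (h1 + h2) * (((x \<bullet> x) * (z \<bullet> z) / rho - rho) / (P + eps))"
    using symmetrised_kernel[OF assms] by (simp add: h1_h2_def P_Q_def)
  moreover have "h1 * kLG rho eps x z + h2 * kLG rho eps z x = (h1 + h2) * (P / (P + eps) - Q / (Q + eps))
      + (h1 + h2) * (((x \<bullet> x) * (z \<bullet> z) / rho - rho) / (P + eps)) - (h1 - h2) * ((x \<bullet> x - z \<bullet> z) / (Q + eps))"
    unfolding kLG_def kP_commute[of rho z] kQ_commute[of z] P_Q_def[symmetric]
    by (simp add: algebra_simps add_divide_distrib diff_divide_distrib)
  ultimately show ?thesis unfolding h1_h2_def P_Q_def by linarith
qed

text \<open>A logarithm of a squared distance, differentiated along a bounded field, is of the order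
  of the inverse distance, and \<open>eps\<close> only enlarges denominators. On one side of the
  circle \<open>kP\<close> dominates \<open>kQ\<close>, so the reflected pole is no worse than the
  direct one.\<close>

lemma kLG_bound:
  fixes x z :: "'a::real_inner"
  assumes "rho > 0" "rho <= 1" "eps > 0" "norm x <= 1" "norm z <= 1" "x ~= z" and D: "(x \<bullet> x - rho) * (z \<bullet> z - rho) >= 0"
  shows "\<bar>kLG rho eps x z\<bar> <= (6 + 2 / rho) / norm (x - z)"
proof -
  define d where "d = norm (x - z)"
  have d: "d > 0" "d <= 2" using assms norm_triangle_ineq4[of x z] by (auto simp: d_def)
  have Q: "kQ x z = d^2" by (simp add: kQ_norm d_def)
  define P where "P = kP rho x z"
  have PQ: "d^2 <= P" using kQ_le_kP[OF assms(1) D] by (simp add: P_def Q)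
  define w where "w = (x \<bullet> x) * (z \<bullet> z) / rho - rho"
  have xz: "norm x * norm z <= 1" using assms by (intro mult_le_one) auto
  \<comment> \<open>\<open>w\<close> contains the factor \<open>norm x * norm z - rho\<close>, which
    \<open>kP_ge\<close> bounds by the square root of \<open>P\<close>; so
    \<open>w / (P + eps)\<close> is of the order of the inverse square root of
    \<open>P\<close>.\<close>
  have w1: "w^2 <= (4 / rho) * P"
  proof -
    have "w = (norm x * norm z - rho) * (norm x * norm z + rho) / rho"
      using assms(1) by (simp add: w_def power2_norm_eq_inner[symmetric] field_simps power2_eq_square)
    then have "w^2 = ((norm x * norm z - rho)^2 / rho) * ((norm x * norm z + rho)^2 / rho)"
      by (simp add: power_mult_distrib power_divide power2_eq_square)
    also have "\<dots> <= P * (2^2 / rho)"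
      using kP_ge[OF assms(1), of x z] assms(1,2) xz unfolding P_def
      by (intro mult_mono divide_right_mono power_mono) (auto simp: kP_nonneg)
    finally show ?thesis by (simp add: mult.commute)
  qed
  have P0: "P > 0" using PQ d by (smt (verit) zero_less_power)
  have 1: "\<bar>w\<bar> / (P + eps) <= (2 / rho) / d"
  proof -
    have "(\<bar>w\<bar> * d)^2 = w^2 * d^2" by (simp add: power_mult_distrib)
    also have "\<dots> <= ((4 / rho) * P) * P" using w1 PQ P0 assms(1) by (intro mult_mono) auto
    also have "\<dots> <= ((4 / rho^2) * P) * P"
    proof -
      have "rho^2 <= rho" using assms(1,2) by (simp add: power2_eq_square mult_left_le)
      then have "4 / rho <= 4 / rho^2" using assms(1) by (intro divide_left_mono) auto
      then show ?thesis using P0 by (intro mult_right_mono) auto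
    qed
    also have "\<dots> = ((2 / rho) * P)^2" by (simp add: power2_eq_square)
    finally have "\<bar>w\<bar> * d <= (2 / rho) * P" by (rule power2_le_imp_le) (use P0 assms(1) in auto)
    also have "\<dots> <= (2 / rho) * (P + eps)" using assms by (intro mult_left_mono) auto
    finally have "\<bar>w\<bar> <= (2 / rho) * (P + eps) / d" using d(1) by (simp only: pos_le_divide_eq)
    then show ?thesis using P0 assms(3) by (simp add: pos_divide_le_eq mult.commute)
  qed
  have 2: "\<bar>x \<bullet> x - z \<bullet> z\<bar> / (d^2 + eps) <= 2 / d"
  proof -
    have "\<bar>x \<bullet> x - z \<bullet> z\<bar> = \<bar>norm x - norm z\<bar> * (norm x + norm z)"
    proof -
      have "x \<bullet> x - z \<bullet> z = (norm x - norm z) * (norm x + norm z)"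
        by (simp add: power2_norm_eq_inner[symmetric] power2_eq_square algebra_simps)
      then show ?thesis by (simp add: abs_mult)
    qed
    also have "\<dots> <= d * 2" unfolding d_def using assms norm_triangle_ineq3[of x z] by (intro mult_mono) auto
    finally have "\<bar>x \<bullet> x - z \<bullet> z\<bar> * d <= (d * 2) * d" using d by (intro mult_right_mono) auto
    then have "\<bar>x \<bullet> x - z \<bullet> z\<bar> * d <= 2 * (d^2 + eps)"
      using assms(3) by (simp add: power2_eq_square mult_ac)
    then show ?thesis using d assms(3) by (simp add: divide_simps add_pos_nonneg mult_ac)
  qed
  have 3: "0 <= P / (P + eps)" "P / (P + eps) <= 1" "0 <= d^2 / (d^2 + eps)" "d^2 / (d^2 + eps) <= 1"
    using P0 assms(3) by (auto simp: divide_le_eq_1 add_nonneg_pos)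
  have "kLG rho eps x z = P / (P + eps) + w / (P + eps) - d^2 / (d^2 + eps) - (x \<bullet> x - z \<bullet> z) / (d^2 + eps)"
    unfolding kLG_def Q P_def[symmetric] w_def by (simp add: add_divide_distrib diff_divide_distrib)
  moreover have "\<bar>w / (P + eps)\<bar> <= (2 / rho) / d" "\<bar>(x \<bullet> x - z \<bullet> z) / (d^2 + eps)\<bar> <= 2 / d"
    using 1 2 P0 assms(3) by (simp_all add: abs_divide abs_of_pos add_nonneg_pos)
  ultimately have "\<bar>kLG rho eps x z\<bar> <= 2 + (2 / rho) / d + 2 / d" using 3 by linarith
  also have "\<dots> <= 4 / d + (2 / rho) / d + 2 / d"
    using d by (simp add: field_simps)
  also have "\<dots> = (6 + 2 / rho) / d" by (simp add: add_divide_distrib)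
  finally show ?thesis by (simp add: d_def)
qed

section \<open>Derivatives of the regularised Green function and its cutoff near one circle\<close>

lemma kG_dilation_derivative:
  assumes "rho > 0" "eps > 0" "t > 0"
  shows "((\<lambda>t. kG rho eps (t *\<^sub>R x) z) has_real_derivative kLG rho eps (t *\<^sub>R x) z / t) (at t)"
proof -
  have P: "((\<lambda>t. kP rho (t *\<^sub>R x) z + eps) has_real_derivative
      (kP rho (t *\<^sub>R x) z + (t *\<^sub>R x \<bullet> t *\<^sub>R x) * (z \<bullet> z) / rho - rho) / t) (at t)"
    unfolding kP_def using assms by (auto intro!: derivative_eq_intros simp: field_simps)
  have Q: "((\<lambda>t. kQ (t *\<^sub>R x) z + eps) has_real_derivative
      (kQ (t *\<^sub>R x) z + t *\<^sub>R x \<bullet> t *\<^sub>R x - z \<bullet> z) / t) (at t)"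
    unfolding kQ_eq using assms by (auto intro!: derivative_eq_intros simp: field_simps)
  have pos: "kP rho (t *\<^sub>R x) z + eps > 0" "kQ (t *\<^sub>R x) z + eps > 0"
    using kP_nonneg[OF assms(1), of "t *\<^sub>R x" z] kQ_nonneg[of "t *\<^sub>R x" z] assms by linarith+
  show ?thesis
    unfolding kG_def kLG_def
    by (rule DERIV_cong[OF DERIV_diff[OF DERIV_ln_divide[THEN DERIV_chain2, OF pos(1) P] DERIV_ln_divide[THEN DERIV_chain2, OF pos(2) Q]]])
      (simp add: diff_divide_distrib mult.commute)
qed

text \<open>The inner \<open>flat\<close> vanishes for \<open>\<bar>s - 1\<bar> <= 3/5\<close> and
  reaches \<open>flat (13/100)\<close> at \<open>7/10\<close>, since
  \<open>49/100 - 9/25 = 13/100\<close>. So the value is 1 up to distance \<open>3/5\<close> and 0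
  from \<open>7/10\<close> on, which is less than the distance \<open>3/4\<close> of the inner
  circle when \<open>rho = 1\<close>.\<close>

definition cutoff :: "real => real" where
  "cutoff s = flat (1 - flat ((s - 1)^2 - 9/25) / flat (13/100)) / flat 1"

definition cutoff1 :: "real => real" where "cutoff1 = partial_deriv 1 cutoff"
definition cutoff2 :: "real => real" where "cutoff2 = partial_deriv 1 cutoff1"

lemma Ck_on_cutoff: "Ck_on k UNIV cutoff"
proof -
  have 1: "Ck_on k UNIV (\<lambda>s::real. s)" using Ck_on_inner[of UNIV k "1::real"] by simp
  have "Ck_on k UNIV (\<lambda>s. (1 / flat 1) * flat (1 - (1 / flat (13/100)) * flat ((s - 1) * (s - 1) - 9/25)))"
    by (intro Ck_on_cmult Ck_on_flat Ck_on_diff Ck_on_mult 1 Ck_on_const open_UNIV)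
  then show ?thesis by (simp add: cutoff_def[abs_def] power2_eq_square)
qed

lemma cutoff_derivatives:
  "(cutoff has_real_derivative cutoff1 s) (at s)" "(cutoff1 has_real_derivative cutoff2 s) (at s)"
  "continuous_on UNIV cutoff" "continuous_on UNIV cutoff1" "continuous_on UNIV cutoff2"
proof -
  have *: "(f has_real_derivative partial_deriv 1 f s) (at s)" if "f differentiable at s" for f :: "real => real" and s
  proof -
    have g: "GDERIV f s :> grad f s" using that by (rule GDERIV_grad)
    then have "partial_deriv 1 f s = grad f s" by (simp add: partial_deriv_GDERIV[OF g])
    then show ?thesis using g by (simp only: gderiv_deriv)
  qed
  show "(cutoff has_real_derivative cutoff1 s) (at s)"
    unfolding cutoff1_def using Ck_on_cutoff[of 1] by (intro *) simp
  show "(cutoff1 has_real_derivative cutoff2 s) (at s)"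
    unfolding cutoff2_def using Ck_on_cutoff[of 2] by (intro *) (simp add: numeral_2_eq_2 cutoff1_def)
  show "continuous_on UNIV cutoff" using Ck_on_cutoff[of 0] by simp
  show "continuous_on UNIV cutoff1" "continuous_on UNIV cutoff2"
    using Ck_on_cutoff[of 1] Ck_on_cutoff[of 2] by (simp_all add: cutoff1_def cutoff2_def numeral_2_eq_2)
qed

lemma cutoff_bounds: "0 <= cutoff s" "cutoff s <= 1"
proof -
  show "0 <= cutoff s" by (simp add: cutoff_def flat_nonneg)
  have "flat (1 - flat ((s - 1)^2 - 9/25) / flat (13/100)) <= flat 1"
    by (rule flat_mono) (simp add: flat_nonneg)
  then show "cutoff s <= 1" by (simp add: cutoff_def divide_le_eq_1 flat_eq)
qed

lemma cutoff_eq_1: "\<bar>s - 1\<bar> <= 3/5 ==> cutoff s = 1"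
proof -
  assume "\<bar>s - 1\<bar> <= 3/5"
  then have "\<bar>s - 1\<bar>^2 <= (3/5)^2" by (intro power_mono) auto
  then show ?thesis by (simp add: cutoff_def flat_eq power_divide)
qed

lemma cutoff_eq_0: "7/10 <= \<bar>s - 1\<bar> ==> cutoff s = 0"
proof -
  assume "7/10 <= \<bar>s - 1\<bar>"
  then have "(7/10)^2 <= \<bar>s - 1\<bar>^2" by (intro power_mono) auto
  then have "flat (13/100) <= flat ((s - 1)^2 - 9/25)" by (intro flat_mono) (simp add: power_divide)
  moreover have "flat (13/100) > 0" by (simp add: flat_eq)
  ultimately show ?thesis by (simp add: cutoff_def flat_poly_def[of _ "1 - _"])
qed

lemma cutoff12_eq_0: "\<bar>s - 1\<bar> < 3/5 ==> cutoff1 s = 0 \<and> cutoff2 s = 0"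
proof -
  assume s: "\<bar>s - 1\<bar> < 3/5"
  let ?U = "{s::real. \<bar>s - 1\<bar> < 3/5}"
  have "open ?U" by (intro open_Collect_less continuous_intros)
  have 1: "cutoff1 t = 0" if "t \<in> ?U" for t
  proof -
    have "cutoff1 t = partial_deriv 1 (\<lambda>_. 1) t"
      unfolding cutoff1_def by (rule partial_deriv_cong[OF \<open>open ?U\<close> that]) (simp add: cutoff_eq_1)
    then show ?thesis by (simp add: partial_deriv_eqI[OF has_derivative_const])
  qed
  have "cutoff2 s = partial_deriv 1 (\<lambda>_. 0) s"
    unfolding cutoff2_def by (rule partial_deriv_cong[OF \<open>open ?U\<close>]) (use s 1 in auto)
  then show ?thesis using 1 s by (simp add: partial_deriv_eqI[OF has_derivative_const])
qed

definition chi :: "real => 'a::real_inner => real" where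
  "chi rho z = cutoff (z \<bullet> z / rho)"

text \<open>Minus the Laplacian of the regularised Green function in \<open>z\<close>. The first
  part concentrates at \<open>x\<close> as \<open>eps\<close> tends to 0; the second belongs to the
  reflected pole and fades away when \<open>x\<close> is off the circle.\<close>

definition psi :: "real => real => 'a::real_inner => 'a => real" where
  "psi rho eps x z = 4 * eps / (kQ x z + eps)^2 - 4 * (x \<bullet> x / rho) * eps / (kP rho x z + eps)^2"

text \<open>The error term that the cut-off contributes to the Laplacian of \<open>chi rho z * kG rho eps x z\<close> in the plane.\<close>

definition kR :: "real => real => 'a::real_inner => 'a => real" where
  "kR rho eps x z = 4 / rho * cutoff1 (z \<bullet> z / rho) * kLG rho eps z x
     + (4 * (z \<bullet> z) / rho^2 * cutoff2 (z \<bullet> z / rho) + 4 / rho * cutoff1 (z \<bullet> z / rho)) * kG rho eps x z"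

lemma Ck_on_cutoff_compose:
  assumes "open S" "Ck_on k S g"
  shows "Ck_on k S (\<lambda>x. cutoff (g x))"
proof -
  have "Ck_on k S (\<lambda>x. (1 / flat 1) * flat (1 - (1 / flat (13/100)) * flat ((g x - 1) * (g x - 1) - 9/25)))"
    by (intro Ck_on_cmult Ck_on_flat Ck_on_diff Ck_on_mult assms Ck_on_const)
  then show ?thesis by (simp add: cutoff_def[abs_def] power2_eq_square)
qed

lemma Ck_on_kG:
  fixes x :: "'a::euclidean_space"
  assumes "rho > 0" "eps > 0"
  shows "Ck_on k UNIV (kG rho eps x)"
proof -
  have in1: "Ck_on k UNIV (\<lambda>z. x \<bullet> z)" using Ck_on_inner[of UNIV k x] by (simp add: inner_commute)
  have P: "Ck_on k UNIV (\<lambda>z. ((x \<bullet> x) / rho) * (z \<bullet> z) + rho - 2 * (x \<bullet> z) + eps)"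
    by (intro Ck_on_add Ck_on_diff Ck_on_cmult Ck_on_inner_self in1 Ck_on_const open_UNIV)
  have Q: "Ck_on k UNIV (\<lambda>z. (x \<bullet> x) + (z \<bullet> z) - 2 * (x \<bullet> z) + eps)"
    by (intro Ck_on_add Ck_on_diff Ck_on_cmult Ck_on_inner_self in1 Ck_on_const open_UNIV)
  have "Ck_on k UNIV (\<lambda>z. ln (((x \<bullet> x) / rho) * (z \<bullet> z) + rho - 2 * (x \<bullet> z) + eps) - ln ((x \<bullet> x) + (z \<bullet> z) - 2 * (x \<bullet> z) + eps))"
  proof (intro Ck_on_diff Ck_on_ln P Q open_UNIV)
    fix z
    show "((x \<bullet> x) / rho) * (z \<bullet> z) + rho - 2 * (x \<bullet> z) + eps > 0"
      using kP_nonneg[OF assms(1), of x z] assms(2) by (simp add: kP_def)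
    show "(x \<bullet> x) + (z \<bullet> z) - 2 * (x \<bullet> z) + eps > 0"
      using kQ_nonneg[of x z] assms(2) by (simp add: kQ_eq)
  qed
  then show ?thesis by (simp add: kG_def[abs_def] kP_def kQ_eq)
qed

lemma laplacian_mult:
  assumes "open S" "x \<in> S" "Ck_on 2 S f" "Ck_on 2 S g"
  shows "laplacian (\<lambda>x. f x * g x) x = f x * laplacian g x + 2 * (grad f x \<bullet> grad g x) + g x * laplacian f x"
proof -
  have d: "f differentiable at y" "g differentiable at y"
    "i \<in> Basis ==> partial_deriv i f differentiable at y" "i \<in> Basis ==> partial_deriv i g differentiable at y"
    if "y \<in> S" for y i
    using assms(3,4) that by (auto simp: numeral_2_eq_2)
  have prod: "partial_deriv i (\<lambda>x. f x * g x) y = f y * partial_deriv i g y + g y * partial_deriv i f y"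
    if "f differentiable at y" "g differentiable at y" for f g and y i :: 'a
    by (simp add: partial_deriv_GDERIV[OF GDERIV_mult[OF GDERIV_grad GDERIV_grad]] that
        partial_deriv_GDERIV[OF GDERIV_grad] inner_add_right)
  have sum: "partial_deriv i (\<lambda>x. f x + g x) y = partial_deriv i f y + partial_deriv i g y"
    if "f differentiable at y" "g differentiable at y" for f g and y i :: 'a
    by (simp add: partial_deriv_GDERIV[OF GDERIV_add[OF GDERIV_grad GDERIV_grad]] that
        partial_deriv_GDERIV[OF GDERIV_grad] inner_add_right)
  have "partial_deriv i (partial_deriv i (\<lambda>x. f x * g x)) x
      = f x * partial_deriv i (partial_deriv i g) x + 2 * (partial_deriv i f x * partial_deriv i g x)
        + g x * partial_deriv i (partial_deriv i f) x" if i: "i \<in> Basis" for i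
  proof -
    have "partial_deriv i (partial_deriv i (\<lambda>x. f x * g x)) x
        = partial_deriv i (\<lambda>x. f x * partial_deriv i g x + g x * partial_deriv i f x) x"
      by (rule partial_deriv_cong[OF assms(1,2)]) (simp add: prod d)
    also have "\<dots> = partial_deriv i (\<lambda>x. f x * partial_deriv i g x) x + partial_deriv i (\<lambda>x. g x * partial_deriv i f x) x"
      by (rule sum) (use d i assms(2) in auto)
    finally show ?thesis using d i assms(2) by (simp add: prod)
  qed
  then have "laplacian (\<lambda>x. f x * g x) x = (\<Sum>i\<in>Basis. f x * partial_deriv i (partial_deriv i g) x
      + 2 * (partial_deriv i f x * partial_deriv i g x) + g x * partial_deriv i (partial_deriv i f) x)"
    unfolding laplacian_def by (rule sum.cong[OF refl])
  also have "\<dots> = f x * laplacian g x + 2 * (\<Sum>i\<in>Basis. partial_deriv i f x * partial_deriv i g x) + g x * laplacian f x"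
    by (simp add: laplacian_def sum.distrib sum_distrib_left)
  also have "(\<Sum>i\<in>Basis. partial_deriv i f x * partial_deriv i g x) = grad f x \<bullet> grad g x"
    by (simp add: grad_def inner_sum_left inner_sum_right inner_Basis if_distrib mult.commute cong: if_cong)
  finally show ?thesis .
qed

text \<open>The arguments of both logarithms in \<open>kG\<close> are quadratic polynomials in
  \<open>z\<close> of this shape, so their first and second derivatives are computed once.\<close>

lemma gradient_quadratic_quotient:
  fixes b x :: "'a::real_inner"
  assumes "\<alpha> * (x \<bullet> x) - 2 * (b \<bullet> x) + \<gamma> > 0"
  defines "A \<equiv> \<lambda>x. \<alpha> * (x \<bullet> x) - 2 * (b \<bullet> x) + \<gamma>"
  shows "GDERIV (\<lambda>x. ln (A x)) x :> (2 / A x) *\<^sub>R (\<alpha> *\<^sub>R x - b)"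
    "((\<lambda>x. (2 / A x) *\<^sub>R (\<alpha> *\<^sub>R x - b)) has_derivative
      (\<lambda>h. (2 * \<alpha> / A x) *\<^sub>R h - (4 / (A x)^2 * (h \<bullet> (\<alpha> *\<^sub>R x - b))) *\<^sub>R (\<alpha> *\<^sub>R x - b))) (at x)"
proof -
  have Ax: "A x > 0" using assms by simp
  have A: "(A has_derivative (\<lambda>h. 2 * (h \<bullet> (\<alpha> *\<^sub>R x - b)))) (at x)"
    unfolding A_def by (auto intro!: derivative_eq_intros simp: inner_diff_right inner_commute algebra_simps)
  have "((\<lambda>x. ln (A x)) has_derivative (\<lambda>h. 2 * (h \<bullet> (\<alpha> *\<^sub>R x - b)) * inverse (A x))) (at x)"
    using has_derivative_ln[OF Ax A] by simp
  then show "GDERIV (\<lambda>x. ln (A x)) x :> (2 / A x) *\<^sub>R (\<alpha> *\<^sub>R x - b)"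
    unfolding gderiv_def by (rule has_derivative_eq_rhs) (simp add: divide_inverse mult_ac)
  note [derivative_intros] = A
  show "((\<lambda>x. (2 / A x) *\<^sub>R (\<alpha> *\<^sub>R x - b)) has_derivative
      (\<lambda>h. (2 * \<alpha> / A x) *\<^sub>R h - (4 / (A x)^2 * (h \<bullet> (\<alpha> *\<^sub>R x - b))) *\<^sub>R (\<alpha> *\<^sub>R x - b))) (at x)"
    using Ax by (auto intro!: derivative_eq_intros simp: divide_inverse power2_eq_square mult_ac)
qed

lemma sum_inner_Basis: "(\<Sum>i\<in>Basis. i \<bullet> (c *\<^sub>R i - (d * (i \<bullet> w)) *\<^sub>R w)) = c * real DIM('a) - d * (w \<bullet> (w :: 'a::euclidean_space))"
proof -
  have "(\<Sum>i\<in>Basis. i \<bullet> (c *\<^sub>R i - (d * (i \<bullet> w)) *\<^sub>R w)) = (\<Sum>i\<in>(Basis :: 'a set). c) - d * (\<Sum>i\<in>Basis. (w \<bullet> i) * (w \<bullet> i))"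
    unfolding sum_distrib_left sum_subtractf[symmetric]
    by (intro sum.cong) (auto simp: inner_diff_right inner_commute)
  then show ?thesis by (simp flip: euclidean_inner)
qed

lemma kG_gradient_laplacian:
  fixes x z :: "real^2"
  assumes "rho > 0" "eps > 0"
  shows "z \<bullet> grad (kG rho eps x) z = kLG rho eps z x" "laplacian (kG rho eps x) z = - psi rho eps x z"
proof -
  define A where "A z = ((x \<bullet> x) / rho) * (z \<bullet> z) - 2 * (x \<bullet> z) + (rho + eps)" for z
  define B where "B z = 1 * (z \<bullet> z) - 2 * (x \<bullet> z) + (x \<bullet> x + eps)" for z
  have AP: "A z = kP rho x z + eps" and BQ: "B z = kQ x z + eps" for z
    by (simp_all add: A_def B_def kP_def kQ_eq)
  have pos: "A z > 0" "B z > 0" for z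
    using kP_nonneg[OF assms(1), of x z] kQ_nonneg[of x z] assms(2) by (auto simp: AP BQ)
  have G: "kG rho eps x = (\<lambda>z. ln (A z) - ln (B z))" by (auto simp: kG_def AP BQ)
  note qA = gradient_quadratic_quotient[OF pos(1)[unfolded A_def], folded A_def]
  note qB = gradient_quadratic_quotient[OF pos(2)[unfolded B_def], folded B_def]
  let ?a = "\<lambda>z. ((x \<bullet> x) / rho) *\<^sub>R z - x" and ?b = "\<lambda>z. 1 *\<^sub>R z - x"
  have g: "GDERIV (kG rho eps x) z :> (2 / A z) *\<^sub>R ?a z - (2 / B z) *\<^sub>R ?b z" for z
    unfolding G by (rule GDERIV_diff[OF qA(1) qB(1)])
  have Az: "2 * (z \<bullet> ?a z) = kP rho z x + (z \<bullet> z) * (x \<bullet> x) / rho - rho"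
    by (simp add: kP_def inner_diff_right inner_commute algebra_simps)
  have Bz: "2 * (z \<bullet> ?b z) = kQ z x + z \<bullet> z - x \<bullet> x"
    by (simp add: kQ_eq inner_diff_right inner_commute algebra_simps)
  have "z \<bullet> grad (kG rho eps x) z = 2 * (z \<bullet> ?a z) / A z - 2 * (z \<bullet> ?b z) / B z"
    unfolding grad_eqI[OF g] by (simp add: inner_diff_right)
  then show "z \<bullet> grad (kG rho eps x) z = kLG rho eps z x"
    unfolding Az Bz AP BQ kLG_def kP_commute[of rho x z] kQ_commute[of x z] .
  have "laplacian (kG rho eps x) z = (\<Sum>i\<in>Basis. i \<bullet>
      (((2 * ((x \<bullet> x) / rho) / A z) *\<^sub>R i - (4 / (A z)^2 * (i \<bullet> ?a z)) *\<^sub>R ?a z)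
      - ((2 * 1 / B z) *\<^sub>R i - (4 / (B z)^2 * (i \<bullet> ?b z)) *\<^sub>R ?b z)))"
    by (rule laplacian_GDERIV[OF open_UNIV UNIV_I g has_derivative_diff[OF qA(2) qB(2)]])
  also have "\<dots> = (2 * ((x \<bullet> x) / rho) / A z * 2 - 4 / (A z)^2 * (?a z \<bullet> ?a z)) - (2 * 1 / B z * 2 - 4 / (B z)^2 * (?b z \<bullet> ?b z))"
    unfolding inner_diff_right[of _ "_ - _" "_ - _"] sum_subtractf sum_inner_Basis by simp
  \<comment> \<open>The trace of the identity is 2 in the plane. With this square rewritten through
    \<open>A z\<close> the terms of order \<open>1 / A z\<close> therefore cancel, and only a
    multiple of \<open>eps / (A z)^2\<close> is left.\<close>
  also have "?a z \<bullet> ?a z = ((x \<bullet> x) / rho) * A z - ((x \<bullet> x) / rho) * (rho + eps) + x \<bullet> x"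
    unfolding A_def using assms(1)
    by (simp add: inner_diff_right inner_diff_left inner_commute algebra_simps add_divide_distrib)
  also have "?b z \<bullet> ?b z = B z - (x \<bullet> x + eps) + x \<bullet> x"
    unfolding B_def by (simp add: inner_diff_right inner_diff_left inner_commute algebra_simps)
  also have "(2 * ((x \<bullet> x) / rho) / A z * 2 - 4 / (A z)^2 * (((x \<bullet> x) / rho) * A z - ((x \<bullet> x) / rho) * (rho + eps) + x \<bullet> x))
      = 4 * ((x \<bullet> x) / rho) * eps / (A z)^2"
    using pos(1)[of z] assms(1) by (simp add: field_simps power2_eq_square)
  also have "2 * 1 / B z * 2 - 4 / (B z)^2 * (B z - (x \<bullet> x + eps) + x \<bullet> x) = 4 * eps / (B z)^2"
    using pos(2)[of z] by (simp add: field_simps power2_eq_square)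
  finally show "laplacian (kG rho eps x) z = - psi rho eps x z"
    by (simp add: psi_def AP BQ)
qed

lemma chi_gradient_laplacian:
  fixes z :: "real^2"
  assumes "rho > 0"
  shows "grad (chi rho) z = (2 / rho * cutoff1 (z \<bullet> z / rho)) *\<^sub>R z"
    "laplacian (chi rho) z = 4 * (z \<bullet> z) / rho^2 * cutoff2 (z \<bullet> z / rho) + 4 / rho * cutoff1 (z \<bullet> z / rho)"
    "Ck_on k UNIV (chi rho :: real^2 => real)"
proof -
  have c: "chi rho = (\<lambda>z::real^2. (\<lambda>t. cutoff (t / rho)) (z \<bullet> z))" by (simp add: chi_def[abs_def])
  have d1: "((\<lambda>t. cutoff (t / rho)) has_real_derivative cutoff1 (t / rho) / rho) (at t)" for t
    using DERIV_chain2[OF cutoff_derivatives(1) DERIV_cdivide[OF DERIV_ident]] by simp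
  have d2: "((\<lambda>t. cutoff1 (t / rho) / rho) has_real_derivative cutoff2 (t / rho) / rho / rho) (at t)" for t
    using DERIV_cdivide[OF DERIV_chain2[OF cutoff_derivatives(2) DERIV_cdivide[OF DERIV_ident]]] by simp
  note rad = laplacian_radial[OF open_UNIV UNIV_I d1 d2]
  show "grad (chi rho) z = (2 / rho * cutoff1 (z \<bullet> z / rho)) *\<^sub>R z"
    unfolding c by (rule grad_eqI) (use rad(2)[of z] in simp)
  show "laplacian (chi rho) z = 4 * (z \<bullet> z) / rho^2 * cutoff2 (z \<bullet> z / rho) + 4 / rho * cutoff1 (z \<bullet> z / rho)"
    unfolding c using rad(1)[of z] by (simp add: power2_eq_square)
  have "Ck_on k UNIV (\<lambda>z::real^2. cutoff ((1 / rho) * (z \<bullet> z)))"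
    by (intro Ck_on_cutoff_compose Ck_on_cmult Ck_on_inner_self open_UNIV)
  then show "Ck_on k UNIV (chi rho :: real^2 => real)" by (simp add: chi_def[abs_def])
qed

text \<open>The gradient of \<open>chi\<close> is radial, so the mixed term of the product rule is
  the derivative of the Green function along the field \<open>z\<close>, that is
  \<open>kLG rho eps z x\<close>.\<close>

lemma laplacian_chi_kG:
  fixes x z :: "real^2"
  assumes "rho > 0" "eps > 0"
  shows "laplacian (\<lambda>z. chi rho z * kG rho eps x z) z = kR rho eps x z - chi rho z * psi rho eps x z"
proof -
  have "laplacian (\<lambda>z. chi rho z * kG rho eps x z) z
      = chi rho z * laplacian (kG rho eps x) z + 2 * (grad (chi rho) z \<bullet> grad (kG rho eps x) z) + kG rho eps x z * laplacian (chi rho) z"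
    using laplacian_mult[OF open_UNIV UNIV_I chi_gradient_laplacian(3) Ck_on_kG] assms by blast
  then show ?thesis
    unfolding chi_gradient_laplacian[OF assms(1)] kG_gradient_laplacian[OF assms] inner_scaleR_left kR_def
    by (simp add: mult_ac)
qed

text \<open>The squared radii of the two boundary circles.\<close>

definition side :: "real => bool" where
  "side rho \<longleftrightarrow> rho = 1/4 \<or> rho = 1"

lemma side_facts: "side rho ==> rho > 0" "side rho ==> rho <= 1"
  by (auto simp: side_def)

lemma inner_self_bounds:
  assumes "1/2 <= norm x" "norm x <= 1"
  shows "1/4 <= x \<bullet> x" "x \<bullet> x <= 1"
  using power_mono[of "norm x" 1 2] power_mono[of "1/2" "norm x" 2] assms
  by (auto simp: power2_norm_eq_inner power_divide)

lemma side_product: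
  assumes "side rho" "1/2 <= norm x" "norm x <= 1" "1/2 <= norm z" "norm z <= 1"
  shows "x \<bullet> x >= rho \<and> z \<bullet> z >= rho \<or> x \<bullet> x <= rho \<and> z \<bullet> z <= rho"
    "(x \<bullet> x - rho) * (z \<bullet> z - rho) >= 0"
proof -
  show c: "x \<bullet> x >= rho \<and> z \<bullet> z >= rho \<or> x \<bullet> x <= rho \<and> z \<bullet> z <= rho"
    using inner_self_bounds[OF assms(2,3)] inner_self_bounds[OF assms(4,5)] assms(1) by (auto simp: side_def)
  show "(x \<bullet> x - rho) * (z \<bullet> z - rho) >= 0"
    using c by (auto intro: mult_nonneg_nonneg mult_nonpos_nonpos)
qed

lemma closure_annulus_norm:
  assumes "x \<in> closure annulus"
  shows "1/2 <= norm x" "norm x <= 1"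
  using assms annulus_facts(5) by auto

lemma continuous_imp_bounded_annulus:
  fixes f :: "real^2 => 'b::real_normed_vector"
  assumes "continuous_on UNIV f"
  obtains B where "!!x. x \<in> annulus ==> norm (f x) <= B"
proof -
  have "compact (f ` closure annulus)"
    by (intro compact_continuous_image continuous_on_subset[OF assms]) (auto simp: annulus_facts)
  then obtain B where "!!y. y \<in> f ` closure annulus ==> norm y <= B"
    using compact_imp_bounded bounded_iff by metis
  then show ?thesis using that closure_subset by (metis imageI subsetD)
qed

text \<open>The equation is tested with \<open>chi\<close> times the regularised Green function.
  This is nonnegative on the annulus and vanishes on its own circle, where \<open>kP\<close> and
  \<open>kQ\<close> agree, and on the other circle because of \<open>chi\<close>.\<close>

lemma kernel_identity:
  assumes rho: "side rho" and eps: "eps > 0" and x: "x \<in> annulus"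
    and u: "u \<in> W11_0 annulus" "neg_laplacian_distr annulus u f" "integrable Om f"
  shows "(LINT z|Om. u z * (chi rho z * psi rho eps x z))
    = (LINT z|Om. f z * (chi rho z * kG rho eps x z)) + (LINT z|Om. u z * kR rho eps x z)"
    "integrable Om (\<lambda>z. f z * (chi rho z * kG rho eps x z))"
    "integrable Om (\<lambda>z. u z * (chi rho z * psi rho eps x z))"
    "integrable Om (\<lambda>z. u z * kR rho eps x z)"
proof -
  note r = side_facts[OF rho]
  let ?T = "\<lambda>z. chi rho z * kG rho eps x z"
  have Ck: "Ck_on k UNIV ?T" for k
    by (intro Ck_on_mult chi_gradient_laplacian(3) Ck_on_kG r eps open_UNIV)
  have ui: "integrable Om u" using u(1) by (auto simp: W11_0_def)
  have cG: "continuous_on UNIV (kG rho eps x)" and cc: "continuous_on UNIV (chi rho :: real^2 => real)"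
    using Ck_on_continuous_on[OF Ck_on_kG[OF r(1) eps]] Ck_on_continuous_on[OF chi_gradient_laplacian(3)[OF r(1)]] by auto
  have clap: "continuous_on UNIV (laplacian ?T)" and cgrad: "continuous_on UNIV (grad ?T)"
    using continuous_on_laplacian[OF Ck] continuous_on_grad[OF Ck] .
  have cpsi: "continuous_on UNIV (psi rho eps x)"
  proof -
    have "continuous_on UNIV (\<lambda>z. - laplacian (kG rho eps x) z)"
      by (intro continuous_intros continuous_on_laplacian Ck_on_kG r eps)
    then show ?thesis by (simp add: kG_gradient_laplacian(2)[OF r(1) eps])
  qed
  have ib: "integrable Om (\<lambda>z. w z * g z)" if w: "integrable Om w" and g: "continuous_on UNIV g" for w g :: "real^2 => real"
  proof -
    obtain B where "!!x. x \<in> annulus ==> norm (g x) <= B"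
      using continuous_imp_bounded_annulus[OF g] by blast
    then show ?thesis
      using w g by (intro integrable_mult_bounded[where B = B])
        (auto intro!: borel_measurable_lebesgue_on borel_measurable_continuous_onI)
  qed
  show "integrable Om (\<lambda>z. f z * (chi rho z * kG rho eps x z))"
    by (rule ib[OF u(3)]) (intro continuous_intros cG cc)
  show iu: "integrable Om (\<lambda>z. u z * (chi rho z * psi rho eps x z))"
    by (rule ib[OF ui]) (intro continuous_intros cpsi cc)
  have R: "kR rho eps x z = laplacian ?T z + chi rho z * psi rho eps x z" for z
    by (simp add: laplacian_chi_kG[OF r(1) eps])
  show iR: "integrable Om (\<lambda>z. u z * kR rho eps x z)"
    unfolding R by (rule ib[OF ui]) (intro continuous_intros cpsi cc clap)
  obtain B1 where B1: "!!x. x \<in> annulus ==> norm (grad ?T x) <= B1"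
    using continuous_imp_bounded_annulus[OF cgrad] by blast
  obtain B2 where B2: "!!x. x \<in> annulus ==> norm (laplacian ?T x) <= B2"
    using continuous_imp_bounded_annulus[OF clap] by blast
  have "- (LINT z|Om. u z * laplacian ?T z) = (LINT z|Om. f z * ?T z)"
  proof (rule neg_laplacian_W11_0_boundary[OF annulus_facts(1,2) u, where B = "max B1 B2"])
    show "Ck_on k annulus ?T" for k using Ck by (rule Ck_on_subset) simp
    show "continuous_on (closure annulus) ?T"
      using Ck_on_continuous_on[OF Ck] by (rule continuous_on_subset) simp
    show "0 <= ?T z" if "z \<in> annulus" for z
    proof -
      have "kQ x z <= kP rho x z"
        using side_product(2)[OF rho, of x z] annulus_norm[OF x] annulus_norm[OF that] by (intro kQ_le_kP r) auto
      then have "0 <= kG rho eps x z"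
        unfolding kG_def using kQ_nonneg[of x z] eps by simp
      then show ?thesis using cutoff_bounds by (simp add: chi_def)
    qed
    show "?T z = 0" if "z \<in> frontier annulus" for z
    proof (cases "z \<bullet> z = rho")
      case True
      then have "kP rho x z = kQ x z" using kP_minus_kQ[of rho x z] r by simp
      then show ?thesis by (simp add: kG_def)
    next
      case False
      have "z \<bullet> z = 1/4 \<or> z \<bullet> z = 1"
      proof -
        have "z \<bullet> z = norm z * norm z" by (simp add: power2_norm_eq_inner[symmetric] power2_eq_square)
        moreover have "norm z = 1/2 \<or> norm z = 1" by (rule annulus_facts(6)[OF that])
        ultimately show ?thesis by (elim disjE) simp_all
      qed
      \<comment> \<open>The other circle has the value 4 if \<open>rho = 1/4\<close> and
        \<open>1/4\<close> if \<open>rho = 1\<close>, in both cases farther than \<open>7/10\<close>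
        from 1.\<close>
      then have "z \<bullet> z / rho = 4 \<or> z \<bullet> z / rho = 1/4"
        using False rho unfolding side_def by (elim disjE; hypsubst) simp_all
      then have "chi rho z = 0" unfolding chi_def by (intro cutoff_eq_0) auto
      then show ?thesis by simp
    qed
    show "norm (grad ?T z) <= max B1 B2" "\<bar>laplacian ?T z\<bar> <= max B1 B2" if "z \<in> annulus" for z
      using B1[OF that] B2[OF that] by auto
  qed
  moreover have "(LINT z|Om. u z * laplacian ?T z) = (LINT z|Om. u z * kR rho eps x z) - (LINT z|Om. u z * (chi rho z * psi rho eps x z))"
    unfolding laplacian_chi_kG[OF r(1) eps] right_diff_distrib by (rule Bochner_Integration.integral_diff[OF iR iu])
  ultimately show "(LINT z|Om. u z * (chi rho z * psi rho eps x z))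
    = (LINT z|Om. f z * (chi rho z * kG rho eps x z)) + (LINT z|Om. u z * kR rho eps x z)" by simp
qed

section \<open>Approximation by potentials\<close>

lemma integral_lborel_affine:
  fixes f :: "'a::euclidean_space => real"
  assumes [measurable]: "f \<in> borel_measurable borel" and c: "c > 0"
  shows "(LINT z|lborel. f z) = c ^ DIM('a) * (LINT t|lborel. f (x + c *\<^sub>R t))"
    "(\<integral>\<^sup>+z. ennreal (f z) \<partial>lborel) = ennreal (c ^ DIM('a)) * (\<integral>\<^sup>+t. ennreal (f (x + c *\<^sub>R t)) \<partial>lborel)"
    "integrable lborel f \<longleftrightarrow> integrable lborel (\<lambda>t. f (x + c *\<^sub>R t))"
proof -
  have l: "lborel = density (distr lborel borel (\<lambda>t. x + c *\<^sub>R t)) (\<lambda>_. ennreal (c ^ DIM('a)))"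
    using lborel_affine[of c x] c by simp
  show "(LINT z|lborel. f z) = c ^ DIM('a) * (LINT t|lborel. f (x + c *\<^sub>R t))"
    by (subst l) (use c in \<open>simp add: integral_density integral_distr\<close>)
  show "(\<integral>\<^sup>+z. ennreal (f z) \<partial>lborel) = ennreal (c ^ DIM('a)) * (\<integral>\<^sup>+t. ennreal (f (x + c *\<^sub>R t)) \<partial>lborel)"
    by (subst l) (simp add: nn_integral_density nn_integral_distr nn_integral_cmult)
  show "integrable lborel f \<longleftrightarrow> integrable lborel (\<lambda>t. f (x + c *\<^sub>R t))"
    by (subst l) (use c in \<open>simp add: integrable_density integrable_distr_eq\<close>)
qed

definition bump :: "real^2 => real" where
  "bump t = 4 / (t \<bullet> t + 1)^2"

text \<open>The integral equals \<open>4 * pi\<close>, but it is kept as a symbol: all that enters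
  is that it is finite and positive.\<close>

definition kappa :: real where
  "kappa = (LINT t|lborel. bump t)"

lemma inner_plus1_pos [simp]: "0 < t \<bullet> t + (1::real)"
  by (rule add_nonneg_pos) auto

lemma bump_pos: "0 < bump t"
  by (simp add: bump_def less_imp_neq[symmetric])

lemma bump_measurable [measurable]: "bump \<in> borel_measurable borel"
  unfolding bump_def[abs_def] by measurable

text \<open>Dyadic decomposition outwards: for the first \<open>n\<close> with
  \<open>norm z <= 2 ^ n\<close> the value is at most \<open>64 / 16 ^ n\<close>, while the disc has
  an area proportional to \<open>4 ^ n\<close>.\<close>

lemma bump_integrable: "integrable lborel bump"
proof (rule integrableI_bounded)
  define c :: "nat => real" where "c n = 64 / 16 ^ n" for n
  define D where "D n = cball (0 :: real^2) (2 ^ n)" for n :: nat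
  have ptw: "ennreal (bump z) <= (\<Sum>n. ennreal (c n) * indicator (D n) z)" for z :: "real^2"
  proof -
    have ex: "\<exists>n. norm z <= 2 ^ n" using real_arch_pow[of 2 "norm z"] by (auto intro: less_imp_le)
    define n where "n = (LEAST n. norm z <= 2 ^ n)"
    have n: "norm z <= 2 ^ n" unfolding n_def using ex by (rule LeastI_ex)
    have zz: "z \<bullet> z = (norm z)^2" by (simp add: power2_norm_eq_inner)
    have "4 ^ n / 4 <= z \<bullet> z + 1"
    proof (cases n)
      case (Suc m)
      then have "2 ^ m < norm z" using not_less_Least[of m "\<lambda>n. norm z <= 2 ^ n"] n_def by auto
      then have "(2 ^ m)^2 <= (norm z)^2" by (intro power_mono) auto
      moreover have "((2::real) ^ m)^2 = 4 ^ m" by (simp add: power2_eq_square flip: power_mult_distrib)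
      ultimately show ?thesis using Suc by (simp add: zz)
    qed (auto simp: add_increasing)
    then have "(4 ^ n / 4)^2 <= (z \<bullet> z + 1)^2" by (intro power_mono) auto
    moreover have "((4::real) ^ n / 4)^2 = 16 ^ n / 16"
      by (simp add: power_divide power2_eq_square flip: power_mult_distrib)
    ultimately have "bump z <= 4 / (16 ^ n / 16)"
      unfolding bump_def by (intro divide_left_mono) (auto simp: less_imp_neq[symmetric])
    then have "ennreal (bump z) <= ennreal (c n) * indicator (D n) z"
      using n by (auto simp: c_def D_def intro: ennreal_leI)
    also have "\<dots> <= (\<Sum>n. ennreal (c n) * indicator (D n) z)"
    proof -
      define f where "f n = ennreal (c n) * indicator (D n) z" for n
      have "f n <= suminf f" using sum_le_suminf[of f "{n}"] by simp
      then show ?thesis by (simp add: f_def[abs_def])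
    qed
    finally show ?thesis .
  qed
  have [measurable]: "D n \<in> sets lborel" for n by (simp add: D_def)
  have e: "emeasure lborel (D n) = ennreal (unit_ball_vol 2 * (2 ^ n)^2)" for n
    unfolding D_def by (subst emeasure_cball) auto
  have te: "ennreal (c n) * emeasure lborel (D n) = ennreal (64 * unit_ball_vol 2 * (1/4) ^ n)" for n
  proof -
    have "c n * (unit_ball_vol 2 * (2 ^ n)^2) = 64 * unit_ball_vol 2 * (1/4) ^ n"
    proof -
      have "((2::real) ^ n)^2 = 4 ^ n" "(16::real) ^ n = 4 ^ n * 4 ^ n"
        by (simp_all add: power2_eq_square flip: power_mult_distrib)
      then show ?thesis by (simp add: c_def power_one_over field_simps)
    qed
    then show ?thesis unfolding e by (simp add: c_def flip: ennreal_mult)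
  qed
  have "(\<integral>\<^sup>+z. ennreal (bump z) \<partial>lborel) <= (\<integral>\<^sup>+z. (\<Sum>n. ennreal (c n) * indicator (D n) z) \<partial>lborel)"
    by (intro nn_integral_mono ptw)
  also have "\<dots> = (\<Sum>n. ennreal (c n) * emeasure lborel (D n))"
    by (subst nn_integral_suminf) (auto intro!: suminf_cong nn_integral_cmult_indicator, simp add: D_def)
  also have "\<dots> = (\<Sum>n. ennreal (64 * unit_ball_vol 2 * (1/4) ^ n))" by (simp only: te)
  also have "\<dots> = ennreal (\<Sum>n. 64 * unit_ball_vol 2 * (1/4) ^ n)"
    by (rule suminf_ennreal2) (auto intro!: summable_mult summable_geometric)
  also have "\<dots> < \<infinity>" by simp
  finally show "(\<integral>\<^sup>+z. ennreal (norm (bump z)) \<partial>lborel) < \<infinity>"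
    using bump_pos by (simp add: less_imp_le)
qed simp

lemma kappa_pos: "kappa > 0"
proof -
  have "kappa ~= 0"
  proof
    assume "kappa = 0"
    then have "AE x in lborel. bump x = 0"
      unfolding kappa_def using bump_integrable bump_pos
      by (subst (asm) integral_nonneg_eq_0_iff_AE) (auto intro: less_imp_le)
    then have "AE x in (lborel :: (real^2) measure). False"
      using bump_pos by (auto simp: less_imp_neq[symmetric])
    then have "UNIV \<in> null_sets (lborel :: (real^2) measure)" by (subst (asm) AE_iff_null) simp_all
    then show False by (simp add: null_sets_def)
  qed
  moreover have "kappa >= 0" unfolding kappa_def
    by (rule Bochner_Integration.integral_nonneg) (auto intro: less_imp_le bump_pos)
  ultimately show ?thesis by simp
qed

definition bump_eps :: "real => real^2 => real^2 => real" where
  "bump_eps eps x z = 4 * eps / (kQ x z + eps)^2"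

lemma bump_eps_scaled:
  assumes "eps > 0"
  shows "eps * bump_eps eps x (x + sqrt eps *\<^sub>R t) = bump t"
proof -
  have "kQ x (x + sqrt eps *\<^sub>R t) + eps = eps * (t \<bullet> t + 1)"
    using assms by (simp add: kQ_def algebra_simps)
  then show ?thesis
    using assms by (simp add: bump_eps_def bump_def power_mult_distrib power2_eq_square)
qed

lemma bump_eps_measurable [measurable]: "bump_eps eps x \<in> borel_measurable borel"
  unfolding bump_eps_def[abs_def] kQ_def by measurable

lemma bump_eps_nonneg: "eps > 0 ==> 0 <= bump_eps eps x z"
  by (simp add: bump_eps_def)

lemma bump_eps_commute: "bump_eps eps x z = bump_eps eps z x"
  by (simp add: bump_eps_def kQ_commute[of x])

lemma bump_eps_integral:
  fixes g :: "real^2 => real"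
  assumes eps: "eps > 0" and [measurable]: "g \<in> borel_measurable borel"
  shows "(LINT z|lborel. g z * bump_eps eps x z) = (LINT t|lborel. g (x + sqrt eps *\<^sub>R t) * bump t)"
    "(\<integral>\<^sup>+z. ennreal (bump_eps eps x z) \<partial>lborel) = ennreal kappa"
    "integrable lborel (bump_eps eps x)"
proof -
  have c: "sqrt eps > 0" "sqrt eps ^ DIM(real^2) = eps" using eps by (auto simp: power2_eq_square[symmetric])
  have "(LINT z|lborel. g z * bump_eps eps x z)
      = eps * (LINT t|lborel. g (x + sqrt eps *\<^sub>R t) * bump_eps eps x (x + sqrt eps *\<^sub>R t))"
    using integral_lborel_affine(1)[of "\<lambda>z. g z * bump_eps eps x z", OF _ c(1), of x] unfolding c(2) by simp
  also have "\<dots> = (LINT t|lborel. g (x + sqrt eps *\<^sub>R t) * (eps * bump_eps eps x (x + sqrt eps *\<^sub>R t)))"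
    by (simp add: mult.left_commute)
  finally show "(LINT z|lborel. g z * bump_eps eps x z) = (LINT t|lborel. g (x + sqrt eps *\<^sub>R t) * bump t)"
    by (simp only: bump_eps_scaled[OF eps])
  have "(\<integral>\<^sup>+z. ennreal (bump_eps eps x z) \<partial>lborel)
     = ennreal eps * (\<integral>\<^sup>+t. ennreal (bump_eps eps x (x + sqrt eps *\<^sub>R t)) \<partial>lborel)"
    using integral_lborel_affine(2)[of "bump_eps eps x", OF _ c(1), of x] unfolding c(2) by simp
  also have "\<dots> = (\<integral>\<^sup>+t. ennreal (eps * bump_eps eps x (x + sqrt eps *\<^sub>R t)) \<partial>lborel)"
    using eps by (simp add: ennreal_mult bump_eps_nonneg nn_integral_cmult)
  also have "\<dots> = ennreal kappa"
    unfolding bump_eps_scaled[OF eps] kappa_def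
    by (rule nn_integral_eq_integral[OF bump_integrable]) (auto intro: less_imp_le bump_pos)
  finally show nn: "(\<integral>\<^sup>+z. ennreal (bump_eps eps x z) \<partial>lborel) = ennreal kappa" .
  show "integrable lborel (bump_eps eps x)"
    by (rule integrableI_bounded) (use nn bump_eps_nonneg[OF eps] in auto)
qed

lemma bump_eps_tendsto:
  fixes g :: "real^2 => real"
  assumes g: "continuous_on UNIV g" "!!z. \<bar>g z\<bar> <= B" and eps: "!!n. eps n > 0" "eps \<longlonglongrightarrow> 0"
  shows "(\<lambda>n. LINT z|lborel. g z * bump_eps (eps n) x z) \<longlonglongrightarrow> kappa * g x"
proof -
  have [measurable]: "g \<in> borel_measurable borel" using g(1) by (rule borel_measurable_continuous_onI)
  have "(\<lambda>n. LINT t|lborel. g (x + sqrt (eps n) *\<^sub>R t) * bump t) \<longlonglongrightarrow> (LINT t|lborel. g x * bump t)"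
  proof (rule integral_dominated_convergence)
    show "integrable lborel (\<lambda>t. B * bump t)" using bump_integrable by simp
    show "AE t in lborel. (\<lambda>n. g (x + sqrt (eps n) *\<^sub>R t) * bump t) \<longlonglongrightarrow> g x * bump t"
    proof (rule AE_I2)
      fix t
      have "(\<lambda>n. x + sqrt (eps n) *\<^sub>R t) \<longlonglongrightarrow> x + sqrt 0 *\<^sub>R t" by (intro tendsto_intros eps)
      moreover have "isCont g (x + sqrt 0 *\<^sub>R t)" using g(1) by (simp add: continuous_on_eq_continuous_at)
      ultimately have "(\<lambda>n. g (x + sqrt (eps n) *\<^sub>R t)) \<longlonglongrightarrow> g (x + sqrt 0 *\<^sub>R t)"
        by (rule isCont_tendsto_compose[rotated])
      then show "(\<lambda>n. g (x + sqrt (eps n) *\<^sub>R t) * bump t) \<longlonglongrightarrow> g x * bump t"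
        by (intro tendsto_intros) simp
    qed
    show "AE t in lborel. norm (g (x + sqrt (eps n) *\<^sub>R t) * bump t) <= B * bump t" for n
      using g(2) bump_pos by (intro AE_I2) (auto simp: abs_mult less_imp_le intro!: mult_mono)
  qed simp_all
  then show ?thesis
    by (simp add: bump_eps_integral(1)[OF eps(1)] kappa_def mult.commute)
qed

text \<open>The boundary layer is as wide as the support of \<open>plateau\<close> and lies where
  \<open>chi\<close> equals 1. Being contained in the annulus, it is the one-sided neighbourhood of
  the circle.\<close>

definition near :: "real => (real^2) set" where
  "near rho = {x \<in> annulus. \<bar>x \<bullet> x / rho - 1\<bar> <= 1/2}"

lemma near_sets [measurable]: "near rho \<in> sets borel"
proof -
  have "closed {x::real^2. \<bar>x \<bullet> x / rho - 1\<bar> <= 1/2}"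
    by (cases "rho = 0") (auto intro!: closed_Collect_le continuous_intros)
  then have "annulus \<inter> {x. \<bar>x \<bullet> x / rho - 1\<bar> <= 1/2} \<in> sets borel"
    using annulus_facts(4) by (intro sets.Int) auto
  then show ?thesis by (simp add: near_def Int_def)
qed

lemma lebesgue_on_annulus_le_lborel:
  assumes "f \<in> borel_measurable borel"
  shows "(\<integral>\<^sup>+x. f x \<partial>Om) <= (\<integral>\<^sup>+x. f x \<partial>lborel)"
proof -
  have "(\<integral>\<^sup>+x. f x \<partial>Om) = (\<integral>\<^sup>+x. f x * indicator annulus x \<partial>lebesgue)"
    using annulus_facts(3) by (simp add: nn_integral_restrict_space)
  also have "\<dots> = (\<integral>\<^sup>+x. f x * indicator annulus x \<partial>lborel)"
    by (rule nn_integral_completion)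
  also have "\<dots> <= (\<integral>\<^sup>+x. f x \<partial>lborel)"
    by (intro nn_integral_mono) (auto simp: indicator_def)
  finally show ?thesis .
qed

text \<open>In each variable the sets of \<open>Om\<close> refine the Borel sets, so Borel
  measurability in both variables together passes to the product measure.\<close>

lemma pair_measurable_borel:
  fixes K :: "real^2 => real^2 => real"
  assumes "(\<lambda>p. K (fst p) (snd p)) \<in> borel_measurable borel"
  shows "(\<lambda>p. K (fst p) (snd p)) \<in> borel_measurable (Om \<Otimes>\<^sub>M Om)"
proof -
  have 1: "(\<lambda>p. K (fst p) (snd p)) \<in> borel_measurable (borel \<Otimes>\<^sub>M borel)"
    unfolding borel_prod by (rule assms)
  have 2: "(\<lambda>x. x) \<in> Om \<rightarrow>\<^sub>M borel" by (rule borel_measurable_lebesgue_on) simp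
  have "(\<lambda>p. (fst p, snd p)) \<in> Om \<Otimes>\<^sub>M Om \<rightarrow>\<^sub>M borel \<Otimes>\<^sub>M borel"
    by (intro measurable_Pair measurable_compose[OF measurable_fst 2] measurable_compose[OF measurable_snd 2])
  from measurable_compose[OF this 1] show ?thesis by simp
qed

lemma pair_measurable_continuous:
  fixes K :: "real^2 => real^2 => real"
  assumes "continuous_on UNIV (\<lambda>p. K (fst p) (snd p))"
  shows "(\<lambda>p. K (fst p) (snd p)) \<in> borel_measurable (Om \<Otimes>\<^sub>M Om)"
  by (rule pair_measurable_borel[OF borel_measurable_continuous_onI[OF assms]])

interpretation OmOm: pair_sigma_finite "Om" "Om" ..

lemma kernel_continuous:
  fixes K :: "real^2 => real^2 => real"
  assumes "rho > 0" "eps > 0"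
  shows "continuous_on UNIV (\<lambda>p. kG rho eps (fst p) (snd p :: real^2))"
    "continuous_on UNIV (\<lambda>p. kLG rho eps (fst p) (snd p :: real^2))"
    "continuous_on UNIV (\<lambda>p. kLG rho eps (snd p) (fst p :: real^2))"
    "continuous_on UNIV (\<lambda>p. psi rho eps (fst p) (snd p :: real^2))"
    "continuous_on UNIV (\<lambda>p. kR rho eps (fst p) (snd p :: real^2))"
    "continuous_on UNIV (\<lambda>p :: (real^2) \<times> (real^2). chi rho (snd p))"
    "continuous_on UNIV (\<lambda>p. bump_eps eps (fst p) (snd p))"
proof -
  have P: "kP rho x z + eps ~= 0" "kP rho x z + eps > 0" and Q: "kQ x z + eps ~= 0" "kQ x z + eps > 0" for x z :: "real^2"
    using kP_nonneg[OF assms(1), of x z] kQ_nonneg[of x z] assms(2) by linarith+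
  have c: "continuous_on UNIV (\<lambda>p. cutoff (f p))" "continuous_on UNIV (\<lambda>p. cutoff1 (f p))"
    "continuous_on UNIV (\<lambda>p. cutoff2 (f p))" if "continuous_on UNIV f" for f :: "(real^2) \<times> (real^2) => real"
    using continuous_on_compose2[OF cutoff_derivatives(3) that] continuous_on_compose2[OF cutoff_derivatives(4) that]
      continuous_on_compose2[OF cutoff_derivatives(5) that] by auto
  have cP: "continuous_on UNIV (\<lambda>p. kP rho (f p) (g p))" and cQ: "continuous_on UNIV (\<lambda>p. kQ (f p) (g p))"
    if "continuous_on UNIV f" "continuous_on UNIV g" for f g :: "(real^2) \<times> (real^2) => real^2"
    unfolding kP_def kQ_def using assms(1) by (auto intro!: continuous_intros that)
  note f = continuous_on_fst[OF continuous_on_id] and s = continuous_on_snd[OF continuous_on_id]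
  show G: "continuous_on UNIV (\<lambda>p. kG rho eps (fst p) (snd p :: real^2))"
    unfolding kG_def by (intro continuous_intros cP cQ ballI P Q)
  show "continuous_on UNIV (\<lambda>p. kLG rho eps (fst p) (snd p :: real^2))"
    unfolding kLG_def by (intro continuous_intros cP cQ ballI P Q) (use assms in auto)
  show L: "continuous_on UNIV (\<lambda>p. kLG rho eps (snd p) (fst p :: real^2))"
    unfolding kLG_def by (intro continuous_intros cP cQ ballI P Q) (use assms in auto)
  show "continuous_on UNIV (\<lambda>p. psi rho eps (fst p) (snd p :: real^2))"
    unfolding psi_def using P(1) Q(1) assms by (intro continuous_intros cP cQ) auto
  show "continuous_on UNIV (\<lambda>p. kR rho eps (fst p) (snd p :: real^2))"
    unfolding kR_def by (intro continuous_intros L G c) (use assms in auto)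
  show "continuous_on UNIV (\<lambda>p :: (real^2) \<times> (real^2). chi rho (snd p))"
    unfolding chi_def by (intro continuous_intros c) (use assms in auto)
  show "continuous_on UNIV (\<lambda>p. bump_eps eps (fst p) (snd p))"
    unfolding bump_eps_def using Q(1) by (intro continuous_intros cQ) auto
qed

lemma near_facts:
  assumes "side rho" "x \<in> near rho"
  shows "x \<in> annulus" "x \<bullet> x / rho <= 3/2" "chi rho x = 1"
proof -
  have "\<bar>x \<bullet> x / rho - 1\<bar> <= 1/2" using assms(2) by (simp add: near_def)
  then show "x \<bullet> x / rho <= 3/2" by linarith
  show "x \<in> annulus" using assms(2) by (simp add: near_def)
  show "chi rho x = 1" unfolding chi_def by (rule cutoff_eq_1) (use assms(2) in \<open>auto simp: near_def\<close>)
qed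

text \<open>\<open>5/2\<close> is \<open>1 + 3/2\<close>: as \<open>kQ <= kP\<close>, the reflected
  bump is no larger than the direct one, and its coefficient \<open>x \<bullet> x / rho\<close> is
  at most \<open>3/2\<close> in the layer.\<close>

lemma psi_bound:
  assumes "side rho" "eps > 0" "x \<in> near rho" "z \<in> annulus"
  shows "\<bar>chi rho z * psi rho eps x z\<bar> <= 5/2 * bump_eps eps x z"
proof -
  note r = side_facts[OF assms(1)]
  note x = near_facts[OF assms(1,3)]
  have PQ: "kQ x z <= kP rho x z"
    using side_product(2)[OF assms(1), of x z] annulus_norm[OF x(1)] annulus_norm[OF assms(4)]
    by (intro kQ_le_kP r) auto
  define E where "E = 4 * eps / (kQ x z + eps)^2"
  define F where "F = 4 * eps / (kP rho x z + eps)^2"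
  have FE: "0 <= F" "F <= E"
  proof -
    have "0 < kQ x z + eps" using kQ_nonneg[of x z] assms(2) by simp
    then show "F <= E" unfolding E_def F_def using PQ assms(2)
      by (intro divide_left_mono power_mono mult_pos_pos zero_less_power) auto
    show "0 <= F" using assms(2) by (simp add: F_def)
  qed
  have psi: "psi rho eps x z = E - (x \<bullet> x / rho) * F" by (simp add: psi_def E_def F_def)
  have "0 <= (x \<bullet> x / rho) * F" using FE r(1) by simp
  moreover have "(x \<bullet> x / rho) * F <= 3/2 * E" by (rule mult_mono[OF x(2) FE(2)]) (use FE in auto)
  ultimately have "\<bar>psi rho eps x z\<bar> <= 5/2 * E" using FE unfolding psi by linarith
  moreover have "\<bar>chi rho z * psi rho eps x z\<bar> <= 1 * \<bar>psi rho eps x z\<bar>"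
    unfolding abs_mult using cutoff_bounds by (intro mult_right_mono) (auto simp: chi_def)
  ultimately show ?thesis by (simp add: E_def bump_eps_def)
qed

text \<open>A smoothing of \<open>w\<close> near the circle that is not normalised: it tends to
  \<open>kappa\<close> times \<open>w\<close>.\<close>

definition smear :: "real => real => (real^2 => real) => real^2 => real" where
  "smear rho eps w x = (LINT z|Om. w z * (chi rho z * psi rho eps x z))"

lemma bounded_kernel_integrable:
  fixes g :: "real^2 => real"
  assumes "integrable Om w" "continuous_on UNIV g"
  shows "integrable Om (\<lambda>z. w z * g z)"
proof -
  obtain B where "!!x. x \<in> annulus ==> norm (g x) <= B"
    using continuous_imp_bounded_annulus[OF assms(2)] by blast
  then show ?thesis
    using assms by (intro integrable_mult_bounded[where B = B])
      (auto intro!: borel_measurable_lebesgue_on borel_measurable_continuous_onI)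
qed

lemma continuous_on_section:
  "continuous_on UNIV (\<lambda>p. K (fst p) (snd p)) ==> continuous_on UNIV (K x)"
  using continuous_on_compose2[of UNIV "\<lambda>p. K (fst p) (snd p)" UNIV "\<lambda>z. (x, z)"]
    continuous_on_Pair[OF continuous_on_const continuous_on_id, of UNIV x]
  by simp

lemma potential_measurable:
  fixes K :: "real^2 => real^2 => real"
  assumes "w \<in> borel_measurable Om" "continuous_on UNIV (\<lambda>p. K (fst p) (snd p))"
  shows "(\<lambda>x. LINT z|Om. w z * K x z) \<in> borel_measurable Om"
proof (rule Om.borel_measurable_lebesgue_integral)
  have [measurable]: "(\<lambda>p. K (fst p) (snd p)) \<in> borel_measurable (Om \<Otimes>\<^sub>M Om)"
    by (rule pair_measurable_continuous[OF assms(2)])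
  note [measurable] = assms(1)
  show "(\<lambda>(x, z). w z * K x z) \<in> borel_measurable (Om \<Otimes>\<^sub>M Om)"
    unfolding split_def by measurable
qed

lemma chi_psi_continuous:
  assumes "rho > 0" "eps > 0"
  shows "continuous_on UNIV (\<lambda>p. chi rho (snd p :: real^2) * psi rho eps (fst p) (snd p))"
  by (rule continuous_on_mult[OF kernel_continuous(6)[OF assms] kernel_continuous(4)[OF assms]])

text \<open>The kernel is dominated by a multiple of \<open>bump_eps\<close>. After the integrals
  have been exchanged, the symmetry of \<open>bump_eps\<close> in its two points makes the inner
  integral at most \<open>kappa\<close>, uniformly in \<open>eps\<close>.\<close>

lemma smear_bound:
  assumes rho: "side rho" and eps: "eps > 0" and w: "integrable Om w"
  shows "integrable Om (\<lambda>x. indicator (near rho) x * smear rho eps w x)"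
    "(LINT x|Om. \<bar>indicator (near rho) x * smear rho eps w x\<bar>)
      <= 5/2 * kappa * (LINT x|Om. \<bar>w x\<bar>)"
proof -
  note r = side_facts[OF rho]
  have wm [measurable]: "w \<in> borel_measurable Om" using w by simp
  have cont: "continuous_on UNIV (\<lambda>p. chi rho (snd p :: real^2) * psi rho eps (fst p) (snd p))"
    by (rule chi_psi_continuous[OF r(1) eps])
  have sm: "smear rho eps w \<in> borel_measurable Om"
    unfolding smear_def[abs_def] by (rule potential_measurable[OF wm cont])
  have bm [measurable]: "(\<lambda>p. bump_eps eps (fst p) (snd p)) \<in> borel_measurable (Om \<Otimes>\<^sub>M Om)"
    by (rule pair_measurable_continuous[OF kernel_continuous(7)[OF r(1) eps]])
  have ptw: "ennreal \<bar>indicator (near rho) x * smear rho eps w x\<bar>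
      <= (\<integral>\<^sup>+z. ennreal (\<bar>w z\<bar> * (5/2 * bump_eps eps x z)) \<partial>Om)" if "x \<in> annulus" for x
  proof (cases "x \<in> near rho")
    case True
    have i: "integrable Om (\<lambda>z. w z * (chi rho z * psi rho eps x z))"
      by (rule bounded_kernel_integrable[OF w continuous_on_section[where K = "\<lambda>x z. chi rho z * psi rho eps x z", OF cont]])
    have "ennreal \<bar>indicator (near rho) x * smear rho eps w x\<bar> = ennreal \<bar>smear rho eps w x\<bar>" using True by simp
    also have "\<dots> <= ennreal (LINT z|Om. \<bar>w z * (chi rho z * psi rho eps x z)\<bar>)"
      unfolding smear_def by (rule ennreal_leI[OF integral_abs_bound])
    also have "\<dots> = (\<integral>\<^sup>+z. ennreal \<bar>w z * (chi rho z * psi rho eps x z)\<bar> \<partial>Om)"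
      by (rule nn_integral_eq_integral[symmetric]) (use i in auto)
    also have "\<dots> <= (\<integral>\<^sup>+z. ennreal (\<bar>w z\<bar> * (5/2 * bump_eps eps x z)) \<partial>Om)"
    proof (intro nn_integral_mono ennreal_leI)
      fix z assume "z \<in> space Om"
      then have "\<bar>w z\<bar> * \<bar>chi rho z * psi rho eps x z\<bar> <= \<bar>w z\<bar> * (5/2 * bump_eps eps x z)"
        using psi_bound[OF rho eps True] by (intro mult_left_mono) auto
      then show "\<bar>w z * (chi rho z * psi rho eps x z)\<bar> <= \<bar>w z\<bar> * (5/2 * bump_eps eps x z)"
        by (simp only: abs_mult)
    qed
    finally show ?thesis .
  qed simp
  have "(\<integral>\<^sup>+x. ennreal \<bar>indicator (near rho) x * smear rho eps w x\<bar> \<partial>Om)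
      <= (\<integral>\<^sup>+x. (\<integral>\<^sup>+z. ennreal (\<bar>w z\<bar> * (5/2 * bump_eps eps x z)) \<partial>Om) \<partial>Om)"
    by (intro nn_integral_mono ptw) simp
  also have "\<dots> = (\<integral>\<^sup>+z. (\<integral>\<^sup>+x. ennreal (\<bar>w z\<bar> * (5/2 * bump_eps eps x z)) \<partial>Om) \<partial>Om)"
    by (rule OmOm.Fubini'[symmetric]) (simp add: split_def)
  also have "\<dots> = (\<integral>\<^sup>+z. ennreal (5/2 * \<bar>w z\<bar>) * (\<integral>\<^sup>+x. ennreal (bump_eps eps z x) \<partial>Om) \<partial>Om)"
  proof (rule nn_integral_cong)
    fix z
    have "(\<integral>\<^sup>+x. ennreal (\<bar>w z\<bar> * (5/2 * bump_eps eps x z)) \<partial>Om)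
        = (\<integral>\<^sup>+x. ennreal (5/2 * \<bar>w z\<bar>) * ennreal (bump_eps eps z x) \<partial>Om)"
      by (rule nn_integral_cong) (simp add: ennreal_mult[symmetric] bump_eps_nonneg[OF eps] bump_eps_commute[of eps z] mult_ac)
    also have "\<dots> = ennreal (5/2 * \<bar>w z\<bar>) * (\<integral>\<^sup>+x. ennreal (bump_eps eps z x) \<partial>Om)"
      by (rule nn_integral_cmult) (auto intro!: borel_measurable_lebesgue_on)
    finally show "(\<integral>\<^sup>+x. ennreal (\<bar>w z\<bar> * (5/2 * bump_eps eps x z)) \<partial>Om)
      = ennreal (5/2 * \<bar>w z\<bar>) * (\<integral>\<^sup>+x. ennreal (bump_eps eps z x) \<partial>Om)" .
  qed
  also have "\<dots> <= (\<integral>\<^sup>+z. ennreal (5/2 * \<bar>w z\<bar>) * ennreal kappa \<partial>Om)"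
  proof (intro nn_integral_mono mult_left_mono)
    fix z
    have "(\<integral>\<^sup>+x. ennreal (bump_eps eps z x) \<partial>Om) <= (\<integral>\<^sup>+x. ennreal (bump_eps eps z x) \<partial>lborel)"
      by (rule lebesgue_on_annulus_le_lborel) simp
    then show "(\<integral>\<^sup>+x. ennreal (bump_eps eps z x) \<partial>Om) <= ennreal kappa"
      using bump_eps_integral(2)[OF eps] by (metis borel_measurable_const)
  qed simp
  also have "\<dots> = (\<integral>\<^sup>+z. ennreal (5/2 * kappa * \<bar>w z\<bar>) \<partial>Om)"
    using kappa_pos by (intro nn_integral_cong) (simp add: ennreal_mult[symmetric] mult_ac)
  also have "\<dots> = ennreal (LINT z|Om. 5/2 * kappa * \<bar>w z\<bar>)"
    by (rule nn_integral_eq_integral) (use w kappa_pos in auto)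
  finally have nn: "(\<integral>\<^sup>+x. ennreal \<bar>indicator (near rho) x * smear rho eps w x\<bar> \<partial>Om)
      <= ennreal (5/2 * kappa * (LINT z|Om. \<bar>w z\<bar>))" by simp
  have mm: "(\<lambda>x. indicator (near rho) x * smear rho eps w x) \<in> borel_measurable Om"
    using sm by (intro borel_measurable_times borel_measurable_lebesgue_on[of "indicator _"]) auto
  show int: "integrable Om (\<lambda>x. indicator (near rho) x * smear rho eps w x)"
    by (rule integrableI_bounded[OF mm]) (use nn in \<open>auto intro: order.strict_trans1\<close>)
  have "ennreal (LINT x|Om. \<bar>indicator (near rho) x * smear rho eps w x\<bar>)
      = (\<integral>\<^sup>+x. ennreal \<bar>indicator (near rho) x * smear rho eps w x\<bar> \<partial>Om)"
    by (rule nn_integral_eq_integral[symmetric]) (use integrable_abs[OF int] in auto)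
  with nn have "ennreal (LINT x|Om. \<bar>indicator (near rho) x * smear rho eps w x\<bar>)
      <= ennreal (5/2 * kappa * (LINT z|Om. \<bar>w z\<bar>))" by (simp only:)
  then show "(LINT x|Om. \<bar>indicator (near rho) x * smear rho eps w x\<bar>) <= 5/2 * kappa * (LINT x|Om. \<bar>w x\<bar>)"
    by (rule ennreal_le_iff[THEN iffD1, rotated])
      (use kappa_pos in \<open>auto intro!: mult_nonneg_nonneg Bochner_Integration.integral_nonneg\<close>)
qed

lemma integral_lebesgue_on_annulus:
  fixes g :: "real^2 => real"
  assumes "g \<in> borel_measurable borel" "!!x. x \<notin> annulus ==> g x = 0"
  shows "(LINT x|Om. g x) = (LINT x|lborel. g x)"
proof -
  have "(LINT x|Om. g x) = (LINT x|lebesgue. indicator annulus x *\<^sub>R g x)"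
    using annulus_facts(3) by (simp add: integral_restrict_space)
  also have "(\<lambda>x. indicator annulus x *\<^sub>R g x) = g"
    using assms(2) by (auto simp: indicator_def fun_eq_iff)
  finally show ?thesis using assms(1) by (simp add: integral_completion)
qed

lemma kP_pos:
  assumes "side rho" "x \<in> annulus" "z \<in> closure annulus"
  shows "kP rho x z > 0"
proof (cases "x = z")
  case False
  have "kQ x z <= kP rho x z"
    using side_product(2)[OF assms(1), of x z] annulus_norm[OF assms(2)] closure_annulus_norm[OF assms(3)]
    by (intro kQ_le_kP side_facts assms) auto
  moreover have "kQ x z > 0" using False by (simp add: kQ_norm)
  ultimately show ?thesis by simp
next
  case True
  have "x \<bullet> x ~= rho" using annulus_inner[OF assms(2)] assms(1) by (auto simp: side_def)
  then have "(x \<bullet> x - rho) * (x \<bullet> x - rho) / rho > 0"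
    using side_facts[OF assms(1)] by (intro divide_pos_pos) (auto simp: zero_less_mult_iff)
  moreover have "kP rho x x - kQ x x = (x \<bullet> x - rho) * (x \<bullet> x - rho) / rho"
    using side_facts[OF assms(1)] by (intro kP_minus_kQ) auto
  ultimately show ?thesis using True by (simp add: kQ_def)
qed

text \<open>The direct bump reproduces the value at \<open>x\<close>. The reflected one tends to 0
  uniformly, because for \<open>x\<close> inside the annulus \<open>kP rho x\<close> is positive on
  the compact closure and hence bounded below by some \<open>c > 0\<close>.\<close>

lemma smear_test_function:
  assumes rho: "side rho" and \<phi>: "\<phi> \<in> test_functions annulus" and x: "x \<in> near rho"
    and eps: "!!n. eps n > 0" "eps \<longlonglongrightarrow> 0"
  shows "(\<lambda>n. smear rho (eps n) \<phi> x) \<longlonglongrightarrow> kappa * \<phi> x"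
proof -
  note r = side_facts[OF rho] and xx = near_facts[OF rho x]
  obtain B where B: "B > 0" "!!x. \<bar>\<phi> x\<bar> <= B" using test_function_bounded[OF \<phi>] by blast
  define g where "g z = \<phi> z * chi rho z" for z
  have gc: "continuous_on UNIV g"
    unfolding g_def using test_functionsD(2)[OF \<phi>] Ck_on_continuous_on[OF chi_gradient_laplacian(3)[OF r(1)]]
    by (intro continuous_on_mult)
  have gB: "\<bar>g z\<bar> <= B" for z
  proof -
    have "\<bar>g z\<bar> <= B * 1" unfolding g_def abs_mult
      by (rule mult_mono) (use B cutoff_bounds in \<open>auto simp: chi_def\<close>)
    then show ?thesis by simp
  qed
  have [measurable]: "g \<in> borel_measurable borel" using gc by (rule borel_measurable_continuous_onI)
  have g0: "g z = 0" if "z \<notin> annulus" for z using test_function_outside[OF \<phi> that] by (simp add: g_def)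
  have 1: "(\<lambda>n. LINT z|Om. g z * bump_eps (eps n) x z) \<longlonglongrightarrow> kappa * g x"
  proof -
    have "(LINT z|Om. g z * bump_eps (eps n) x z) = (LINT z|lborel. g z * bump_eps (eps n) x z)" for n
      by (rule integral_lebesgue_on_annulus) (use g0 in simp_all)
    then show ?thesis using bump_eps_tendsto[OF gc gB eps] by simp
  qed
  have "continuous_on (closure annulus) (\<lambda>z. kP rho x z)"
    unfolding kP_def using r by (intro continuous_intros) auto
  moreover have "compact (closure annulus)" "closure annulus ~= {}"
    using annulus_facts(2) xx(1) closure_subset by auto
  ultimately obtain z0 where z0: "z0 \<in> closure annulus" "!!z. z \<in> closure annulus ==> kP rho x z0 <= kP rho x z"
    using continuous_attains_inf[of "closure annulus" "\<lambda>z. kP rho x z"] by blast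
  define c where "c = kP rho x z0"
  have c: "c > 0" "!!z. z \<in> annulus ==> c <= kP rho x z"
    using z0 kP_pos[OF rho xx(1)] closure_subset unfolding c_def by auto
  let ?h = "\<lambda>n z. 4 * (x \<bullet> x / rho) * eps n / (kP rho x z + eps n)^2"
  have p: "x \<bullet> x / rho >= 0" using r by simp
  have hb: "\<bar>?h n z\<bar> <= 4 * (x \<bullet> x / rho) * eps n / c^2" if "z \<in> annulus" for n z
  proof -
    have "c^2 <= (kP rho x z + eps n)^2" using c(1) c(2)[OF that] eps(1)[of n] by (intro power_mono) auto
    then have "?h n z <= 4 * (x \<bullet> x / rho) * eps n / c^2"
    proof (rule divide_left_mono)
      have "0 < kP rho x z + eps n" using c(1) c(2)[OF that] eps(1)[of n] by linarith
      then show "0 < (kP rho x z + eps n)^2 * c^2" using c(1) by simp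
      show "0 <= 4 * (x \<bullet> x / rho) * eps n" using p eps(1)[of n] by (intro mult_nonneg_nonneg) auto
    qed
    moreover have "0 <= ?h n z"
      by (intro divide_nonneg_nonneg mult_nonneg_nonneg p) (use eps(1)[of n] in auto)
    ultimately show ?thesis by linarith
  qed
  have epsb: "\<exists>E. \<forall>n. eps n <= E"
    using convergent_imp_Bseq[OF convergentI[OF eps(2)]] by (auto simp: Bseq_def abs_le_iff)
  then obtain E where E: "!!n. eps n <= E" by blast
  have hm: "(\<lambda>z. g z * ?h n z) \<in> borel_measurable Om" for n
    by (rule borel_measurable_lebesgue_on) (unfold kP_def, measurable)
  have 2: "(\<lambda>n. LINT z|Om. g z * ?h n z) \<longlonglongrightarrow> (LINT z|Om. 0)"
  proof (rule integral_dominated_convergence)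
    show "integrable Om (\<lambda>z. B * (4 * (x \<bullet> x / rho) * E / c^2))" by simp
    show "AE z in Om. (\<lambda>n. g z * ?h n z) \<longlonglongrightarrow> 0"
    proof (rule AE_I2)
      fix z assume "z \<in> space Om"
      then have "kP rho x z > 0" using c by (auto intro: less_le_trans)
      then have "(\<lambda>n. g z * ?h n z) \<longlonglongrightarrow> g z * (4 * (x \<bullet> x / rho) * 0 / (kP rho x z + 0)^2)"
        by (intro tendsto_intros eps) auto
      then show "(\<lambda>n. g z * ?h n z) \<longlonglongrightarrow> 0" by simp
    qed
    show "AE z in Om. norm (g z * ?h n z) <= B * (4 * (x \<bullet> x / rho) * E / c^2)" for n
    proof (rule AE_I2)
      fix z assume "z \<in> space Om"
      then have "\<bar>?h n z\<bar> <= 4 * (x \<bullet> x / rho) * eps n / c^2" using hb by simp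
      also have "\<dots> <= 4 * (x \<bullet> x / rho) * E / c^2" using E[of n] p by (intro divide_right_mono mult_left_mono) auto
      finally show "norm (g z * ?h n z) <= B * (4 * (x \<bullet> x / rho) * E / c^2)"
        unfolding real_norm_def abs_mult[of "g z"] using gB[of z] by (intro mult_mono) auto
    qed
  qed (use hm in simp_all)
  have i1: "integrable Om (\<lambda>z. g z * bump_eps (eps n) x z)" for n
    using bounded_kernel_integrable[OF test_function_integral_lebesgue_on(2)[OF \<phi> annulus_facts(3)]
        continuous_on_mult[OF Ck_on_continuous_on[OF chi_gradient_laplacian(3)[OF r(1)]]
        continuous_on_section[OF kernel_continuous(7)[OF r(1) eps(1)]]]] by (simp add: g_def mult.assoc)
  have i2: "integrable Om (\<lambda>z. g z * ?h n z)" for n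
  proof (rule integrable_mult_bounded)
    show "integrable Om g"
      using bounded_kernel_integrable[OF test_function_integral_lebesgue_on(2)[OF \<phi> annulus_facts(3)]
        Ck_on_continuous_on[OF chi_gradient_laplacian(3)[OF r(1)]]] by (simp add: g_def[abs_def])
    show "(\<lambda>z. ?h n z) \<in> borel_measurable Om"
      by (rule borel_measurable_lebesgue_on) (unfold kP_def, measurable)
  qed (use hb in simp)
  have "smear rho (eps n) \<phi> x = (LINT z|Om. g z * bump_eps (eps n) x z) - (LINT z|Om. g z * ?h n z)" for n
  proof -
    have "smear rho (eps n) \<phi> x = (LINT z|Om. g z * bump_eps (eps n) x z - g z * ?h n z)"
      unfolding smear_def by (rule Bochner_Integration.integral_cong[OF refl])
        (simp only: g_def psi_def bump_eps_def right_diff_distrib mult.assoc)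
    then show ?thesis using Bochner_Integration.integral_diff[OF i1 i2, of n n] by (simp only:)
  qed
  then have "(\<lambda>n. smear rho (eps n) \<phi> x) \<longlonglongrightarrow> kappa * g x - (LINT z|Om. 0)"
    using tendsto_diff[OF 1 2] by simp
  then show ?thesis by (simp add: g_def xx(3))
qed

lemma smear_test_function_bound:
  assumes rho: "side rho" and eps: "eps > 0" and B: "!!z. \<bar>\<phi> z\<bar> <= B" and x: "x \<in> near rho"
    and \<phi>: "integrable Om \<phi>"
  shows "\<bar>smear rho eps \<phi> x\<bar> <= 5/2 * kappa * B"
proof -
  note r = side_facts[OF rho]
  have B0: "B >= 0" using B[of 0] by linarith
  have ib: "integrable Om (bump_eps eps x)"
    using bounded_kernel_integrable[of "\<lambda>_. 1", OF _ continuous_on_section[OF kernel_continuous(7)[OF r(1) eps]]] by simp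
  have "\<bar>smear rho eps \<phi> x\<bar> <= (LINT z|Om. B * (5/2 * bump_eps eps x z))"
    unfolding smear_def
  proof (rule order.trans[OF integral_abs_bound], rule integral_mono)
    show "integrable Om (\<lambda>z. \<bar>\<phi> z * (chi rho z * psi rho eps x z)\<bar>)"
      by (intro integrable_abs bounded_kernel_integrable[OF \<phi>]
          continuous_on_section[where K = "\<lambda>x z. chi rho z * psi rho eps x z", OF chi_psi_continuous] r eps)
    show "\<bar>\<phi> z * (chi rho z * psi rho eps x z)\<bar> <= B * (5/2 * bump_eps eps x z)" if "z \<in> space Om" for z
      unfolding abs_mult[of "\<phi> z"] using B psi_bound[OF rho eps x] that B0 by (intro mult_mono) auto
  qed (use ib in simp)
  also have "\<dots> = 5/2 * B * (LINT z|Om. bump_eps eps x z)" by simp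
  also have "\<dots> <= 5/2 * B * kappa"
  proof (rule mult_left_mono)
    have "ennreal (LINT z|Om. bump_eps eps x z) = (\<integral>\<^sup>+z. ennreal (bump_eps eps x z) \<partial>Om)"
      by (rule nn_integral_eq_integral[OF ib, symmetric]) (simp add: bump_eps_nonneg[OF eps])
    also have "\<dots> <= (\<integral>\<^sup>+z. ennreal (bump_eps eps x z) \<partial>lborel)" by (rule lebesgue_on_annulus_le_lborel) simp
    also have "\<dots> = ennreal kappa" by (rule bump_eps_integral(2)[OF eps borel_measurable_const])
    finally show "(LINT z|Om. bump_eps eps x z) <= kappa" using kappa_pos by (simp add: ennreal_le_iff)
  qed (use B0 in simp)
  finally show ?thesis by (simp add: mult_ac)
qed

text \<open>A density argument: convergence holds for test functions, and replacing \<open>u\<close>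
  by a test function costs at most \<open>7/2 * kappa\<close> times the L1 distance, namely
  \<open>5/2 * kappa\<close> from \<open>smear_bound\<close> and \<open>kappa\<close> for the
  function itself.\<close>

lemma smear_L1_tendsto:
  assumes rho: "side rho" and u: "u \<in> W11_0 annulus" and eps: "!!n. eps n > 0" "eps \<longlonglongrightarrow> 0"
  shows "integrable Om (\<lambda>x. indicator (near rho) x * (smear rho (eps n) u x - kappa * u x))"
    "(\<lambda>n. LINT x|Om. \<bar>indicator (near rho) x * (smear rho (eps n) u x - kappa * u x)\<bar>) \<longlonglongrightarrow> 0"
proof -
  let ?I = "\<lambda>x. indicator (near rho) x :: real"
  note r = side_facts[OF rho]
  obtain G \<phi> where ui: "integrable Om u" and Gi: "integrable Om G" and \<phi>: "!!n. \<phi> n \<in> test_functions annulus"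
    and lim: "(\<lambda>n. (LINT x|Om. \<bar>\<phi> n x - u x\<bar>) + (LINT x|Om. norm (grad (\<phi> n) x - G x))) \<longlonglongrightarrow> 0"
    using u unfolding W11_0_def by blast
  have \<phi>i: "integrable Om (\<phi> n)" for n by (rule test_function_integral_lebesgue_on(2)[OF \<phi> annulus_facts(3)])
  have Im: "?I \<in> borel_measurable Om" by (rule borel_measurable_lebesgue_on) simp
  have Ii: "integrable Om (\<lambda>x. ?I x * w x)" if "integrable Om w" for w
    using integrable_mult_bounded[OF that Im, of 1] by (simp add: mult.commute indicator_def)
  have Di: "integrable Om (\<lambda>x. ?I x * (smear rho (eps n) w x - kappa * w x))" if "integrable Om w" for w n
    unfolding right_diff_distrib
    using smear_bound(1)[OF rho eps(1) that] Ii[of "\<lambda>x. kappa * w x"] that by auto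
  show "integrable Om (\<lambda>x. ?I x * (smear rho (eps n) u x - kappa * u x))" by (rule Di[OF ui])
  define d where "d n = (LINT x|Om. \<bar>?I x * (smear rho (eps n) u x - kappa * u x)\<bar>)" for n
  define e where "e m = (LINT x|Om. \<bar>\<phi> m x - u x\<bar>)" for m
  define q where "q m n = (LINT x|Om. \<bar>?I x * (smear rho (eps n) (\<phi> m) x - kappa * \<phi> m x)\<bar>)" for m n
  have e0: "e \<longlonglongrightarrow> 0"
  proof (rule tendsto_sandwich[OF _ _ tendsto_const lim])
    show "eventually (\<lambda>n. 0 <= e n) sequentially" by (simp add: e_def)
    show "eventually (\<lambda>n. e n <= (LINT x|Om. \<bar>\<phi> n x - u x\<bar>) + (LINT x|Om. norm (grad (\<phi> n) x - G x))) sequentially"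
      by (simp add: e_def)
  qed
  have q0: "q m \<longlonglongrightarrow> 0" for m
  proof -
    obtain B where B: "B > 0" "!!x. \<bar>\<phi> m x\<bar> <= B" using test_function_bounded[OF \<phi>] by blast
    have "q m \<longlonglongrightarrow> (LINT x|Om. 0)" unfolding q_def
    proof (rule integral_dominated_convergence)
      show "integrable Om (\<lambda>x. 5/2 * kappa * B + kappa * B)" by simp
      show "AE x in Om. (\<lambda>n. \<bar>?I x * (smear rho (eps n) (\<phi> m) x - kappa * \<phi> m x)\<bar>) \<longlonglongrightarrow> 0"
      proof (rule AE_I2)
        fix x
        show "(\<lambda>n. \<bar>?I x * (smear rho (eps n) (\<phi> m) x - kappa * \<phi> m x)\<bar>) \<longlonglongrightarrow> 0"
        proof (cases "x \<in> near rho")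
          case True
          have "(\<lambda>n. \<bar>smear rho (eps n) (\<phi> m) x - kappa * \<phi> m x\<bar>) \<longlonglongrightarrow> \<bar>kappa * \<phi> m x - kappa * \<phi> m x\<bar>"
            by (intro tendsto_intros smear_test_function[OF rho \<phi> True eps])
          then show ?thesis using True by simp
        qed simp
      qed
      show "AE x in Om. norm \<bar>?I x * (smear rho (eps n) (\<phi> m) x - kappa * \<phi> m x)\<bar> <= 5/2 * kappa * B + kappa * B" for n
      proof (rule AE_I2)
        fix x
        show "norm \<bar>?I x * (smear rho (eps n) (\<phi> m) x - kappa * \<phi> m x)\<bar> <= 5/2 * kappa * B + kappa * B"
        proof (cases "x \<in> near rho")
          case True
          have "\<bar>kappa * \<phi> m x\<bar> <= kappa * B" using B kappa_pos by (simp add: abs_mult)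
          then have "\<bar>smear rho (eps n) (\<phi> m) x - kappa * \<phi> m x\<bar> <= 5/2 * kappa * B + kappa * B"
            using smear_test_function_bound[OF rho eps(1) B(2) True \<phi>i, of n] by linarith
          then show ?thesis using True by simp
        qed (use B kappa_pos in simp)
      qed
      show "(\<lambda>x. \<bar>?I x * (smear rho (eps n) (\<phi> m) x - kappa * \<phi> m x)\<bar>) \<in> borel_measurable Om" for n
        using Di[OF \<phi>i, of n m] by auto
    qed simp
    then show ?thesis by simp
  qed
  have dle: "d n <= (7/2 * kappa) * e m + q m n" for n m
  proof -
    let ?w = "\<lambda>x. u x - \<phi> m x"
    have wi: "integrable Om ?w" using ui \<phi>i by simp
    have sm: "smear rho (eps n) u x = smear rho (eps n) ?w x + smear rho (eps n) (\<phi> m) x" for x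
    proof -
      note i = bounded_kernel_integrable[OF _ continuous_on_section[where K = "\<lambda>x z. chi rho z * psi rho (eps n) x z", OF chi_psi_continuous[OF r(1) eps(1)]]]
      show ?thesis unfolding smear_def
        by (subst Bochner_Integration.integral_add[OF i[OF wi] i[OF \<phi>i], symmetric]) (simp add: algebra_simps)
    qed
    have "d n <= (LINT x|Om. \<bar>?I x * smear rho (eps n) ?w x\<bar> + \<bar>?I x * (smear rho (eps n) (\<phi> m) x - kappa * \<phi> m x)\<bar> + kappa * \<bar>\<phi> m x - u x\<bar>)"
      unfolding d_def
    proof (rule integral_mono)
      show "\<bar>?I x * (smear rho (eps n) u x - kappa * u x)\<bar> <= \<bar>?I x * smear rho (eps n) ?w x\<bar>
          + \<bar>?I x * (smear rho (eps n) (\<phi> m) x - kappa * \<phi> m x)\<bar> + kappa * \<bar>\<phi> m x - u x\<bar>" for x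
      proof (cases "x \<in> near rho")
        case True
        have "kappa * \<bar>\<phi> m x - u x\<bar> = \<bar>kappa * \<phi> m x - kappa * u x\<bar>"
          using kappa_pos by (simp add: abs_mult flip: right_diff_distrib)
        then show ?thesis using True unfolding sm by simp
      qed (use kappa_pos in simp)
    qed (use Di[OF ui] Di[OF \<phi>i] smear_bound(1)[OF rho eps(1) wi] ui \<phi>i in \<open>auto intro!: Bochner_Integration.integrable_add integrable_mult_right integrable_abs\<close>)
    also have "\<dots> = (LINT x|Om. \<bar>?I x * smear rho (eps n) ?w x\<bar>) + q m n + kappa * e m"
      unfolding q_def e_def
      by (subst Bochner_Integration.integral_add, (use Di[OF \<phi>i] smear_bound(1)[OF rho eps(1) wi] ui \<phi>i in \<open>auto intro!: Bochner_Integration.integrable_add integrable_mult_right integrable_abs\<close>)[2])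
        (subst Bochner_Integration.integral_add, use Di[OF \<phi>i] smear_bound(1)[OF rho eps(1) wi] in \<open>auto intro!: integrable_abs\<close>)
    also have "\<dots> <= 5/2 * kappa * e m + q m n + kappa * e m"
      using smear_bound(2)[OF rho eps(1) wi, of n] by (simp add: e_def abs_minus_commute[of "\<phi> m _"])
    finally show ?thesis by simp
  qed
  show "d \<longlonglongrightarrow> 0"
  proof (rule LIMSEQ_I)
    fix s :: real assume s: "s > 0"
    have "(\<lambda>m. (7/2 * kappa) * e m) \<longlonglongrightarrow> 0" using tendsto_mult_right_zero[OF e0] .
    from LIMSEQ_D[OF this, of "s/2"] s obtain m where "norm ((7/2 * kappa) * e m - 0) < s/2" by auto
    then have m: "(7/2 * kappa) * e m < s/2" by simp
    from LIMSEQ_D[OF q0[of m], of "s/2"] s obtain N where N: "!!n. n >= N ==> \<bar>q m n\<bar> < s/2" by auto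
    have "norm (d n - 0) < s" if "n >= N" for n
      using dle[of n m] m N[OF that] by (simp add: d_def)
    then show "\<exists>N. \<forall>n\<ge>N. norm (d n - 0) < s" by blast
  qed
qed

text \<open>
  Compactness in \<open>(eps, x, z)\<close>: the error kernel is only evaluated away from the diagonal, where it
  stays bounded down to \<open>eps = 0\<close>.
\<close>

definition kLR :: "real => real => real^2 => real^2 => real" where
  "kLR rho eps x z = 4 / rho * cutoff1 (z \<bullet> z / rho) *
      ((kP rho x z + (x \<bullet> x) * (z \<bullet> z) / rho - rho + 2 * (x \<bullet> x) * (z \<bullet> z) / rho) / (kP rho x z + eps)
        - (kP rho x z + (x \<bullet> x) * (z \<bullet> z) / rho - rho)^2 / (kP rho x z + eps)^2
        - (kQ x z - x \<bullet> x - z \<bullet> z) / (kQ x z + eps)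
        + (kQ x z + z \<bullet> z - x \<bullet> x) * (kQ x z + x \<bullet> x - z \<bullet> z) / (kQ x z + eps)^2)
     + (4 * (z \<bullet> z) / rho^2 * cutoff2 (z \<bullet> z / rho) + 4 / rho * cutoff1 (z \<bullet> z / rho)) * kLG rho eps x z"

lemma kP_kQ_dilation:
  assumes "rho > 0" "t > 0"
  shows "((\<lambda>t. kP rho (t *\<^sub>R x) z) has_real_derivative
      (kP rho (t *\<^sub>R x) z + (t *\<^sub>R x \<bullet> t *\<^sub>R x) * (z \<bullet> z) / rho - rho) / t) (at t)"
    "((\<lambda>t. kQ (t *\<^sub>R x) z) has_real_derivative
      (kQ (t *\<^sub>R x) z + t *\<^sub>R x \<bullet> t *\<^sub>R x - z \<bullet> z) / t) (at t)"
    "((\<lambda>t. t *\<^sub>R x \<bullet> t *\<^sub>R x) has_real_derivative 2 * (t *\<^sub>R x \<bullet> t *\<^sub>R x) / t) (at t)"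
  using assms unfolding kP_def kQ_eq by (auto intro!: derivative_eq_intros simp: field_simps)

text \<open>Dilating \<open>x\<close> leaves the cutoff factors fixed, as they depend on
  \<open>z\<close>. The work lies in \<open>kLG rho eps z x\<close>, which is differentiated here
  with respect to its second argument.\<close>

lemma kR_dilation_derivative:
  assumes "rho > 0" "eps > 0" "t > 0"
  shows "((\<lambda>t. kR rho eps (t *\<^sub>R x) z) has_real_derivative kLR rho eps (t *\<^sub>R x) z / t) (at t)"
proof -
  note P = kP_kQ_dilation(1)[OF assms(1,3), of x z] and Q = kP_kQ_dilation(2)[OF assms(1,3), of x z]
    and p = kP_kQ_dilation(3)[OF assms(1,3), of x]
  have G: "((\<lambda>t. kG rho eps (t *\<^sub>R x) z) has_real_derivative kLG rho eps (t *\<^sub>R x) z / t) (at t)"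
    by (rule kG_dilation_derivative[OF assms])
  have pos: "kP rho (t *\<^sub>R x) z + eps ~= 0" "kQ (t *\<^sub>R x) z + eps ~= 0"
    using kP_nonneg[OF assms(1), of "t *\<^sub>R x" z] kQ_nonneg[of "t *\<^sub>R x" z] assms by linarith+
  define A where "A s = kP rho (s *\<^sub>R x) z" for s
  define B where "B s = kQ (s *\<^sub>R x) z" for s
  define q where "q s = s *\<^sub>R x \<bullet> s *\<^sub>R x" for s
  define w where "w = z \<bullet> z"
  have dA: "(A has_real_derivative (A t + q t * w / rho - rho) / t) (at t)"
    and dB: "(B has_real_derivative (B t + q t - w) / t) (at t)"
    and dq: "(q has_real_derivative 2 * q t / t) (at t)"
    using P Q p by (simp_all only: A_def[abs_def] B_def[abs_def] q_def[abs_def] w_def)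
  note [derivative_intros] = dA dB dq
  have n: "A t + eps ~= 0" "B t + eps ~= 0" using pos by (simp_all add: A_def B_def)
  have "((\<lambda>t. (A t + w * q t / rho - rho) / (A t + eps)) has_real_derivative
      (((A t + q t * w / rho - rho) / t + w * (2 * q t / t) / rho) * (A t + eps)
        - (A t + w * q t / rho - rho) * ((A t + q t * w / rho - rho) / t)) / ((A t + eps) * (A t + eps))) (at t)"
    using n assms(1) by (auto intro!: derivative_eq_intros)
  moreover have "(((A t + q t * w / rho - rho) / t + w * (2 * q t / t) / rho) * (A t + eps)
        - (A t + w * q t / rho - rho) * ((A t + q t * w / rho - rho) / t)) / ((A t + eps) * (A t + eps))
      = ((A t + q t * w / rho - rho + 2 * q t * w / rho) / (A t + eps) - (A t + q t * w / rho - rho)^2 / (A t + eps)^2) / t"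
  proof -
    have "((a / t + w * (2 * r / t) / rho) * c - a * (a / t)) / (c * c)
        = ((a + 2 * r * w / rho) / c - a^2 / c^2) / t" if "c ~= 0" for a r c
      using that assms by (simp add: field_simps power2_eq_square)
    from this[OF n(1), of "A t + q t * w / rho - rho" "q t"] show ?thesis by (simp only: mult.commute[of w "q t"])
  qed
  ultimately have 1: "((\<lambda>t. (A t + w * q t / rho - rho) / (A t + eps)) has_real_derivative
      ((A t + q t * w / rho - rho + 2 * q t * w / rho) / (A t + eps) - (A t + q t * w / rho - rho)^2 / (A t + eps)^2) / t) (at t)"
    by simp
  have "((\<lambda>t. (B t + w - q t) / (B t + eps)) has_real_derivative
      (((B t + q t - w) / t - 2 * q t / t) * (B t + eps) - (B t + w - q t) * ((B t + q t - w) / t)) / ((B t + eps) * (B t + eps))) (at t)"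
    using n by (auto intro!: derivative_eq_intros)
  moreover have "(((B t + q t - w) / t - 2 * q t / t) * (B t + eps) - (B t + w - q t) * ((B t + q t - w) / t)) / ((B t + eps) * (B t + eps))
      = ((B t - q t - w) / (B t + eps) - (B t + w - q t) * (B t + q t - w) / (B t + eps)^2) / t"
  proof -
    have "(((b + r - w) / t - 2 * r / t) * c - (b + w - r) * ((b + r - w) / t)) / (c * c)
        = ((b - r - w) / c - (b + w - r) * (b + r - w) / c^2) / t" if "c ~= 0" for b r c
      using that assms by (simp add: field_simps power2_eq_square)
    from this[OF n(2)] show ?thesis .
  qed
  ultimately have 2: "((\<lambda>t. (B t + w - q t) / (B t + eps)) has_real_derivative
      ((B t - q t - w) / (B t + eps) - (B t + w - q t) * (B t + q t - w) / (B t + eps)^2) / t) (at t)"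
    by simp
  have L: "((\<lambda>t. kLG rho eps z (t *\<^sub>R x)) has_real_derivative
      ((A t + q t * w / rho - rho + 2 * q t * w / rho) / (A t + eps) - (A t + q t * w / rho - rho)^2 / (A t + eps)^2) / t
      - ((B t - q t - w) / (B t + eps) - (B t + w - q t) * (B t + q t - w) / (B t + eps)^2) / t) (at t)"
    using DERIV_diff[OF 1 2] by (simp add: kLG_def A_def B_def q_def w_def kP_commute[of rho z] kQ_commute[of z])
  show ?thesis
    unfolding kR_def
  proof (rule DERIV_cong[OF DERIV_add[OF DERIV_cmult[OF L] DERIV_cmult[OF G]]])
    have gen: "c1 * ((a - b) / t - (c - d) / t) + c2 * (e / t) = (c1 * (a - b - c + d) + c2 * e) / t" for c1 c2 a b c d e :: real
      by (simp add: add_divide_distrib diff_divide_distrib algebra_simps)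
    show "4 / rho * cutoff1 (z \<bullet> z / rho) *
        (((A t + q t * w / rho - rho + 2 * q t * w / rho) / (A t + eps) - (A t + q t * w / rho - rho)^2 / (A t + eps)^2) / t
        - ((B t - q t - w) / (B t + eps) - (B t + w - q t) * (B t + q t - w) / (B t + eps)^2) / t)
      + (4 * (z \<bullet> z) / rho^2 * cutoff2 (z \<bullet> z / rho) + 4 / rho * cutoff1 (z \<bullet> z / rho)) * (kLG rho eps (t *\<^sub>R x) z / t)
      = kLR rho eps (t *\<^sub>R x) z / t"
      unfolding kLR_def A_def B_def q_def w_def by (rule gen)
  qed
qed

section \<open>Uniform bounds for the error kernels\<close>

lemma cutoff12_eq_0': "7/10 < \<bar>s - 1\<bar> ==> cutoff1 s = 0 \<and> cutoff2 s = 0"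
proof -
  assume s: "7/10 < \<bar>s - 1\<bar>"
  let ?U = "{s::real. 7/10 < \<bar>s - 1\<bar>}"
  have "open ?U" by (intro open_Collect_less continuous_intros)
  have 1: "cutoff1 t = 0" if "t \<in> ?U" for t
  proof -
    have "cutoff1 t = partial_deriv 1 (\<lambda>_. 0) t"
      unfolding cutoff1_def by (rule partial_deriv_cong[OF \<open>open ?U\<close> that]) (simp add: cutoff_eq_0)
    then show ?thesis by (simp add: partial_deriv_eqI[OF has_derivative_const])
  qed
  have "cutoff2 s = partial_deriv 1 (\<lambda>_. 0) s"
    unfolding cutoff2_def by (rule partial_deriv_cong[OF \<open>open ?U\<close>]) (use s 1 in auto)
  then show ?thesis using 1 s by (simp add: partial_deriv_eqI[OF has_derivative_const])
qed

lemma phi_pos: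
  assumes "x \<in> annulus"
  shows "phi x > 0"
  unfolding phi_def
proof (rule sin_gt_zero)
  have xx: "x \<bullet> x > 1/4" "x \<bullet> x < 1" using annulus_inner[OF assms] by auto
  have "ln (4 * (x \<bullet> x)) > 0" using xx by (intro ln_gt_zero) linarith
  then show "0 < pi / (2 * ln 2) * ln (4 * (x \<bullet> x))" by (intro mult_pos_pos divide_pos_pos) auto
  have "ln (4 * (x \<bullet> x)) < ln (2 ^ 2)" using xx by (subst ln_less_cancel_iff) auto
  also have "\<dots> = 2 * ln 2" by (subst ln_realpow) auto
  finally show "pi / (2 * ln 2) * ln (4 * (x \<bullet> x)) < pi" by (simp add: field_simps)
qed

text \<open>Where the cutoff is active the other circle is out of reach:
  \<open>z \<bullet> z\<close> stays above \<open>1/4\<close> if \<open>rho = 1\<close> and below 1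
  if \<open>rho = 1/4\<close>. Off its own circle the point is therefore interior.\<close>

lemma side_middle_in_annulus:
  assumes "side rho" "z \<in> closure annulus" "\<bar>z \<bullet> z / rho - 1\<bar> <= 7/10" "z \<bullet> z ~= rho"
  shows "z \<in> annulus"
proof -
  have n: "1/2 <= norm z" "norm z <= 1" using closure_annulus_norm[OF assms(2)] by auto
  have "z \<bullet> z ~= 1/4 \<and> z \<bullet> z ~= 1"
    using assms(1,3,4) unfolding side_def by (elim disjE; hypsubst) (auto simp: abs_if split: if_splits)
  moreover have "z \<bullet> z = norm z * norm z" by (simp add: power2_norm_eq_inner[symmetric] power2_eq_square)
  ultimately have "norm z ~= 1/2 \<and> norm z ~= 1" by (metis mult_1 mult.commute times_divide_times_eq numeral_times_numeral num_double mult_numeral_1 semiring_norm(12) semiring_norm(13))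
  then show ?thesis using n by (auto simp: annulus_def)
qed

text \<open>The derivatives of the cutoff live at distance \<open>3/5\<close> to \<open>7/10\<close>
  while \<open>x\<close> is at distance at most \<open>1/2\<close>, which separates the two points.
  On the support of these derivatives \<open>phi\<close> has a positive minimum, so the bounds can
  be stated as multiples of \<open>phi z\<close>, the weight for which the integrals of
  \<open>u\<close> and \<open>v\<close> are under uniform control.\<close>

lemma kR_kLR_bound:
  assumes rho: "side rho"
  shows "\<exists>C\<ge>0. \<forall>eps x z. 0 < eps --> eps <= 1 --> x \<in> near rho --> z \<in> annulus -->
    \<bar>kR rho eps x z\<bar> <= C * phi z \<and> \<bar>kLR rho eps x z\<bar> <= C * phi z"
proof -
  note r = side_facts[OF rho]
  define X where "X = {x \<in> closure annulus. \<bar>x \<bullet> x / rho - 1\<bar> <= 1/2}"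
  define Z where "Z = {z \<in> closure annulus. 3/5 <= \<bar>z \<bullet> z / rho - 1\<bar> \<and> \<bar>z \<bullet> z / rho - 1\<bar> <= 7/10}"
  define S where "S = {0..1::real} \<times> X \<times> Z"
  have cc: "compact (closure annulus)" using annulus_facts(2) by simp
  have cX: "compact X"
  proof -
    have "closed {x::real^2. \<bar>x \<bullet> x / rho - 1\<bar> <= 1/2}" using r by (intro closed_Collect_le continuous_intros) auto
    from compact_Int_closed[OF cc this] show ?thesis by (simp add: X_def Int_def)
  qed
  have cZ: "compact Z"
  proof -
    have "closed ({z::real^2. 3/5 <= \<bar>z \<bullet> z / rho - 1\<bar>} \<inter> {z. \<bar>z \<bullet> z / rho - 1\<bar> <= 7/10})"
      using r by (intro closed_Int closed_Collect_le continuous_intros) auto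
    from compact_Int_closed[OF cc this] show ?thesis by (simp add: Z_def Int_def)
  qed
  have cS: "compact S" unfolding S_def by (intro compact_Times cX cZ compact_Icc)
  have pos: "kQ x z > 0" "kP rho x z > 0" if "x \<in> X" "z \<in> Z" for x z
  proof -
    have "x ~= z" using that by (auto simp: X_def Z_def)
    then show "kQ x z > 0" by (simp add: kQ_norm)
    moreover have "kQ x z <= kP rho x z"
      using side_product(2)[OF rho, of x z] closure_annulus_norm[of x] closure_annulus_norm[of z] that
      by (intro kQ_le_kP r) (simp add: X_def Z_def)
    ultimately show "kP rho x z > 0" by simp
  qed
  have c: "continuous_on S (\<lambda>p. cutoff1 (snd (snd p) \<bullet> snd (snd p) / rho))" "continuous_on S (\<lambda>p. cutoff2 (snd (snd p) \<bullet> snd (snd p) / rho))"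
    using r by (auto intro!: continuous_on_compose2[OF cutoff_derivatives(4)] continuous_on_compose2[OF cutoff_derivatives(5)] continuous_intros)
  have nz: "kP rho (fst (snd p)) (snd (snd p)) + fst p > 0" "kQ (fst (snd p)) (snd (snd p)) + fst p > 0" if "p \<in> S" for p
    using pos[of "fst (snd p)" "snd (snd p)"] that by (auto simp: S_def intro!: add_pos_nonneg)
  have nz': "kP rho (fst (snd p)) (snd (snd p)) + fst p ~= 0" "kQ (fst (snd p)) (snd (snd p)) + fst p ~= 0" if "p \<in> S" for p
    using nz[OF that] by auto
  have cP: "continuous_on S (\<lambda>p. kP rho (fst (snd p)) (snd (snd p)))" and cQ: "continuous_on S (\<lambda>p. kQ (fst (snd p)) (snd (snd p)))"
    unfolding kP_def kQ_def using r by (auto intro!: continuous_intros)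
  have cG: "continuous_on S (\<lambda>p. kG rho (fst p) (fst (snd p)) (snd (snd p)))"
    unfolding kG_def by (intro continuous_intros cP cQ ballI nz nz')
  have cL: "continuous_on S (\<lambda>p. kLG rho (fst p) (fst (snd p)) (snd (snd p)))"
    unfolding kLG_def using r by (intro continuous_intros cP cQ ballI nz nz') auto
  have cL': "continuous_on S (\<lambda>p. kLG rho (fst p) (snd (snd p)) (fst (snd p)))"
    unfolding kLG_def kP_commute[of rho "snd (snd _)"] kQ_commute[of "snd (snd _)"]
    using r by (intro continuous_intros cP cQ ballI nz nz') auto
  have cR: "continuous_on S (\<lambda>p. kR rho (fst p) (fst (snd p)) (snd (snd p)))"
    unfolding kR_def using r by (intro continuous_intros c cG cL') auto
  have cLR: "continuous_on S (\<lambda>p. kLR rho (fst p) (fst (snd p)) (snd (snd p)))"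
    unfolding kLR_def using r nz' by (intro continuous_intros c cP cQ cL ballI) auto
  obtain C1 where C1: "!!p. p \<in> S ==> \<bar>kR rho (fst p) (fst (snd p)) (snd (snd p))\<bar> <= C1"
    using compact_imp_bounded[OF compact_continuous_image[OF cR cS]] by (auto simp: bounded_iff)
  obtain C2 where C2: "!!p. p \<in> S ==> \<bar>kLR rho (fst p) (fst (snd p)) (snd (snd p))\<bar> <= C2"
    using compact_imp_bounded[OF compact_continuous_image[OF cLR cS]] by (auto simp: bounded_iff)
  have "\<exists>c>0. \<forall>z\<in>Z. c <= phi z"
  proof (cases "Z = {}")
    case False
    have "continuous_on Z phi" using continuous_on_phi by (rule continuous_on_subset) (auto simp: Z_def)
    then obtain z0 where z0: "z0 \<in> Z" "!!z. z \<in> Z ==> phi z0 <= phi z"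
      using continuous_attains_inf[OF cZ False] by blast
    have "z0 \<in> annulus"
      by (rule side_middle_in_annulus[OF rho]) (use z0(1) r in \<open>auto simp: Z_def\<close>)
    then show ?thesis using phi_pos z0 by blast
  qed (auto intro: exI[of _ 1])
  then obtain c where c: "c > 0" "!!z. z \<in> Z ==> c <= phi z" by blast
  define C where "C = (\<bar>C1\<bar> + \<bar>C2\<bar>) / c"
  have C0: "C >= 0" using c by (simp add: C_def)
  show ?thesis
  proof (intro exI[of _ C] conjI allI impI C0)
    fix eps :: real and x z assume a: "0 < eps" "eps <= 1" "x \<in> near rho" "z \<in> annulus"
    show "\<bar>kR rho eps x z\<bar> <= C * phi z" "\<bar>kLR rho eps x z\<bar> <= C * phi z"
    proof -
      have "\<bar>kR rho eps x z\<bar> <= C * phi z \<and> \<bar>kLR rho eps x z\<bar> <= C * phi z"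
      proof (cases "z \<in> Z")
        case True
        have "(eps, x, z) \<in> S" using a True closure_subset[of annulus] by (auto simp: S_def X_def near_def)
        then have "\<bar>kR rho eps x z\<bar> <= C1" "\<bar>kLR rho eps x z\<bar> <= C2" using C1 C2 by fastforce+
        moreover have "\<bar>C1\<bar> + \<bar>C2\<bar> <= C * phi z"
          using c(1) c(2)[OF True] mult_left_mono[OF c(2)[OF True] C0] by (simp add: C_def)
        ultimately show ?thesis by linarith
      next
        case False
        then have "\<bar>z \<bullet> z / rho - 1\<bar> < 3/5 \<or> 7/10 < \<bar>z \<bullet> z / rho - 1\<bar>"
          using a(4) closure_subset[of annulus] by (auto simp: Z_def not_le)
        then have "cutoff1 (z \<bullet> z / rho) = 0 \<and> cutoff2 (z \<bullet> z / rho) = 0"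
          using cutoff12_eq_0 cutoff12_eq_0' by blast
        then show ?thesis using C0 phi_nonneg[OF a(4)] by (simp add: kR_def kLR_def)
      qed
      then show "\<bar>kR rho eps x z\<bar> <= C * phi z" "\<bar>kLR rho eps x z\<bar> <= C * phi z" by auto
    qed
  qed
qed

text \<open>Jensen's inequality for a measure whose mass \<open>m\<close> may fall short of
  \<open>M\<close>: the tangent of the exponential at the averaged exponent is integrated against
  \<open>f\<close>. The missing mass costs the additive 1.\<close>

lemma exp_average_bound:
  fixes f h :: "'a => real"
  assumes M: "M > 0" "(LINT z|N. f z) <= M" and f: "!!z. z \<in> space N ==> f z >= 0" "integrable N f"
    and h: "integrable N (\<lambda>z. f z * h z)" "integrable N (\<lambda>z. f z * exp (c * M * h z))"
  shows "exp (c * (LINT z|N. f z * h z)) <= 1 + (1 / M) * (LINT z|N. f z * exp (c * M * h z))"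
proof -
  define t where "t = c * (LINT z|N. f z * h z)"
  define m where "m = (LINT z|N. f z)"
  define J where "J = (LINT z|N. f z * exp (c * M * h z))"
  have m: "0 <= m" "m <= M" using M f by (auto simp: m_def intro!: Bochner_Integration.integral_nonneg)
  have "exp t * ((1 - t) * m + M * t) = (LINT z|N. exp t * ((1 - t) * f z + c * M * (f z * h z)))"
    using f h by (simp add: t_def m_def)
  also have "\<dots> <= J" unfolding J_def
  proof (rule integral_mono)
    fix z assume z: "z \<in> space N"
    have "1 + (c * M * h z - t) <= exp (c * M * h z - t)" by (rule exp_ge_add_one_self)
    then have "exp t * (1 + (c * M * h z - t)) <= exp t * exp (c * M * h z - t)" by simp
    also have "\<dots> = exp (c * M * h z)" by (simp flip: exp_add)
    finally have "f z * (exp t * (1 + (c * M * h z - t))) <= f z * exp (c * M * h z)"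
      using f(1)[OF z] by (rule mult_left_mono)
    then show "exp t * ((1 - t) * f z + c * M * (f z * h z)) <= f z * exp (c * M * h z)"
      by (simp add: algebra_simps)
  qed (use f h in auto)
  finally have 1: "exp t * ((1 - t) * m + M * t) <= J" .
  have "M * exp t <= M + J"
  \<comment> \<open>For \<open>t <= 1\<close> the term with \<open>1 - t\<close> is absorbed through
    \<open>exp t * (1 - t) <= 1\<close>; for \<open>t > 1\<close> it is negative, and enlarging
    \<open>m\<close> to \<open>M\<close> only lowers the left side.\<close>
  proof (cases "t <= 1")
    case True
    have "exp t * (1 - t) <= exp t * exp (- t)"
      using exp_ge_add_one_self[of "- t"] by (intro mult_left_mono) auto
    then have "M * (exp t * (1 - t)) <= M" using M(1) mult_left_mono[of "exp t * (1 - t)" 1 M] by (simp add: exp_minus)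
    moreover have "0 <= m * (exp t * (1 - t))" using m True by simp
    ultimately show ?thesis using 1 by (simp add: algebra_simps)
  next
    case False
    have "0 <= (M - m) * (exp t * (t - 1))" using m False by simp
    then show ?thesis using 1 M(1) by (simp add: algebra_simps)
  qed
  then have "exp t <= (M + J) / M" using M(1) by (simp add: pos_le_divide_eq mult.commute)
  also have "\<dots> = 1 + (1 / M) * J" using M(1) by (simp add: add_divide_distrib)
  finally show ?thesis by (simp add: t_def J_def)
qed

text \<open>\<open>kP\<close> is at most \<open>4 + 1 + 2\<close> on the annulus, so with
  \<open>eps <= 1\<close> the numerator stays below the square number 9, and the denominator is at
  least the squared distance. Half of \<open>kG\<close> is thus at most the logarithm of 3 divided
  by the distance.\<close>

lemma kG_upper:
  assumes "side rho" "0 < eps" "eps <= 1" "x \<in> annulus" "z \<in> annulus" "x ~= z"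
  shows "0 <= kG rho eps x z" "exp (1/2 * kG rho eps x z) <= 3 * norm (x - z) powr - 1" "kG rho eps x z <= 6 * norm (x - z) powr - 1"
proof -
  note r = side_facts[OF assms(1)]
  define d where "d = norm (x - z)"
  have d: "d > 0" using assms(6) by (simp add: d_def)
  have Q: "kQ x z = d^2" by (simp add: kQ_norm d_def)
  have PQ: "kQ x z <= kP rho x z"
    using side_product(2)[OF assms(1), of x z] annulus_norm[OF assms(4)] annulus_norm[OF assms(5)] by (intro kQ_le_kP r) auto
  show g0: "0 <= kG rho eps x z"
    unfolding kG_def using PQ kQ_nonneg[of x z] assms(2) by simp
  have "kP rho x z <= 7"
  proof -
    have "(x \<bullet> x) * (z \<bullet> z) <= 1" using annulus_inner[OF assms(4)] annulus_inner[OF assms(5)] by (intro mult_le_one) auto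
    then have "(x \<bullet> x) * (z \<bullet> z) / rho <= 4" using assms(1) unfolding side_def by (elim disjE; hypsubst) auto
    moreover have "\<bar>x \<bullet> z\<bar> <= 1"
      using Cauchy_Schwarz_ineq2[of x z] mult_le_one[of "norm x" "norm z"] annulus_norm[OF assms(4)] annulus_norm[OF assms(5)] by simp
    ultimately show ?thesis using r unfolding kP_def by linarith
  qed
  then have Pe: "kP rho x z + eps <= 9" "kP rho x z + eps > 0" "d^2 + eps > 0" "d^2 <= d^2 + eps"
    using assms(2,3) PQ kQ_nonneg[of x z] Q zero_less_power[OF d, of 2] by linarith+
  have "kG rho eps x z = ln ((kP rho x z + eps) / (d^2 + eps))"
    unfolding kG_def Q using Pe by (simp add: ln_div)
  also have "\<dots> <= ln (9 / d^2)"
    using Pe d by (subst ln_le_cancel_iff) (auto intro!: frac_le divide_pos_pos)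
  also have "9 / d^2 = (3 / d)^2" by (simp add: power_divide)
  also have "ln ((3 / d)^2) = 2 * ln (3 / d)" using d by (subst ln_realpow) auto
  finally have k: "kG rho eps x z <= 2 * ln (3 / d)" .
  then have "exp (1/2 * kG rho eps x z) <= exp (ln (3 / d))" by simp
  also have "\<dots> = 3 / d" using d by simp
  finally show "exp (1/2 * kG rho eps x z) <= 3 * norm (x - z) powr - 1"
    using d by (simp add: d_def powr_minus inverse_eq_divide)
  have "ln (3 / d) <= 3 / d" using ln_le_minus_one[of "3 / d"] d by simp
  then have "kG rho eps x z <= 6 / d" using k by simp
  then show "kG rho eps x z <= 6 * norm (x - z) powr - 1"
    using d by (simp add: d_def powr_minus inverse_eq_divide)
qed

lemma AE_annulus_neq: "AE z in Om. z ~= x"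
proof -
  have "AE z in lborel. z ~= x" by (rule AE_lborel_singleton)
  then have "AE z in lebesgue. z ~= x" by (rule AE_completion)
  then have "AE z in lebesgue. z \<in> annulus --> z ~= x" by (rule eventually_mono) simp
  then show ?thesis using annulus_facts(3) by (simp add: AE_restrict_space_iff)
qed

text \<open>The argument of Brezis and Merle: split off a part of small mass and apply Jensen's inequality to it.\<close>

lemma exp_potential_bound:
  assumes rho: "side rho" and f: "integrable Om f" "!!z. z \<in> annulus ==> f z >= 0"
  shows "\<exists>C\<ge>0. \<forall>eps. 0 < eps --> eps <= 1 -->
    (\<integral>\<^sup>+x. ennreal (exp (4 / kappa * (LINT z|Om. f z * (chi rho z * kG rho eps x z)))) \<partial>Om) <= ennreal C"
proof -
  note r = side_facts[OF rho]
  \<comment> \<open>At this mass the exponent \<open>4 / kappa * M\<close> equals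
    \<open>1/2\<close>, for which \<open>kG_upper\<close> leaves the singularity of the inverse
    distance, integrable in the plane.\<close>
  define M where "M = kappa / 8"
  have M: "M > 0" "4 / kappa * M = 1/2" using kappa_pos by (auto simp: M_def)
  have fm [measurable]: "f \<in> borel_measurable Om" using f by simp
  have "(\<lambda>n. LINT z|Om. f z - min (f z) (real n)) \<longlonglongrightarrow> (LINT z|Om. 0)"
  proof (rule integral_dominated_convergence)
    show "AE z in Om. (\<lambda>n. f z - min (f z) (real n)) \<longlonglongrightarrow> 0"
    proof (rule AE_I2)
      fix z
      obtain N where N: "f z <= real N" using real_arch_simple by blast
      have "eventually (\<lambda>n. f z - min (f z) (real n) = 0) sequentially"
        using eventually_ge_at_top[of N] by eventually_elim (use N in auto)
      then show "(\<lambda>n. f z - min (f z) (real n)) \<longlonglongrightarrow> 0" by (rule tendsto_eventually)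
    qed
    show "AE z in Om. norm (f z - min (f z) (real n)) <= f z" for n
      using f(2) by (intro AE_I2) (auto simp: min_def)
  qed (use f in simp_all)
  then have "(\<lambda>n. LINT z|Om. f z - min (f z) (real n)) \<longlonglongrightarrow> 0" by simp
  \<comment> \<open>The truncation level depends on \<open>f\<close> and not only on its integral.
    The final constant is therefore not uniform over solutions; it serves to justify limits
    only.\<close>
  from order_tendstoD(2)[OF this M(1)] obtain K :: nat where K: "(LINT z|Om. f z - min (f z) (real K)) < M"
    by (auto simp: eventually_sequentially)
  define f1 where "f1 z = f z - min (f z) (real K)" for z
  define f2 where "f2 z = min (f z) (real K)" for z
  have f12: "0 <= f1 z" "0 <= f2 z" "f2 z <= real K" "f z = f1 z + f2 z" if "z \<in> annulus" for z
    using f(2)[OF that] by (auto simp: f1_def f2_def)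
  have f2i: "integrable Om f2" unfolding f2_def by (rule integrable_min) (use f in auto)
  have f1i: "integrable Om f1" unfolding f1_def using f2i f(1) by (simp add: f2_def[abs_def])
  have f1M: "(LINT z|Om. f1 z) <= M" using K by (simp add: f1_def)
  obtain C1 where C1: "!!x::real^2. norm x <= 1 ==> integrable Om (\<lambda>z. norm (x - z) powr - 1)"
    "!!x::real^2. norm x <= 1 ==> (LINT z|Om. norm (x - z) powr - 1) <= C1"
    using norm_powr_integrable[of 1] by auto
  have C10: "C1 >= 0"
    by (rule order.trans[OF _ C1(2)[of 0]]) (auto intro!: Bochner_Integration.integral_nonneg)
  define E where "E = exp (4 / kappa * (real K * (6 * C1)))"
  define J where "J x = (\<integral>\<^sup>+z. ennreal (f1 z * (3 * norm (x - z) powr - 1)) \<partial>Om)" for x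
  have ptw: "ennreal (exp (4 / kappa * (LINT z|Om. f z * (chi rho z * kG rho eps x z)))) <= ennreal E * (1 + ennreal (1 / M) * J x)"
    if eps: "0 < eps" "eps <= 1" and x: "x \<in> annulus" for eps x
  proof -
    let ?h = "\<lambda>z. chi rho z * kG rho eps x z"
    have hc: "continuous_on UNIV ?h"
      by (intro continuous_on_mult continuous_on_section[OF kernel_continuous(1)] r eps
          Ck_on_continuous_on[OF chi_gradient_laplacian(3)])
    have he: "continuous_on UNIV (\<lambda>z. exp (4 / kappa * M * ?h z))" by (intro continuous_intros hc)
    have hle: "?h z <= kG rho eps x z" "0 <= ?h z" if "z \<in> annulus" "z ~= x" for z
    proof -
      have g: "0 <= kG rho eps x z" using kG_upper(1)[OF rho eps x that(1)] that(2) by blast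
      have "chi rho z * kG rho eps x z <= 1 * kG rho eps x z"
        using g cutoff_bounds by (intro mult_right_mono) (auto simp: chi_def)
      then show "?h z <= kG rho eps x z" by simp
      show "0 <= ?h z" using g cutoff_bounds by (simp add: chi_def)
    qed
    note i1 = bounded_kernel_integrable[OF f1i hc] and i2 = bounded_kernel_integrable[OF f2i hc]
      and ie = bounded_kernel_integrable[OF f1i he]
    have split: "(LINT z|Om. f z * ?h z) = (LINT z|Om. f1 z * ?h z) + (LINT z|Om. f2 z * ?h z)"
      unfolding Bochner_Integration.integral_add[OF i1 i2, symmetric]
      by (rule Bochner_Integration.integral_cong) (auto simp: f12(4) distrib_right)
    have "(LINT z|Om. f2 z * ?h z) <= (LINT z|Om. real K * (6 * norm (x - z) powr - 1))"
    proof (rule integral_mono_AE)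
      show "AE z in Om. f2 z * ?h z <= real K * (6 * norm (x - z) powr - 1)"
        using AE_annulus_neq[of x] AE_space
      proof eventually_elim
        case (elim z)
        then have z: "z \<in> annulus" "z ~= x" "x ~= z" by auto
        have hb: "?h z <= 6 * norm (x - z) powr - 1" using hle(1)[OF z(1,2)] kG_upper(3)[OF rho eps x z(1,3)] by simp
        show ?case by (rule mult_mono[OF f12(3)[OF z(1)] hb]) (use hle(2)[OF z(1,2)] in auto)
      qed
    qed (intro i2 integrable_mult_right C1(1) less_imp_le annulus_norm x)+
    also have "\<dots> = real K * (6 * (LINT z|Om. norm (x - z) powr - 1))"
      by (simp only: integral_mult_right_zero)
    also have "\<dots> <= real K * (6 * C1)" using C1(2)[of x] annulus_norm[OF x] by (intro mult_left_mono) auto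
    finally have b2: "exp (4 / kappa * (LINT z|Om. f2 z * ?h z)) <= E"
      unfolding E_def exp_le_cancel_iff using kappa_pos by (rule_tac mult_left_mono) auto
    have b1: "exp (4 / kappa * (LINT z|Om. f1 z * ?h z)) <= 1 + (1 / M) * (LINT z|Om. f1 z * exp (4 / kappa * M * ?h z))"
      by (rule exp_average_bound[OF M(1) f1M _ f1i i1 ie]) (use f12 in auto)
    have J: "ennreal (LINT z|Om. f1 z * exp (4 / kappa * M * ?h z)) <= J x"
    proof -
      have "ennreal (LINT z|Om. f1 z * exp (4 / kappa * M * ?h z)) = (\<integral>\<^sup>+z. ennreal (f1 z * exp (4 / kappa * M * ?h z)) \<partial>Om)"
        by (rule nn_integral_eq_integral[OF ie, symmetric]) (auto intro!: AE_I2 simp: f12)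
      also have "\<dots> <= J x" unfolding J_def
      proof (rule nn_integral_mono_AE)
        show "AE z in Om. ennreal (f1 z * exp (4 / kappa * M * ?h z)) <= ennreal (f1 z * (3 * norm (x - z) powr - 1))"
          using AE_annulus_neq[of x] AE_space
        proof eventually_elim
          case (elim z)
          then have z: "z \<in> annulus" "z ~= x" "x ~= z" by auto
          have "exp (1/2 * ?h z) <= exp (1/2 * kG rho eps x z)" using hle(1)[OF z(1,2)] by simp
          also have "\<dots> <= 3 * norm (x - z) powr - 1" by (rule kG_upper(2)[OF rho eps x z(1,3)])
          finally show ?case unfolding M(2) using f12[OF z(1)] by (intro ennreal_leI mult_left_mono) auto
        qed
      qed
      finally show ?thesis .
    qed
    have "exp (4 / kappa * (LINT z|Om. f z * ?h z)) = exp (4 / kappa * (LINT z|Om. f2 z * ?h z)) * exp (4 / kappa * (LINT z|Om. f1 z * ?h z))"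
      unfolding split by (simp add: distrib_left exp_add mult.commute)
    also have "\<dots> <= E * (1 + (1 / M) * (LINT z|Om. f1 z * exp (4 / kappa * M * ?h z)))"
      using b1 b2 by (intro mult_mono) (auto simp: E_def)
    finally have "ennreal (exp (4 / kappa * (LINT z|Om. f z * ?h z))) <= ennreal \<dots>" by (rule ennreal_leI)
    also have "\<dots> = ennreal E * (1 + ennreal (1 / M) * ennreal (LINT z|Om. f1 z * exp (4 / kappa * M * ?h z)))"
    proof -
      have J0: "0 <= (LINT z|Om. f1 z * exp (4 / kappa * M * ?h z))"
        by (rule Bochner_Integration.integral_nonneg) (auto simp: f12)
      have gen: "ennreal (E * (1 + a * b)) = ennreal E * (1 + ennreal a * ennreal b)" if "0 <= a" "0 <= b" for a b
        using that by (simp add: E_def ennreal_mult)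
      show ?thesis by (rule gen[OF _ J0]) (use M(1) in simp)
    qed
    also have "\<dots> <= ennreal E * (1 + ennreal (1 / M) * J x)" using J by (intro mult_left_mono add_left_mono) auto
    finally show ?thesis .
  qed
  have pm [measurable]: "(\<lambda>p. norm (fst p - snd p) powr - 1 :: real) \<in> borel_measurable (Om \<Otimes>\<^sub>M Om)"
    by (rule pair_measurable_borel[of "\<lambda>x z. norm (x - z) powr - 1"]) (unfold borel_prod[symmetric], measurable)
  have f1m [measurable]: "f1 \<in> borel_measurable Om" using f1i by simp
  have Jm [measurable]: "J \<in> borel_measurable Om"
    unfolding J_def[abs_def] by (rule Om.borel_measurable_nn_integral) (unfold split_def, measurable)
  have JJ: "(\<integral>\<^sup>+x. J x \<partial>Om) <= ennreal (3 * C1 * M)"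
  proof -
    have "(\<integral>\<^sup>+x. J x \<partial>Om) = (\<integral>\<^sup>+z. (\<integral>\<^sup>+x. ennreal (f1 z * (3 * norm (x - z) powr - 1)) \<partial>Om) \<partial>Om)"
      unfolding J_def by (rule OmOm.Fubini'[symmetric]) (unfold split_def, measurable)
    also have "\<dots> <= (\<integral>\<^sup>+z. ennreal (3 * C1 * f1 z) \<partial>Om)"
    proof (rule nn_integral_mono)
      fix z assume "z \<in> space Om"
      then have z: "z \<in> annulus" by simp
      have i: "integrable Om (\<lambda>x. f1 z * (3 * norm (z - x) powr - 1))"
        by (intro integrable_mult_right C1(1) less_imp_le annulus_norm z)
      have "(\<integral>\<^sup>+x. ennreal (f1 z * (3 * norm (x - z) powr - 1)) \<partial>Om) = ennreal (LINT x|Om. f1 z * (3 * norm (z - x) powr - 1))"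
        unfolding norm_minus_commute[of _ z] by (rule nn_integral_eq_integral[OF i]) (auto simp: f12[OF z])
      also have "\<dots> <= ennreal (3 * C1 * f1 z)"
      proof (rule ennreal_leI)
        have "f1 z * (3 * (LINT x|Om. norm (z - x) powr - 1)) <= f1 z * (3 * C1)"
          using C1(2)[of z] annulus_norm[OF z] f12[OF z] by (intro mult_left_mono) auto
        then show "(LINT x|Om. f1 z * (3 * norm (z - x) powr - 1)) <= 3 * C1 * f1 z"
          by (simp only: integral_mult_right_zero mult_ac)
      qed
      finally show "(\<integral>\<^sup>+x. ennreal (f1 z * (3 * norm (x - z) powr - 1)) \<partial>Om) <= ennreal (3 * C1 * f1 z)" .
    qed
    also have "\<dots> = ennreal (LINT z|Om. 3 * C1 * f1 z)"
      by (rule nn_integral_eq_integral) (use f1i f12 C10 in \<open>auto intro!: AE_I2\<close>)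
    also have "\<dots> <= ennreal (3 * C1 * M)" using f1M C10 by (intro ennreal_leI) (simp add: mult_left_mono)
    finally show ?thesis .
  qed
  define m where "m = measure Om annulus"
  define C where "C = E * (m + (1 / M) * (3 * C1 * M))"
  show ?thesis
  proof (intro exI[of _ C] conjI allI impI)
    show "C >= 0" using C10 M(1) by (simp add: C_def E_def m_def)
    fix eps :: real assume eps: "0 < eps" "eps <= 1"
    have "(\<integral>\<^sup>+x. ennreal (exp (4 / kappa * (LINT z|Om. f z * (chi rho z * kG rho eps x z)))) \<partial>Om)
        <= (\<integral>\<^sup>+x. ennreal E * (1 + ennreal (1 / M) * J x) \<partial>Om)"
      by (intro nn_integral_mono ptw eps) simp
    also have "\<dots> = ennreal E * (emeasure Om annulus + ennreal (1 / M) * (\<integral>\<^sup>+x. J x \<partial>Om))"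
      by (simp add: nn_integral_cmult nn_integral_add)
    also have "\<dots> <= ennreal E * (ennreal m + ennreal (1 / M) * ennreal (3 * C1 * M))"
      using JJ Om.emeasure_eq_measure[of annulus] by (intro mult_left_mono add_mono) (auto simp: m_def)
    also have "\<dots> = ennreal C"
      using C10 M(1) by (simp add: C_def E_def m_def ennreal_mult[symmetric] ennreal_plus[symmetric] del: ennreal_plus)
    finally show "(\<integral>\<^sup>+x. ennreal (exp (4 / kappa * (LINT z|Om. f z * (chi rho z * kG rho eps x z)))) \<partial>Om) <= ennreal C" .
  qed
qed

section \<open>Integration by parts along dilations\<close>

text \<open>Left without normalisation; its integral \<open>c\<close> cancels in the single estimate
  where it is used.\<close>

definition mollifier :: "real => real^2 => real^2 => real" where
  "mollifier \<delta> x z = flat (1 - ((x - z) \<bullet> (x - z)) / \<delta>^2)"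

lemma mollifier_support:
  assumes "\<delta> > 0" "mollifier \<delta> x z ~= 0"
  shows "z \<in> cball x \<delta>"
proof -
  have "((x - z) \<bullet> (x - z)) / \<delta>^2 < 1"
    using assms by (auto simp: mollifier_def flat_eq split: if_splits)
  then have "(norm (x - z))^2 < \<delta>^2" using assms by (simp add: power2_norm_eq_inner)
  then have "norm (x - z) < \<delta>" by (rule power2_less_imp_less) (use assms in simp)
  then show ?thesis by (simp add: dist_norm)
qed

lemma mollifier_test_function:
  assumes "\<delta> > 0" "cball x \<delta> \<subseteq> S"
  shows "mollifier \<delta> x \<in> test_functions S"
proof -
  have supp: "closure {z. mollifier \<delta> x z ~= 0} \<subseteq> cball x \<delta>"
    by (rule closure_minimal) (use mollifier_support[OF assms(1)] in auto)
  have ck: "Ck_on k UNIV (\<lambda>z. flat (1 - (1 / \<delta>^2) * ((z \<bullet> z) - 2 * (z \<bullet> x) + x \<bullet> x)))" for k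
    by (intro Ck_on_flat Ck_on_diff Ck_on_cmult Ck_on_add Ck_on_const Ck_on_inner_self Ck_on_inner open_UNIV)
  have sq: "(x - z) \<bullet> (x - z) = (z \<bullet> z) - 2 * (z \<bullet> x) + x \<bullet> x" for z
    by (simp add: inner_diff_left inner_diff_right inner_commute)
  have "Ck k (mollifier \<delta> x)" for k
    using ck[of k] by (simp add: Ck_on_UNIV mollifier_def[abs_def] sq)
  moreover have "compact (closure {z. mollifier \<delta> x z ~= 0})"
    using compact_Int_closed[OF compact_cball closed_closure, of x \<delta> "{z. mollifier \<delta> x z ~= 0}"] supp
    by (simp add: Int_absorb1)
  ultimately show ?thesis using supp assms(2) by (auto simp: test_functions_def)
qed

text \<open>The Lipschitz constant \<open>L\<close> of \<open>V\<close> is arbitrary and must not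
  enter the result. Averages of \<open>V\<close> over a mollifier that travels along the segment
  have a derivative equal to an average of the weak gradient, which is bounded by \<open>A\<close>;
  \<open>L\<close> only measures how far the averages are from the values of \<open>V\<close>.
  Segments inside the annulus are required, as the annulus is not convex.\<close>

lemma weak_gradient_bound_segment:
  fixes V :: "real^2 => real"
  assumes L: "L-lipschitz_on annulus V" and G: "has_weak_gradient annulus V G" "Linfty_norm annulus G <= ereal A"
    and seg: "closed_segment x y \<subseteq> annulus"
  shows "\<bar>V y - V x\<bar> <= A * norm (y - x)"
proof -
  define e where "e = y - x"
  define p where "p s = x + s *\<^sub>R e" for s
  have pseg: "p s \<in> closed_segment x y" if "0 <= s" "s <= 1" for s
    using that unfolding p_def e_def closed_segment_def by (auto intro!: exI[of _ s] simp: algebra_simps)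
  have L0: "L >= 0" using L by (rule lipschitz_on_nonneg)
  have AE: "AE z in Om. norm (G z) <= A"
  proof -
    have meas: "(\<lambda>z. ereal (norm (G z))) \<in> borel_measurable Om"
    proof (rule ccontr)
      assume "\<not> ?thesis"
      then have "esssup Om (\<lambda>z. ereal (norm (G z))) = \<infinity>" by (simp add: esssup_def top_ereal_def)
      then show False using G(2) by (simp add: Linfty_norm_def)
    qed
    have "AE z in Om. ereal (norm (G z)) <= esssup Om (\<lambda>z. ereal (norm (G z)))" by (rule esssup_AE)
    then show ?thesis
      by (rule eventually_mono) (use G(2) in \<open>auto simp: Linfty_norm_def dest: order.trans\<close>)
  qed
  obtain r where r: "r > 0" "!!z. z \<in> closed_segment x y ==> cball z r \<subseteq> annulus"
  proof -
    have "closed_segment x y \<inter> - annulus = {}" using seg by auto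
    then obtain d where d: "d > 0" "!!a b. a \<in> closed_segment x y ==> b \<in> - annulus ==> d <= dist a b"
      using separate_compact_closed[OF compact_segment, of "- annulus" x y] closed_Compl[OF annulus_facts(1)]
      by blast
    have "cball z (d / 2) \<subseteq> annulus" if "z \<in> closed_segment x y" for z
      using d(1) d(2)[OF that] by fastforce
    then show ?thesis using d(1) that[of "d / 2"] by simp
  qed
  have "\<bar>V y - V x\<bar> <= A * norm e + 2 * L * \<delta>" if \<delta>: "0 < \<delta>" "\<delta> <= r / 2" for \<delta>
  proof -
    let ?m0 = "mollifier \<delta> 0 :: real^2 => real"
    have mT: "?m0 \<in> test_functions UNIV" by (rule mollifier_test_function[OF \<delta>(1) subset_UNIV])
    have shift: "mollifier \<delta> q z = ?m0 (z - q)" for q z :: "real^2" by (simp add: mollifier_def)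
    have grad: "grad (mollifier \<delta> q) z = grad ?m0 (z - q)" for q z
    proof (rule grad_eqI)
      have "GDERIV ?m0 (z - q) :> grad ?m0 (z - q)" by (rule GDERIV_grad[OF test_functionsD(3)[OF mT]])
      then show "GDERIV (mollifier \<delta> q) z :> grad ?m0 (z - q)"
        unfolding gderiv_def ext[of "mollifier \<delta> q", OF shift]
        by (rule has_derivative_compose[rotated]) (auto intro!: derivative_eq_intros)
    qed
    define D where "D s z = - (e \<bullet> grad ?m0 (z - p s))" for s z
    \<comment> \<open>Parameters up to \<open>\<eta>\<close> outside \<open>[0, 1]\<close> move the
      centre by at most \<open>r / 2\<close>; together with \<open>\<delta> <= r / 2\<close> the
      ball of the mollifier stays in the annulus. The endpoints 0 and 1 thus become interior points
      for differentiation.\<close>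
    define \<eta> where "\<eta> = min 1 (r / (2 * (norm e + 1)))"
    have \<eta>: "\<eta> > 0" using r(1) by (simp add: \<eta>_def add_nonneg_pos)
    have inside: "cball (p s) \<delta> \<subseteq> annulus" if "- \<eta> < s" "s < 1 + \<eta>" for s
    proof -
      define s' where "s' = max 0 (min 1 s)"
      have "\<bar>s - s'\<bar> <= \<eta>" using that \<eta> by (auto simp: s'_def)
      then have "norm (p s - p s') <= \<eta> * norm e"
        unfolding p_def by (simp add: mult_right_mono flip: scaleR_diff_left)
      also have "\<dots> <= (r / (2 * (norm e + 1))) * (norm e + 1)"
        using r(1) by (intro mult_mono) (auto simp: \<eta>_def)
      also have "\<dots> = r / 2"
      proof -
        have "norm e + 1 ~= 0" using norm_ge_zero[of e] by linarith
        then show ?thesis by (simp add: field_simps)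
      qed
      finally have ps: "dist (p s') (p s) <= r / 2" by (simp add: dist_norm norm_minus_commute)
      have "cball (p s) \<delta> \<subseteq> cball (p s') r"
      proof
        fix w assume "w \<in> cball (p s) \<delta>"
        then have "dist (p s) w <= r / 2" using \<delta>(2) by simp
        then show "w \<in> cball (p s') r" using ps dist_triangle[of "p s'" w "p s"] by simp
      qed
      also have "\<dots> \<subseteq> annulus" by (rule r(2), rule pseg) (auto simp: s'_def)
      finally show ?thesis .
    qed
    note test = mollifier_test_function[OF \<delta>(1) inside]
    define c where "c = (LINT w|lborel. mollifier \<delta> 0 w)"
    have mm: "mollifier \<delta> q \<in> borel_measurable borel" for q
      unfolding mollifier_def by (intro borel_measurable_continuous_onI continuous_intros) (use \<delta>(1) in auto)
    have m0: "0 <= mollifier \<delta> q z" for q z by (simp add: mollifier_def flat_nonneg)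
    have cint: "(LINT z|Om. mollifier \<delta> (p s) z) = c" and mi: "integrable Om (mollifier \<delta> (p s))"
      if s: "- \<eta> < s" "s < 1 + \<eta>" for s
    proof -
      have "(LINT z|Om. mollifier \<delta> (p s) z) = (LINT z|lborel. mollifier \<delta> (p s) z)"
        by (rule test_function_integral_lebesgue_on[OF test[OF s] annulus_facts(3)])
      also have "\<dots> = c"
        using integral_lborel_affine(1)[OF mm, of 1 "p s" "p s"] unfolding c_def by (simp add: mollifier_def[abs_def])
      finally show "(LINT z|Om. mollifier \<delta> (p s) z) = c" .
      show "integrable Om (mollifier \<delta> (p s))"
        by (rule test_function_integral_lebesgue_on[OF test[OF s] annulus_facts(3)])
    qed
    have c0: "c > 0"
    proof -
      have i: "integrable lborel (mollifier \<delta> 0)" by (rule test_function_integrable_lborel[OF mT])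
      have "c ~= 0"
      proof
        assume "c = 0"
        then have "AE w in lborel. mollifier \<delta> 0 w = 0"
          unfolding c_def using i m0 by (subst (asm) integral_nonneg_eq_0_iff_AE) auto
        then have "AE w :: real^2 in lborel. w \<notin> ball 0 \<delta>"
        proof (rule eventually_mono)
          fix w :: "real^2" assume "mollifier \<delta> 0 w = 0"
          then have "1 <= (w \<bullet> w) / \<delta>^2" by (auto simp: mollifier_def flat_eq split: if_splits)
          then have "\<delta>^2 <= (norm w)^2" using \<delta>(1) by (simp add: power2_norm_eq_inner)
          then have "\<delta> <= norm w" by (rule power2_le_imp_le) simp
          then show "w \<notin> ball 0 \<delta>" by simp
        qed
        then have "ball 0 \<delta> \<in> null_sets (lborel :: (real^2) measure)" by (subst (asm) AE_iff_null) (simp_all add: ball_def Collect_neg_eq)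
        then have "negligible (ball 0 \<delta> :: (real^2) set)" by (simp add: negligible_iff_null_sets null_sets_completionI)
        then show False using open_not_negligible[of "ball 0 \<delta> :: (real^2) set"] \<delta>(1) by simp
      qed
      moreover have "c >= 0" unfolding c_def by (rule Bochner_Integration.integral_nonneg) (rule m0)
      ultimately show ?thesis by simp
    qed
    have Vm: "V \<in> borel_measurable Om"
      using L by (intro continuous_on_measurable_lebesgue_on annulus_facts lipschitz_on_continuous_on)
    have xa: "x \<in> annulus" using seg by auto
    define VB where "VB = \<bar>V x\<bar> + 2 * L"
    have VB: "\<bar>V z\<bar> <= VB" if "z \<in> annulus" for z
    proof -
      have "\<bar>V z - V x\<bar> <= L * dist z x" using lipschitz_onD[OF L that xa] by (simp add: dist_real_def)
      also have "\<dots> <= L * 2"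
        using norm_triangle_ineq4[of z x] annulus_norm[OF that] annulus_norm[OF xa] L0
        by (intro mult_left_mono) (auto simp: dist_norm)
      finally show ?thesis by (simp add: VB_def)
    qed
    have Vi: "integrable Om V"
      by (rule Om.integrable_const_bound[where B = VB]) (use VB Vm in \<open>auto intro!: AE_I2\<close>)
    have Vmi: "integrable Om (\<lambda>z. V z * g z)" if tf: "g \<in> test_functions annulus" for g
    proof -
      obtain B where "!!z. \<bar>g z\<bar> <= B" using test_function_bounded[OF tf] by blast
      then show ?thesis
        using tf by (intro integrable_mult_bounded[OF Vi, where B = B])
          (auto intro!: borel_measurable_lebesgue_on test_function_measurable)
    qed
    have "\<exists>B. \<forall>w. \<bar>partial_deriv i ?m0 w\<bar> <= B" if "i \<in> Basis" for i
      by (rule test_function_bounded[OF test_functions_partial[OF mT that]]) blast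
    then obtain Bi where Bi: "!!i w. i \<in> Basis ==> \<bar>partial_deriv i ?m0 w\<bar> <= Bi i" by metis
    define K where "K = (\<Sum>i\<in>Basis. \<bar>e \<bullet> i\<bar> * Bi i)"
    have DB: "\<bar>D s z\<bar> <= K" for s z
      unfolding D_def K_def grad_def inner_sum_right abs_minus_cancel inner_scaleR_right
      by (rule order.trans[OF sum_abs sum_mono])
        (metis Bi abs_ge_zero abs_mult mult.commute mult_left_mono)
    define \<Phi> where "\<Phi> s = (LINT z|Om. V z * mollifier \<delta> (p s) z)" for s
    have d\<Phi>: "(\<Phi> has_real_derivative (LINT z|Om. V z * D s z)) (at s)" and iD: "integrable Om (\<lambda>z. V z * D s z)"
      if s: "- \<eta> < s" "s < 1 + \<eta>" for s
    proof -
      have der: "((\<lambda>s. V z * mollifier \<delta> (p s) z) has_real_derivative V z * D s z) (at s)" for s z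
      proof -
        have m: "mollifier \<delta> (p s) z = ?m0 (z - x + s *\<^sub>R - e)" for s
          by (subst shift) (simp add: p_def algebra_simps)
        show ?thesis
          unfolding m D_def using DERIV_cmult[OF test_function_derivative_line[OF mT, of "z - x" "- e" s], of "V z"]
          by (simp add: p_def algebra_simps)
      qed
      have bd: "\<bar>V z * D s z\<bar> <= VB * K" if "z \<in> space Om" for s z
        unfolding abs_mult using VB[of z] DB[of s z] that by (intro mult_mono) (auto intro: order.trans[OF abs_ge_zero])
      show "(\<Phi> has_real_derivative (LINT z|Om. V z * D s z)) (at s)"
        unfolding \<Phi>_def by (rule DERIV_integral(1)[OF s Vmi[OF test] der _ bd]) auto
      show "integrable Om (\<lambda>z. V z * D s z)"
        by (rule DERIV_integral(2)[OF s Vmi[OF test] der _ bd]) auto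
    qed
    have \<Phi>'b: "\<bar>LINT z|Om. V z * D s z\<bar> <= A * norm e * c" if s: "- \<eta> < s" "s < 1 + \<eta>" for s
    proof -
      let ?m = "mollifier \<delta> (p s)"
      have De: "D s z = - (\<Sum>i\<in>Basis. (e \<bullet> i) * partial_deriv i ?m z)" for z
        unfolding D_def grad[symmetric] by (simp add: grad_def inner_sum_right mult.commute)
      have iV: "integrable Om (\<lambda>z. V z * partial_deriv i ?m z)" if "i \<in> Basis" for i
        by (rule Vmi[OF test_functions_partial[OF test[OF s] that]])
      \<comment> \<open>\<open>G\<close> is only locally integrable, so integrability is obtained on
        the closed ball that carries the mollifier and then transferred.\<close>
      have iGm: "integrable Om (\<lambda>z. ?m z * (G z \<bullet> d))" for d
      proof -
        let ?C = "cball (p s) \<delta>"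
        have "integrable (lebesgue_on ?C) (\<lambda>z. (G z \<bullet> d) * ?m z)"
        proof (rule integrable_mult_bounded[where B = 1])
          show "integrable (lebesgue_on ?C) (\<lambda>z. G z \<bullet> d)"
            using G(1) inside[OF s] unfolding has_weak_gradient_def locally_integrable_def
            by (intro integrable_inner_left) auto
          show "?m \<in> borel_measurable (lebesgue_on ?C)" by (rule borel_measurable_lebesgue_on[OF mm])
          show "\<bar>?m z\<bar> <= 1" for z using m0[of "p s" z] by (simp add: mollifier_def flat_le_1)
        qed
        then have "integrable lebesgue (\<lambda>z. indicator ?C z *\<^sub>R ((G z \<bullet> d) * ?m z))"
          by (subst (asm) integrable_restrict_space) auto
        moreover have "indicator ?C z *\<^sub>R ((G z \<bullet> d) * ?m z) = indicator annulus z *\<^sub>R (?m z * (G z \<bullet> d))" for z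
          using mollifier_support[OF \<delta>(1), of "p s" z] inside[OF s] by (cases "?m z = 0") auto
        ultimately have "integrable lebesgue (\<lambda>z. indicator annulus z *\<^sub>R (?m z * (G z \<bullet> d)))" by (simp only:)
        then show ?thesis using annulus_facts(3) by (subst integrable_restrict_space) simp_all
      qed
      have "(LINT z|Om. V z * D s z) = (LINT z|Om. - (\<Sum>i\<in>Basis. (e \<bullet> i) * (V z * partial_deriv i ?m z)))"
        by (rule Bochner_Integration.integral_cong[OF refl]) (simp add: De sum_distrib_left mult.left_commute)
      also have "\<dots> = - (\<Sum>i\<in>Basis. (e \<bullet> i) * (LINT z|Om. V z * partial_deriv i ?m z))"
        using iV by (simp add: Bochner_Integration.integral_sum)
      also have "\<dots> = (\<Sum>i\<in>Basis. (e \<bullet> i) * (LINT z|Om. (G z \<bullet> i) * ?m z))"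
      proof -
        have "(LINT z|Om. V z * partial_deriv i ?m z) = - (LINT z|Om. (G z \<bullet> i) * ?m z)" if "i \<in> Basis" for i
          using G(1) test[OF s] that unfolding has_weak_gradient_def by blast
        then show ?thesis by (simp add: sum_negf)
      qed
      also have "\<dots> = (LINT z|Om. (\<Sum>i\<in>Basis. (e \<bullet> i) * (?m z * (G z \<bullet> i))))"
        using iGm by (subst Bochner_Integration.integral_sum) (auto simp: mult.commute)
      also have "\<dots> = (LINT z|Om. ?m z * (G z \<bullet> e))"
        by (rule Bochner_Integration.integral_cong[OF refl])
          (simp add: euclidean_inner[of "G _" e] sum_distrib_left mult_ac)
      finally have eq: "(LINT z|Om. V z * D s z) = (LINT z|Om. ?m z * (G z \<bullet> e))" .
      have "\<bar>LINT z|Om. ?m z * (G z \<bullet> e)\<bar> <= (LINT z|Om. (A * norm e) * ?m z)"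
      proof (rule order.trans[OF integral_abs_bound], rule integral_mono_AE)
        show "integrable Om (\<lambda>z. \<bar>?m z * (G z \<bullet> e)\<bar>)" by (rule integrable_abs[OF iGm])
        show "AE z in Om. \<bar>?m z * (G z \<bullet> e)\<bar> <= (A * norm e) * ?m z"
          using AE
        proof (rule eventually_mono)
          fix z assume "norm (G z) <= A"
          then have "\<bar>G z \<bullet> e\<bar> <= A * norm e"
            by (intro order.trans[OF Cauchy_Schwarz_ineq2] mult_right_mono) auto
          from mult_left_mono[OF this m0[of "p s" z]] show "\<bar>?m z * (G z \<bullet> e)\<bar> <= (A * norm e) * ?m z"
            using m0[of "p s" z] by (simp add: abs_mult mult.commute)
        qed
      qed (use mi[OF s] in simp)
      then show ?thesis unfolding eq using cint[OF s] by simp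
    qed
    have "\<bar>\<Phi> 1 - \<Phi> 0\<bar> <= A * norm e * c"
    proof -
      have "\<exists>s>0. s < 1 \<and> \<Phi> 1 - \<Phi> 0 = (1 - 0) * (LINT z|Om. V z * D s z)"
        by (rule MVT2) (use d\<Phi> \<eta> in auto)
      then show ?thesis using \<Phi>'b \<eta> by force
    qed
    moreover have near: "\<bar>\<Phi> s - V (p s) * c\<bar> <= L * \<delta> * c" if s: "0 <= s" "s <= 1" for s
    proof -
      have s': "- \<eta> < s" "s < 1 + \<eta>" using s \<eta> by auto
      have ps: "p s \<in> annulus" using pseg[OF s] seg by auto
      have "\<Phi> s - V (p s) * c = (LINT z|Om. (V z - V (p s)) * mollifier \<delta> (p s) z)"
        unfolding \<Phi>_def cint[OF s', symmetric] left_diff_distrib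
        using Vmi[OF test[OF s']] mi[OF s'] by simp
      also have "\<bar>\<dots>\<bar> <= (LINT z|Om. (L * \<delta>) * mollifier \<delta> (p s) z)"
      proof (rule order.trans[OF integral_abs_bound], rule integral_mono)
        show "integrable Om (\<lambda>z. \<bar>(V z - V (p s)) * mollifier \<delta> (p s) z\<bar>)"
          unfolding left_diff_distrib using Vmi[OF test[OF s']] mi[OF s'] by auto
        fix z assume "z \<in> space Om"
        then have z: "z \<in> annulus" by simp
        show "\<bar>(V z - V (p s)) * mollifier \<delta> (p s) z\<bar> <= (L * \<delta>) * mollifier \<delta> (p s) z"
        proof (cases "mollifier \<delta> (p s) z = 0")
          case False
          then have "z \<in> cball (p s) \<delta>" using mollifier_support[OF \<delta>(1)] by blast
          then have "\<bar>V z - V (p s)\<bar> <= L * \<delta>"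
            using lipschitz_onD[OF L z ps] mult_left_mono[of "dist z (p s)" \<delta> L] L0
            by (auto simp: dist_real_def dist_commute)
          from mult_right_mono[OF this m0[of "p s" z]] show ?thesis using m0[of "p s" z] by (simp add: abs_mult)
        qed simp
      qed (use mi[OF s'] in simp)
      also have "\<dots> = L * \<delta> * c" using cint[OF s'] by simp
      finally show ?thesis .
    qed
    have "p 0 = x" "p 1 = y" by (auto simp: p_def e_def)
    then have "\<bar>\<Phi> 0 - V x * c\<bar> <= L * \<delta> * c" "\<bar>\<Phi> 1 - V y * c\<bar> <= L * \<delta> * c"
      using near[of 0] near[of 1] by auto
    ultimately have "\<bar>V y * c - V x * c\<bar> <= A * norm e * c + 2 * (L * \<delta> * c)" by linarith
    then have "\<bar>V y - V x\<bar> * c <= (A * norm e + 2 * L * \<delta>) * c"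
      using c0 by (simp add: abs_mult distrib_right flip: left_diff_distrib)
    then show ?thesis using c0 by simp
  qed
  note bound = this
  \<comment> \<open>Shrinking the mollifier removes the term with the Lipschitz constant.\<close>
  have "(\<lambda>n. A * norm e + 2 * L * (r / 2 * (1 / real (Suc n)))) \<longlonglongrightarrow> A * norm e + 2 * L * (r / 2 * 0)"
    unfolding divide_inverse mult_1_left by (intro tendsto_intros LIMSEQ_inverse_real_of_nat)
  then have "\<bar>V y - V x\<bar> <= A * norm e + 2 * L * (r / 2 * 0)"
  proof (rule LIMSEQ_le_const, intro exI[of _ 0] allI impI)
    fix n
    have "0 < r / 2 * (1 / real (Suc n))" using r(1) by simp
    moreover have "r / 2 * (1 / real (Suc n)) <= r / 2 * 1" using r(1) by (intro mult_left_mono) auto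
    ultimately show "\<bar>V y - V x\<bar> <= A * norm e + 2 * L * (r / 2 * (1 / real (Suc n)))"
      using bound[of "r / 2 * (1 / real (Suc n))"] by simp
  qed
  then show ?thesis by (simp add: e_def)
qed

text \<open>
  Dilation factors that move the annulus across the boundary circle of squared radius \<open>rho\<close>, so
  that a point of the dilated support always stems from a point of the annulus.
\<close>

definition dil :: "real => nat => real" where
  "dil rho n = 1 + (if rho = 1 then 1 else - 1) / real (n + 20)"

lemma dil_facts:
  "9/10 <= dil rho n" "dil rho n <= 11/10" "dil rho n ~= 1" "dil rho \<longlonglongrightarrow> 1" "rho = 1 ==> 1 < dil rho n" "rho ~= 1 ==> dil rho n < 1"
proof -
  have b: "0 < 1 / real (n + 20)" "1 / real (n + 20) <= 1/10" by (auto simp: divide_simps)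
  then show "9/10 <= dil rho n" "dil rho n <= 11/10" "dil rho n ~= 1" "rho = 1 ==> 1 < dil rho n" "rho ~= 1 ==> dil rho n < 1"
    by (auto simp: dil_def)
  have "(\<lambda>n. 1 / real (n + 20)) \<longlonglongrightarrow> 0"
    using LIMSEQ_ignore_initial_segment[OF lim_inverse_n, of 20] by (simp add: inverse_eq_divide)
  then have "(\<lambda>n. 1 + (if rho = 1 then 1 else - 1) * (1 / real (n + 20))) \<longlonglongrightarrow> 1 + (if rho = 1 then 1 else - 1) * 0"
    by (intro tendsto_intros)
  then show "dil rho \<longlonglongrightarrow> 1" by (simp add: dil_def[abs_def])
qed

lemma near_norm:
  assumes "side rho" "x \<in> near rho"
  shows "rho = 1/4 ==> norm x <= 7/10" "rho = 1 ==> 7/10 <= norm x"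
proof -
  have b: "\<bar>x \<bullet> x / rho - 1\<bar> <= 1/2" using assms(2) by (simp add: near_def)
  show "norm x <= 7/10" if "rho = 1/4"
  proof (rule power2_le_imp_le)
    have "x \<bullet> x / rho = 4 * (x \<bullet> x)" unfolding that by simp
    then have "x \<bullet> x <= 49/100" using b by linarith
    then show "(norm x)^2 <= (7/10)^2" by (simp add: power2_norm_eq_inner power_divide)
  qed simp
  show "7/10 <= norm x" if "rho = 1"
  proof (rule power2_le_imp_le)
    have "x \<bullet> x / rho = x \<bullet> x" unfolding that by simp
    then have "49/100 <= x \<bullet> x" using b by linarith
    then show "(7/10)^2 <= (norm x)^2" by (simp add: power2_norm_eq_inner power_divide)
  qed simp
qed

text \<open>The direction of the dilation settles the circle of squared radius \<open>rho\<close>.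
  For the other circle, the layer lies at norm at least \<open>7/10\<close> if
  \<open>rho = 1\<close> and at most \<open>7/10\<close> if \<open>rho = 1/4\<close>, and a factor
  within \<open>1/10\<close> of 1 cannot bridge the remaining gap.\<close>

lemma dil_in_annulus:
  assumes rho: "side rho" and y: "dil rho n *\<^sub>R x \<in> near rho"
  shows "x \<in> annulus"
proof -
  define t where "t = dil rho n"
  have t: "9/10 <= t" "t <= 11/10" using dil_facts(1,2) by (auto simp: t_def)
  have nt: "norm (t *\<^sub>R x) = t * norm x" using t by simp
  have ya: "1/2 < t * norm x" "t * norm x < 1"
    using near_facts(1)[OF rho y] nt by (auto simp: annulus_def t_def)
  show ?thesis
  proof (cases "rho = 1")
    case True
    then have t1: "1 < t" using dil_facts(5) by (simp add: t_def)
    have "7/10 <= t * norm x" using near_norm(2)[OF rho y True] unfolding t_def[symmetric] nt .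
    also have "\<dots> <= 11/10 * norm x" using t by (intro mult_right_mono) auto
    finally have "1/2 < norm x" by simp
    moreover have "1 * norm x <= t * norm x" using t1 by (intro mult_right_mono) auto
    ultimately show ?thesis using ya by (auto simp: annulus_def)
  next
    case False
    then have t1: "t < 1" and rho4: "rho = 1/4" using dil_facts(6) rho by (auto simp: t_def side_def)
    have "9/10 * norm x <= t * norm x" using t by (intro mult_right_mono) auto
    also have "\<dots> <= 7/10" using near_norm(1)[OF rho y rho4] unfolding t_def[symmetric] nt .
    finally have "norm x < 1" by simp
    moreover have "t * norm x <= 1 * norm x" using t1 by (intro mult_right_mono) auto
    ultimately show ?thesis using ya by (auto simp: annulus_def)
  qed
qed

text \<open>On a ray the norm is an affine function of the parameter, so the bounds at the two ends
  hold in between.\<close>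

lemma dilation_segment:
  fixes x :: "real^2"
  assumes "x \<in> annulus" "t *\<^sub>R x \<in> annulus" "t > 0"
  shows "closed_segment x (t *\<^sub>R x) \<subseteq> annulus"
proof
  fix y assume "y \<in> closed_segment x (t *\<^sub>R x)"
  then obtain s where s: "0 <= s" "s <= 1" "y = (1 - s) *\<^sub>R x + s *\<^sub>R (t *\<^sub>R x)" by (auto simp: closed_segment_def)
  have y: "y = ((1 - s) + s * t) *\<^sub>R x" by (simp add: s(3) scaleR_add_left)
  have "0 <= (1 - s) + s * t" using s assms(3) by (intro add_nonneg_nonneg mult_nonneg_nonneg) auto
  then have n: "norm y = (1 - s) * norm x + s * (t * norm x)" unfolding y by (simp add: distrib_right mult.assoc)
  have tx: "1/2 < t * norm x" "t * norm x < 1" using assms by (auto simp: annulus_def)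
  note nx = annulus_norm[OF assms(1)]
  define a b where "a = (1 - s) * norm x" "b = s * (t * norm x)"
  have half: "(1 - s) * (1/2) + s * (1/2) = 1/2" and one: "(1 - s) * 1 + s * 1 = 1"
    unfolding distrib_right[symmetric] by simp_all
  have "1/2 < norm y"
  proof (cases "s = 1")
    case False
    then have "(1 - s) * (1/2) < (1 - s) * norm x" using s nx by (intro mult_strict_left_mono) auto
    moreover have "s * (1/2) <= s * (t * norm x)" using s tx by (intro mult_left_mono) auto
    ultimately show ?thesis unfolding n a_b_def[symmetric] using half by linarith
  qed (use n tx in simp)
  moreover have "norm y < 1"
  proof (cases "s = 1")
    case False
    then have "(1 - s) * norm x < (1 - s) * 1" using s nx by (intro mult_strict_left_mono) auto
    moreover have "s * (t * norm x) <= s * 1" using s tx by (intro mult_left_mono) auto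
    ultimately show ?thesis unfolding n a_b_def[symmetric] using one by linarith
  qed (use n tx in simp)
  ultimately show "y \<in> annulus" by (simp add: annulus_def)
qed

text \<open>
  Integration by parts against the radial field \<open>x\<close>, without differentiating \<open>V\<close>: the integral of
  \<open>V w\<close> is compared with that of its dilation.
\<close>

lemma radial_integration_by_parts:
  fixes V w Lw :: "real^2 => real"
  assumes rho: "side rho" and L: "L-lipschitz_on annulus V"
    and G: "has_weak_gradient annulus V G" "Linfty_norm annulus G <= ereal A"
    and VB: "!!x. x \<in> annulus ==> \<bar>V x\<bar> <= VB"
    and wm: "w \<in> borel_measurable borel" and wB: "!!x. \<bar>w x\<bar> <= B"
    and w0: "!!x. x \<notin> near rho ==> w x = 0"
    and Lw: "!!x. x \<in> annulus ==> ((\<lambda>t. w (t *\<^sub>R x)) has_real_derivative Lw x) (at 1)"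
    and K: "!!x n. x \<in> annulus ==> \<bar>w (dil rho n *\<^sub>R x) - w x\<bar> <= K * \<bar>dil rho n - 1\<bar>"
  shows "\<bar>LINT x|Om. V x * (2 * w x + Lw x)\<bar> <= A * (LINT x|Om. norm x * \<bar>w x\<bar>)"
    "integrable Om (\<lambda>x. V x * (2 * w x + Lw x))"
proof -
  let ?t = "dil rho"
  have seg: "\<bar>V (t *\<^sub>R x) - V x\<bar> <= A * norm (t *\<^sub>R x - x)" if "x \<in> annulus" "t *\<^sub>R x \<in> annulus" "t > 0" for t x
    using weak_gradient_bound_segment[OF L G dilation_segment[OF that]] .
  have Vc: "continuous_on annulus V" using L by (rule lipschitz_on_continuous_on)
  have Vm: "V \<in> borel_measurable Om" by (intro continuous_on_measurable_lebesgue_on annulus_facts Vc)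
  define F where "F x = indicator annulus x *\<^sub>R V x * w x" for x
  have Fm: "F \<in> borel_measurable borel"
    unfolding F_def using borel_measurable_continuous_on_indicator[OF annulus_facts(4) Vc] wm by measurable
  have B0: "B >= 0" "VB >= 0" using wB[of 0] VB[of x for x] weight_pos
  proof -
    show "B >= 0" using wB[of 0] by linarith
    have "(3/4) *\<^sub>R axis 1 1 \<in> annulus" by (simp add: annulus_def norm_axis_1)
    from VB[OF this] show "VB >= 0" by linarith
  qed
  have F0: "F x = 0" if "x \<notin> annulus" for x using that by (simp add: F_def)
  have Fd0: "F (?t n *\<^sub>R x) = 0" if "x \<notin> annulus" for x n
  proof (cases "?t n *\<^sub>R x \<in> near rho")
    case True
    then show ?thesis using dil_in_annulus[OF rho] that by blast
  qed (simp add: F_def w0)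
  have Fi: "integrable lborel F"
  proof -
    have "integrable lborel (\<lambda>x. (VB * B) * indicator annulus x :: real)"
      using emeasure_bounded_finite[OF annulus_facts(2)] annulus_facts(4)
      by (intro integrable_mult_right) (simp add: integrable_indicator_iff)
    then show ?thesis
    proof (rule Bochner_Integration.integrable_bound)
      show "AE x in lborel. norm (F x) <= norm (VB * B * indicator annulus x :: real)"
        using VB wB B0 by (intro AE_I2) (auto simp: F_def indicator_def abs_mult intro!: mult_mono)
    qed (use Fm in simp)
  qed
  have tpos: "?t n > 0" for n using dil_facts(1)[of rho n] by linarith
  \<comment> \<open>Change of variables in the plane: the dilated integrand with its Jacobian has
    the same integral, so the difference quotient at factor 1 integrates to 0.\<close>
  have scale: "(LINT x|lborel. (?t n)^2 * F (?t n *\<^sub>R x)) = (LINT x|lborel. F x)" for n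
    using integral_lborel_affine(1)[OF Fm tpos[of n], where x = 0] by simp
  have Fdi: "integrable lborel (\<lambda>x. F (?t n *\<^sub>R x))" for n
    using integral_lborel_affine(3)[OF Fm tpos[of n], where x = 0] Fi by simp
  \<comment> \<open>The difference quotient is split by the product rule. In \<open>D\<close> the
    dilation acts on \<open>w\<close> and on the Jacobian, whose derivative at 1 is the 2 in the
    conclusion; in \<open>R\<close> it acts on \<open>V\<close>, for which there is a bound but no
    limit.\<close>
  define D where "D n x = V x * (((?t n)^2 * w (?t n *\<^sub>R x) - w x) / (?t n - 1))" for n x
  define R where "R n x = (?t n)^2 * w (?t n *\<^sub>R x) * (indicator annulus (?t n *\<^sub>R x) * ((V (?t n *\<^sub>R x) - V x) / (?t n - 1)))" for n x
  have DR: "((?t n)^2 * F (?t n *\<^sub>R x) - F x) / (?t n - 1) = D n x + R n x" if "x \<in> annulus" for n x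
  proof (cases "?t n *\<^sub>R x \<in> annulus")
    case True
    have gen: "(t2 * (v' * w') - v * w) / r = v * ((t2 * w' - w) / r) + t2 * w' * ((v' - v) / r)" for t2 v' w' v w r :: real
      by (simp add: algebra_simps add_divide_distrib diff_divide_distrib)
    show ?thesis using True that by (simp add: F_def D_def R_def gen)
  next
    case False
    then have "w (?t n *\<^sub>R x) = 0" using w0 near_facts(1)[OF rho] by blast
    then show ?thesis using False that by (simp add: F_def D_def R_def)
  qed
  have wtm: "(\<lambda>x. w (?t n *\<^sub>R x)) \<in> borel_measurable borel" for n using wm by measurable
  have Dm: "D n \<in> borel_measurable Om" for n
    unfolding D_def[abs_def] using Vm borel_measurable_lebesgue_on[OF wtm] borel_measurable_lebesgue_on[OF wm] by measurable
  have zero: "(LINT x|Om. D n x + R n x) = 0" for n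
  proof -
    have "(LINT x|Om. D n x + R n x) = (LINT x|Om. ((?t n)^2 * F (?t n *\<^sub>R x) - F x) / (?t n - 1))"
      by (rule Bochner_Integration.integral_cong[OF refl]) (use DR in simp)
    also have "\<dots> = (LINT x|lborel. ((?t n)^2 * F (?t n *\<^sub>R x) - F x) / (?t n - 1))"
      using Fm by (intro integral_lebesgue_on_annulus) (auto simp: F0 Fd0)
    also have "\<dots> = ((LINT x|lborel. (?t n)^2 * F (?t n *\<^sub>R x)) - (LINT x|lborel. F x)) / (?t n - 1)"
      using Fi Fdi by simp
    finally show ?thesis unfolding scale by simp
  qed
  have t2: "(?t n)^2 <= 2" for n
  proof -
    have "(?t n)^2 <= (11/10)^2" using dil_facts(1,2)[of rho n] by (intro power_mono) auto
    then show ?thesis by (simp add: power_divide)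
  qed
  have Db: "\<bar>D n x\<bar> <= VB * (2 * \<bar>K\<bar> + 3 * B)" if x: "x \<in> annulus" for n x
  proof -
    have t: "?t n - 1 ~= 0" using dil_facts(3)[of rho n] by simp
    have eq: "((?t n)^2 * w (?t n *\<^sub>R x) - w x) / (?t n - 1)
        = (?t n)^2 * ((w (?t n *\<^sub>R x) - w x) / (?t n - 1)) + (?t n + 1) * w x"
      using t by (simp add: field_simps power2_eq_square)
    have "\<bar>w (?t n *\<^sub>R x) - w x\<bar> <= \<bar>K\<bar> * \<bar>?t n - 1\<bar>"
      by (rule order.trans[OF K[OF x]]) (auto intro: mult_right_mono)
    then have q: "\<bar>(w (?t n *\<^sub>R x) - w x) / (?t n - 1)\<bar> <= \<bar>K\<bar>" using t by (simp add: abs_divide pos_divide_le_eq)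
    have "\<bar>(?t n)^2 * ((w (?t n *\<^sub>R x) - w x) / (?t n - 1))\<bar> <= 2 * \<bar>K\<bar>"
      unfolding abs_mult using q t2[of n] by (intro mult_mono) auto
    moreover have "\<bar>(?t n + 1) * w x\<bar> <= 3 * B"
      unfolding abs_mult using dil_facts(1,2)[of rho n] wB[of x] by (intro mult_mono) auto
    ultimately have "\<bar>((?t n)^2 * w (?t n *\<^sub>R x) - w x) / (?t n - 1)\<bar> <= 2 * \<bar>K\<bar> + 3 * B"
      unfolding eq by linarith
    then show ?thesis unfolding D_def abs_mult[of "V x"] using VB[OF x] B0 by (intro mult_mono) auto
  qed
  have Di: "integrable Om (D n)" for n
    by (rule Om.integrable_const_bound[where B = "VB * (2 * \<bar>K\<bar> + 3 * B)"]) (use Db Dm in \<open>auto intro!: AE_I2\<close>)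
  have Dlim: "(\<lambda>n. D n x) \<longlonglongrightarrow> V x * (2 * w x + Lw x)" if x: "x \<in> annulus" for x
  proof -
    have "((\<lambda>t. (w (t *\<^sub>R x) - w (1 *\<^sub>R x)) / (t - 1)) \<longlongrightarrow> Lw x) (at 1)"
      using Lw[OF x] by (simp add: has_field_derivative_iff)
    moreover have "filterlim ?t (at 1) sequentially" using dil_facts(3,4) by (simp add: filterlim_at)
    ultimately have q: "(\<lambda>n. (w (?t n *\<^sub>R x) - w (1 *\<^sub>R x)) / (?t n - 1)) \<longlonglongrightarrow> Lw x" by (rule filterlim_compose)
    have eq: "D n x = V x * ((?t n)^2 * ((w (?t n *\<^sub>R x) - w (1 *\<^sub>R x)) / (?t n - 1)) + (?t n + 1) * w x)" for n
      unfolding D_def using dil_facts(3)[of rho n] by (simp add: field_simps power2_eq_square)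
    have "(\<lambda>n. V x * ((?t n)^2 * ((w (?t n *\<^sub>R x) - w (1 *\<^sub>R x)) / (?t n - 1)) + (?t n + 1) * w x))
        \<longlonglongrightarrow> V x * (1^2 * Lw x + (1 + 1) * w x)"
      by (intro tendsto_intros q dil_facts(4))
    then show ?thesis unfolding eq by (simp add: add.commute)
  qed
  have lm: "(\<lambda>x. V x * (2 * w x + Lw x)) \<in> borel_measurable Om"
    by (rule borel_measurable_LIMSEQ_real[where u = D]) (use Dlim Dm in auto)
  have Dconv: "(\<lambda>n. LINT x|Om. D n x) \<longlonglongrightarrow> (LINT x|Om. V x * (2 * w x + Lw x))"
    by (rule integral_dominated_convergence[where w = "\<lambda>_. VB * (2 * \<bar>K\<bar> + 3 * B)", OF lm Dm])
      (use Dlim Db in \<open>auto intro!: AE_I2\<close>)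
  show "integrable Om (\<lambda>x. V x * (2 * w x + Lw x))"
    by (rule integrable_dominated_convergence[where w = "\<lambda>_. VB * (2 * \<bar>K\<bar> + 3 * B)" and s = D, OF lm Dm])
      (use Dlim Db in \<open>auto intro!: AE_I2\<close>)
  define S where "S n x = (?t n)^2 * (norm x * \<bar>w (?t n *\<^sub>R x)\<bar>)" for n x
  have Sb: "\<bar>S n x\<bar> <= 2 * B" if x: "x \<in> annulus" for n x
  proof -
    have nb: "norm x * \<bar>w (?t n *\<^sub>R x)\<bar> <= 1 * B" using wB annulus_norm[OF x] by (intro mult_mono) auto
    have "(?t n)^2 * (norm x * \<bar>w (?t n *\<^sub>R x)\<bar>) <= 2 * (1 * B)" by (rule mult_mono[OF t2 nb]) auto
    then show ?thesis by (simp add: S_def abs_mult)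
  qed
  have Sm: "S n \<in> borel_measurable Om" for n
    unfolding S_def[abs_def] using wtm by (intro borel_measurable_lebesgue_on) measurable
  have Si: "integrable Om (S n)" for n
    by (rule Om.integrable_const_bound[where B = "2 * B"]) (use Sb Sm in \<open>auto intro!: AE_I2\<close>)
  have Slim: "(\<lambda>n. LINT x|Om. S n x) \<longlonglongrightarrow> (LINT x|Om. norm x * \<bar>w x\<bar>)"
  proof (rule integral_dominated_convergence[where w = "\<lambda>_. 2 * B"])
    show "AE x in Om. (\<lambda>n. S n x) \<longlonglongrightarrow> norm x * \<bar>w x\<bar>"
    proof (rule AE_I2)
      fix x assume "x \<in> space Om"
      then have x: "x \<in> annulus" by simp
      have "isCont (\<lambda>t. w (t *\<^sub>R x)) 1" using DERIV_isCont[OF Lw[OF x]] .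
      from isCont_tendsto_compose[OF this dil_facts(4)] have "(\<lambda>n. w (?t n *\<^sub>R x)) \<longlonglongrightarrow> w (1 *\<^sub>R x)" .
      then have "(\<lambda>n. S n x) \<longlonglongrightarrow> 1^2 * (norm x * \<bar>w (1 *\<^sub>R x)\<bar>)"
        unfolding S_def by (intro tendsto_intros dil_facts(4))
      then show "(\<lambda>n. S n x) \<longlonglongrightarrow> norm x * \<bar>w x\<bar>" by simp
    qed
    show "(\<lambda>x. norm x * \<bar>w x\<bar>) \<in> borel_measurable Om" using wm by (intro borel_measurable_lebesgue_on) measurable
  qed (use Sb Sm in \<open>auto intro!: AE_I2\<close>)
  have Rb: "\<bar>R n x\<bar> <= A * S n x" if x: "x \<in> annulus" for n x
  proof (cases "?t n *\<^sub>R x \<in> annulus")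
    case True
    have t: "\<bar>?t n - 1\<bar> > 0" using dil_facts(3)[of rho n] by simp
    have "norm (?t n *\<^sub>R x - x) = \<bar>?t n - 1\<bar> * norm x"
      by (metis norm_scaleR scaleR_left_diff_distrib scaleR_one)
    then have "\<bar>V (?t n *\<^sub>R x) - V x\<bar> <= (A * norm x) * \<bar>?t n - 1\<bar>"
      using seg[OF x True tpos] by (simp add: mult_ac)
    then have "\<bar>(V (?t n *\<^sub>R x) - V x) / (?t n - 1)\<bar> <= A * norm x"
      using t by (simp add: abs_divide pos_divide_le_eq)
    from mult_left_mono[OF this, of "(?t n)^2 * \<bar>w (?t n *\<^sub>R x)\<bar>"] show ?thesis
      using True by (simp add: R_def S_def abs_mult mult_ac)
  next
    case False
    then have "w (?t n *\<^sub>R x) = 0" using w0 near_facts(1)[OF rho] by blast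
    then show ?thesis by (simp add: R_def S_def)
  qed
  have "\<bar>LINT x|Om. D n x\<bar> <= A * (LINT x|Om. S n x)" for n
  proof -
    have DRi: "integrable Om (\<lambda>x. D n x + R n x)"
    proof -
      have "integrable lborel (\<lambda>x. ((?t n)^2 * F (?t n *\<^sub>R x) - F x) / (?t n - 1))" using Fi Fdi by auto
      then have "integrable lebesgue (\<lambda>x. ((?t n)^2 * F (?t n *\<^sub>R x) - F x) / (?t n - 1))"
        using Fm by (subst integrable_completion) auto
      then have "integrable Om (\<lambda>x. ((?t n)^2 * F (?t n *\<^sub>R x) - F x) / (?t n - 1))"
        using annulus_facts(3)
        by (subst integrable_restrict_space) (simp, rule integrable_mult_indicator)
      then show ?thesis by (rule Bochner_Integration.integrable_cong[THEN iffD1, rotated -1]) (use DR in auto)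
    qed
    have Ri: "integrable Om (R n)" using Bochner_Integration.integrable_diff[OF DRi Di[of n]] by simp
    have "(LINT x|Om. D n x) = - (LINT x|Om. R n x)" using zero[of n] Di[of n] Ri by simp
    also have "\<bar>\<dots>\<bar> <= (LINT x|Om. A * S n x)" unfolding abs_minus_cancel
      by (rule order.trans[OF integral_abs_bound], rule integral_mono) (use Ri Si Rb in auto)
    finally show ?thesis by simp
  qed
  then show "\<bar>LINT x|Om. V x * (2 * w x + Lw x)\<bar> <= A * (LINT x|Om. norm x * \<bar>w x\<bar>)"
    using LIMSEQ_le[OF tendsto_rabs[OF Dconv] tendsto_mult_left[OF Slim, of A]] by blast
qed

section \<open>The radial field and its divergence\<close>

definition plateau' :: "real => real" where
  "plateau' s = 2 * max 0 (1 - 4 * (s - 1)^2) * (- 8 * (s - 1))"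

lemma max_0_square_derivative: "((\<lambda>y::real. (max 0 y)^2) has_real_derivative 2 * max 0 y) (at y)"
proof -
  consider "y > 0" | "y < 0" | "y = 0" by linarith
  then show ?thesis
  proof cases
    case 1
    have "((\<lambda>y. y^2) has_real_derivative 2 * max 0 y) (at y)"
      using 1 by (auto intro!: derivative_eq_intros)
    then show ?thesis
      by (rule has_field_derivative_transform_within_open[of _ _ _ "{0<..}"]) (use 1 in auto)
  next
    case 2
    have "((\<lambda>y. 0) has_real_derivative 2 * max 0 y) (at y)" using 2 by auto
    then show ?thesis
      by (rule has_field_derivative_transform_within_open[of _ _ _ "{..<0}"]) (use 2 in auto)
  next
    case 3
    have "((\<lambda>h. (max 0 h)^2 / h) \<longlongrightarrow> 0) (at (0::real))"
    proof (rule tendsto_0_le[of "\<lambda>h. h" _ _ 1])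
      show "eventually (\<lambda>h::real. norm ((max 0 h)^2 / h) <= norm h * 1) (at 0)"
        by (intro always_eventually) (auto simp: max_def power2_eq_square)
    qed (rule tendsto_ident_at)
    then show ?thesis using 3 by (simp add: has_field_derivative_iff)
  qed
qed

lemma plateau_derivative: "(plateau has_real_derivative plateau' s) (at s)"
proof -
  have "((\<lambda>s. 1 - 4 * (s - 1)^2) has_real_derivative - 8 * (s - 1)) (at s)"
    by (auto intro!: derivative_eq_intros)
  from DERIV_chain2[OF max_0_square_derivative this] show ?thesis
    by (simp add: plateau_def[abs_def] plateau'_def)
qed

text \<open>The derivative of \<open>rho_fun rho (x \<bullet> x)\<close> along the field \<open>x\<close>, as a function of \<open>s = x \<bullet> x / rho\<close>.\<close>

definition ell :: "real => real" where
  "ell s = 4 * s / (s + 1)^2 * plateau s + 2 * s * (s - 1) / (s + 1) * plateau' s"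

lemma rho_fun_scaled:
  assumes "rho > 0"
  shows "rho_fun rho p = (p / rho - 1) / (p / rho + 1) * plateau (p / rho)"
proof -
  have "p / rho - 1 = (p - rho) / rho" "p / rho + 1 = (p + rho) / rho" using assms by (simp_all add: field_simps)
  then have "(p / rho - 1) / (p / rho + 1) = (p - rho) / (p + rho)" using assms by simp
  then show ?thesis by (simp add: rho_fun_def)
qed

lemma rho_fun_dilation:
  assumes "rho > 0" "t > 0"
  shows "((\<lambda>t. rho_fun rho (t *\<^sub>R x \<bullet> t *\<^sub>R x)) has_real_derivative ell (t *\<^sub>R x \<bullet> t *\<^sub>R x / rho) / t) (at t)"
proof -
  define s where "s t = t *\<^sub>R x \<bullet> t *\<^sub>R x / rho" for t
  have s0: "s t >= 0" for t unfolding s_def using assms by (intro divide_nonneg_pos inner_ge_zero)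
  have s1: "s t + 1 ~= 0" for t using s0[of t] by linarith
  have ds: "(s has_real_derivative 2 * s t / t) (at t)"
    unfolding s_def[abs_def] using assms by (auto intro!: derivative_eq_intros simp: field_simps)
  have "((\<lambda>s. (s - 1) / (s + 1) * plateau s) has_real_derivative
      2 / (s t + 1)^2 * plateau (s t) + (s t - 1) / (s t + 1) * plateau' (s t)) (at (s t))"
  proof -
    have q: "((\<lambda>s. (s - 1) / (s + 1)) has_real_derivative 2 / (s t + 1)^2) (at (s t))"
      using s1[of t] by (auto intro!: derivative_eq_intros simp: power2_eq_square)
    show ?thesis using DERIV_mult[OF q plateau_derivative] by (simp only: mult.commute add.commute)
  qed
  from DERIV_chain2[OF this ds] have "((\<lambda>t. (s t - 1) / (s t + 1) * plateau (s t)) has_real_derivative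
      (2 / (s t + 1)^2 * plateau (s t) + (s t - 1) / (s t + 1) * plateau' (s t)) * (2 * s t / t)) (at t)" .
  moreover have "(X * p + Y / z * p') * (2 * s / t) = (2 * X * s * p + 2 * s * Y / z * p') / t" for X Y z s t p p' :: real
    by (cases "t = 0"; cases "z = 0"; simp add: field_simps)
  from this[of "2 / (s t + 1)^2"] have "(2 / (s t + 1)^2 * plateau (s t) + (s t - 1) / (s t + 1) * plateau' (s t)) * (2 * s t / t) = ell (s t) / t"
    by (simp add: ell_def)
  ultimately show ?thesis using assms(1) by (simp add: rho_fun_scaled s_def)
qed

lemma ell_outside: "1/2 <= \<bar>s - 1\<bar> ==> ell s = 0"
proof -
  assume a: "1/2 <= \<bar>s - 1\<bar>"
  then have "(1/2)^2 <= \<bar>s - 1\<bar>^2" by (intro power_mono) auto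
  then show ?thesis using plateau_eq_0[OF a] by (simp add: ell_def plateau'_def power_divide)
qed

text \<open>On the circle \<open>ell\<close> equals 1. The three factors lose at most
  \<open>d\<close>, \<open>4 * d\<close> and \<open>16 * d\<close> at distance \<open>d\<close>,
  which gives 21; the bound 9 is \<open>1 + 16 / 2\<close>.\<close>

lemma ell_bounds:
  assumes "\<bar>s - 1\<bar> <= 1/2"
  shows "1 - 21 * \<bar>s - 1\<bar> <= ell s" "\<bar>ell s\<bar> <= 9"
proof -
  define d where "d = \<bar>s - 1\<bar>"
  have d: "0 <= d" "d <= 1/2" "1/2 <= s" "s <= 3/2" using assms unfolding d_def by linarith+
  have dd: "d^2 <= d * (1/2)" unfolding power2_eq_square using d by (intro mult_left_mono) auto
  have d4: "0 <= 1 - 4 * d^2" "1 - 4 * d^2 <= 1" using dd d by auto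
  have sd: "(s - 1)^2 = d^2" by (simp add: d_def)
  define X where "X = 4 * s / (s + 1)^2"
  have X: "1 - d <= X" "X <= 1"
  proof -
    have sp: "(s + 1)^2 > 0" using d by simp
    have eq: "X = 1 - d^2 / (s + 1)^2"
      unfolding X_def sd[symmetric] using sp d by (simp add: field_simps power2_eq_square)
    have "1^2 <= (s + 1)^2" using d by (intro power_mono) auto
    then have "d^2 / (s + 1)^2 <= d^2 / 1" by (intro divide_left_mono) auto
    then show "1 - d <= X" using dd d unfolding eq by simp
    show "X <= 1" unfolding eq by simp
  qed
  define Y where "Y = plateau s"
  have Y: "1 - 4 * d <= Y" "Y <= 1" "0 <= Y"
  proof -
    have "Y = (1 - 4 * d^2)^2" using d4 by (simp add: Y_def plateau_def sd)
    then have "Y = 1 - 8 * d^2 + 16 * (d^2)^2" by (simp add: power2_eq_square algebra_simps)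
    then show "1 - 4 * d <= Y" using dd zero_le_power2[of "d^2"] by linarith
    show "Y <= 1" "0 <= Y" unfolding Y_def by (rule plateau_bounds)+
  qed
  define Z where "Z = 2 * s * (s - 1) / (s + 1) * plateau' s"
  have Z: "\<bar>Z\<bar> <= 16 * d"
  proof -
    have "\<bar>plateau' s\<bar> = 2 * (1 - 4 * d^2) * (8 * d)"
    proof -
      have "\<bar>8 * (1 - s)\<bar> = 8 * d" unfolding abs_mult d_def by (simp add: abs_minus_commute)
      then show ?thesis using d4 unfolding plateau'_def sd abs_mult by (simp add: abs_minus_commute[of 1 s] d_def[symmetric])
    qed
    also have "\<dots> <= 2 * 1 * (8 * (1/2))" using d d4 by (intro mult_mono) auto
    finally have p: "\<bar>plateau' s\<bar> <= 8" by simp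
    have "\<bar>2 * s * (s - 1) / (s + 1)\<bar> = (s / (s + 1)) * (2 * d)" using d by (simp add: abs_mult d_def[symmetric])
    also have "\<dots> <= 1 * (2 * d)" using d by (intro mult_right_mono) auto
    finally have "\<bar>2 * s * (s - 1) / (s + 1)\<bar> <= 2 * d" by simp
    then have "\<bar>Z\<bar> <= (2 * d) * 8" unfolding Z_def abs_mult[of _ "plateau' s"] using p d by (intro mult_mono) auto
    then show ?thesis by simp
  qed
  have e: "ell s = X * Y + Z" by (simp add: ell_def X_def Y_def Z_def)
  have "0 <= (1 - X) * (1 - Y)" using X Y by simp
  then have "X + Y - 1 <= X * Y" by (simp add: algebra_simps)
  then show "1 - 21 * \<bar>s - 1\<bar> <= ell s" unfolding e d_def[symmetric] using X Y Z by linarith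
  have "X * Y <= 1" "0 <= X * Y" using X Y d by (auto intro!: mult_le_one)
  then show "\<bar>ell s\<bar> <= 9" unfolding e using Z d by linarith
qed

lemma ell_abs_le: "\<bar>ell s\<bar> <= 9"
  using ell_bounds(2)[of s] ell_outside[of s] by (cases "\<bar>s - 1\<bar> <= 1/2") auto

text \<open>The factor of the radial field. \<open>rho_fun\<close> vanishes on the circle of squared
  radius \<open>rho\<close> and its plateau removes the other circle, so the extension by zero
  creates no jump.\<close>

definition hh :: "real => real^2 => real" where
  "hh rho x = (if x \<in> annulus then rho_fun rho (x \<bullet> x) else 0)"

lemma hh_outside_near: "rho > 0 ==> x \<notin> near rho ==> hh rho x = 0"
  using plateau_eq_0[of "x \<bullet> x / rho"] by (auto simp: hh_def near_def rho_fun_def not_le)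

lemma hh_abs_le:
  assumes "side rho"
  shows "\<bar>hh rho x\<bar> <= 1" "\<bar>hh rho x\<bar> <= \<bar>x \<bullet> x / rho - 1\<bar>"
proof -
  note r = side_facts[OF assms]
  show "\<bar>hh rho x\<bar> <= 1" using rho_fun_abs_le(2)[OF r(1), of "x \<bullet> x"] by (simp add: hh_def)
  have "x \<bullet> x / rho - 1 = (x \<bullet> x - rho) / rho" using r(1) by (simp add: diff_divide_distrib)
  then have "\<bar>x \<bullet> x - rho\<bar> / rho = \<bar>x \<bullet> x / rho - 1\<bar>" using r(1) by (simp only: abs_divide abs_of_pos)
  then show "\<bar>hh rho x\<bar> <= \<bar>x \<bullet> x / rho - 1\<bar>"
    using rho_fun_abs_le(1)[OF r(1), of "x \<bullet> x"] by (simp add: hh_def)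
qed

lemma hh_measurable [measurable]: "hh rho \<in> borel_measurable borel"
  unfolding hh_def[abs_def] rho_fun_def plateau_def using annulus_facts(4) by measurable

lemma hh_dilation:
  assumes rho: "side rho" and x: "x \<in> annulus"
  shows "((\<lambda>t. hh rho (t *\<^sub>R x)) has_real_derivative ell (x \<bullet> x / rho)) (at 1)"
    "\<bar>hh rho (dil rho n *\<^sub>R x) - hh rho x\<bar> <= 10 * \<bar>dil rho n - 1\<bar>"
proof -
  note r = side_facts[OF rho]
  have d: "((\<lambda>t. rho_fun rho (t *\<^sub>R x \<bullet> t *\<^sub>R x)) has_real_derivative ell (t *\<^sub>R x \<bullet> t *\<^sub>R x / rho) / t) (at t)" if "t > 0" for t
    by (rule rho_fun_dilation[OF r(1) that])
  have op: "open ((\<lambda>t::real. t *\<^sub>R x) -` annulus)"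
    by (intro open_vimage annulus_facts continuous_intros)
  show "((\<lambda>t. hh rho (t *\<^sub>R x)) has_real_derivative ell (x \<bullet> x / rho)) (at 1)"
  proof (rule has_field_derivative_transform_within_open[OF _ op])
    show "((\<lambda>t. rho_fun rho (t *\<^sub>R x \<bullet> t *\<^sub>R x)) has_real_derivative ell (x \<bullet> x / rho)) (at 1)"
      using d[OF zero_less_one] by (simp only: scaleR_one div_by_1)
  qed (use x in \<open>simp_all add: hh_def\<close>)
  define t where "t = dil rho n"
  have t: "9/10 <= t" "t <= 11/10" using dil_facts(1,2) by (auto simp: t_def)
  show "\<bar>hh rho (dil rho n *\<^sub>R x) - hh rho x\<bar> <= 10 * \<bar>dil rho n - 1\<bar>"
    unfolding t_def[symmetric]
  proof (cases "t *\<^sub>R x \<in> annulus")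
    case True
    have "norm (rho_fun rho (t *\<^sub>R x \<bullet> t *\<^sub>R x) - rho_fun rho (1 *\<^sub>R x \<bullet> 1 *\<^sub>R x)) <= 10 * norm (t - 1)"
    proof (rule field_differentiable_bound[where S = "{9/10..11/10}"])
      fix s :: real assume s: "s \<in> {9/10..11/10}"
      then have "s > 0" by auto
      from has_field_derivative_at_within[OF d[OF this]]
      show "((\<lambda>t. rho_fun rho (t *\<^sub>R x \<bullet> t *\<^sub>R x)) has_field_derivative ell (s *\<^sub>R x \<bullet> s *\<^sub>R x / rho) / s) (at s within {9/10..11/10})" .
      have "\<bar>ell (s *\<^sub>R x \<bullet> s *\<^sub>R x / rho)\<bar> <= 10 * s" using ell_abs_le[of "s *\<^sub>R x \<bullet> s *\<^sub>R x / rho"] s by auto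
      then show "norm (ell (s *\<^sub>R x \<bullet> s *\<^sub>R x / rho) / s) <= 10" using s by (simp add: pos_divide_le_eq)
    qed (use t in auto)
    then show "\<bar>hh rho (t *\<^sub>R x) - hh rho x\<bar> <= 10 * \<bar>t - 1\<bar>" using True x by (simp add: hh_def)
  next
    case False
    have nt: "norm (t *\<^sub>R x) = t * norm x" using t by simp
    have xx: "t *\<^sub>R x \<bullet> t *\<^sub>R x = t^2 * (x \<bullet> x)" by (simp add: power2_eq_square)
    have sq: "t *\<^sub>R x \<bullet> t *\<^sub>R x = (t * norm x)^2" unfolding nt[symmetric] by (rule power2_norm_eq_inner[symmetric])
    have fac: "1 - t^2 = (1 - t) * (1 + t)" by (simp add: power2_eq_square algebra_simps)
    \<comment> \<open>If the dilated point has left the annulus, \<open>hh\<close> is 0 there, and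
      \<open>x\<close> itself is so close to the circle that \<open>hh rho x\<close> is of the order
      of \<open>t - 1\<close>.\<close>
    have "\<bar>x \<bullet> x / rho - 1\<bar> <= 10 * \<bar>t - 1\<bar>"
    proof (cases "rho = 1")
      case True
      then have t1: "1 < t" using dil_facts(5) by (simp add: t_def)
      have "norm x <= t * norm x" using t1 mult_right_mono[of 1 t "norm x"] by simp
      then have "1 <= t * norm x" using False annulus_norm[OF x] nt by (auto simp: annulus_def not_less)
      then have "1^2 <= (t * norm x)^2" by (intro power_mono) auto
      then have "1 <= t^2 * (x \<bullet> x)" unfolding xx[symmetric] sq by simp
      moreover have "(t^2 - 1) * (x \<bullet> x) <= (t^2 - 1) * 1"
        using annulus_inner[OF x] t1 by (intro mult_left_mono) auto
      moreover have "t^2 - 1 <= 10 * (t - 1)"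
      proof -
        have "(t - 1) * (1 + t) <= (t - 1) * 10" using t t1 by (intro mult_left_mono) auto
        then show ?thesis using fac by (simp add: algebra_simps)
      qed
      moreover have "x \<bullet> x < 1" by (rule annulus_inner[OF x])
      ultimately have "1 - x \<bullet> x <= 10 * (t - 1)" by (simp add: algebra_simps)
      then show ?thesis using True t1 \<open>x \<bullet> x < 1\<close> by simp
    next
      case False': False
      then have t1: "t < 1" and rho4: "rho = 1/4" using dil_facts(6) rho by (auto simp: t_def side_def)
      have "t * norm x <= norm x" using t1 mult_right_mono[of t 1 "norm x"] by simp
      then have "t * norm x <= 1/2" using False annulus_norm[OF x] nt by (auto simp: annulus_def not_less)
      then have "(t * norm x)^2 <= (1/2)^2" using t by (intro power_mono) auto
      then have "t^2 * (x \<bullet> x) <= 1/4" unfolding xx[symmetric] sq by (simp add: power_divide)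
      moreover have "(1 - t^2) * (x \<bullet> x) <= (1 - t^2) * 1"
      proof (rule mult_left_mono)
        show "0 <= 1 - t^2" unfolding fac using t t1 by simp
      qed (use annulus_inner[OF x] in simp)
      moreover have "1 - t^2 <= 2 * (1 - t)"
      proof -
        have "(1 - t) * (1 + t) <= (1 - t) * 2" using t t1 by (intro mult_left_mono) auto
        then show ?thesis using fac by simp
      qed
      moreover have "1/4 < x \<bullet> x" by (rule annulus_inner[OF x])
      ultimately have "x \<bullet> x - 1/4 <= 2 * (1 - t)" by (simp add: algebra_simps)
      moreover have "x \<bullet> x / rho - 1 = 4 * (x \<bullet> x - 1/4)" unfolding rho4 by simp
      ultimately show ?thesis using t1 \<open>1/4 < x \<bullet> x\<close> by simp
    qed
    then show "\<bar>hh rho (t *\<^sub>R x) - hh rho x\<bar> <= 10 * \<bar>t - 1\<bar>"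
      using hh_abs_le(2)[OF rho, of x] False by (simp add: hh_def)
  qed
qed

text \<open>For \<open>rho = 1/4\<close> the point \<open>x0\<close> is on the circle, so the
  distance to the circle is at most the distance to \<open>x0\<close>; the constant is
  \<open>4 * (3/2)\<close>. For \<open>rho = 1\<close> the layer keeps the distance
  \<open>1/5\<close> from \<open>x0\<close>. This is what tames the singularity of the
  weight.\<close>

lemma hh_le_distance:
  assumes rho: "side rho" and x0: "norm x0 = 1/2" and x: "x \<in> annulus"
  shows "\<bar>hh rho x\<bar> <= 6 * norm (x - x0)"
proof (cases "rho = 1")
  case True
  show ?thesis
  proof (cases "x \<in> near rho")
    case n: True
    have "7/10 <= norm x" by (rule near_norm(2)[OF rho n True])
    then have "1/5 <= norm (x - x0)" using norm_triangle_ineq2[of x x0] x0 by linarith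
    then show ?thesis using hh_abs_le(1)[OF rho, of x] by linarith
  qed (use hh_outside_near side_facts(1)[OF rho] in simp)
next
  case False
  then have rho4: "rho = 1/4" using rho by (simp add: side_def)
  have "x \<bullet> x / rho - 1 = 4 * ((norm x - norm x0) * (norm x + norm x0))"
    unfolding rho4 x0 by (simp add: power2_norm_eq_inner[symmetric] power2_eq_square algebra_simps)
  also have "\<bar>\<dots>\<bar> = 4 * (\<bar>norm x - norm x0\<bar> * (norm x + norm x0))" by (simp add: abs_mult)
  also have "\<dots> <= 4 * (norm (x - x0) * (3/2))"
    using norm_triangle_ineq3[of x x0] annulus_norm[OF x] x0 by (intro mult_left_mono mult_mono) auto
  finally show ?thesis using hh_abs_le(2)[OF rho, of x] by simp
qed

text \<open>The weight is regularised by \<open>\<delta>\<close>, as it need not be Lipschitz along rays near \<open>x0\<close>.\<close>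

definition dweight :: "real^2 => real => real => real^2 => real" where
  "dweight x0 \<beta> \<delta> x = ((x - x0) \<bullet> (x - x0) + \<delta>) powr \<beta>"

text \<open>The divergence of \<open>hh rho x * dweight x0 \<beta> \<delta> x\<close> times the field \<open>x\<close>, divided by \<open>dweight x0 \<beta> \<delta> x\<close>.\<close>

definition Jd :: "real^2 => real => real => real => real^2 => real" where
  "Jd x0 \<beta> rho \<delta> x = 2 * hh rho x + ell (x \<bullet> x / rho)
    + 2 * \<beta> * hh rho x * (x \<bullet> (x - x0)) / ((x - x0) \<bullet> (x - x0) + \<delta>)"

text \<open>The last term of \<open>Jd\<close> only looks singular: \<open>hh\<close> supplies one
  factor of the distance to \<open>x0\<close> and the inner product the other. The constants are
  \<open>2 + 9\<close> from the first two terms and \<open>2 * 6\<close> from the last.\<close>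

lemma Jd_abs_le:
  assumes rho: "side rho" and x0: "norm x0 = 1/2" and x: "x \<in> annulus" and \<delta>: "\<delta> >= 0"
  shows "\<bar>Jd x0 \<beta> rho \<delta> x\<bar> <= 11 + 12 * \<bar>\<beta>\<bar>"
proof -
  define y where "y = x - x0"
  have y0: "norm y > 0" using x x0 by (auto simp: y_def annulus_def)
  have "\<bar>x \<bullet> y\<bar> <= 1 * norm y"
    by (rule order.trans[OF Cauchy_Schwarz_ineq2]) (use annulus_norm[OF x] in \<open>intro mult_right_mono, auto\<close>)
  then have "\<bar>hh rho x\<bar> * \<bar>x \<bullet> y\<bar> <= (6 * norm y) * (1 * norm y)"
    using hh_le_distance[OF rho x0 x] by (intro mult_mono) (auto simp: y_def)
  also have "\<dots> = 6 * (y \<bullet> y)" by (simp add: power2_norm_eq_inner[symmetric] power2_eq_square)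
  also have "\<dots> <= 6 * (y \<bullet> y + \<delta>)" using \<delta> by simp
  finally have "\<bar>hh rho x * (x \<bullet> y)\<bar> <= 6 * (y \<bullet> y + \<delta>)" by (simp add: abs_mult)
  moreover have yp: "0 < y \<bullet> y + \<delta>" using y0 \<delta> by (simp add: add_pos_nonneg)
  ultimately have "\<bar>hh rho x * (x \<bullet> y) / (y \<bullet> y + \<delta>)\<bar> <= 6"
    by (simp add: abs_divide pos_divide_le_eq)
  then have "\<bar>2 * \<beta>\<bar> * \<bar>hh rho x * (x \<bullet> y) / (y \<bullet> y + \<delta>)\<bar> <= \<bar>2 * \<beta>\<bar> * 6" by (intro mult_left_mono) auto
  then have "\<bar>2 * \<beta> * hh rho x * (x \<bullet> y) / (y \<bullet> y + \<delta>)\<bar> <= 12 * \<bar>\<beta>\<bar>"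
    by (simp add: abs_mult mult.assoc)
  then show ?thesis
    unfolding Jd_def y_def[symmetric] using hh_abs_le(1)[OF rho, of x] ell_abs_le[of "x \<bullet> x / rho"] by linarith
qed

section \<open>The regularised weight and the radial inequality for exponentials\<close>

lemma powr_between:
  fixes y :: real
  assumes "0 < a" "a <= y" "y <= b"
  shows "y powr \<gamma> <= a powr \<gamma> + b powr \<gamma>"
proof (cases "\<gamma> >= 0")
  case True
  then have "y powr \<gamma> <= b powr \<gamma>" using assms by (intro powr_mono2) auto
  then show ?thesis by (simp add: add_increasing)
next
  case False
  then have "y powr \<gamma> <= a powr \<gamma>" using assms by (intro powr_mono2') auto
  then show ?thesis by (simp add: add_increasing2)
qed

lemma dweight_dilation:
  assumes x0: "norm x0 = 1/2" and \<delta>: "0 < \<delta>" "\<delta> <= 1"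
  shows "((\<lambda>t. dweight x0 \<beta> \<delta> (t *\<^sub>R x)) has_real_derivative
      dweight x0 \<beta> \<delta> (t *\<^sub>R x) * (2 * \<beta> * (x \<bullet> (t *\<^sub>R x - x0)) / ((t *\<^sub>R x - x0) \<bullet> (t *\<^sub>R x - x0) + \<delta>))) (at t)"
    "norm x <= 2 ==> 0 <= dweight x0 \<beta> \<delta> x \<and> dweight x0 \<beta> \<delta> x <= \<delta> powr \<beta> + 8 powr \<beta>"
proof -
  define y where "y t = (t *\<^sub>R x - x0) \<bullet> (t *\<^sub>R x - x0) + \<delta>" for t
  have yp: "y t > 0" for t using \<delta> by (simp add: y_def add_nonneg_pos)
  have dy: "(y has_real_derivative 2 * (x \<bullet> (t *\<^sub>R x - x0))) (at t)"
    unfolding y_def[abs_def] has_field_derivative_def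
    by (auto intro!: derivative_eq_intros simp: inner_diff_left inner_diff_right inner_commute fun_eq_iff algebra_simps)
  have "((\<lambda>t. y t powr \<beta>) has_real_derivative \<beta> * y t powr (\<beta> - 1) * (2 * (x \<bullet> (t *\<^sub>R x - x0)))) (at t)"
    using has_real_derivative_powr[OF yp, of \<beta>] by (rule DERIV_chain2) (rule dy)
  moreover have "\<beta> * y t powr (\<beta> - 1) * (2 * (x \<bullet> (t *\<^sub>R x - x0))) = y t powr \<beta> * (2 * \<beta> * (x \<bullet> (t *\<^sub>R x - x0)) / y t)"
    using yp[of t] by (simp add: powr_diff)
  ultimately show "((\<lambda>t. dweight x0 \<beta> \<delta> (t *\<^sub>R x)) has_real_derivative
      dweight x0 \<beta> \<delta> (t *\<^sub>R x) * (2 * \<beta> * (x \<bullet> (t *\<^sub>R x - x0)) / ((t *\<^sub>R x - x0) \<bullet> (t *\<^sub>R x - x0) + \<delta>))) (at t)"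
    by (simp add: dweight_def y_def)
  show "0 <= dweight x0 \<beta> \<delta> x \<and> dweight x0 \<beta> \<delta> x <= \<delta> powr \<beta> + 8 powr \<beta>" if "norm x <= 2"
  proof
    show "0 <= dweight x0 \<beta> \<delta> x" by (simp add: dweight_def)
    have "norm (x - x0) <= 5/2" using norm_triangle_ineq4[of x x0] that x0 by linarith
    then have "(norm (x - x0))^2 <= (5/2)^2" by (intro power_mono) auto
    then have "(x - x0) \<bullet> (x - x0) + \<delta> <= 8" using \<delta> by (simp add: power2_norm_eq_inner power_divide)
    then show "dweight x0 \<beta> \<delta> x <= \<delta> powr \<beta> + 8 powr \<beta>"
      unfolding dweight_def using \<delta> by (intro powr_between) auto
  qed
qed

lemma dweight_measurable [measurable]: "dweight x0 \<beta> \<delta> \<in> borel_measurable borel"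
  unfolding dweight_def[abs_def] by measurable

lemma product_difference_bound:
  fixes a b a' b' :: real
  assumes "\<bar>a' - a\<bar> <= K * d" "\<bar>b' - b\<bar> <= L * d" "\<bar>a'\<bar> <= M" "\<bar>b\<bar> <= N" "0 <= d" "0 <= K" "0 <= L"
  shows "\<bar>a' * b' - a * b\<bar> <= (M * L + K * N) * d"
proof -
  have "a' * b' - a * b = a' * (b' - b) + (a' - a) * b" by (simp add: algebra_simps)
  also have "\<bar>\<dots>\<bar> <= \<bar>a'\<bar> * \<bar>b' - b\<bar> + \<bar>a' - a\<bar> * \<bar>b\<bar>" by (metis abs_mult abs_triangle_ineq)
  also have "\<dots> <= M * (L * d) + (K * d) * N"
    using assms by (intro add_mono mult_mono) (auto intro: order.trans[OF abs_ge_zero])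
  finally show ?thesis by (simp add: algebra_simps)
qed

lemma weight_integrable:
  assumes x0: "norm x0 = 1/2" and \<beta>: "\<beta> > - 1/2"
  shows "integrable Om (weight x0 \<beta>)"
proof (cases "\<beta> < 0")
  case True
  then obtain C where "\<forall>x::real^2. norm x <= 1 --> integrable Om (\<lambda>z. norm (x - z) powr - (- 2 * \<beta>))
      \<and> (LINT z|Om. norm (x - z) powr - (- 2 * \<beta>)) <= C"
    using norm_powr_integrable[of "- 2 * \<beta>"] \<beta> by auto
  then have "integrable Om (\<lambda>z. norm (x0 - z) powr - (- 2 * \<beta>))" using x0 by simp
  then show ?thesis by (simp add: weight_def[abs_def] norm_minus_commute)
next
  case False
  have "\<bar>weight x0 \<beta> x\<bar> <= 2 powr (2 * \<beta>)" if "x \<in> annulus" for x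
  proof -
    have "norm (x - x0) <= 2" using norm_triangle_ineq4[of x x0] annulus_norm[OF that] x0 by linarith
    then show ?thesis unfolding weight_def using False by (simp add: powr_mono2)
  qed
  then show ?thesis
    by (intro Om.integrable_const_bound[where B = "2 powr (2 * \<beta>)"])
      (auto intro!: AE_I2 borel_measurable_lebesgue_on)
qed

text \<open>For either sign of \<open>\<beta>\<close> a power on an interval is at most the sum of
  its values at the ends. The bound is free of \<open>\<delta>\<close> and integrable, so it can
  dominate the limit in \<open>\<delta>\<close>.\<close>

lemma dweight_le:
  assumes x0: "norm x0 = 1/2" and \<delta>: "0 < \<delta>" "\<delta> <= 1" and x: "x \<in> annulus"
  shows "dweight x0 \<beta> \<delta> x <= weight x0 \<beta> x + 8 powr \<beta>"
proof -
  define y where "y = (x - x0) \<bullet> (x - x0)"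
  have w: "weight x0 \<beta> x = y powr \<beta>"
    using x x0 by (auto simp: weight_def y_def power2_norm_eq_inner[symmetric] powr_powr annulus_def simp flip: powr_numeral)
  have y0: "y > 0" using x x0 by (auto simp: y_def annulus_def)
  have "norm (x - x0) <= 5/2" using norm_triangle_ineq4[of x x0] annulus_norm[OF x] x0 by linarith
  then have "(norm (x - x0))^2 <= (5/2)^2" by (intro power_mono) auto
  then have y8: "y + \<delta> <= 8" using \<delta> by (simp add: y_def power2_norm_eq_inner power_divide)
  have "(y + \<delta>) powr \<beta> <= y powr \<beta> + 8 powr \<beta>" by (rule powr_between) (use y0 y8 \<delta> in auto)
  then show ?thesis by (simp add: dweight_def y_def w[unfolded y_def])
qed

lemma dweight_tendsto:
  assumes x0: "norm x0 = 1/2" and x: "x \<in> annulus" and \<delta>: "\<delta> \<longlonglongrightarrow> 0"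
  shows "(\<lambda>n. dweight x0 \<beta> (\<delta> n) x) \<longlonglongrightarrow> weight x0 \<beta> x"
proof -
  define y where "y = (x - x0) \<bullet> (x - x0)"
  have w: "weight x0 \<beta> x = (y + 0) powr \<beta>"
    using x x0 by (auto simp: weight_def y_def power2_norm_eq_inner[symmetric] powr_powr annulus_def simp flip: powr_numeral)
  have y0: "y + 0 ~= 0" using x x0 by (auto simp: y_def annulus_def)
  show ?thesis unfolding w dweight_def y_def[symmetric]
    by (intro tendsto_powr tendsto_add tendsto_const \<delta> y0)
qed

lemma ell_measurable [measurable]: "ell \<in> borel_measurable borel"
  unfolding ell_def[abs_def] plateau_def plateau'_def by measurable

lemma Jd_measurable [measurable]: "Jd x0 \<beta> rho \<delta> \<in> borel_measurable borel"
  unfolding Jd_def[abs_def] by measurable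

lemma Jd_tendsto:
  assumes x0: "norm x0 = 1/2" and x: "x \<in> annulus" and \<delta>: "\<delta> \<longlonglongrightarrow> 0"
  shows "(\<lambda>n. Jd x0 \<beta> rho (\<delta> n) x) \<longlonglongrightarrow> Jd x0 \<beta> rho 0 x"
proof -
  have y0: "(x - x0) \<bullet> (x - x0) + 0 ~= 0" using x x0 by (auto simp: annulus_def)
  show ?thesis unfolding Jd_def by (intro tendsto_intros \<delta> y0)
qed

lemma dilation_lipschitz:
  fixes f :: "real^2 => real"
  assumes d: "!!s. s \<in> {9/10..11/10} ==> ((\<lambda>s. f (s *\<^sub>R x)) has_real_derivative f' s) (at s)"
    and B: "!!s. s \<in> {9/10..11/10} ==> \<bar>f' s\<bar> <= B"
  shows "\<bar>f (dil rho n *\<^sub>R x) - f x\<bar> <= B * \<bar>dil rho n - 1\<bar>"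
proof -
  have "norm (f (dil rho n *\<^sub>R x) - f (1 *\<^sub>R x)) <= B * norm (dil rho n - 1)"
  proof (rule field_differentiable_bound[where S = "{9/10..11/10}"])
    fix s :: real assume s: "s \<in> {9/10..11/10}"
    show "((\<lambda>s. f (s *\<^sub>R x)) has_field_derivative f' s) (at s within {9/10..11/10})"
      by (rule has_field_derivative_at_within[OF d[OF s]])
    show "norm (f' s) <= B" using B[OF s] by simp
  qed (use dil_facts(1,2)[of rho n] in auto)
  then show ?thesis by simp
qed

text \<open>\<open>radial_integration_by_parts\<close> for the product of regularised weight,
  exponential and \<open>hh\<close>. The Lipschitz constants along dilations depend on
  \<open>\<delta>\<close> and on the bound of \<open>P\<close>; they are required as hypotheses but
  do not show in the conclusion.\<close>

lemma exp_radial_inequality_aux: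
  fixes V P LP :: "real^2 => real"
  assumes rho: "side rho" and x0: "norm x0 = 1/2" and \<delta>: "0 < \<delta>" "\<delta> <= 1"
    and V: "L-lipschitz_on annulus V" "has_weak_gradient annulus V G" "Linfty_norm annulus G <= ereal A"
    and VB: "!!x. x \<in> annulus ==> \<bar>V x\<bar> <= VB"
    and Pm: "P \<in> borel_measurable borel"
    and PB: "!!x. norm x <= 2 ==> \<bar>P x\<bar> <= PB" "!!x. norm x <= 2 ==> \<bar>LP x\<bar> <= PB"
    and dP: "!!x s. x \<in> annulus ==> s \<in> {9/10..11/10} ==>
        ((\<lambda>s. P (s *\<^sub>R x)) has_real_derivative LP (s *\<^sub>R x) / s) (at s)"
  shows "\<bar>LINT x|Om. V x * (dweight x0 \<beta> \<delta> x * exp (P x) * (Jd x0 \<beta> rho \<delta> x + hh rho x * LP x))\<bar>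
      <= A * (LINT x|Om. norm x * \<bar>dweight x0 \<beta> \<delta> x * exp (P x) * hh rho x\<bar>)"
proof -
  define M where "M = \<delta> powr \<beta> + 8 powr \<beta>"
  define E where "E = exp PB"
  define w where "w x = dweight x0 \<beta> \<delta> x * exp (P x) * hh rho x" for x
  define Lw where "Lw x = dweight x0 \<beta> \<delta> x * exp (P x) * (ell (x \<bullet> x / rho)
    + 2 * \<beta> * hh rho x * (x \<bullet> (x - x0)) / ((x - x0) \<bullet> (x - x0) + \<delta>) + hh rho x * LP x)" for x
  have PB0: "PB >= 0" using PB(1)[of 0] by simp
  have M0: "M >= 0" by (simp add: M_def)
  have mB: "0 <= dweight x0 \<beta> \<delta> x" "dweight x0 \<beta> \<delta> x <= M" if "norm x <= 2" for x
    using dweight_dilation(2)[OF x0 \<delta> that] by (auto simp: M_def)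
  have eB: "\<bar>exp (P x)\<bar> <= E" if "norm x <= 2" for x using PB(1)[OF that] by (simp add: E_def)
  have n2: "norm (s *\<^sub>R x) <= 2" if "x \<in> annulus" "s \<in> {9/10..11/10}" for x and s :: real
  proof -
    have "s * norm x <= 2 * 1" using that annulus_norm(1)[OF that(1)] by (intro mult_mono) auto
    then show ?thesis using that by simp
  qed
  have n2': "norm (dil rho n *\<^sub>R x) <= 2" if "x \<in> annulus" for x n
    using n2[OF that, of "dil rho n"] dil_facts(1,2)[of rho n] by simp
  have n1: "norm x <= 2" if "x \<in> annulus" for x using annulus_norm(1)[OF that] by simp
  have de: "((\<lambda>s. exp (P (s *\<^sub>R x))) has_real_derivative exp (P (s *\<^sub>R x)) * (LP (s *\<^sub>R x) / s)) (at s)"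
    if "x \<in> annulus" "s \<in> {9/10..11/10}" for x s
    by (rule DERIV_chain2[OF DERIV_exp dP[OF that]])
  have eL: "\<bar>exp (P (dil rho n *\<^sub>R x)) - exp (P x)\<bar> <= (E * (2 * PB)) * \<bar>dil rho n - 1\<bar>" if x: "x \<in> annulus" for x n
  proof (rule dilation_lipschitz[OF de[OF x]])
    fix s :: real assume s: "s \<in> {9/10..11/10}"
    have "\<bar>LP (s *\<^sub>R x) / s\<bar> <= 2 * PB"
    proof -
      have "PB * 1 <= PB * (2 * s)" using s PB0 by (intro mult_left_mono) auto
      then have "\<bar>LP (s *\<^sub>R x)\<bar> <= 2 * PB * s" using PB(2)[OF n2[OF x s]] by simp
      then show ?thesis using s by (simp add: abs_divide pos_divide_le_eq)
    qed
    then show "\<bar>exp (P (s *\<^sub>R x)) * (LP (s *\<^sub>R x) / s)\<bar> <= E * (2 * PB)"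
      unfolding abs_mult by (intro mult_mono eB n2[OF x s]) (auto simp: E_def)
  qed
  define K1 where "K1 = M * (2 * \<bar>\<beta>\<bar> * (1 * 4) / \<delta>)"
  have K1: "K1 >= 0" using M0 \<delta> by (simp add: K1_def)
  have mL: "\<bar>dweight x0 \<beta> \<delta> (dil rho n *\<^sub>R x) - dweight x0 \<beta> \<delta> x\<bar> <= K1 * \<bar>dil rho n - 1\<bar>" if x: "x \<in> annulus" for x n
  proof (rule dilation_lipschitz[OF dweight_dilation(1)[OF x0 \<delta>]])
    fix s :: real assume s: "s \<in> {9/10..11/10}"
    let ?y = "s *\<^sub>R x - x0"
    have "norm ?y <= 4" using norm_triangle_ineq4[of "s *\<^sub>R x" x0] n2[OF x s] x0 by linarith
    then have "norm x * norm ?y <= 1 * 4" using annulus_norm(1)[OF x] by (intro mult_mono) auto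
    then have xy: "\<bar>x \<bullet> ?y\<bar> <= 1 * 4" by (rule order.trans[OF Cauchy_Schwarz_ineq2])
    have "\<bar>2 * \<beta> * (x \<bullet> ?y)\<bar> <= 2 * \<bar>\<beta>\<bar> * (1 * 4)"
      unfolding abs_mult using xy by (intro mult_mono) auto
    then have "\<bar>2 * \<beta> * (x \<bullet> ?y) / (?y \<bullet> ?y + \<delta>)\<bar> <= 2 * \<bar>\<beta>\<bar> * (1 * 4) / \<delta>"
      unfolding abs_divide using \<delta> by (intro frac_le) (auto simp: abs_of_pos add_nonneg_pos)
    then show "\<bar>dweight x0 \<beta> \<delta> (s *\<^sub>R x) * (2 * \<beta> * (x \<bullet> ?y) / (?y \<bullet> ?y + \<delta>))\<bar> <= K1"
      unfolding abs_mult[of "dweight x0 \<beta> \<delta> (s *\<^sub>R x)"] K1_def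
      using mB[OF n2[OF x s]] M0 by (intro mult_mono) auto
  qed
  have "\<bar>LINT x|Om. V x * (2 * w x + Lw x)\<bar> <= A * (LINT x|Om. norm x * \<bar>w x\<bar>)"
  proof (rule radial_integration_by_parts(1)[OF rho V VB])
    show "w \<in> borel_measurable borel" unfolding w_def[abs_def] using Pm by measurable
    show "w x = 0" if "x \<notin> near rho" for x
      using hh_outside_near[OF side_facts(1)[OF rho] that] by (simp add: w_def)
    show "\<bar>w x\<bar> <= M * E * 1" for x
    proof (cases "x \<in> near rho")
      case True
      have x2: "norm x <= 2" by (rule n1[OF near_facts(1)[OF rho True]])
      show ?thesis unfolding w_def abs_mult using mB[OF x2] eB[OF x2] hh_abs_le(1)[OF rho, of x] M0
        by (intro mult_mono) (auto simp: E_def)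
    next
      case False
      then show ?thesis using hh_outside_near[OF side_facts(1)[OF rho] False] M0 by (simp add: w_def E_def)
    qed
    show "((\<lambda>t. w (t *\<^sub>R x)) has_real_derivative Lw x) (at 1)" if x: "x \<in> annulus" for x
    proof -
      have d1: "((\<lambda>t. dweight x0 \<beta> \<delta> (t *\<^sub>R x)) has_real_derivative
          dweight x0 \<beta> \<delta> x * (2 * \<beta> * (x \<bullet> (x - x0)) / ((x - x0) \<bullet> (x - x0) + \<delta>))) (at 1)"
        using dweight_dilation(1)[OF x0 \<delta>, of \<beta> x 1] by simp
      have d2: "((\<lambda>t. exp (P (t *\<^sub>R x))) has_real_derivative exp (P x) * LP x) (at 1)"
        using de[OF x, of 1] by simp
      have "((\<lambda>t. dweight x0 \<beta> \<delta> (t *\<^sub>R x) * exp (P (t *\<^sub>R x)) * hh rho (t *\<^sub>R x)) has_real_derivative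
        ((dweight x0 \<beta> \<delta> x * (2 * \<beta> * (x \<bullet> (x - x0)) / ((x - x0) \<bullet> (x - x0) + \<delta>))) * exp (P x)
          + (exp (P x) * LP x) * dweight x0 \<beta> \<delta> x) * hh rho x
          + ell (x \<bullet> x / rho) * (dweight x0 \<beta> \<delta> x * exp (P x))) (at 1)"
        using DERIV_mult[OF DERIV_mult[OF d1 d2] hh_dilation(1)[OF rho x]] by (simp only: scaleR_one)
      moreover have "((m * (2 * b * c / z)) * e + (e * l) * m) * h + el * (m * e) = m * e * (el + 2 * b * h * c / z + h * l)"
        for m b c z e l h el :: real
        by (simp add: algebra_simps)
      note this[of "dweight x0 \<beta> \<delta> x" \<beta> "x \<bullet> (x - x0)" "(x - x0) \<bullet> (x - x0) + \<delta>" "exp (P x)" "LP x" "hh rho x" "ell (x \<bullet> x / rho)"]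
      ultimately show ?thesis unfolding w_def[abs_def] Lw_def by (simp only:)
    qed
    show "\<bar>w (dil rho n *\<^sub>R x) - w x\<bar> <= ((M * E) * 10 + (M * (E * (2 * PB)) + K1 * E) * 1) * \<bar>dil rho n - 1\<bar>"
      if x: "x \<in> annulus" for x n
      unfolding w_def
    proof (rule product_difference_bound)
      show "\<bar>dweight x0 \<beta> \<delta> (dil rho n *\<^sub>R x) * exp (P (dil rho n *\<^sub>R x)) - dweight x0 \<beta> \<delta> x * exp (P x)\<bar>
        <= (M * (E * (2 * PB)) + K1 * E) * \<bar>dil rho n - 1\<bar>"
        using mB[OF n2'[OF x]] PB0 K1
        by (intro product_difference_bound mL[OF x] eL[OF x] eB n1[OF x]) (auto simp: E_def)
      show "\<bar>hh rho (dil rho n *\<^sub>R x) - hh rho x\<bar> <= 10 * \<bar>dil rho n - 1\<bar>" by (rule hh_dilation(2)[OF rho x])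
      show "\<bar>dweight x0 \<beta> \<delta> (dil rho n *\<^sub>R x) * exp (P (dil rho n *\<^sub>R x))\<bar> <= M * E"
        unfolding abs_mult using mB[OF n2'[OF x]] eB[OF n2'[OF x]] M0 by (intro mult_mono) auto
      show "\<bar>hh rho x\<bar> <= 1" by (rule hh_abs_le(1)[OF rho])
      show "0 <= M * (E * (2 * PB)) + K1 * E" using M0 PB0 K1 by (simp add: E_def)
    qed auto
  qed
  moreover have "2 * w x + Lw x = dweight x0 \<beta> \<delta> x * exp (P x) * (Jd x0 \<beta> rho \<delta> x + hh rho x * LP x)" for x
    unfolding w_def Lw_def Jd_def by (simp add: algebra_simps)
  ultimately show ?thesis by (simp add: w_def)
qed

text \<open>As \<open>\<delta>\<close> tends to 0, dominated convergence applies because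
  \<open>Jd\<close> is bounded uniformly in \<open>\<delta>\<close> and the weights lie below the
  integrable \<open>D\<close>. Of the absolute value in the auxiliary inequality, the direction that
  bounds the energy from above is kept.\<close>

lemma exp_radial_inequality:
  fixes V P LP :: "real^2 => real"
  assumes rho: "side rho" and x0: "norm x0 = 1/2" and \<beta>: "\<beta> > -1/2"
    and V: "L-lipschitz_on annulus V" "has_weak_gradient annulus V G" "Linfty_norm annulus G <= ereal A"
    and VB: "!!x. x \<in> annulus ==> \<bar>V x\<bar> <= VB"
    and Pm: "P \<in> borel_measurable borel" "LP \<in> borel_measurable borel"
    and PB: "!!x. norm x <= 2 ==> \<bar>P x\<bar> <= PB" "!!x. norm x <= 2 ==> \<bar>LP x\<bar> <= PB"
    and dP: "!!x s. x \<in> annulus ==> s \<in> {9/10..11/10} ==>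
        ((\<lambda>s. P (s *\<^sub>R x)) has_real_derivative LP (s *\<^sub>R x) / s) (at s)"
  shows "(LINT x|Om. V x * weight x0 \<beta> x * exp (P x) * hh rho x * LP x)
      <= - (LINT x|Om. weight x0 \<beta> x * (V x * Jd x0 \<beta> rho 0 x - A * norm x * \<bar>hh rho x\<bar>) * exp (P x))"
    "integrable Om (\<lambda>x. V x * weight x0 \<beta> x * exp (P x) * hh rho x * LP x)"
    "integrable Om (\<lambda>x. weight x0 \<beta> x * (V x * Jd x0 \<beta> rho 0 x - A * norm x * \<bar>hh rho x\<bar>) * exp (P x))"
proof -
  have sp: "space Om = annulus" by simp
  define E where "E = exp PB"
  define \<delta> where "\<delta> n = 1 / real (Suc n)" for n
  have \<delta>: "0 < \<delta> n" "\<delta> n <= 1" for n by (auto simp: \<delta>_def)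
  have \<delta>0: "\<delta> \<longlonglongrightarrow> 0" unfolding \<delta>_def[abs_def] using LIMSEQ_inverse_real_of_nat by (simp add: inverse_eq_divide)
  have Vm: "V \<in> borel_measurable Om"
    by (intro continuous_on_measurable_lebesgue_on annulus_facts lipschitz_on_continuous_on[OF V(1)])
  note [measurable] = Pm borel_measurable_lebesgue_on[OF Pm(1), of annulus] borel_measurable_lebesgue_on[OF Pm(2), of annulus] Vm
  have n1: "norm x <= 2" if "x \<in> annulus" for x using annulus_norm(1)[OF that] by simp
  have eB: "\<bar>exp (P x)\<bar> <= E" if "x \<in> annulus" for x using PB(1)[OF n1[OF that]] by (simp add: E_def)
  have PB0: "PB >= 0" using PB(1)[of 0] by simp
  have E0: "E > 0" by (simp add: E_def)
  define D where "D x = weight x0 \<beta> x + 8 powr \<beta>" for x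
  have Di: "integrable Om (\<lambda>x. D x * c)" for c
    unfolding D_def by (intro integrable_mult_left Bochner_Integration.integrable_add weight_integrable[OF x0 \<beta>]) simp
  have D0: "0 <= D x" for x by (simp add: D_def weight_nonneg)
  have dD: "\<bar>dweight x0 \<beta> (\<delta> n) x\<bar> <= D x" if "x \<in> annulus" for n x
    using dweight_le[OF x0 \<delta>[of n] that, of \<beta>] by (simp add: D_def dweight_def)
  have wD: "\<bar>weight x0 \<beta> x\<bar> <= D x" for x by (simp add: D_def weight_nonneg)
  define Q where "Q \<delta> x = Jd x0 \<beta> rho \<delta> x + hh rho x * LP x" for \<delta> x
  define QB where "QB = 11 + 12 * \<bar>\<beta>\<bar> + 1 * PB"
  have hLP: "\<bar>hh rho x * LP x\<bar> <= 1 * PB" if "x \<in> annulus" for x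
    unfolding abs_mult using hh_abs_le(1)[OF rho, of x] PB(2)[OF n1[OF that]] by (intro mult_mono) auto
  have QB: "\<bar>Q d x\<bar> <= QB" if "x \<in> annulus" "d >= 0" for x d
    using Jd_abs_le[OF rho x0 that, of \<beta>] hLP[OF that(1)] unfolding Q_def QB_def by linarith
  have QB0: "QB >= 0" using PB0 by (simp add: QB_def)
  have VB0: "VB >= 0" if "x \<in> annulus" for x using VB[OF that] by simp
  have b1: "norm (V x * (m * exp (P x) * q)) <= D x * (VB * (E * QB))"
    if x: "x \<in> annulus" and m: "\<bar>m\<bar> <= D x" and q: "\<bar>q\<bar> <= QB" for x m q
  proof -
    have "\<bar>V x\<bar> * (\<bar>m\<bar> * \<bar>exp (P x)\<bar> * \<bar>q\<bar>) <= VB * ((D x * E) * QB)"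
      by (rule mult_mono[OF VB[OF x] mult_mono[OF mult_mono[OF m eB[OF x]] q]])
        (use E0 D0 QB0 VB0[OF x] in auto)
    then show ?thesis by (simp add: abs_mult mult_ac)
  qed
  have lim1: "(\<lambda>n. LINT x|Om. V x * (dweight x0 \<beta> (\<delta> n) x * exp (P x) * Q (\<delta> n) x))
      \<longlonglongrightarrow> (LINT x|Om. V x * (weight x0 \<beta> x * exp (P x) * Q 0 x))"
    and int1: "integrable Om (\<lambda>x. V x * (weight x0 \<beta> x * exp (P x) * Q 0 x))"
  proof -
    have meas: "(\<lambda>x. V x * (weight x0 \<beta> x * exp (P x) * Q 0 x)) \<in> borel_measurable Om"
      "(\<lambda>x. V x * (dweight x0 \<beta> (\<delta> n) x * exp (P x) * Q (\<delta> n) x)) \<in> borel_measurable Om" for n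
      unfolding Q_def by measurable
    have conv: "AE x in Om. (\<lambda>n. V x * (dweight x0 \<beta> (\<delta> n) x * exp (P x) * Q (\<delta> n) x))
        \<longlonglongrightarrow> V x * (weight x0 \<beta> x * exp (P x) * Q 0 x)"
      unfolding Q_def sp
      by (intro AE_I2 tendsto_intros dweight_tendsto[OF x0 _ \<delta>0] Jd_tendsto[OF x0 _ \<delta>0]) simp_all
    have bd: "AE x in Om. norm (V x * (dweight x0 \<beta> (\<delta> n) x * exp (P x) * Q (\<delta> n) x)) <= D x * (VB * (E * QB))" for n
      using \<delta>[of n] by (intro AE_I2 b1 dD QB) auto
    show "(\<lambda>n. LINT x|Om. V x * (dweight x0 \<beta> (\<delta> n) x * exp (P x) * Q (\<delta> n) x))
      \<longlonglongrightarrow> (LINT x|Om. V x * (weight x0 \<beta> x * exp (P x) * Q 0 x))"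
      by (rule integral_dominated_convergence[OF meas Di conv bd])
    show "integrable Om (\<lambda>x. V x * (weight x0 \<beta> x * exp (P x) * Q 0 x))"
      by (rule integrable_dominated_convergence[OF meas Di conv bd])
  qed
  have lim2: "(\<lambda>n. LINT x|Om. norm x * \<bar>dweight x0 \<beta> (\<delta> n) x * exp (P x) * hh rho x\<bar>)
      \<longlonglongrightarrow> (LINT x|Om. norm x * \<bar>weight x0 \<beta> x * exp (P x) * hh rho x\<bar>)"
    and int2: "integrable Om (\<lambda>x. norm x * \<bar>weight x0 \<beta> x * exp (P x) * hh rho x\<bar>)"
  proof -
    have meas: "(\<lambda>x. norm x * \<bar>weight x0 \<beta> x * exp (P x) * hh rho x\<bar>) \<in> borel_measurable Om"
      "(\<lambda>x. norm x * \<bar>dweight x0 \<beta> (\<delta> n) x * exp (P x) * hh rho x\<bar>) \<in> borel_measurable Om" for n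
      by (measurable; measurable)+
    have conv: "AE x in Om. (\<lambda>n. norm x * \<bar>dweight x0 \<beta> (\<delta> n) x * exp (P x) * hh rho x\<bar>)
        \<longlonglongrightarrow> norm x * \<bar>weight x0 \<beta> x * exp (P x) * hh rho x\<bar>"
      by (intro AE_I2 tendsto_intros dweight_tendsto[OF x0 _ \<delta>0]) simp_all
    have bd: "AE x in Om. norm (norm x * \<bar>dweight x0 \<beta> (\<delta> n) x * exp (P x) * hh rho x\<bar>) <= D x * E" for n
    proof (rule AE_I2)
      fix x assume "x \<in> space Om"
      then have x: "x \<in> annulus" by simp
      have "norm x * (\<bar>dweight x0 \<beta> (\<delta> n) x\<bar> * \<bar>exp (P x)\<bar> * \<bar>hh rho x\<bar>) <= 1 * ((D x * E) * 1)"
        by (rule mult_mono[OF _ mult_mono[OF mult_mono[OF dD[OF x] eB[OF x]] hh_abs_le(1)[OF rho]]])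
          (use E0 D0[of x] annulus_norm(1)[OF x] in auto)
      then show "norm (norm x * \<bar>dweight x0 \<beta> (\<delta> n) x * exp (P x) * hh rho x\<bar>) <= D x * E"
        by (simp add: abs_mult)
    qed
    show "(\<lambda>n. LINT x|Om. norm x * \<bar>dweight x0 \<beta> (\<delta> n) x * exp (P x) * hh rho x\<bar>)
      \<longlonglongrightarrow> (LINT x|Om. norm x * \<bar>weight x0 \<beta> x * exp (P x) * hh rho x\<bar>)"
      by (rule integral_dominated_convergence[OF meas Di conv bd])
    show "integrable Om (\<lambda>x. norm x * \<bar>weight x0 \<beta> x * exp (P x) * hh rho x\<bar>)"
      by (rule integrable_dominated_convergence[OF meas Di conv bd])
  qed
  have main: "\<bar>LINT x|Om. V x * (weight x0 \<beta> x * exp (P x) * Q 0 x)\<bar>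
      <= A * (LINT x|Om. norm x * \<bar>weight x0 \<beta> x * exp (P x) * hh rho x\<bar>)"
    using exp_radial_inequality_aux[OF rho x0 \<delta> V VB Pm(1) PB dP]
    by (intro LIMSEQ_le[OF tendsto_rabs[OF lim1] tendsto_mult_left[OF lim2]]) (auto simp: Q_def)
  have int3: "integrable Om (\<lambda>x. V x * (weight x0 \<beta> x * exp (P x) * (hh rho x * LP x)))"
  proof (rule Bochner_Integration.integrable_bound[OF Di])
    show "AE x in Om. norm (V x * (weight x0 \<beta> x * exp (P x) * (hh rho x * LP x))) <= norm (D x * (VB * (E * QB)))"
    proof (rule AE_I2)
      fix x assume "x \<in> space Om"
      then have x: "x \<in> annulus" by simp
      have "norm (V x * (weight x0 \<beta> x * exp (P x) * (hh rho x * LP x))) <= D x * (VB * (E * QB))"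
        using hLP[OF x] by (intro b1[OF x wD]) (simp add: QB_def)
      then show "norm (V x * (weight x0 \<beta> x * exp (P x) * (hh rho x * LP x))) <= norm (D x * (VB * (E * QB)))" by simp
    qed
  qed measurable
  show i3: "integrable Om (\<lambda>x. V x * weight x0 \<beta> x * exp (P x) * hh rho x * LP x)"
    using int3 by (simp add: mult_ac)
  have eq: "weight x0 \<beta> x * (V x * Jd x0 \<beta> rho 0 x - A * norm x * \<bar>hh rho x\<bar>) * exp (P x)
    = V x * (weight x0 \<beta> x * exp (P x) * Q 0 x) - V x * weight x0 \<beta> x * exp (P x) * hh rho x * LP x
      - A * (norm x * \<bar>weight x0 \<beta> x * exp (P x) * hh rho x\<bar>)" for x
    unfolding Q_def abs_mult abs_exp_cancel abs_of_nonneg[OF weight_nonneg] by (simp add: algebra_simps)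
  show "integrable Om (\<lambda>x. weight x0 \<beta> x * (V x * Jd x0 \<beta> rho 0 x - A * norm x * \<bar>hh rho x\<bar>) * exp (P x))"
    unfolding eq by (intro Bochner_Integration.integrable_diff int1 i3 integrable_mult_right int2)
  have "(LINT x|Om. weight x0 \<beta> x * (V x * Jd x0 \<beta> rho 0 x - A * norm x * \<bar>hh rho x\<bar>) * exp (P x))
    = (LINT x|Om. V x * (weight x0 \<beta> x * exp (P x) * Q 0 x)) - (LINT x|Om. V x * weight x0 \<beta> x * exp (P x) * hh rho x * LP x)
      - A * (LINT x|Om. norm x * \<bar>weight x0 \<beta> x * exp (P x) * hh rho x\<bar>)"
    unfolding eq by (simp only: Bochner_Integration.integral_diff Bochner_Integration.integrable_diff
        int1 i3 integrable_mult_right int2 integral_mult_right_zero)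
  then show "(LINT x|Om. V x * weight x0 \<beta> x * exp (P x) * hh rho x * LP x)
      <= - (LINT x|Om. weight x0 \<beta> x * (V x * Jd x0 \<beta> rho 0 x - A * norm x * \<bar>hh rho x\<bar>) * exp (P x))"
    using main by linarith
qed

section \<open>The regularised potentials and their convergence\<close>

lemma kLR_continuous:
  assumes "rho > 0" "eps > 0"
  shows "continuous_on UNIV (\<lambda>p. kLR rho eps (fst p) (snd p))"
proof -
  have nz: "kP rho (fst p) (snd p) + eps ~= 0" "kQ (fst p) (snd p) + eps ~= 0" for p :: "(real^2) \<times> (real^2)"
    using kP_nonneg[OF assms(1), of "fst p" "snd p"] kQ_nonneg[of "fst p" "snd p"] assms(2) by linarith+
  have c: "continuous_on UNIV (\<lambda>p::(real^2) \<times> (real^2). cutoff1 (snd p \<bullet> snd p / rho))"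
    "continuous_on UNIV (\<lambda>p::(real^2) \<times> (real^2). cutoff2 (snd p \<bullet> snd p / rho))"
    using assms by (auto intro!: continuous_on_compose2[OF cutoff_derivatives(4)] continuous_on_compose2[OF cutoff_derivatives(5)] continuous_intros)
  have k: "continuous_on UNIV (\<lambda>p::(real^2) \<times> (real^2). kP rho (fst p) (snd p))"
    "continuous_on UNIV (\<lambda>p::(real^2) \<times> (real^2). kQ (fst p) (snd p))"
    unfolding kP_def kQ_def using assms by (auto intro!: continuous_intros)
  show ?thesis
    unfolding kLR_def using assms nz by (intro continuous_intros c k kernel_continuous(2) ballI) auto
qed

lemma continuous_kernel_bound:
  fixes K :: "real^2 => real^2 => real"
  assumes "continuous_on UNIV (\<lambda>p. K (fst p) (snd p))"
  obtains B where "B >= 0" "!!x z. norm x <= 2 ==> z \<in> annulus ==> \<bar>K x z\<bar> <= B"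
proof -
  have "compact (cball (0::real^2) 2 \<times> closure annulus)" by (intro compact_Times compact_cball) (simp add: annulus_facts(2))
  from compact_continuous_image[OF continuous_on_subset[OF assms subset_UNIV] this]
  obtain B where B: "!!p. p \<in> cball 0 2 \<times> closure annulus ==> \<bar>K (fst p) (snd p)\<bar> <= B"
    using compact_imp_bounded[THEN bounded_iff[THEN iffD1]] by fastforce
  show ?thesis
  proof (rule that[of "\<bar>B\<bar>"])
    fix x z :: "real^2" assume "norm x <= 2" "z \<in> annulus"
    then show "\<bar>K x z\<bar> <= \<bar>B\<bar>" using B[of "(x, z)"] closure_subset[of annulus] by fastforce
  qed simp
qed

text \<open>Dilated points may leave the annulus, so the potentials are treated as Borel functions
  on the plane with bounds up to norm 2. Their radial derivative is obtained under the integral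
  sign.\<close>

lemma continuous_kernel_potential:
  fixes K LK :: "real^2 => real^2 => real"
  assumes w: "integrable Om w"
    and K: "continuous_on UNIV (\<lambda>p. K (fst p) (snd p))"
  shows "(\<lambda>x. LINT z|Om. w z * K x z) \<in> borel_measurable borel"
    "\<exists>B. \<forall>x. norm x <= 2 --> \<bar>LINT z|Om. w z * K x z\<bar> <= B"
    "integrable Om (\<lambda>z. w z * K x z)"
    "continuous_on UNIV (\<lambda>p. LK (fst p) (snd p)) ==>
      (!!t x z. t > 0 ==> ((\<lambda>t. K (t *\<^sub>R x) z) has_real_derivative LK (t *\<^sub>R x) z / t) (at t)) ==>
      x \<in> annulus ==> s \<in> {9/10..11/10} ==>
      ((\<lambda>s. LINT z|Om. w z * K (s *\<^sub>R x) z) has_real_derivative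
        (LINT z|Om. w z * LK (s *\<^sub>R x) z) / s) (at s)"
proof -
  have [measurable]: "w \<in> borel_measurable Om" using w by simp
  show int: "integrable Om (\<lambda>z. w z * K x z)" for x
    by (rule bounded_kernel_integrable[OF w continuous_on_section[OF K]])
  show "(\<lambda>x. LINT z|Om. w z * K x z) \<in> borel_measurable borel"
  proof (rule Om.borel_measurable_lebesgue_integral)
    have 1: "(\<lambda>p. K (fst p) (snd p)) \<in> borel_measurable (borel \<Otimes>\<^sub>M borel)"
      unfolding borel_prod by (rule borel_measurable_continuous_onI[OF K])
    have 2: "(\<lambda>x. x) \<in> Om \<rightarrow>\<^sub>M borel" by (rule borel_measurable_lebesgue_on) simp
    have "(\<lambda>p. (fst p, snd p)) \<in> borel \<Otimes>\<^sub>M Om \<rightarrow>\<^sub>M borel \<Otimes>\<^sub>M borel"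
      by (intro measurable_Pair measurable_fst measurable_compose[OF measurable_snd 2])
    from measurable_compose[OF this 1]
    have [measurable]: "(\<lambda>p. K (fst p) (snd p)) \<in> borel_measurable (borel \<Otimes>\<^sub>M Om)" by simp
    show "(\<lambda>(x, z). w z * K x z) \<in> borel_measurable (borel \<Otimes>\<^sub>M Om)"
      unfolding split_def by measurable
  qed
  obtain B where B: "B >= 0" "!!x z. norm x <= 2 ==> z \<in> annulus ==> \<bar>K x z\<bar> <= B"
    using continuous_kernel_bound[OF K] by blast
  have "\<bar>LINT z|Om. w z * K x z\<bar> <= (LINT z|Om. \<bar>w z\<bar> * B)" if "norm x <= 2" for x
  proof (rule integral_abs_bound_integral[OF int])
    show "\<bar>w z * K x z\<bar> <= \<bar>w z\<bar> * B" if "z \<in> space Om" for z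
      unfolding abs_mult using B(2)[OF \<open>norm x <= 2\<close>, of z] that by (intro mult_left_mono) auto
  qed (use w in simp)
  then show "\<exists>B. \<forall>x. norm x <= 2 --> \<bar>LINT z|Om. w z * K x z\<bar> <= B" by blast
  assume LK: "continuous_on UNIV (\<lambda>p. LK (fst p) (snd p))"
    and d: "!!t x z. t > 0 ==> ((\<lambda>t. K (t *\<^sub>R x) z) has_real_derivative LK (t *\<^sub>R x) z / t) (at t)"
    and x: "x \<in> annulus" and s: "s \<in> {9/10..11/10}"
  obtain B where B: "B >= 0" "!!x z. norm x <= 2 ==> z \<in> annulus ==> \<bar>LK x z\<bar> <= B"
    using continuous_kernel_bound[OF LK] by blast
  have "((\<lambda>s. LINT z|Om. w z * K (s *\<^sub>R x) z) has_real_derivative (LINT z|Om. w z * (LK (s *\<^sub>R x) z / s))) (at s)"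
  \<comment> \<open>The wider interval makes the ends of \<open>{9/10..11/10}\<close> interior, and
    the dilated points still have norm at most \<open>3/2\<close>.\<close>
  proof (rule DERIV_integral(1)[where a = "1/2" and b = "3/2" and B = "\<lambda>z. \<bar>w z\<bar> * (2 * B)"])
    fix s :: real assume s: "1/2 < s" "s < 3/2"
    show "integrable Om (\<lambda>z. w z * K (s *\<^sub>R x) z)" by (rule int)
    fix z assume z: "z \<in> space Om"
    have sp: "s > 0" using s by simp
    show "((\<lambda>s. w z * K (s *\<^sub>R x) z) has_real_derivative w z * (LK (s *\<^sub>R x) z / s)) (at s)"
      by (rule DERIV_cmult[OF d[OF sp]])
    have "s * norm x <= (3/2) * 1" using s annulus_norm(1)[OF x] by (intro mult_mono) auto
    then have "norm (s *\<^sub>R x) <= 2" using s by simp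
    then have b: "\<bar>LK (s *\<^sub>R x) z\<bar> <= B" using B(2) z by simp
    also have "\<dots> <= 2 * B * s" using mult_left_mono[of 1 "2 * s" B] B(1) s by simp
    finally have "\<bar>LK (s *\<^sub>R x) z / s\<bar> <= 2 * B" using s by (simp add: abs_divide pos_divide_le_eq)
    then show "\<bar>w z * (LK (s *\<^sub>R x) z / s)\<bar> <= \<bar>w z\<bar> * (2 * B)"
      unfolding abs_mult by (intro mult_left_mono) auto
  qed (use s w in auto)
  then show "((\<lambda>s. LINT z|Om. w z * K (s *\<^sub>R x) z) has_real_derivative (LINT z|Om. w z * LK (s *\<^sub>R x) z) / s) (at s)"
    by simp
qed

text \<open>The Green potential of \<open>f\<close> with cutoff, corrected by the cutoff error and
  divided by the mass \<open>kappa\<close>. If \<open>u\<close> solves the equation with right-hand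
  side \<open>f\<close>, then by \<open>kernel_identity\<close> this is
  \<open>smear rho eps u x / kappa\<close>, a smoothing of \<open>u\<close> itself.\<close>

definition pot :: "real => real => (real^2 => real) => (real^2 => real) => real^2 => real" where
  "pot rho eps f u x = ((LINT z|Om. f z * (chi rho z * kG rho eps x z))
     + (LINT z|Om. u z * kR rho eps x z)) / kappa"

text \<open>The derivative of \<open>pot\<close> along the field \<open>x\<close>; the cutoff
  factors depend on \<open>z\<close> and are not differentiated.\<close>

definition Lpot :: "real => real => (real^2 => real) => (real^2 => real) => real^2 => real" where
  "Lpot rho eps f u x = ((LINT z|Om. f z * (chi rho z * kLG rho eps x z))
     + (LINT z|Om. u z * kLR rho eps x z)) / kappa"

lemma pot_facts:
  assumes rho: "side rho" and eps: "eps > 0"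
    and f: "integrable Om f" and u: "integrable Om u"
  shows "pot rho eps f u \<in> borel_measurable borel" "Lpot rho eps f u \<in> borel_measurable borel"
    "\<exists>B. (\<forall>x. norm x <= 2 --> \<bar>pot rho eps f u x\<bar> <= B) \<and> (\<forall>x. norm x <= 2 --> \<bar>Lpot rho eps f u x\<bar> <= B)"
    "x \<in> annulus ==> s \<in> {9/10..11/10} ==>
      ((\<lambda>s. pot rho eps f u (s *\<^sub>R x)) has_real_derivative Lpot rho eps f u (s *\<^sub>R x) / s) (at s)"
proof -
  note r = side_facts[OF rho]
  have k1: "continuous_on UNIV (\<lambda>p. chi rho (snd p) * kG rho eps (fst p) (snd p :: real^2))"
    and k2: "continuous_on UNIV (\<lambda>p. chi rho (snd p) * kLG rho eps (fst p) (snd p :: real^2))"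
    by (intro continuous_intros kernel_continuous(1,2,6)[OF r(1) eps])+
  note k3 = kernel_continuous(5)[OF r(1) eps] and k4 = kLR_continuous[OF r(1) eps]
  note p1 = continuous_kernel_potential[OF f, of "\<lambda>x z. chi rho z * kG rho eps x z", OF k1]
    and p2 = continuous_kernel_potential[OF f, of "\<lambda>x z. chi rho z * kLG rho eps x z", OF k2]
    and p3 = continuous_kernel_potential[OF u, of "kR rho eps", OF k3]
    and p4 = continuous_kernel_potential[OF u, of "kLR rho eps", OF k4]
  note [measurable] = p1(1) p2(1) p3(1) p4(1)
  show "pot rho eps f u \<in> borel_measurable borel" unfolding pot_def[abs_def] by measurable
  show "Lpot rho eps f u \<in> borel_measurable borel" unfolding Lpot_def[abs_def] by measurable
  obtain B1 B2 B3 B4 where B: "!!x. norm x <= 2 ==> \<bar>LINT z|Om. f z * (chi rho z * kG rho eps x z)\<bar> <= B1"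
    "!!x. norm x <= 2 ==> \<bar>LINT z|Om. f z * (chi rho z * kLG rho eps x z)\<bar> <= B2"
    "!!x. norm x <= 2 ==> \<bar>LINT z|Om. u z * kR rho eps x z\<bar> <= B3"
    "!!x. norm x <= 2 ==> \<bar>LINT z|Om. u z * kLR rho eps x z\<bar> <= B4"
    using p1(2) p2(2) p3(2) p4(2) by blast
  have div: "\<bar>(a + b) / kappa\<bar> <= (\<bar>B1\<bar> + \<bar>B2\<bar> + \<bar>B3\<bar> + \<bar>B4\<bar>) / kappa"
    if "\<bar>a\<bar> + \<bar>b\<bar> <= \<bar>B1\<bar> + \<bar>B2\<bar> + \<bar>B3\<bar> + \<bar>B4\<bar>" for a b
    using order.trans[OF abs_triangle_ineq that] kappa_pos by (auto simp: abs_divide intro!: divide_right_mono)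
  show "\<exists>B. (\<forall>x. norm x <= 2 --> \<bar>pot rho eps f u x\<bar> <= B) \<and> (\<forall>x. norm x <= 2 --> \<bar>Lpot rho eps f u x\<bar> <= B)"
  proof (intro exI[of _ "(\<bar>B1\<bar> + \<bar>B2\<bar> + \<bar>B3\<bar> + \<bar>B4\<bar>) / kappa"] conjI allI impI)
    fix x :: "real^2" assume x: "norm x <= 2"
    show "\<bar>pot rho eps f u x\<bar> <= (\<bar>B1\<bar> + \<bar>B2\<bar> + \<bar>B3\<bar> + \<bar>B4\<bar>) / kappa"
      unfolding pot_def by (rule div) (use B(1,3)[OF x] in linarith)
    show "\<bar>Lpot rho eps f u x\<bar> <= (\<bar>B1\<bar> + \<bar>B2\<bar> + \<bar>B3\<bar> + \<bar>B4\<bar>) / kappa"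
      unfolding Lpot_def by (rule div) (use B(2,4)[OF x] in linarith)
  qed
  assume xs: "x \<in> annulus" "s \<in> {9/10..11/10}"
  have d1: "((\<lambda>s. LINT z|Om. f z * (chi rho z * kG rho eps (s *\<^sub>R x) z)) has_real_derivative
      (LINT z|Om. f z * (chi rho z * kLG rho eps (s *\<^sub>R x) z)) / s) (at s)"
  proof (rule p1(4)[OF k2 _ xs])
    show "((\<lambda>t. chi rho z * kG rho eps (t *\<^sub>R x) z) has_real_derivative chi rho z * kLG rho eps (t *\<^sub>R x) z / t) (at t)"
      if "t > 0" for t and x z :: "real^2"
      using DERIV_cmult[OF kG_dilation_derivative[OF r(1) eps that, of x z], of "chi rho z"] by simp
  qed
  have d2: "((\<lambda>s. LINT z|Om. u z * kR rho eps (s *\<^sub>R x) z) has_real_derivative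
      (LINT z|Om. u z * kLR rho eps (s *\<^sub>R x) z) / s) (at s)"
    by (rule p3(4)[OF k4 kR_dilation_derivative[OF r(1) eps] xs])
  show "((\<lambda>s. pot rho eps f u (s *\<^sub>R x)) has_real_derivative Lpot rho eps f u (s *\<^sub>R x) / s) (at s)"
    unfolding pot_def Lpot_def
    by (rule DERIV_cong[OF DERIV_cdivide[OF DERIV_add[OF d1 d2]]]) (simp add: add_divide_distrib mult.commute)
qed

lemma pot_eq_smear:
  assumes "side rho" "eps > 0" "x \<in> annulus" "u \<in> W11_0 annulus" "neg_laplacian_distr annulus u f"
    "integrable Om f"
  shows "pot rho eps f u x = smear rho eps u x / kappa"
  unfolding pot_def smear_def using kernel_identity(1)[OF assms] by simp

text \<open>Convergence in L1 of the smoothed functions yields convergence almost everywhere along a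
  subsequence.\<close>

lemma pot_subsequence:
  assumes rho: "side rho" and eps: "!!n. eps n > 0" "eps \<longlonglongrightarrow> 0"
    and u: "u \<in> W11_0 annulus" "neg_laplacian_distr annulus u f" "integrable Om f"
  shows "\<exists>r::nat => nat. strict_mono r \<and>
    (AE x in Om. x \<in> near rho --> (\<lambda>n. pot rho (eps (r n)) f u x) \<longlonglongrightarrow> u x)"
proof -
  define D where "D n x = indicator (near rho) x * (smear rho (eps n) u x - kappa * u x)" for n x
  note s = smear_L1_tendsto[OF rho u(1) eps, folded D_def]
  obtain r :: "nat => nat" where r: "strict_mono r" "AE x in Om. (\<lambda>n. D (r n) x) \<longlonglongrightarrow> 0"
    using tendsto_L1_AE_subseq[of Om D] s by auto
  have "AE x in Om. x \<in> near rho --> (\<lambda>n. pot rho (eps (r n)) f u x) \<longlonglongrightarrow> u x"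
    using r(2)
  proof eventually_elim
    case (elim x)
    show ?case
    proof
      assume x: "x \<in> near rho"
      have "pot rho (eps n) f u x = u x + D n x / kappa" for n
        using kappa_pos x by (simp add: pot_eq_smear[OF rho eps(1) near_facts(1)[OF rho x] u] D_def field_simps)
      moreover have "(\<lambda>n. u x + D (r n) x / kappa) \<longlonglongrightarrow> u x + 0 / kappa"
        using kappa_pos by (intro tendsto_intros elim) auto
      ultimately show "(\<lambda>n. pot rho (eps (r n)) f u x) \<longlonglongrightarrow> u x" by simp
    qed
  qed
  then show ?thesis using r(1) by blast
qed

text \<open>The energy involves both solutions at the same \<open>eps\<close>, so a subsequence for
  \<open>u\<close> is refined to one for \<open>v\<close>. Monotonicity of the sequence is kept,
  because the bound of all potentials by their limit depends on it.\<close>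

lemma pot_subsequence2:
  assumes rho: "side rho"
    and u: "u \<in> W11_0 annulus" "neg_laplacian_distr annulus u f" "integrable Om f"
    and v: "v \<in> W11_0 annulus" "neg_laplacian_distr annulus v g" "integrable Om g"
  obtains eps :: "nat => real" where "!!n. 0 < eps n" "!!n. eps n <= 1" "decseq eps" "eps \<longlonglongrightarrow> 0"
    "AE x in Om. x \<in> near rho --> (\<lambda>n. pot rho (eps n) f u x) \<longlonglongrightarrow> u x"
    "AE x in Om. x \<in> near rho --> (\<lambda>n. pot rho (eps n) g v x) \<longlonglongrightarrow> v x"
proof -
  define \<delta> where "\<delta> n = 1 / real (Suc n)" for n
  have \<delta>: "0 < \<delta> n" "\<delta> n <= 1" for n by (auto simp: \<delta>_def)
  have \<delta>0: "\<delta> \<longlonglongrightarrow> 0" unfolding \<delta>_def[abs_def] using LIMSEQ_inverse_real_of_nat by (simp add: inverse_eq_divide)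
  have dec: "decseq \<delta>" unfolding decseq_def \<delta>_def by (auto intro!: divide_left_mono)
  obtain r1 :: "nat => nat" where r1: "strict_mono r1" "AE x in Om. x \<in> near rho --> (\<lambda>n. pot rho (\<delta> (r1 n)) f u x) \<longlonglongrightarrow> u x"
    using pot_subsequence[OF rho \<delta>(1) \<delta>0 u] by blast
  have "(\<lambda>n. \<delta> (r1 n)) \<longlonglongrightarrow> 0" using LIMSEQ_subseq_LIMSEQ[OF \<delta>0 r1(1)] by (simp add: o_def)
  then obtain r2 :: "nat => nat" where r2: "strict_mono r2" "AE x in Om. x \<in> near rho --> (\<lambda>n. pot rho (\<delta> (r1 (r2 n))) g v x) \<longlonglongrightarrow> v x"
    using pot_subsequence[OF rho \<delta>(1) _ v, of "\<lambda>n. r1 n"] by blast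
  have sm: "strict_mono (r1 \<circ> r2)" using r1(1) r2(1) by (rule strict_mono_o)
  show ?thesis
  proof (rule that[of "\<lambda>n. \<delta> (r1 (r2 n))"])
    show "0 < \<delta> (r1 (r2 n))" "\<delta> (r1 (r2 n)) <= 1" for n by (rule \<delta>)+
    show "decseq (\<lambda>n. \<delta> (r1 (r2 n)))"
      using dec strict_mono_mono[OF sm] by (auto simp: decseq_def mono_def)
    show "(\<lambda>n. \<delta> (r1 (r2 n))) \<longlonglongrightarrow> 0" using LIMSEQ_subseq_LIMSEQ[OF \<delta>0 sm] by (simp add: o_def)
    show "AE x in Om. x \<in> near rho --> (\<lambda>n. pot rho (\<delta> (r1 (r2 n))) f u x) \<longlonglongrightarrow> u x"
      using r1(2) by eventually_elim (use LIMSEQ_subseq_LIMSEQ[OF _ r2(1)] in \<open>auto simp: o_def\<close>)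
  qed (rule r2(2))
qed

section \<open>The Pohozaev energy\<close>

text \<open>For \<open>kP >= kQ\<close> the quotient \<open>(kP + t) / (kQ + t)\<close> decreases in
  \<open>t\<close>.\<close>

lemma kG_antimono:
  assumes rho: "side rho" and eps: "0 < \<delta>" "\<delta> <= eps" and x: "x \<in> annulus" "z \<in> annulus"
  shows "kG rho eps x z <= kG rho \<delta> x z"
proof -
  note r = side_facts[OF rho]
  have PQ: "kQ x z <= kP rho x z" "0 <= kQ x z"
    using side_product(2)[OF rho, of x z] annulus_norm[OF x(1)] annulus_norm[OF x(2)] kQ_nonneg
    by (auto intro!: kQ_le_kP r)
  have pos: "0 < kP rho x z + eps" "0 < kP rho x z + \<delta>" "0 < kQ x z + eps" "0 < kQ x z + \<delta>" using PQ eps by linarith+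
  have "0 <= (kP rho x z - kQ x z) * (eps - \<delta>)" using PQ eps by simp
  then have "(kP rho x z + eps) * (kQ x z + \<delta>) <= (kP rho x z + \<delta>) * (kQ x z + eps)" by (simp add: algebra_simps)
  then have "ln ((kP rho x z + eps) * (kQ x z + \<delta>)) <= ln ((kP rho x z + \<delta>) * (kQ x z + eps))"
    using pos by simp
  then show ?thesis unfolding kG_def using pos by (simp add: ln_mult)
qed

text \<open>The potential of a nonnegative \<open>f\<close> grows as \<open>eps\<close> decreases,
  so each one is at most the limit; passing between \<open>pot\<close> and this monotone part costs
  \<open>D / kappa\<close> twice. The integrability of \<open>exp (4 * u)\<close> follows from
  \<open>exp_potential_bound\<close> by Fatou's lemma.\<close>

lemma pot_limit_bounds:
  assumes rho: "side rho" and eps: "!!n. 0 < eps n" "!!n. eps n <= 1" "decseq eps"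
    and f: "integrable Om f" "!!z. z \<in> annulus ==> 0 <= f z"
    and u: "integrable Om u"
    and D: "!!n x. x \<in> near rho ==> \<bar>LINT z|Om. u z * kR rho (eps n) x z\<bar> <= D"
    and lim: "AE x in Om. x \<in> near rho --> (\<lambda>n. pot rho (eps n) f u x) \<longlonglongrightarrow> u x"
  shows "AE x in Om. x \<in> near rho --> (\<forall>n. pot rho (eps n) f u x <= u x + 2 * D / kappa)"
    "(\<integral>\<^sup>+x. indicator (near rho) x * ennreal (exp (4 * u x)) \<partial>Om) < \<infinity>"
proof -
  note r = side_facts[OF rho]
  define a where "a n x = (LINT z|Om. f z * (chi rho z * kG rho (eps n) x z))" for n x
  define b where "b n x = (LINT z|Om. u z * kR rho (eps n) x z)" for n x
  have pot: "pot rho (eps n) f u x = (a n x + b n x) / kappa" for n x by (simp add: pot_def a_def b_def)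
  have int: "integrable Om (\<lambda>z. f z * (chi rho z * kG rho (eps n) x z))" for n x
  proof -
    have "continuous_on UNIV (\<lambda>p. chi rho (snd p) * kG rho (eps n) (fst p) (snd p :: real^2))"
      by (intro continuous_intros kernel_continuous(1,6)[OF r(1) eps(1)])
    from continuous_kernel_potential(3)[OF f(1), of "\<lambda>x z. chi rho z * kG rho (eps n) x z", OF this]
    show ?thesis .
  qed
  have mono: "a m x <= a n x" if "m <= n" "x \<in> annulus" for m n x
    unfolding a_def
  proof (rule integral_mono[OF int int])
    fix z assume z: "z \<in> space Om"
    show "f z * (chi rho z * kG rho (eps m) x z) <= f z * (chi rho z * kG rho (eps n) x z)"
      using z f(2)[of z] cutoff_bounds that eps(3)
      by (intro mult_left_mono kG_antimono rho eps) (auto simp: chi_def decseq_def)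
  qed
  have lower: "pot rho (eps n) f u x - D / kappa <= a n x / kappa" "a n x / kappa <= pot rho (eps n) f u x + D / kappa"
    if "x \<in> near rho" for x n
  proof -
    have "\<bar>b n x\<bar> <= D" using D[OF that] by (simp add: b_def)
    then have "(a n x + b n x - D) / kappa <= a n x / kappa" "a n x / kappa <= (a n x + b n x + D) / kappa"
      using kappa_pos by (intro divide_right_mono; simp)+
    then show "pot rho (eps n) f u x - D / kappa <= a n x / kappa" "a n x / kappa <= pot rho (eps n) f u x + D / kappa"
      by (simp_all only: pot add_divide_distrib diff_divide_distrib)
  qed
  show "AE x in Om. x \<in> near rho --> (\<forall>n. pot rho (eps n) f u x <= u x + 2 * D / kappa)"
    using lim
  proof eventually_elim
    case (elim x)
    show ?case
    proof (intro impI allI)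
      fix m assume x: "x \<in> near rho"
      have "a m x / kappa <= u x + D / kappa"
      proof (rule LIMSEQ_le_const[OF tendsto_add[OF elim[rule_format, OF x] tendsto_const]], intro exI[of _ m] allI impI)
        fix n assume "m <= n"
        from divide_right_mono[OF mono[OF this near_facts(1)[OF rho x]], of kappa] lower(2)[OF x, of n]
        show "a m x / kappa <= pot rho (eps n) f u x + D / kappa" using kappa_pos by linarith
      qed
      then show "pot rho (eps m) f u x <= u x + 2 * D / kappa" using lower(1)[OF x, of m] by linarith
    qed
  qed
  obtain C where C: "C >= 0" "!!eps. 0 < eps ==> eps <= 1 ==>
    (\<integral>\<^sup>+x. ennreal (exp (4 / kappa * (LINT z|Om. f z * (chi rho z * kG rho eps x z)))) \<partial>Om) <= ennreal C"
    using exp_potential_bound[OF rho f] by blast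
  have [measurable]: "(\<lambda>x. pot rho (eps n) f u x) \<in> borel_measurable Om" for n
    by (rule borel_measurable_lebesgue_on[OF pot_facts(1)[OF rho eps(1) f(1) u]])
  have [measurable]: "u \<in> borel_measurable Om" using u by simp
  have Im [measurable]: "(\<lambda>x. indicator (near rho) x :: ennreal) \<in> borel_measurable Om"
    by (rule borel_measurable_lebesgue_on) measurable
  define w where "w n x = indicator (near rho) x * ennreal (exp (4 * pot rho (eps n) f u x))" for n x
  have wm: "w n \<in> borel_measurable Om" for n unfolding w_def[abs_def] by measurable
  have am [measurable]: "a n \<in> borel_measurable Om" for n
  proof -
    have "continuous_on UNIV (\<lambda>p. chi rho (snd p) * kG rho (eps n) (fst p) (snd p :: real^2))"
      by (intro continuous_intros kernel_continuous(1,6)[OF r(1) eps(1)])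
    from continuous_kernel_potential(1)[OF f(1), of "\<lambda>x z. chi rho z * kG rho (eps n) x z", OF this]
    show ?thesis unfolding a_def[abs_def] by (rule borel_measurable_lebesgue_on)
  qed
  have wB: "(\<integral>\<^sup>+x. w n x \<partial>Om) <= ennreal (exp (4 * D / kappa)) * ennreal C" for n
  proof -
    have "w n x <= ennreal (exp (4 * D / kappa)) * ennreal (exp (4 / kappa * a n x))" for x
    proof (cases "x \<in> near rho")
      case True
      have "4 * pot rho (eps n) f u x <= 4 * D / kappa + 4 / kappa * a n x" using lower(1)[OF True, of n] by simp
      then have "exp (4 * pot rho (eps n) f u x) <= exp (4 * D / kappa) * exp (4 / kappa * a n x)" by (simp flip: exp_add)
      then show ?thesis using True by (simp add: w_def ennreal_leI flip: ennreal_mult)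
    qed (simp add: w_def)
    then have "(\<integral>\<^sup>+x. w n x \<partial>Om) <= (\<integral>\<^sup>+x. ennreal (exp (4 * D / kappa)) * ennreal (exp (4 / kappa * a n x)) \<partial>Om)"
      by (intro nn_integral_mono) auto
    also have "\<dots> = ennreal (exp (4 * D / kappa)) * (\<integral>\<^sup>+x. ennreal (exp (4 / kappa * a n x)) \<partial>Om)"
      by (rule nn_integral_cmult) measurable
    also have "\<dots> <= ennreal (exp (4 * D / kappa)) * ennreal C"
      using C(2)[OF eps(1,2), of n] by (intro mult_left_mono) (auto simp: a_def)
    finally show ?thesis .
  qed
  have "(\<integral>\<^sup>+x. indicator (near rho) x * ennreal (exp (4 * u x)) \<partial>Om) = (\<integral>\<^sup>+x. liminf (\<lambda>n. w n x) \<partial>Om)"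
  proof (rule nn_integral_cong_AE)
    show "AE x in Om. indicator (near rho) x * ennreal (exp (4 * u x)) = liminf (\<lambda>n. w n x)"
      using lim
    proof eventually_elim
      case (elim x)
      show ?case
      proof (cases "x \<in> near rho")
        case True
        then have "(\<lambda>n. w n x) \<longlonglongrightarrow> ennreal (exp (4 * u x))"
          using elim unfolding w_def by (auto intro!: tendsto_intros)
        then show ?thesis using True by (simp add: lim_imp_Liminf)
      qed (simp add: w_def Liminf_const)
    qed
  qed
  also have "\<dots> <= liminf (\<lambda>n. \<integral>\<^sup>+x. w n x \<partial>Om)" by (rule nn_integral_liminf[OF wm])
  also have "\<dots> <= liminf (\<lambda>n::nat. ennreal (exp (4 * D / kappa)) * ennreal C)"
    by (intro Liminf_mono always_eventually allI wB)
  also have "\<dots> < \<infinity>" by (simp add: Liminf_const ennreal_mult_less_top)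
  finally show "(\<integral>\<^sup>+x. indicator (near rho) x * ennreal (exp (4 * u x)) \<partial>Om) < \<infinity>" .
qed

lemma product_integrable:
  fixes f g :: "real^2 => real"
  assumes f: "integrable Om f" and g: "integrable Om g"
    and K: "(\<lambda>p. K (fst p) (snd p)) \<in> borel_measurable (Om \<Otimes>\<^sub>M Om)"
      "!!x z. x \<in> annulus ==> z \<in> annulus ==> \<bar>K x z\<bar> <= B"
  shows "integrable (Om \<Otimes>\<^sub>M Om) (\<lambda>p. f (fst p) * g (snd p) * K (fst p) (snd p))"
proof (rule integrable_mult_bounded[where B = B])
  have [measurable]: "f \<in> borel_measurable Om" "g \<in> borel_measurable Om"
    using f g by simp_all
  show "integrable (Om \<Otimes>\<^sub>M Om) (\<lambda>p. f (fst p) * g (snd p))"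
  proof (rule OmOm.Fubini_integrable)
    show "integrable Om (\<lambda>x. LINT y|Om. norm (f (fst (x, y)) * g (snd (x, y))))"
      using f by (simp add: abs_mult)
    show "AE x in Om. integrable Om (\<lambda>y. f (fst (x, y)) * g (snd (x, y)))"
      using g by simp
  qed measurable
qed (use K in \<open>auto simp: space_pair_measure\<close>)

text \<open>\<open>symmetrised_kLG\<close> is integrated over pairs of points and the double
  integrals are rewritten by Fubini. The potentials carry \<open>chi\<close> in one variable only;
  as \<open>hh\<close> vanishes wherever \<open>chi\<close> differs from 1, a factor
  \<open>chi\<close> in the other variable can be added, which restores the symmetry.\<close>

lemma symmetrised_energy:
  assumes rho: "side rho" and eps: "0 < eps"
    and f: "integrable Om f" "!!z. z \<in> annulus ==> 0 <= f z"
    and g: "integrable Om g" "!!z. z \<in> annulus ==> 0 <= g z"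
  shows "- 2 * (LINT x|Om. f x * (LINT z|Om. g z * (eps / (kQ x z + eps))))
    <= (LINT x|Om. f x * hh rho x * (LINT z|Om. g z * (chi rho z * kLG rho eps x z)))
     + (LINT x|Om. g x * hh rho x * (LINT z|Om. f z * (chi rho z * kLG rho eps x z)))"
proof -
  let ?MM = "Om \<Otimes>\<^sub>M Om"
  note r = side_facts[OF rho]
  have [measurable]: "f \<in> borel_measurable Om" "g \<in> borel_measurable Om" using f g by simp_all
  have chi01: "0 <= chi rho x" "chi rho x <= 1" for x :: "real^2" by (simp_all add: chi_def cutoff_bounds)
  have hchi: "hh rho x = hh rho x * chi rho x" for x
    using hh_outside_near[OF r(1), of x] near_facts(3)[OF rho, of x] by (cases "x \<in> near rho") auto
  obtain B where B: "B >= 0" "!!x z. norm x <= 2 ==> z \<in> annulus ==> \<bar>kLG rho eps x z\<bar> <= B"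
    using continuous_kernel_bound[OF kernel_continuous(2)[OF r(1) eps]] by blast
  have n2: "norm x <= 2" if "x \<in> annulus" for x using annulus_norm(1)[OF that] by simp
  have chic: "(chi rho :: real^2 => real) \<in> borel_measurable borel"
    by (rule borel_measurable_continuous_onI) (rule continuous_on_section[of "\<lambda>x. chi rho" 0, OF kernel_continuous(6)[OF r(1) eps]])
  have prod_meas: "(\<lambda>p. k (fst p) * l (snd p) * K (fst p) (snd p)) \<in> borel_measurable ?MM"
    if [measurable]: "k \<in> borel_measurable borel" "l \<in> borel_measurable borel" and K: "continuous_on UNIV (\<lambda>p. K (fst p) (snd p))"
    for k l :: "real^2 => real" and K :: "real^2 => real^2 => real"
  proof -
    have [measurable]: "(\<lambda>p. K (fst p) (snd p)) \<in> borel_measurable ?MM" by (rule pair_measurable_continuous[OF K])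
    have [measurable]: "k \<in> borel_measurable Om" "l \<in> borel_measurable Om" by (rule borel_measurable_lebesgue_on; fact)+
    show ?thesis by measurable
  qed
  define F where "F x z = f x * g z * (hh rho x * chi rho z * kLG rho eps x z)" for x z
  define G where "G x z = f x * g z * (chi rho x * hh rho z * kLG rho eps z x)" for x z
  define E where "E x z = f x * g z * (eps / (kQ x z + eps))" for x z
  have Fi: "integrable ?MM (\<lambda>p. F (fst p) (snd p))" unfolding F_def
  proof (rule product_integrable[OF f(1) g(1)])
    show "(\<lambda>p. hh rho (fst p) * chi rho (snd p) * kLG rho eps (fst p) (snd p)) \<in> borel_measurable ?MM"
      by (rule prod_meas[OF hh_measurable chic kernel_continuous(2)[OF r(1) eps]])
    fix x z assume xz: "x \<in> annulus" "z \<in> annulus"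
    show "\<bar>hh rho x * chi rho z * kLG rho eps x z\<bar> <= 1 * 1 * B"
      unfolding abs_mult using hh_abs_le(1)[OF rho, of x] chi01[of z] B(2)[OF n2[OF xz(1)] xz(2)] B(1)
      by (intro mult_mono) auto
  qed
  have Gi: "integrable ?MM (\<lambda>p. G (fst p) (snd p))" unfolding G_def
  proof (rule product_integrable[OF f(1) g(1)])
    show "(\<lambda>p. chi rho (fst p) * hh rho (snd p) * kLG rho eps (snd p) (fst p)) \<in> borel_measurable ?MM"
      by (rule prod_meas[OF chic hh_measurable kernel_continuous(3)[OF r(1) eps]])
    fix x z assume xz: "x \<in> annulus" "z \<in> annulus"
    show "\<bar>chi rho x * hh rho z * kLG rho eps z x\<bar> <= 1 * 1 * B"
      unfolding abs_mult using hh_abs_le(1)[OF rho, of z] chi01[of x] B(2)[OF n2[OF xz(2)] xz(1)] B(1)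
      by (intro mult_mono) auto
  qed
  have kQp: "0 < kQ x z + eps" for x z :: "real^2" using kQ_nonneg[of x z] eps by linarith
  have Ei: "integrable ?MM (\<lambda>p. E (fst p) (snd p))" unfolding E_def
  proof (rule product_integrable[OF f(1) g(1)])
    have "continuous_on UNIV (\<lambda>p. eps / (kQ (fst p) (snd p :: real^2) + eps))"
      unfolding kQ_def using kQp[unfolded kQ_def] by (intro continuous_intros ballI) (metis less_irrefl)
    then show "(\<lambda>p. eps / (kQ (fst p) (snd p) + eps)) \<in> borel_measurable ?MM" by (rule pair_measurable_continuous)
    show "\<bar>eps / (kQ x z + eps)\<bar> <= 1" for x z :: "real^2"
      using kQp[of x z] kQ_nonneg[of x z] eps by (simp add: abs_divide)
  qed
  have "- 2 * (LINT p|?MM. E (fst p) (snd p)) = (LINT p|?MM. - 2 * E (fst p) (snd p))" by simp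
  also have "\<dots> <= (LINT p|?MM. F (fst p) (snd p) + G (fst p) (snd p))"
  proof (rule integral_mono)
    fix p assume p: "p \<in> space ?MM"
    define x z where "x = fst p" "z = snd p"
    have xz: "x \<in> annulus" "z \<in> annulus" using p by (auto simp: x_z_def space_pair_measure)
    have c: "x \<bullet> x >= rho \<and> z \<bullet> z >= rho \<or> x \<bullet> x <= rho \<and> z \<bullet> z <= rho"
      using annulus_norm[OF xz(1)] annulus_norm[OF xz(2)] by (intro side_product(1)[OF rho]) auto
    have s: "- 2 * (eps / (kQ x z + eps)) <= hh rho x * kLG rho eps x z + hh rho z * kLG rho eps z x"
      using symmetrised_kLG[OF r(1) eps c] xz by (simp add: hh_def)
    have e0: "0 <= eps / (kQ x z + eps)" using kQp[of x z] eps by simp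
    \<comment> \<open>Multiplying the negative defect by a factor between 0 and 1 only raises
      it.\<close>
    have "- 2 * (eps / (kQ x z + eps)) <= (chi rho x * chi rho z) * (- 2 * (eps / (kQ x z + eps)))"
    proof -
      have "chi rho x * chi rho z <= 1" using chi01 by (intro mult_le_one) auto
      from mult_right_mono_neg[OF this, of "- 2 * (eps / (kQ x z + eps))"] e0 show ?thesis by linarith
    qed
    also have "\<dots> <= (chi rho x * chi rho z) * (hh rho x * kLG rho eps x z + hh rho z * kLG rho eps z x)"
      by (rule mult_left_mono[OF s]) (simp add: chi01)
    also have "\<dots> = (hh rho x * chi rho x) * chi rho z * kLG rho eps x z + chi rho x * (hh rho z * chi rho z) * kLG rho eps z x"
      by (simp add: algebra_simps)
    also have "\<dots> = hh rho x * chi rho z * kLG rho eps x z + chi rho x * hh rho z * kLG rho eps z x" by (simp only: hchi[symmetric])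
    finally have "f x * g z * (- 2 * (eps / (kQ x z + eps)))
      <= f x * g z * (hh rho x * chi rho z * kLG rho eps x z + chi rho x * hh rho z * kLG rho eps z x)"
      using f(2)[OF xz(1)] g(2)[OF xz(2)] by (intro mult_left_mono) auto
    then show "- 2 * E (fst p) (snd p) <= F (fst p) (snd p) + G (fst p) (snd p)"
      unfolding E_def F_def G_def x_z_def by (simp add: algebra_simps)
  qed (use Ei Fi Gi in auto)
  also have "\<dots> = (LINT p|?MM. F (fst p) (snd p)) + (LINT p|?MM. G (fst p) (snd p))"
    by (rule Bochner_Integration.integral_add[OF Fi Gi])
  also have "(LINT p|?MM. F (fst p) (snd p)) = (LINT x|Om. LINT z|Om. F x z)"
    using OmOm.integral_fst'[OF Fi] by simp
  also have "(LINT p|?MM. G (fst p) (snd p)) = (LINT z|Om. LINT x|Om. G x z)"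
    using OmOm.integral_snd[of G] Gi by (simp add: split_def)
  also have "(LINT p|?MM. E (fst p) (snd p)) = (LINT x|Om. LINT z|Om. E x z)"
    using OmOm.integral_fst'[OF Ei] by simp
  also have "(\<lambda>x. LINT z|Om. E x z) = (\<lambda>x. f x * (LINT z|Om. g z * (eps / (kQ x z + eps))))"
    unfolding E_def mult.assoc by (simp only: integral_mult_right_zero)
  also have "(\<lambda>x. LINT z|Om. F x z) = (\<lambda>x. f x * hh rho x * (LINT z|Om. g z * (chi rho z * kLG rho eps x z)))"
  proof -
    have "F x z = f x * hh rho x * (g z * (chi rho z * kLG rho eps x z))" for x z by (simp add: F_def)
    then show ?thesis by (simp only: integral_mult_right_zero)
  qed
  also have "(\<lambda>z. LINT x|Om. G x z) = (\<lambda>z. g z * hh rho z * (LINT x|Om. f x * (chi rho x * kLG rho eps z x)))"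
  proof -
    have "G x z = g z * hh rho z * (f x * (chi rho x * kLG rho eps z x))" for x z by (simp add: G_def)
    then show ?thesis by (simp only: integral_mult_right_zero)
  qed
  finally show ?thesis .
qed

text \<open>The kernel is at most 1 and tends to 0 off the diagonal, so two applications of
  dominated convergence suffice.\<close>

lemma energy_defect_tendsto:
  assumes eps: "!!n. 0 < eps n" "eps \<longlonglongrightarrow> 0"
    and f: "integrable Om f" and g: "integrable Om g"
  shows "(\<lambda>n. LINT x|Om. f x * (LINT z|Om. g z * (eps n / (kQ x z + eps n)))) \<longlonglongrightarrow> 0"
proof -
  have [measurable]: "f \<in> borel_measurable Om" "g \<in> borel_measurable Om" using f g by simp_all
  have kQp: "0 < kQ x z + eps n" for n and x z :: "real^2" using kQ_nonneg[of x z] eps(1)[of n] by linarith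
  have b: "\<bar>eps n / (kQ x z + eps n)\<bar> <= 1" for n and x z :: "real^2"
    using kQp[of x z n] kQ_nonneg[of x z] eps(1)[of n] by (simp add: abs_divide)
  have gb: "\<bar>g z * (eps n / (kQ x z + eps n))\<bar> <= \<bar>g z\<bar>" for n x z
    unfolding abs_mult[of "g z"] using mult_left_mono[OF b, of "\<bar>g z\<bar>"] by simp
  have c: "continuous_on UNIV (\<lambda>p. eps n / (kQ (fst p) (snd p :: real^2) + eps n))" for n
    unfolding kQ_def using kQp[unfolded kQ_def] by (intro continuous_intros ballI) (metis less_irrefl)
  have gm: "(\<lambda>z. g z * (eps n / (kQ x z + eps n))) \<in> borel_measurable Om" for n x
    using continuous_kernel_potential(3)[OF g, of "\<lambda>x z. eps n / (kQ x z + eps n)", OF c] by simp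
  define T where "T n x = (LINT z|Om. g z * (eps n / (kQ x z + eps n)))" for n x
  have Tm [measurable]: "T n \<in> borel_measurable Om" for n
    unfolding T_def[abs_def] using continuous_kernel_potential(1)[OF g, of "\<lambda>x z. eps n / (kQ x z + eps n)", OF c]
    by (rule borel_measurable_lebesgue_on)
  have T0: "(\<lambda>n. T n x) \<longlonglongrightarrow> (LINT z|Om. 0)" for x
    unfolding T_def
  proof (rule integral_dominated_convergence[where w = "\<lambda>z. \<bar>g z\<bar>"])
    show "AE z in Om. (\<lambda>n. g z * (eps n / (kQ x z + eps n))) \<longlonglongrightarrow> 0"
      using AE_annulus_neq[of x]
    proof eventually_elim
      case (elim z)
      then have "kQ x z + 0 ~= 0" by (simp add: kQ_norm)
      then have "(\<lambda>n. g z * (eps n / (kQ x z + eps n))) \<longlonglongrightarrow> g z * (0 / (kQ x z + 0))"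
        by (intro tendsto_intros eps(2))
      then show ?case by simp
    qed
  qed (use g gm gb in auto)
  have Tb: "\<bar>T n x\<bar> <= (LINT z|Om. \<bar>g z\<bar>)" for n x
    unfolding T_def
    by (rule integral_abs_bound_integral[OF continuous_kernel_potential(3)[OF g, of "\<lambda>x z. eps n / (kQ x z + eps n)", OF c]])
      (use g gb in auto)
  have "(\<lambda>n. LINT x|Om. f x * T n x) \<longlonglongrightarrow> (LINT x|Om. 0)"
  proof (rule integral_dominated_convergence[where w = "\<lambda>x. \<bar>f x\<bar> * (LINT z|Om. \<bar>g z\<bar>)"])
    show "AE x in Om. (\<lambda>n. f x * T n x) \<longlonglongrightarrow> 0"
      using tendsto_mult_right_zero[OF T0[simplified]] by simp
    show "AE x in Om. norm (f x * T n x) <= \<bar>f x\<bar> * (LINT z|Om. \<bar>g z\<bar>)" for n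
      using mult_left_mono[OF Tb, of "\<bar>f _\<bar>"] by (simp add: abs_mult)
  qed (use f in auto)
  then show ?thesis by (simp add: T_def)
qed

text \<open>Young's inequality for the exponents 4 and \<open>4/3\<close>, without its constants. As
  \<open>4/3 < 2\<close>, the corresponding power of the inverse distance is integrable in the
  plane; this is the origin of the 4 in \<open>exp (4 * u)\<close>.\<close>

lemma mult_le_fourth_power:
  fixes q t :: real
  assumes "0 <= q" "0 <= t"
  shows "q * t <= q ^ 4 + t powr (4/3)"
proof (cases "t <= q ^ 3")
  case True
  then have "q * t <= q * q ^ 3" using assms by (intro mult_left_mono) auto
  then show ?thesis by (simp add: power_numeral_reduce add_increasing2)
next
  case False
  then have t: "t > 0" "q ^ 3 <= t" using assms by (auto simp: not_le intro: order.strict_trans1[OF zero_le_power])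
  have "q <= t powr (1/3)"
  proof (cases "q = 0")
    case False
    then have "q = (q powr 3) powr (1/3)" using assms by (subst powr_powr) simp
    also have "\<dots> <= t powr (1/3)" using t assms False by (intro powr_mono2) auto
    finally show ?thesis .
  qed simp
  then have "q * t <= t powr (1/3) * t powr 1" using t by (intro mult_mono) auto
  also have "\<dots> = t powr (1/3 + 1)" by (rule powr_add[symmetric])
  finally show ?thesis by (simp add: add_increasing)
qed

text \<open>Integrating first in \<open>x\<close>, Young's inequality bounds the inner integral by
  \<open>Q\<close> for every \<open>z\<close>, and then the integrability of \<open>g\<close> is
  enough.\<close>

lemma singular_product_integrable:
  assumes q: "q \<in> borel_measurable Om" "!!x. 0 <= q x"
      "(\<integral>\<^sup>+x. ennreal (q x ^ 4) \<partial>Om) < \<infinity>"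
    and g: "integrable Om g" "!!z. z \<in> annulus ==> 0 <= g z"
  shows "integrable (Om \<Otimes>\<^sub>M Om) (\<lambda>p. q (fst p) * g (snd p) * (1 / norm (fst p - snd p)))"
proof (rule integrableI_bounded)
  let ?MM = "Om \<Otimes>\<^sub>M Om"
  note [measurable] = q(1) borel_measurable_integrable[OF g(1)]
  have [measurable]: "(\<lambda>p. 1 / norm (fst p - snd p)) \<in> borel_measurable ?MM"
    by (intro pair_measurable_borel borel_measurable_divide borel_measurable_const borel_measurable_continuous_onI continuous_intros)
  show "(\<lambda>p. q (fst p) * g (snd p) * (1 / norm (fst p - snd p))) \<in> borel_measurable ?MM" by measurable
  obtain C where C: "!!x::real^2. norm x <= 1 ==> integrable Om (\<lambda>z. norm (x - z) powr - (4/3))"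
    "!!x::real^2. norm x <= 1 ==> (LINT z|Om. norm (x - z) powr - (4/3)) <= C"
    using norm_powr_integrable[of "4/3"] by auto
  define Q where "Q = (\<integral>\<^sup>+x. ennreal (q x ^ 4) \<partial>Om) + ennreal C"
  have Q: "Q < \<infinity>" using q(3) by (simp add: Q_def)
  have "(\<integral>\<^sup>+p. ennreal (norm (q (fst p) * g (snd p) * (1 / norm (fst p - snd p)))) \<partial>?MM)
      = (\<integral>\<^sup>+z. \<integral>\<^sup>+x. ennreal (norm (q x * g z * (1 / norm (x - z)))) \<partial>Om \<partial>Om)"
    by (subst OmOm.nn_integral_snd[symmetric]) (simp_all only: fst_conv snd_conv, measurable)
  also have "\<dots> <= (\<integral>\<^sup>+z. ennreal (g z) * Q \<partial>Om)"
  proof (rule nn_integral_mono)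
    fix z assume "z \<in> space Om"
    then have z: "z \<in> annulus" by simp
    have [measurable]: "(\<lambda>x. norm (x - z)) \<in> borel_measurable Om"
      by (rule borel_measurable_lebesgue_on) measurable
    have "(\<integral>\<^sup>+x. ennreal (norm (q x * g z * (1 / norm (x - z)))) \<partial>Om)
      <= (\<integral>\<^sup>+x. ennreal (g z) * (ennreal (q x ^ 4) + ennreal (norm (x - z) powr - (4/3))) \<partial>Om)"
    proof (rule nn_integral_mono)
      fix x
      have "q x * (1 / norm (x - z)) <= q x ^ 4 + (1 / norm (x - z)) powr (4/3)"
        by (intro mult_le_fourth_power q) simp
      also have "(1 / norm (x - z)) powr (4/3) = norm (x - z) powr - (4/3)"
        unfolding powr_minus_divide by (subst powr_divide) auto
      finally have "g z * (q x * (1 / norm (x - z))) <= g z * (q x ^ 4 + norm (x - z) powr - (4/3))"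
        using g(2)[OF z] by (intro mult_left_mono)
      then have "norm (q x * g z * (1 / norm (x - z))) <= g z * (q x ^ 4 + norm (x - z) powr - (4/3))"
        using g(2)[OF z] q(2)[of x] by (simp add: abs_mult mult_ac)
      then have "ennreal (norm (q x * g z * (1 / norm (x - z)))) <= ennreal (g z * (q x ^ 4 + norm (x - z) powr - (4/3)))"
        by (rule ennreal_leI)
      also have "\<dots> = ennreal (g z) * (ennreal (q x ^ 4) + ennreal (norm (x - z) powr - (4/3)))"
        using g(2)[OF z] by (subst ennreal_plus[symmetric]) (auto simp: ennreal_mult q(2))
      finally show "ennreal (norm (q x * g z * (1 / norm (x - z)))) <= ennreal (g z) * (ennreal (q x ^ 4) + ennreal (norm (x - z) powr - (4/3)))" .
    qed
    also have "\<dots> = ennreal (g z) * ((\<integral>\<^sup>+x. ennreal (q x ^ 4) \<partial>Om) + (\<integral>\<^sup>+x. ennreal (norm (x - z) powr - (4/3)) \<partial>Om))"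
      by (subst nn_integral_cmult) (measurable, simp add: nn_integral_add)
    also have "(\<integral>\<^sup>+x. ennreal (norm (x - z) powr - (4/3)) \<partial>Om) = ennreal (LINT x|Om. norm (z - x) powr - (4/3))"
      using nn_integral_eq_integral[OF C(1)[of z]] annulus_norm(1)[OF z] by (simp add: norm_minus_commute)
    also have "ennreal (g z) * ((\<integral>\<^sup>+x. ennreal (q x ^ 4) \<partial>Om) + \<dots>) <= ennreal (g z) * Q"
      unfolding Q_def using C(2)[of z] annulus_norm(1)[OF z] by (intro mult_left_mono add_left_mono ennreal_leI) auto
    finally show "(\<integral>\<^sup>+x. ennreal (norm (q x * g z * (1 / norm (x - z)))) \<partial>Om) <= ennreal (g z) * Q" .
  qed
  also have "\<dots> = (\<integral>\<^sup>+z. ennreal (g z) \<partial>Om) * Q" by (rule nn_integral_multc) measurable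
  also have "\<dots> < \<infinity>"
  proof -
    have "(\<integral>\<^sup>+z. ennreal (g z) \<partial>Om) <= (\<integral>\<^sup>+z. ennreal (norm (g z)) \<partial>Om)"
      by (intro nn_integral_mono ennreal_leI) auto
    also have "\<dots> < \<infinity>" using g(1) by (simp add: integrable_iff_bounded)
    finally show ?thesis using Q by (simp add: ennreal_mult_less_top)
  qed
  finally show "(\<integral>\<^sup>+p. ennreal (norm (q (fst p) * g (snd p) * (1 / norm (fst p - snd p)))) \<partial>?MM) < \<infinity>" .
qed

text \<open>The integration by parts produces \<open>exp\<close> of the potential, the energy
  contains \<open>exp v\<close>. The difference is multiplied by \<open>Lpot\<close>, which is no
  better than a singular integral of \<open>g\<close>; the fourth-power integrability of
  \<open>exp v\<close> near the circle provides a dominating function for the whole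
  sequence.\<close>

lemma pot_exchange:
  assumes rho: "side rho" and eps: "!!n. 0 < eps n"
    and g: "integrable Om g" "!!z. z \<in> annulus ==> 0 <= g z"
    and v: "integrable Om v"
    and D: "!!n x. x \<in> near rho ==> \<bar>LINT z|Om. v z * kLR rho (eps n) x z\<bar> <= D"
    and upper: "AE x in Om. x \<in> near rho --> (\<forall>n. pot rho (eps n) g v x <= v x + E)"
    and lim: "AE x in Om. x \<in> near rho --> (\<lambda>n. pot rho (eps n) g v x) \<longlonglongrightarrow> v x"
    and int4: "(\<integral>\<^sup>+x. indicator (near rho) x * ennreal (exp (4 * v x)) \<partial>Om) < \<infinity>"
    and c: "c \<in> borel_measurable Om" "!!x. x \<in> annulus ==> \<bar>c x\<bar> <= B"
      "!!x. x \<notin> near rho ==> c x = 0"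
  shows "(\<lambda>n. LINT x|Om. c x * (exp (pot rho (eps n) g v x) - exp (v x)) * Lpot rho (eps n) g v x) \<longlonglongrightarrow> 0"
    "integrable Om (\<lambda>x. c x * exp (v x) * Lpot rho (eps n) g v x)"
    "integrable Om (\<lambda>x. c x * exp (v x))"
proof -
  let ?MM = "Om \<Otimes>\<^sub>M Om"
  note r = side_facts[OF rho]
  have r14: "6 + 2 / rho <= 14" using rho unfolding side_def by (elim disjE; hypsubst) simp_all
  have vm [measurable]: "v \<in> borel_measurable Om" using v by simp
  note [measurable] = c(1)
  have pm [measurable]: "pot rho (eps n) g v \<in> borel_measurable Om" "Lpot rho (eps n) g v \<in> borel_measurable Om" for n
    using pot_facts(1,2)[OF rho eps g(1) v] by (auto intro: borel_measurable_lebesgue_on)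
  have Im [measurable]: "(\<lambda>x. indicator (near rho) x :: real) \<in> borel_measurable Om"
    by (rule borel_measurable_lebesgue_on) measurable
  define q where "q x = indicator (near rho) x * exp (v x)" for x
  have qm [measurable]: "q \<in> borel_measurable Om" unfolding q_def[abs_def] by measurable
  have q0: "0 <= q x" for x by (simp add: q_def)
  have q4: "(\<integral>\<^sup>+x. ennreal (q x ^ 4) \<partial>Om) < \<infinity>"
  proof -
    have "ennreal (q x ^ 4) = indicator (near rho) x * ennreal (exp (4 * v x))" for x
      by (cases "x \<in> near rho") (auto simp: q_def exp_of_nat_mult[of 4, simplified, symmetric])
    then show ?thesis using int4 by simp
  qed
  have qi: "integrable Om q"
  proof (rule integrableI_bounded)
    have "(\<integral>\<^sup>+x. ennreal (norm (q x)) \<partial>Om) <= (\<integral>\<^sup>+x. ennreal (q x ^ 4) + 1 \<partial>Om)"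
    proof (rule nn_integral_mono)
      fix x show "ennreal (norm (q x)) <= ennreal (q x ^ 4) + 1"
        using mult_le_fourth_power[OF q0[of x], of 1] q0[of x] ennreal_leI[of "q x" "q x ^ 4 + 1"]
        by (simp add: ennreal_plus)
    qed
    also have "\<dots> = (\<integral>\<^sup>+x. ennreal (q x ^ 4) \<partial>Om) + emeasure Om (space Om)" by (simp add: nn_integral_add)
    also have "\<dots> < \<infinity>" using q4 Om.emeasure_finite[of "space Om"]
      by (metis ennreal_add_less_top infinity_ennreal_def less_top)
    finally show "(\<integral>\<^sup>+x. ennreal (norm (q x)) \<partial>Om) < \<infinity>" .
  qed measurable
  have sing: "integrable ?MM (\<lambda>p. q (fst p) * g (snd p) * (1 / norm (fst p - snd p)))"
    by (rule singular_product_integrable[OF qm q0 q4 g])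
  define \<Psi> where "\<Psi> x = (LINT z|Om. q x * g z * (1 / norm (x - z)))" for x
  have \<Psi>i: "integrable Om \<Psi>" unfolding \<Psi>_def[abs_def] using OmOm.integrable_fst'[OF sing] by simp
  have sec: "AE x in Om. integrable Om (\<lambda>z. q x * g z * (1 / norm (x - z)))"
    using OmOm.AE_integrable_fst'[OF sing] by simp
  \<comment> \<open>14 bounds the constant \<open>6 + 2 / rho\<close> of \<open>kLG_bound\<close>
    for both circles. \<open>\<Psi>\<close> is the singular integral of \<open>g\<close> with the
    factor \<open>exp v\<close> included, and \<open>D\<close> accounts for the cutoff
    error.\<close>
  define \<Theta> where "\<Theta> x = \<bar>B\<bar> * ((14 * \<Psi> x + q x * D) / kappa)" for x
  have \<Theta>i: "integrable Om \<Theta>" unfolding \<Theta>_def[abs_def] using \<Psi>i qi by auto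
  have bound: "AE x in Om. \<forall>n. \<bar>c x * exp (v x) * Lpot rho (eps n) g v x\<bar> <= \<Theta> x"
    using sec AE_space
  proof eventually_elim
    case (elim x)
    show ?case
    proof (intro allI, cases "x \<in> near rho")
      case True
      fix n
      have x: "x \<in> annulus" by (rule near_facts(1)[OF rho True])
      have kc: "continuous_on UNIV (\<lambda>p. chi rho (snd p) * kLG rho (eps n) (fst p) (snd p :: real^2))"
        by (intro continuous_intros kernel_continuous(2,6)[OF r(1) eps])
      have ki: "integrable Om (\<lambda>z. g z * (chi rho z * kLG rho (eps n) x z))"
        using continuous_kernel_potential(3)[OF g(1), of "\<lambda>x z. chi rho z * kLG rho (eps n) x z", OF kc] .
      have "q x * \<bar>LINT z|Om. g z * (chi rho z * kLG rho (eps n) x z)\<bar> = \<bar>LINT z|Om. q x * (g z * (chi rho z * kLG rho (eps n) x z))\<bar>"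
        using q0[of x] by (simp add: abs_mult)
      also have "\<dots> <= (LINT z|Om. \<bar>q x * (g z * (chi rho z * kLG rho (eps n) x z))\<bar>)" by (rule integral_abs_bound)
      also have "\<dots> <= (LINT z|Om. 14 * (q x * g z * (1 / norm (x - z))))"
      proof (rule integral_mono_AE)
        show "AE z in Om. \<bar>q x * (g z * (chi rho z * kLG rho (eps n) x z))\<bar> <= 14 * (q x * g z * (1 / norm (x - z)))"
          using AE_annulus_neq[of x] AE_space
        proof eventually_elim
          case (elim z)
          then have z: "z \<in> annulus" and xz: "x ~= z" by auto
          have "\<bar>kLG rho (eps n) x z\<bar> <= (6 + 2 / rho) / norm (x - z)"
            using side_product(2)[OF rho, of x z] annulus_norm[OF x] annulus_norm[OF z]
            by (intro kLG_bound r rho eps xz) auto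
          also have "\<dots> <= 14 / norm (x - z)"
            using r14 by (intro divide_right_mono) auto
          finally have "\<bar>chi rho z * kLG rho (eps n) x z\<bar> <= 1 * (14 / norm (x - z))"
            unfolding abs_mult using cutoff_bounds by (intro mult_mono) (auto simp: chi_def)
          then have "(q x * g z) * \<bar>chi rho z * kLG rho (eps n) x z\<bar> <= (q x * g z) * (1 * (14 / norm (x - z)))"
            using q0[of x] g(2)[OF z] by (intro mult_left_mono) auto
          then show ?case using q0[of x] g(2)[OF z] by (simp add: abs_mult mult_ac)
        qed
      next
        show "integrable Om (\<lambda>z. 14 * (q x * g z * (1 / norm (x - z))))" by (rule integrable_mult_right) (rule elim(1))
      qed (use ki in auto)
      also have "\<dots> = 14 * \<Psi> x" by (simp only: \<Psi>_def integral_mult_right_zero)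
      finally have 1: "q x * \<bar>LINT z|Om. g z * (chi rho z * kLG rho (eps n) x z)\<bar> <= 14 * \<Psi> x" .
      have 2: "q x * \<bar>LINT z|Om. v z * kLR rho (eps n) x z\<bar> <= q x * D"
        by (rule mult_left_mono[OF D[OF True] q0])
      have "q x * \<bar>Lpot rho (eps n) g v x\<bar> <= (14 * \<Psi> x + q x * D) / kappa"
      proof -
        have "q x * \<bar>a + b\<bar> <= q x * \<bar>a\<bar> + q x * \<bar>b\<bar>" for a b
          using mult_left_mono[OF abs_triangle_ineq q0[of x]] by (simp add: distrib_left)
        then have "q x * \<bar>(LINT z|Om. g z * (chi rho z * kLG rho (eps n) x z)) + (LINT z|Om. v z * kLR rho (eps n) x z)\<bar>
          <= 14 * \<Psi> x + q x * D" using 1 2 by (meson add_mono order.trans)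
        then show ?thesis unfolding Lpot_def using kappa_pos
          by (simp add: abs_divide divide_right_mono)
      qed
      then have "\<bar>c x\<bar> * (q x * \<bar>Lpot rho (eps n) g v x\<bar>) <= \<bar>B\<bar> * ((14 * \<Psi> x + q x * D) / kappa)"
        using c(2)[OF x] q0[of x] by (intro mult_mono) auto
      then show "\<bar>c x * exp (v x) * Lpot rho (eps n) g v x\<bar> <= \<Theta> x"
        using True by (simp add: \<Theta>_def q_def abs_mult mult_ac)
    next
      case False
      fix n show "\<bar>c x * exp (v x) * Lpot rho (eps n) g v x\<bar> <= \<Theta> x"
        using c(3)[OF False] False by (simp add: \<Theta>_def \<Psi>_def q_def)
    qed
  qed
  show "integrable Om (\<lambda>x. c x * exp (v x) * Lpot rho (eps n) g v x)" for n
  proof (rule Bochner_Integration.integrable_bound[OF \<Theta>i])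
    show "AE x in Om. norm (c x * exp (v x) * Lpot rho (eps n) g v x) <= norm (\<Theta> x)"
      using bound by eventually_elim (auto intro: order.trans[OF _ abs_ge_self])
  qed measurable
  have "integrable Om (\<lambda>x. q x * c x)" by (rule integrable_mult_bounded[OF qi c(1), where B = B]) (use c(2) in auto)
  moreover have "q x * c x = c x * exp (v x)" for x using c(3)[of x] by (cases "x \<in> near rho") (auto simp: q_def)
  ultimately show "integrable Om (\<lambda>x. c x * exp (v x))" by simp
  \<comment> \<open>With \<open>exp v\<close> factored out, what remains is
    \<open>exp (pot - v) - 1\<close>: bounded by \<open>exp E + 1\<close> because of
    \<open>upper\<close>, and tending to 0 because of \<open>lim\<close>.\<close>
  have split: "c x * (exp (pot rho (eps n) g v x) - exp (v x)) * Lpot rho (eps n) g v x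
    = c x * exp (v x) * Lpot rho (eps n) g v x * (exp (pot rho (eps n) g v x - v x) - 1)" for n x
    by (simp add: exp_diff right_diff_distrib left_diff_distrib)
  have "(\<lambda>n. LINT x|Om. c x * (exp (pot rho (eps n) g v x) - exp (v x)) * Lpot rho (eps n) g v x) \<longlonglongrightarrow> (LINT x|Om. 0)"
  proof (rule integral_dominated_convergence[where w = "\<lambda>x. \<Theta> x * (exp E + 1)"])
    show "AE x in Om. (\<lambda>n. c x * (exp (pot rho (eps n) g v x) - exp (v x)) * Lpot rho (eps n) g v x) \<longlonglongrightarrow> 0"
      using bound lim
    proof eventually_elim
      case (elim x)
      show ?case
      proof (cases "x \<in> near rho")
        case True
        then have "(\<lambda>n. \<Theta> x * \<bar>exp (pot rho (eps n) g v x - v x) - 1\<bar>) \<longlonglongrightarrow> \<Theta> x * \<bar>exp (v x - v x) - 1\<bar>"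
          by (intro tendsto_intros) (use elim in auto)
        then have z: "(\<lambda>n. \<Theta> x * \<bar>exp (pot rho (eps n) g v x - v x) - 1\<bar>) \<longlonglongrightarrow> 0" by simp
        show ?thesis
        proof (rule Lim_null_comparison[OF always_eventually z], rule allI)
          fix n
          show "norm (c x * (exp (pot rho (eps n) g v x) - exp (v x)) * Lpot rho (eps n) g v x)
            <= \<Theta> x * \<bar>exp (pot rho (eps n) g v x - v x) - 1\<bar>"
            unfolding split real_norm_def abs_mult[of _ "exp _ - 1"]
            using elim(1)[rule_format, of n] by (intro mult_right_mono) auto
        qed
      qed (simp add: c(3))
    qed
    show "AE x in Om. norm (c x * (exp (pot rho (eps n) g v x) - exp (v x)) * Lpot rho (eps n) g v x) <= \<Theta> x * (exp E + 1)" for n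
      using bound upper
    proof eventually_elim
      case (elim x)
      have \<Theta>0: "0 <= \<Theta> x" using elim(1)[rule_format, of n] by (rule order.trans[OF abs_ge_zero])
      show ?case
      proof (cases "x \<in> near rho")
        case True
        then have "exp (pot rho (eps n) g v x - v x) <= exp E" using elim(2) by (simp add: algebra_simps)
        then have "\<bar>exp (pot rho (eps n) g v x - v x) - 1\<bar> <= exp E + 1"
          using exp_gt_zero[of "pot rho (eps n) g v x - v x"] exp_gt_zero[of E] by linarith
        then show ?thesis
          unfolding split real_norm_def abs_mult[of _ "exp _ - 1"]
          using elim(1)[rule_format, of n] \<Theta>0 by (intro mult_mono) auto
      next
        case False
        show ?thesis using \<Theta>0 exp_gt_zero[of E] by (simp add: c(3)[OF False] add_nonneg_nonneg)
      qed
    qed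
  qed (use \<Theta>i in auto)
  then show "(\<lambda>n. LINT x|Om. c x * (exp (pot rho (eps n) g v x) - exp (v x)) * Lpot rho (eps n) g v x) \<longlonglongrightarrow> 0" by simp
qed

section \<open>Mass near the boundary\<close>

text \<open>A crude form of Jordan's inequality: up to \<open>pi / 3\<close> from the mean value
  theorem, beyond from \<open>sin t >= 1/2\<close> and \<open>pi < 4\<close>.\<close>

lemma sin_ge_quarter:
  fixes t :: real
  assumes "0 <= t" "t <= pi / 2"
  shows "t / 4 <= sin t"
proof (cases "t <= pi / 3")
  case True
  show ?thesis
  proof (cases "t = 0")
    case False
    then have t: "0 < t" using assms by simp
    obtain z where z: "0 < z" "z < t" "sin t - sin 0 = (t - 0) * cos z"
      using MVT2[OF t, of sin cos] by (auto intro: DERIV_sin)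
    have "cos (pi / 3) <= cos z" using z True pi_gt_zero by (intro cos_monotone_0_pi_le) auto
    then have "t * (1/4) <= t * cos z" using t by (intro mult_left_mono) (auto simp: cos_60)
    then show ?thesis using z by simp
  qed simp
next
  case False
  have "sin (pi / 6) <= sin t" using False assms pi_gt_zero by (intro sin_monotone_2pi_le) auto
  then have "1/2 <= sin t" by (simp add: sin_30)
  then show ?thesis using assms pi_less_4 by simp
qed

text \<open>In the layer \<open>phi\<close> is the sine of a multiple of the logarithmic distance to
  the circle, which is comparable with \<open>s - 1\<close>. Because it vanishes only linearly,
  \<open>phi\<close> can absorb every error that vanishes on the circle.\<close>

lemma near_phi:
  assumes rho: "side rho" and x: "x \<in> near rho"
  shows "\<bar>x \<bullet> x / rho - 1\<bar> <= 4 * phi x"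
proof -
  have xa: "x \<in> annulus" by (rule near_facts(1)[OF rho x])
  note p = annulus_inner[OF xa]
  have nx: "\<bar>x \<bullet> x / rho - 1\<bar> <= 1/2" using x by (simp add: near_def)
  have ln2: "0 < ln (2::real)" "ln (2::real) <= 1" using ln_2_less_1 by simp_all
  \<comment> \<open>\<open>d\<close> stands for the distance of \<open>s\<close> from 1 and
    \<open>l\<close> for the distance of \<open>ln s\<close> from 0. The bound
    \<open>l <= ln 2\<close> keeps the angle below \<open>pi / 2\<close>, and \<open>pi > 3\<close>
    compensates the factor \<open>2 / 3\<close>.\<close>
  have slope: "d / 4 <= sin (pi / (2 * ln 2) * l)" if "2 / 3 * d <= l" "l <= ln 2" "0 <= d" for d l :: real
  proof -
    have "2 * ln 2 * d <= 2 * 1 * d" using ln2 that by (intro mult_right_mono) auto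
    also have "\<dots> <= 3 * l" using that by simp
    also have "\<dots> <= pi * l" using pi_gt3 that by (intro mult_right_mono) auto
    finally have 1: "d <= pi / (2 * ln 2) * l" using ln2 by (simp add: field_simps)
    have "pi * l <= pi * ln 2" using that by (intro mult_left_mono) auto
    then have 2: "pi / (2 * ln 2) * l <= pi / 2" using ln2 by (simp add: field_simps)
    have "d / 4 <= (pi / (2 * ln 2) * l) / 4" by (rule divide_right_mono[OF 1]) simp
    also have "\<dots> <= sin (pi / (2 * ln 2) * l)" by (rule sin_ge_quarter[OF order.trans[OF that(3) 1] 2])
    finally show "d / 4 <= sin (pi / (2 * ln 2) * l)" .
  qed
  consider "rho = 1/4" | "rho = 1" using rho by (auto simp: side_def)
  then show ?thesis
  proof cases
    case 1
    define s where "s = 4 * (x \<bullet> x)"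
    have s: "1 < s" "s <= 3/2" using p nx unfolding 1 s_def by auto
    have "1 - 1 / s <= ln s" using ln_le_minus_one[of "1 / s"] s by (simp add: ln_div)
    moreover have "2 / 3 * (s - 1) <= 1 - 1 / s"
    proof -
      have "0 <= (s - 1) * (3 - 2 * s)" using s by simp
      then show ?thesis using s by (simp add: field_simps)
    qed
    moreover have "ln s <= ln 2" using s by simp
    ultimately have "(s - 1) / 4 <= sin (pi / (2 * ln 2) * ln s)"
      using slope[of "s - 1" "ln s"] s by linarith
    then show ?thesis using s unfolding 1 phi_def s_def by simp
  next
    case 2
    define s where "s = x \<bullet> x"
    have s: "s < 1" "1/2 <= s" using p nx unfolding 2 s_def by auto
    have "1 - s <= - ln s" using ln_le_minus_one[of s] s by simp
    moreover have "2 / 3 * (1 - s) <= 1 - s" using s by simp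
    ultimately have "2 / 3 * (1 - s) <= - ln s" by (rule order.trans[rotated])
    moreover have "- ln s <= ln 2" using s ln_mono[of "1/2" s] by (simp add: ln_div)
    ultimately have "(1 - s) / 4 <= sin (pi / (2 * ln 2) * (- ln s))"
      using slope[of "1 - s" "- ln s"] s by linarith
    \<comment> \<open>At the outer circle the angle of \<open>phi\<close> approaches
      \<open>pi\<close>, so the sine is reflected.\<close>
    also have "pi / (2 * ln 2) * (- ln s) = pi - pi / (2 * ln 2) * ln (4 * s)"
    proof -
      have "ln (4 * s) = 2 * ln 2 + ln s" using s ln_realpow[of 2 2] by (simp add: ln_mult)
      then show ?thesis using ln2 by (simp add: field_simps)
    qed
    also have "sin \<dots> = phi x" by (simp add: phi_def s_def)
    finally show ?thesis using s unfolding 2 s_def[symmetric] by simp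
  qed
qed

lemma hh_phi:
  assumes rho: "side rho" and x: "x \<in> annulus"
  shows "\<bar>hh rho x\<bar> <= 4 * phi x"
proof (cases "x \<in> near rho")
  case True
  then show ?thesis using hh_abs_le(2)[OF rho, of x] near_phi[OF rho True] by linarith
next
  case False
  then show ?thesis using hh_outside_near[OF side_facts(1)[OF rho] False] phi_nonneg[OF x] by simp
qed

text \<open>Since \<open>x0\<close> lies on the inner circle, \<open>x \<bullet> (x - x0)\<close> is
  half the squared distance to \<open>x0\<close> plus half of \<open>x \<bullet> x - 1/4\<close>.
  The first half costs an error of the order of the distance to the circle; the second gives a term
  \<open>X\<close> in \<open>[0, 1]\<close>, whose product with \<open>2 * \<beta>\<close> is at
  least \<open>min 0 (2 * \<beta>)\<close>. Near the outer circle \<open>x0\<close> is far away and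
  the whole term is an error.\<close>

lemma hh_divergence_term:
  assumes rho: "side rho" and x0: "norm x0 = 1/2" and x: "x \<in> near rho"
  shows "min 0 (2 * \<beta>) - 10 * \<bar>\<beta>\<bar> * \<bar>x \<bullet> x / rho - 1\<bar>
    <= 2 * \<beta> * hh rho x * (x \<bullet> (x - x0)) / ((x - x0) \<bullet> (x - x0))"
proof -
  define y where "y = x - x0"
  define d where "d = \<bar>x \<bullet> x / rho - 1\<bar>"
  have xa: "x \<in> annulus" by (rule near_facts(1)[OF rho x])
  have y0: "norm y > 0" using xa x0 by (auto simp: y_def annulus_def)
  have hd: "\<bar>hh rho x\<bar> <= d" using hh_abs_le(2)[OF rho, of x] by (simp add: d_def)
  have d0: "0 <= d" by (simp add: d_def)
  consider "rho = 1/4" | "rho = 1" using rho by (auto simp: side_def)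
  then have "min 0 (2 * \<beta>) - 10 * \<bar>\<beta>\<bar> * d <= 2 * \<beta> * (hh rho x * (x \<bullet> y) / (y \<bullet> y))"
  proof cases
    case 1
    define h where "h = hh rho x"
    define X where "X = h * (x \<bullet> x - 1/4) / (2 * (y \<bullet> y))"
    have yy: "y \<bullet> y > 0" using y0 by simp
    have p: "1/4 < x \<bullet> x" by (rule annulus_inner[OF xa])
    have "x0 \<bullet> x0 = 1/4" unfolding power2_norm_eq_inner[symmetric] x0 by (simp add: power_divide)
    then have xy: "x \<bullet> y = (y \<bullet> y + (x \<bullet> x - 1/4)) / 2"
      by (simp add: y_def inner_diff_left inner_diff_right inner_commute)
    have e: "h * (x \<bullet> y) / (y \<bullet> y) = h / 2 + X"
      unfolding X_def xy using yy by (simp add: field_simps)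
    have hr: "h = (x \<bullet> x - 1/4) / (x \<bullet> x + 1/4) * plateau (x \<bullet> x / rho)"
      using xa by (simp add: h_def hh_def rho_fun_def 1)
    have h0: "0 <= h" unfolding hr using p plateau_bounds(1) by simp
    have h1: "h <= (x \<bullet> x - 1/4) / (x \<bullet> x + 1/4)"
      unfolding hr using p plateau_bounds(2) by (intro mult_left_le) auto
    have X0: "0 <= X" unfolding X_def using h0 p yy by simp
    \<comment> \<open>The bound is sharp as \<open>x\<close> tends to \<open>x0\<close> along the
      radius. It combines \<open>norm x - 1/2 <= norm y\<close> with
      \<open>(n + 1/2)^2 <= 2 * (n^2 + 1/4)\<close>, whose right side matches the denominator in
      \<open>rho_fun\<close>.\<close>
    have X1: "X <= 1"
    proof -
      define n where "n = norm x"
      have n: "1/2 < n" using annulus_norm(2)[OF xa] by (simp add: n_def)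
      have xn: "x \<bullet> x = n^2" by (simp add: n_def power2_norm_eq_inner)
      have "n - 1/2 <= norm y" using norm_triangle_ineq2[of x x0] x0 by (simp add: n_def y_def)
      then have "(n - 1/2)^2 <= (norm y)^2" using n by (intro power_mono) auto
      then have ny: "(n - 1/2)^2 <= y \<bullet> y" by (simp add: power2_norm_eq_inner)
      have fac: "n^2 - 1/4 = (n - 1/2) * (n + 1/2)" by (simp add: power2_eq_square algebra_simps)
      have "h * (n^2 + 1/4) <= n^2 - 1/4"
        using h1 n unfolding xn by (simp add: pos_le_divide_eq add_nonneg_pos)
      then have "h * (n^2 + 1/4) * (n^2 - 1/4) <= (n^2 - 1/4) * (n^2 - 1/4)"
        using p unfolding xn by (intro mult_right_mono) auto
      also have "\<dots> = (n - 1/2)^2 * (n + 1/2)^2" unfolding fac by (simp add: power2_eq_square mult_ac)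
      also have "\<dots> <= (y \<bullet> y) * (2 * (n^2 + 1/4))"
      proof (intro mult_mono ny)
        have "0 <= (n - 1/2)^2" by simp
        then show "(n + 1/2)^2 <= 2 * (n^2 + 1/4)" by (simp add: power2_eq_square algebra_simps)
      qed auto
      finally have "(h * (n^2 - 1/4)) * (n^2 + 1/4) <= (2 * (y \<bullet> y)) * (n^2 + 1/4)" by (simp add: mult_ac)
      then have "h * (n^2 - 1/4) <= 2 * (y \<bullet> y)" by (rule mult_right_le_imp_le) (simp add: add_nonneg_pos)
      then show ?thesis unfolding X_def xn using yy by (simp add: pos_divide_le_eq)
    qed
    have "min 0 (2 * \<beta>) <= 2 * \<beta> * X"
    proof (cases "\<beta> >= 0")
      case False
      then have "2 * \<beta> * 1 <= 2 * \<beta> * X" using X1 by (intro mult_left_mono_neg) auto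
      then show ?thesis by simp
    qed (use X0 in simp)
    moreover have "- (10 * \<bar>\<beta>\<bar> * d) <= \<beta> * h"
    proof -
      have "\<bar>\<beta> * h\<bar> <= \<bar>\<beta>\<bar> * d" unfolding abs_mult using hd by (intro mult_left_mono) (auto simp: h_def)
      moreover have "0 <= \<bar>\<beta>\<bar> * d" using d0 by simp
      ultimately show ?thesis by linarith
    qed
    ultimately show ?thesis unfolding h_def[symmetric] e by (simp add: distrib_left)
  next
    case 2
    have "7/10 <= norm x" by (rule near_norm(2)[OF rho x 2])
    then have ny: "1/5 <= norm y" using norm_triangle_ineq2[of x x0] x0 unfolding y_def by linarith
    have "norm x * norm y <= 1 * norm y" using annulus_norm(1)[OF xa] by (intro mult_right_mono) auto
    also have "\<dots> <= 5 * (norm y * norm y)" using mult_right_mono[OF ny, of "norm y"] by simp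
    finally have "\<bar>x \<bullet> y\<bar> <= 5 * (y \<bullet> y)"
      using Cauchy_Schwarz_ineq2[of x y] by (simp add: power2_norm_eq_inner[symmetric] power2_eq_square)
    then have q: "\<bar>(x \<bullet> y) / (y \<bullet> y)\<bar> <= 5" using y0 by (simp add: abs_divide pos_divide_le_eq)
    have "\<bar>2 * \<beta> * (hh rho x * ((x \<bullet> y) / (y \<bullet> y)))\<bar> <= (2 * \<bar>\<beta>\<bar>) * (d * 5)"
      unfolding abs_mult using hd q d0 by (intro mult_mono) auto
    then have "- (10 * \<bar>\<beta>\<bar> * d) <= 2 * \<beta> * (hh rho x * (x \<bullet> y) / (y \<bullet> y))"
      unfolding times_divide_eq_right by (subst (asm) abs_le_iff) simp
    moreover have "min 0 (2 * \<beta>) <= 0" by simp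
    ultimately show ?thesis by linarith
  qed
  then show ?thesis unfolding y_def[symmetric] d_def[symmetric] by (simp add: mult.assoc)
qed

text \<open>The 1 is the value of \<open>ell\<close> on the circle, lost at rate 21;
  \<open>2 * hh\<close> adds the rate 2 and the derivative of the weight
  \<open>10 * \<bar>\<beta>\<bar>\<close>. The factor 4 is that of \<open>near_phi\<close>.\<close>

lemma Jd_lower_bound:
  assumes rho: "side rho" and x0: "norm x0 = 1/2" and x: "x \<in> near rho"
  shows "1 + min 0 (2 * \<beta>) - 4 * (23 + 10 * \<bar>\<beta>\<bar>) * phi x <= Jd x0 \<beta> rho 0 x"
proof -
  define d where "d = \<bar>x \<bullet> x / rho - 1\<bar>"
  have d: "d <= 1/2" "d <= 4 * phi x" using x near_phi[OF rho x] by (auto simp: d_def near_def)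
  have "(23 + 10 * \<bar>\<beta>\<bar>) * d <= (23 + 10 * \<bar>\<beta>\<bar>) * (4 * phi x)" using d by (intro mult_left_mono) auto
  moreover have "- d <= hh rho x" using hh_abs_le(2)[OF rho, of x] by (simp add: d_def abs_le_iff)
  moreover have "1 - 21 * d <= ell (x \<bullet> x / rho)" using ell_bounds(1) d by (simp add: d_def)
  moreover note hh_divergence_term[OF rho x0 x, of \<beta>, folded d_def]
  ultimately show ?thesis unfolding Jd_def by (simp add: algebra_simps)
qed

lemma Jd_outside_near: "side rho ==> x \<in> annulus ==> x \<notin> near rho ==> Jd x0 \<beta> rho \<delta> x = 0"
  using hh_outside_near[OF side_facts(1), of rho x] ell_outside[of "x \<bullet> x / rho"] by (simp add: Jd_def near_def)

text \<open>The weight may blow up at \<open>x0\<close>, but \<open>hh\<close> supplies one power of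
  the distance, and \<open>1 + 2 * \<beta>\<close> is positive.\<close>

lemma weight_hh_bound:
  assumes rho: "side rho" and x0: "norm x0 = 1/2" and \<beta>: "\<beta> > -1/2" and x: "x \<in> annulus"
  shows "weight x0 \<beta> x * \<bar>hh rho x\<bar> <= 6 * 2 powr (1 + 2 * \<beta>)"
proof -
  define n where "n = norm (x - x0)"
  have n: "0 < n" using x x0 by (auto simp: n_def annulus_def)
  have n2: "n <= 2" using norm_triangle_ineq4[of x x0] annulus_norm(1)[OF x] x0 unfolding n_def by linarith
  have "weight x0 \<beta> x * \<bar>hh rho x\<bar> <= n powr (2 * \<beta>) * (6 * n powr 1)"
    using hh_le_distance[OF rho x0 x] n by (simp add: weight_def n_def mult_left_mono)
  also have "\<dots> = 6 * n powr (1 + 2 * \<beta>)" by (simp add: powr_add)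
  also have "\<dots> <= 6 * 2 powr (1 + 2 * \<beta>)" using n n2 \<beta> by (intro mult_left_mono powr_mono2) auto
  finally show ?thesis .
qed

text \<open>Convergence of the energy itself is not claimed; it is bounded by a sequence with a
  known limit. The way there replaces the Green kernel by \<open>Lpot\<close> and
  \<open>exp v\<close> by \<open>exp\<close> of the potential, where
  \<open>exp_radial_inequality\<close> applies, and then returns to \<open>exp v\<close> by
  dominated convergence.\<close>

lemma radial_energy_limit:
  fixes V g u v :: "real^2 => real" and b :: real
  assumes rho: "side rho" and x0: "norm x0 = 1/2" and \<beta>: "\<beta> > -1/2" and a: "0 < a"
    and sys: "half_system x0 \<beta> a b A V u v"
    and eps: "!!n. 0 < eps n"
    and g: "integrable Om g" "!!z. z \<in> annulus ==> 0 <= g z"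
    and v: "integrable Om v"
    and D: "!!n x. x \<in> near rho ==> \<bar>LINT z|Om. v z * kLR rho (eps n) x z\<bar> <= D"
    and upper: "AE x in Om. x \<in> near rho --> (\<forall>n. pot rho (eps n) g v x <= v x + E)"
    and lim: "AE x in Om. x \<in> near rho --> (\<lambda>n. pot rho (eps n) g v x) \<longlonglongrightarrow> v x"
    and int4: "(\<integral>\<^sup>+x. indicator (near rho) x * ennreal (exp (4 * v x)) \<partial>Om) < \<infinity>"
  defines "f \<equiv> \<lambda>x. weight x0 \<beta> x * V x * exp (v x)"
  obtains r :: "nat => real" where
    "!!n. (LINT x|Om. f x * hh rho x *
        (LINT z|Om. g z * (chi rho z * kLG rho (eps n) x z))) <= r n"
    "r \<longlonglongrightarrow> D * (LINT x|Om. f x * \<bar>hh rho x\<bar>)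
      - kappa * (LINT x|Om. weight x0 \<beta> x * (V x * Jd x0 \<beta> rho 0 x - A * norm x * \<bar>hh rho x\<bar>) * exp (v x))"
    "integrable Om (\<lambda>x. weight x0 \<beta> x * (V x * Jd x0 \<beta> rho 0 x - A * norm x * \<bar>hh rho x\<bar>) * exp (v x))"
proof -
  note r = side_facts[OF rho]
  note hs = half_systemD[OF sys a]
  obtain L G where V: "L-lipschitz_on annulus V" "has_weak_gradient annulus V G" "Linfty_norm annulus G <= ereal A"
    using sys by (auto simp: half_system_def)
  have VB: "\<bar>V x\<bar> <= b" if "x \<in> annulus" for x using hs(2,3)[OF that] a by simp
  have [measurable]: "v \<in> borel_measurable Om" "V \<in> borel_measurable Om" using v hs(1) by simp_all
  have fi: "integrable Om f" unfolding f_def by (rule hs(7))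
  have fh: "f x * t = weight x0 \<beta> x * V x * t * exp (v x)" for x t by (simp add: f_def)
  have f0: "0 <= f x" if "x \<in> annulus" for x using hs(2)[OF that] a by (simp add: f_def weight_nonneg)
  define c where "c x = weight x0 \<beta> x * V x * hh rho x" for x
  have cm: "c \<in> borel_measurable Om" unfolding c_def[abs_def] by measurable
  have cB: "\<bar>c x\<bar> <= b * (6 * 2 powr (1 + 2 * \<beta>))" if "x \<in> annulus" for x
  proof -
    have "\<bar>V x\<bar> * (weight x0 \<beta> x * \<bar>hh rho x\<bar>) <= b * (6 * 2 powr (1 + 2 * \<beta>))"
      by (rule mult_mono[OF VB[OF that] weight_hh_bound[OF rho x0 \<beta> that]])
        (use VB[OF that] in \<open>auto simp: weight_nonneg\<close>)
    then show ?thesis by (simp add: c_def abs_mult weight_nonneg mult_ac)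
  qed
  have c0: "c x = 0" if "x \<notin> near rho" for x using hh_outside_near[OF r(1) that] by (simp add: c_def)
  define P where "P n = pot rho (eps n) g v" for n
  define LP where "LP n = Lpot rho (eps n) g v" for n
  note pf = pot_facts[OF rho eps g(1) v, folded P_def LP_def]
  note ex = pot_exchange[OF rho eps g v D upper lim int4 cm cB c0, folded P_def LP_def]
  define err where "err n = (LINT x|Om. c x * (exp (P n x) - exp (v x)) * LP n x)" for n
  define d where "d x = weight x0 \<beta> x * (V x * Jd x0 \<beta> rho 0 x - A * norm x * \<bar>hh rho x\<bar>)" for x
  define X where "X n = (LINT x|Om. d x * exp (P n x))" for n
  have rad: "(LINT x|Om. c x * exp (P n x) * LP n x) <= - X n" "integrable Om (\<lambda>x. c x * exp (P n x) * LP n x)" for n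
  proof -
    obtain B where B: "!!x. norm x <= 2 ==> \<bar>P n x\<bar> <= B" "!!x. norm x <= 2 ==> \<bar>LP n x\<bar> <= B"
      using pf(3) by blast
    have c: "V x * weight x0 \<beta> x * exp (P n x) * hh rho x * LP n x = c x * exp (P n x) * LP n x" for x
      by (simp add: c_def)
    note e = exp_radial_inequality[OF rho x0 \<beta> V VB pf(1,2) B pf(4), unfolded c, folded d_def]
    show "(LINT x|Om. c x * exp (P n x) * LP n x) <= - X n" using e(1) by (simp add: X_def)
    show "integrable Om (\<lambda>x. c x * exp (P n x) * LP n x)" by (rule e(2))
  qed
  define S where "S x = \<bar>c x * exp (v x)\<bar>" for x
  \<comment> \<open>\<open>X\<close> comes from the radial inequality for the potential,
    \<open>err\<close> from exchanging the exponentials, and the last term from the cutoff error in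
    \<open>Lpot\<close>; the factor \<open>kappa\<close> undoes the normalisation.\<close>
  define r where "r n = kappa * (- X n - err n) + D * (LINT x|Om. S x)" for n
  have S: "S x = f x * \<bar>hh rho x\<bar>" if "x \<in> annulus" for x
    using hs(2)[OF that] a by (simp add: S_def c_def f_def abs_mult weight_nonneg)
  have upper_energy: "(LINT x|Om. f x * hh rho x * (LINT z|Om. g z * (chi rho z * kLG rho (eps n) x z))) <= r n" for n
  proof -
    have kc: "continuous_on UNIV (\<lambda>p. chi rho (snd p) * kLG rho (eps n) (fst p) (snd p :: real^2))"
      by (intro continuous_intros kernel_continuous(2,6)[OF side_facts(1)[OF rho] eps])
    note kp = continuous_kernel_potential[OF g(1), of "\<lambda>x z. chi rho z * kLG rho (eps n) x z", OF kc]
    define I where "I x = (LINT z|Om. g z * (chi rho z * kLG rho (eps n) x z))" for x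
    define R where "R x = (LINT z|Om. v z * kLR rho (eps n) x z)" for x
    have LPn: "kappa * LP n x = I x + R x" for x using kappa_pos by (simp add: LP_def Lpot_def I_def R_def)
    obtain B where B: "!!x. norm x <= 2 ==> \<bar>I x\<bar> <= B" using kp(2) by (auto simp: I_def)
    have "(LINT x|Om. (c x * exp (v x)) * I x) <= (LINT x|Om. kappa * (c x * exp (v x) * LP n x) + D * S x)"
    proof (rule integral_mono)
      show "integrable Om (\<lambda>x. (c x * exp (v x)) * I x)"
      proof (rule integrable_mult_bounded[OF ex(3), where B = B])
        show "I \<in> borel_measurable Om" unfolding I_def[abs_def] by (rule borel_measurable_lebesgue_on[OF kp(1)])
        show "\<bar>I x\<bar> <= B" if "x \<in> space Om" for x using B[of x] annulus_norm(1)[of x] that by simp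
      qed
      show "integrable Om (\<lambda>x. kappa * (c x * exp (v x) * LP n x) + D * S x)"
        unfolding S_def using ex(2)[of n] ex(3) by auto
      fix x
      show "c x * exp (v x) * I x <= kappa * (c x * exp (v x) * LP n x) + D * S x"
      proof (cases "x \<in> near rho")
        case True
        have "- (S x * D) <= c x * exp (v x) * R x"
        proof -
          have "\<bar>c x * exp (v x) * R x\<bar> <= S x * D"
            unfolding abs_mult[of _ "R x"] S_def
            by (rule mult_left_mono) (use D[OF True] in \<open>simp_all add: R_def\<close>)
          then show ?thesis by linarith
        qed
        moreover have "kappa * (c x * exp (v x) * LP n x) = c x * exp (v x) * I x + c x * exp (v x) * R x"
          unfolding distrib_left[symmetric] LPn[symmetric] by simp
        ultimately show ?thesis by (simp add: mult.commute)
      qed (simp add: c0 S_def)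
    qed
    also have "\<dots> = kappa * (LINT x|Om. c x * exp (v x) * LP n x) + D * (LINT x|Om. S x)"
      unfolding S_def using ex(2)[of n] ex(3) by (subst Bochner_Integration.integral_add) auto
    also have "(LINT x|Om. c x * exp (v x) * LP n x)
      = (LINT x|Om. c x * exp (P n x) * LP n x) - (LINT x|Om. c x * exp (P n x) * LP n x - c x * exp (v x) * LP n x)"
      using Bochner_Integration.integral_diff[OF rad(2)[of n] ex(2)[of n]] by linarith
    also have "\<dots> = (LINT x|Om. c x * exp (P n x) * LP n x) - err n"
      by (simp add: err_def left_diff_distrib right_diff_distrib)
    also have "kappa * ((LINT x|Om. c x * exp (P n x) * LP n x) - err n) <= kappa * (- X n - err n)"
      using rad(1)[of n] kappa_pos by (intro mult_left_mono) auto
    finally show ?thesis by (simp add: r_def I_def c_def f_def mult_ac)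
  qed
  define M where "M = b * (11 + 12 * \<bar>\<beta>\<bar>) + \<bar>A\<bar> * 1 * 1"
  have d_le: "\<bar>d x\<bar> <= weight x0 \<beta> x * M" if x: "x \<in> annulus" for x
  proof -
    have "\<bar>V x * Jd x0 \<beta> rho 0 x\<bar> <= b * (11 + 12 * \<bar>\<beta>\<bar>)"
      unfolding abs_mult using VB[OF x] Jd_abs_le[OF rho x0 x, of 0 \<beta>] by (intro mult_mono) auto
    moreover have "\<bar>A * norm x * \<bar>hh rho x\<bar>\<bar> <= \<bar>A\<bar> * 1 * 1"
      unfolding abs_mult using annulus_norm(1)[OF x] hh_abs_le(1)[OF rho, of x] by (intro mult_mono) auto
    ultimately have "\<bar>V x * Jd x0 \<beta> rho 0 x - A * norm x * \<bar>hh rho x\<bar>\<bar> <= M"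
      unfolding M_def by (intro order.trans[OF abs_triangle_ineq4] add_mono)
    then show ?thesis unfolding d_def abs_mult[of "weight x0 \<beta> x"] abs_of_nonneg[OF weight_nonneg]
      by (intro mult_left_mono weight_nonneg)
  qed
  have d0: "d x = 0" if "x \<in> annulus" "x \<notin> near rho" for x
    using Jd_outside_near[OF rho that] hh_outside_near[OF side_facts(1)[OF rho] that(2)] by (simp add: d_def)
  have dm [measurable]: "d \<in> borel_measurable Om"
  proof -
    have [measurable]: "(\<lambda>x. norm x) \<in> borel_measurable Om" by (rule borel_measurable_lebesgue_on) measurable
    show ?thesis unfolding d_def[abs_def] by measurable
  qed
  have Pm [measurable]: "P n \<in> borel_measurable Om" for n by (rule borel_measurable_lebesgue_on[OF pf(1)])
  have wi: "integrable Om (\<lambda>x. weight x0 \<beta> x * exp (v x) * (M * exp E))" using hs(6) by simp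
  have meas: "(\<lambda>x. d x * exp (v x)) \<in> borel_measurable Om" "(\<lambda>x. d x * exp (P n x)) \<in> borel_measurable Om" for n
    by measurable
  have conv: "AE x in Om. (\<lambda>n. d x * exp (P n x)) \<longlonglongrightarrow> d x * exp (v x)"
    using lim AE_space
  proof eventually_elim
    case (elim x)
    show ?case
    proof (cases "x \<in> near rho")
      case True
      then show ?thesis unfolding P_def using elim by (intro tendsto_intros) auto
    next
      case False
      then show ?thesis using d0[of x] elim by simp
    qed
  qed
  have bd: "AE x in Om. norm (d x * exp (P n x)) <= weight x0 \<beta> x * exp (v x) * (M * exp E)" for n
    using upper AE_space
  proof eventually_elim
    case (elim x)
    then have x: "x \<in> annulus" by simp
    show ?case
    proof (cases "x \<in> near rho")
      case True
      then have "exp (P n x) <= exp (v x) * exp E" using elim(1) unfolding P_def exp_add[symmetric] by simp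
      then have "\<bar>d x\<bar> * exp (P n x) <= (weight x0 \<beta> x * M) * (exp (v x) * exp E)"
        using d_le[OF x] by (intro mult_mono) auto
      then show ?thesis by (simp add: abs_mult mult_ac)
    next
      case False
      have "0 <= weight x0 \<beta> x * M" using d_le[OF x] by linarith
      then have "0 <= weight x0 \<beta> x * M * (exp (v x) * exp E)" by simp
      then show ?thesis using d0[OF x False] by (simp add: mult_ac)
    qed
  qed
  have Xlim: "X \<longlonglongrightarrow> (LINT x|Om. d x * exp (v x))"
    unfolding X_def[abs_def] by (rule integral_dominated_convergence[OF meas wi conv bd])
  have di: "integrable Om (\<lambda>x. d x * exp (v x))"
    by (rule integrable_dominated_convergence[OF meas wi conv bd])
  have "r \<longlonglongrightarrow> kappa * (- (LINT x|Om. d x * exp (v x)) - 0) + D * (LINT x|Om. S x)"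
    unfolding r_def[abs_def] err_def[abs_def] by (intro tendsto_intros Xlim ex(1))
  moreover have "(LINT x|Om. S x) = (LINT x|Om. f x * \<bar>hh rho x\<bar>)"
    by (rule Bochner_Integration.integral_cong) (simp_all add: S)
  ultimately have rlim: "r \<longlonglongrightarrow> D * (LINT x|Om. f x * \<bar>hh rho x\<bar>) - kappa * (LINT x|Om. d x * exp (v x))" by simp
  show ?thesis
    using that[OF upper_energy rlim[unfolded d_def] di[unfolded d_def]] .
qed

text \<open>In the layer \<open>V\<close> times the divergence is at least
  \<open>a * (1 + min 0 (2 * \<beta>))\<close> up to a multiple of \<open>phi\<close>. The bound
  \<open>V <= b\<close> and \<open>hh_phi\<close> turn the remaining terms, including that of the
  gradient, into the mass weighted by \<open>phi\<close>, which is already under control.\<close>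

lemma radial_density_lower_bound:
  assumes rho: "side rho" and x0: "norm x0 = 1/2" and \<beta>: "\<beta> > -1/2" and a: "0 < a"
    and sys: "half_system x0 \<beta> a b A V u v"
    and di: "integrable Om (\<lambda>x. weight x0 \<beta> x * (V x * Jd x0 \<beta> rho 0 x - A * norm x * \<bar>hh rho x\<bar>) * exp (v x))"
  shows "a * (1 + min 0 (2 * \<beta>)) * (LINT x|Om. indicator (near rho) x * (weight x0 \<beta> x * exp (v x)))
      - (b * (4 * (23 + 10 * \<bar>\<beta>\<bar>)) + 4 * \<bar>A\<bar>) * (LINT x|Om. weight x0 \<beta> x * exp (v x) * phi x)
    <= (LINT x|Om. weight x0 \<beta> x * (V x * Jd x0 \<beta> rho 0 x - A * norm x * \<bar>hh rho x\<bar>) * exp (v x))"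
    "integrable Om (\<lambda>x. indicator (near rho) x * (weight x0 \<beta> x * exp (v x)))"
proof -
  note hs = half_systemD[OF sys a]
  define c where "c = 1 + min 0 (2 * \<beta>)"
  define K where "K = 4 * (23 + 10 * \<bar>\<beta>\<bar>)"
  have c: "c > 0" using \<beta> by (simp add: c_def min_def)
  have K: "K >= 0" by (simp add: K_def)
  have Im: "(\<lambda>x. indicator (near rho) x :: real) \<in> borel_measurable Om"
    by (rule borel_measurable_lebesgue_on) measurable
  have "integrable Om (\<lambda>x. (weight x0 \<beta> x * exp (v x)) * indicator (near rho) x)"
    by (rule integrable_mult_bounded[OF hs(6) Im, where B = 1]) (simp add: indicator_def)
  then show ni: "integrable Om (\<lambda>x. indicator (near rho) x * (weight x0 \<beta> x * exp (v x)))" by (simp add: mult.commute)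
  note pi = phi_mult_integrable(1)[OF hs(6)]
  have "a * c * (LINT x|Om. indicator (near rho) x * (weight x0 \<beta> x * exp (v x)))
      - (b * K + 4 * \<bar>A\<bar>) * (LINT x|Om. weight x0 \<beta> x * exp (v x) * phi x)
    = (LINT x|Om. a * c * (indicator (near rho) x * (weight x0 \<beta> x * exp (v x)))
      - (b * K + 4 * \<bar>A\<bar>) * (weight x0 \<beta> x * exp (v x) * phi x))"
    using ni pi by (subst Bochner_Integration.integral_diff) (auto intro: integrable_mult_right)
  also have "\<dots> <= (LINT x|Om. weight x0 \<beta> x * (V x * Jd x0 \<beta> rho 0 x - A * norm x * \<bar>hh rho x\<bar>) * exp (v x))"
  proof (rule integral_mono[OF _ di])
    show "integrable Om (\<lambda>x. a * c * (indicator (near rho) x * (weight x0 \<beta> x * exp (v x)))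
      - (b * K + 4 * \<bar>A\<bar>) * (weight x0 \<beta> x * exp (v x) * phi x))"
      by (intro Bochner_Integration.integrable_diff integrable_mult_right ni pi)
    fix x assume "x \<in> space Om"
    then have x: "x \<in> annulus" by simp
    note V = hs(2,3)[OF x]
    have p0: "0 <= phi x" by (rule phi_nonneg[OF x])
    have "a * c * indicator (near rho) x - (b * K + 4 * \<bar>A\<bar>) * phi x <= V x * Jd x0 \<beta> rho 0 x - A * norm x * \<bar>hh rho x\<bar>"
    proof (cases "x \<in> near rho")
      case True
      have "V x * (c - K * phi x) <= V x * Jd x0 \<beta> rho 0 x"
        using Jd_lower_bound[OF rho x0 True, of \<beta>] V a by (intro mult_left_mono) (auto simp: c_def K_def)
      moreover have "a * c <= V x * c" using V c by (intro mult_right_mono) auto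
      moreover have "V x * (K * phi x) <= b * (K * phi x)" using V K p0 by (intro mult_right_mono) auto
      moreover have "A * norm x * \<bar>hh rho x\<bar> <= \<bar>A\<bar> * 1 * (4 * phi x)"
        using annulus_norm(1)[OF x] hh_phi[OF rho x] by (intro mult_mono) auto
      ultimately show ?thesis using True by (simp add: algebra_simps)
    next
      case False
      have "0 <= (b * K + 4 * \<bar>A\<bar>) * phi x" using V a K p0 by (intro mult_nonneg_nonneg add_nonneg_nonneg) auto
      then show ?thesis
        using False Jd_outside_near[OF rho x False] hh_outside_near[OF side_facts(1)[OF rho] False] by simp
    qed
    then have "(weight x0 \<beta> x * exp (v x)) * (a * c * indicator (near rho) x - (b * K + 4 * \<bar>A\<bar>) * phi x)
        <= (weight x0 \<beta> x * exp (v x)) * (V x * Jd x0 \<beta> rho 0 x - A * norm x * \<bar>hh rho x\<bar>)"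
      by (rule mult_left_mono) (simp add: weight_nonneg)
    then show "a * c * (indicator (near rho) x * (weight x0 \<beta> x * exp (v x)))
      - (b * K + 4 * \<bar>A\<bar>) * (weight x0 \<beta> x * exp (v x) * phi x)
      <= weight x0 \<beta> x * (V x * Jd x0 \<beta> rho 0 x - A * norm x * \<bar>hh rho x\<bar>) * exp (v x)"
      by (simp add: algebra_simps)
  qed
  finally show "a * (1 + min 0 (2 * \<beta>)) * (LINT x|Om. indicator (near rho) x * (weight x0 \<beta> x * exp (v x)))
      - (b * (4 * (23 + 10 * \<bar>\<beta>\<bar>)) + 4 * \<bar>A\<bar>) * (LINT x|Om. weight x0 \<beta> x * exp (v x) * phi x)
    <= (LINT x|Om. weight x0 \<beta> x * (V x * Jd x0 \<beta> rho 0 x - A * norm x * \<bar>hh rho x\<bar>) * exp (v x))"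
    by (simp add: c_def K_def)
qed

text \<open>Only the sum of the two energies is bounded from below, so the equations cannot be
  treated one by one. The outcome is a bound for the two layer masses with positive coefficients,
  and the one that belongs to \<open>u\<close> is dropped by its sign.\<close>

lemma boundary_layer_mass_bound:
  fixes b1 b2 :: real
  assumes rho: "side rho" and x0: "norm x0 = 1/2" and \<beta>: "\<beta>1 > -1/2" "\<beta>2 > -1/2" and a: "0 < a1" "0 < a2"
  shows "\<exists>C. \<forall>V W u v. full_system x0 \<beta>1 a1 b1 A1 \<beta>2 a2 b2 A2 V W u v -->
    (LINT x|Om. indicator (near rho) x * (weight x0 \<beta>1 x * exp (v x))) <= C"
proof -
  note r = side_facts[OF rho]
  obtain C1 where C1: "!!V W u v. full_system x0 \<beta>1 a1 b1 A1 \<beta>2 a2 b2 A2 V W u v ==>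
      (LINT x|Om. weight x0 \<beta>1 x * V x * exp (v x) * phi x) <= C1 \<and>
      (LINT x|Om. weight x0 \<beta>1 x * exp (v x) * phi x) <= C1 \<and> (LINT x|Om. \<bar>v x\<bar> * phi x) <= C1"
    using full_system_weighted_bound[OF x0 a, of \<beta>1 \<beta>2] by blast
  obtain C2 where C2: "!!V W u v. full_system x0 \<beta>2 a2 b2 A2 \<beta>1 a1 b1 A1 V W u v ==>
      (LINT x|Om. weight x0 \<beta>2 x * V x * exp (v x) * phi x) <= C2 \<and>
      (LINT x|Om. weight x0 \<beta>2 x * exp (v x) * phi x) <= C2 \<and> (LINT x|Om. \<bar>v x\<bar> * phi x) <= C2"
    using full_system_weighted_bound[OF x0 a(2,1), of \<beta>2 \<beta>1] by blast
  obtain K where K: "K >= 0" "!!eps x z. 0 < eps ==> eps <= 1 ==> x \<in> near rho ==> z \<in> annulus ==>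
    \<bar>kR rho eps x z\<bar> <= K * phi z \<and> \<bar>kLR rho eps x z\<bar> <= K * phi z"
    using kR_kLR_bound[OF rho] by blast
  define M1 where "M1 = b1 * (4 * (23 + 10 * \<bar>\<beta>1\<bar>)) + 4 * \<bar>A1\<bar>"
  define M2 where "M2 = b2 * (4 * (23 + 10 * \<bar>\<beta>2\<bar>)) + 4 * \<bar>A2\<bar>"
  define c1 where "c1 = a1 * (1 + min 0 (2 * \<beta>1))"
  define c2 where "c2 = a2 * (1 + min 0 (2 * \<beta>2))"
  have c: "c1 > 0" "c2 > 0" using a \<beta> by (auto simp: c1_def c2_def min_def)
  \<comment> \<open>The error kernels are bounded by multiples of \<open>phi\<close>, so their
    potentials see \<open>u\<close> and \<open>v\<close> only through the integrals of
    \<open>\<bar>u\<bar> * phi\<close> and \<open>\<bar>v\<bar> * phi\<close>, which have uniform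
    bounds.\<close>
  have R_bound: "\<bar>LINT z|Om. w z * kR rho eps x z\<bar> <= K * C" "\<bar>LINT z|Om. w z * kLR rho eps x z\<bar> <= K * C"
    if w: "integrable Om w" "(LINT z|Om. \<bar>w z\<bar> * phi z) <= C" and eps: "0 < eps" "eps <= 1" and x: "x \<in> near rho"
    for w C eps x
  proof -
    have "\<bar>LINT z|Om. w z * k x z\<bar> <= K * C"
      if k: "continuous_on UNIV (\<lambda>p. k (fst p) (snd p))" "!!z. z \<in> annulus ==> \<bar>k x z\<bar> <= K * phi z" for k
    proof -
      have "\<bar>LINT z|Om. w z * k x z\<bar> <= (LINT z|Om. K * (\<bar>w z\<bar> * phi z))"
      proof (rule integral_abs_bound_integral[OF continuous_kernel_potential(3)[OF w(1) k(1)]])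
        show "integrable Om (\<lambda>z. K * (\<bar>w z\<bar> * phi z))"
          by (intro integrable_mult_right phi_mult_integrable(1) integrable_abs w(1))
        show "\<bar>w z * k x z\<bar> <= K * (\<bar>w z\<bar> * phi z)" if "z \<in> space Om" for z
          using mult_left_mono[OF k(2)[of z], of "\<bar>w z\<bar>"] that by (simp add: abs_mult mult_ac)
      qed
      also have "\<dots> <= K * C" using w(2) K(1) by (simp only: integral_mult_right_zero) (rule mult_left_mono)
      finally show ?thesis .
    qed
    from this[of "kR rho eps"] this[of "kLR rho eps"]
    show "\<bar>LINT z|Om. w z * kR rho eps x z\<bar> <= K * C" "\<bar>LINT z|Om. w z * kLR rho eps x z\<bar> <= K * C"
      using kernel_continuous(5)[OF r(1) eps(1)] kLR_continuous[OF r(1) eps(1)] K(2)[OF eps x] by auto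
  qed
  show ?thesis
  proof (intro exI[of _ "(\<bar>M1\<bar> * C1 + \<bar>M2\<bar> * C2 + (4 * K * C1 * C1 + 4 * K * C2 * C2) / kappa) / c1"] allI impI)
    fix V W u v assume sys: "full_system x0 \<beta>1 a1 b1 A1 \<beta>2 a2 b2 A2 V W u v"
    then have s1: "half_system x0 \<beta>1 a1 b1 A1 V u v" and s2: "half_system x0 \<beta>2 a2 b2 A2 W v u"
      by (simp_all add: full_system_def)
    note b1 = C1[OF sys] and b2 = C2[OF full_system_sym[OF sys]]
    note h1 = half_systemD[OF s1 a(1)] and h2 = half_systemD[OF s2 a(2)]
    define f where "f = (\<lambda>x. weight x0 \<beta>1 x * V x * exp (v x))"
    define g where "g = (\<lambda>x. weight x0 \<beta>2 x * W x * exp (u x))"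
    note h1f = h1(7,8)[folded f_def] and h2g = h2(7,8)[folded g_def]
    have f0: "0 <= f x" and g0: "0 <= g x" if "x \<in> annulus" for x
      using h1(2)[OF that] h2(2)[OF that] a by (simp_all add: f_def g_def weight_nonneg)
    obtain eps :: "nat => real" where eps: "!!n. 0 < eps n" "!!n. eps n <= 1" "decseq eps" "eps \<longlonglongrightarrow> 0"
      and limu: "AE x in Om. x \<in> near rho --> (\<lambda>n. pot rho (eps n) f u x) \<longlonglongrightarrow> u x"
      and limv: "AE x in Om. x \<in> near rho --> (\<lambda>n. pot rho (eps n) g v x) \<longlonglongrightarrow> v x"
      by (rule pot_subsequence2[OF rho h1(4) h1f(2,1) h2(4) h2g(2,1)]) (rule that)
    have bu: "(LINT z|Om. \<bar>u z\<bar> * phi z) <= C2" and bv: "(LINT z|Om. \<bar>v z\<bar> * phi z) <= C1" using b1 b2 by blast+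
    note Ru = R_bound[OF h1(5) bu eps(1,2)] and Rv = R_bound[OF h2(5) bv eps(1,2)]
    note pu = pot_limit_bounds[OF rho eps(1,2,3) h1f(1) f0 h1(5) Ru(1) limu]
    note pv = pot_limit_bounds[OF rho eps(1,2,3) h2g(1) g0 h2(5) Rv(1) limv]
    define X1 where "X1 = (LINT x|Om. weight x0 \<beta>1 x * (V x * Jd x0 \<beta>1 rho 0 x - A1 * norm x * \<bar>hh rho x\<bar>) * exp (v x))"
    define X2 where "X2 = (LINT x|Om. weight x0 \<beta>2 x * (W x * Jd x0 \<beta>2 rho 0 x - A2 * norm x * \<bar>hh rho x\<bar>) * exp (u x))"
    define S1 where "S1 = (LINT x|Om. f x * \<bar>hh rho x\<bar>)"
    define S2 where "S2 = (LINT x|Om. g x * \<bar>hh rho x\<bar>)"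
    obtain r1 where r1: "!!n. (LINT x|Om. f x * hh rho x * (LINT z|Om. g z * (chi rho z * kLG rho (eps n) x z))) <= r1 n"
      "r1 \<longlonglongrightarrow> K * C1 * S1 - kappa * X1"
      and i1: "integrable Om (\<lambda>x. weight x0 \<beta>1 x * (V x * Jd x0 \<beta>1 rho 0 x - A1 * norm x * \<bar>hh rho x\<bar>) * exp (v x))"
      by (rule radial_energy_limit[OF rho x0 \<beta>(1) a(1) s1 eps(1) h2g(1) g0 h2(5) Rv(2) pv(1) limv pv(2)];
        (assumption | rule that[unfolded S1_def X1_def f_def]; assumption))
    obtain r2 where r2: "!!n. (LINT x|Om. g x * hh rho x * (LINT z|Om. f z * (chi rho z * kLG rho (eps n) x z))) <= r2 n"
      "r2 \<longlonglongrightarrow> K * C2 * S2 - kappa * X2"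
      and i2: "integrable Om (\<lambda>x. weight x0 \<beta>2 x * (W x * Jd x0 \<beta>2 rho 0 x - A2 * norm x * \<bar>hh rho x\<bar>) * exp (u x))"
      by (rule radial_energy_limit[OF rho x0 \<beta>(2) a(2) s2 eps(1) h1f(1) f0 h1(5) Ru(2) pu(1) limu pu(2)];
        (assumption | rule that[unfolded S2_def X2_def g_def]; assumption))
    define e where "e n = (LINT x|Om. f x * (LINT z|Om. g z * (eps n / (kQ x z + eps n))))" for n
    have e0: "(\<lambda>n. - 2 * e n) \<longlonglongrightarrow> - 2 * 0"
      unfolding e_def by (intro tendsto_mult_left energy_defect_tendsto eps(1,4) h1f(1) h2g(1))
    have le: "- 2 * e n <= r1 n + r2 n" for n
      using symmetrised_energy[OF rho eps(1) h1f(1) f0 h2g(1) g0, of n] r1(1)[of n] r2(1)[of n] unfolding e_def by linarith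
    \<comment> \<open>The regularisation defect disappears in the limit, so the limits of the two
      upper bounds have a nonnegative sum.\<close>
    have "- 2 * 0 <= (K * C1 * S1 - kappa * X1) + (K * C2 * S2 - kappa * X2)"
      by (rule LIMSEQ_le[OF e0 tendsto_add[OF r1(2) r2(2)]]) (use le in blast)
    then have X: "kappa * (X1 + X2) <= K * C1 * S1 + K * C2 * S2" by (simp add: distrib_left)
    have C0: "0 <= C1" "0 <= C2"
    proof -
      have "0 <= (LINT x|Om. \<bar>w x\<bar> * phi x)" for w :: "real^2 => real"
        by (intro integral_nonneg_AE AE_I2) (simp add: phi_nonneg)
      then show "0 <= C1" "0 <= C2" using b1 b2 order.trans by blast+
    qed
    have S_le: "(LINT x|Om. w x * \<bar>hh rho x\<bar>) <= 4 * C"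
      if w: "integrable Om w" "!!x. x \<in> annulus ==> 0 <= w x" "(LINT x|Om. w x * phi x) <= C" for w C
    proof -
      have "(LINT x|Om. w x * \<bar>hh rho x\<bar>) <= (LINT x|Om. 4 * (w x * phi x))"
      proof (rule integral_mono)
        show "integrable Om (\<lambda>x. w x * \<bar>hh rho x\<bar>)"
          by (rule integrable_mult_bounded[OF w(1), where B = 1])
            (auto simp: hh_abs_le(1)[OF rho] intro!: borel_measurable_lebesgue_on)
        show "integrable Om (\<lambda>x. 4 * (w x * phi x))" by (intro integrable_mult_right phi_mult_integrable(1) w(1))
        show "w x * \<bar>hh rho x\<bar> <= 4 * (w x * phi x)" if "x \<in> space Om" for x
          using mult_left_mono[OF hh_phi[OF rho, of x] w(2)[of x]] that by (simp add: mult_ac)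
      qed
      also have "\<dots> <= 4 * C" using w(3) by simp
      finally show ?thesis .
    qed
    have "S1 <= 4 * C1" "S2 <= 4 * C2"
    proof -
      have "(LINT x|Om. f x * phi x) <= C1" "(LINT x|Om. g x * phi x) <= C2" using b1 b2 by (simp_all add: f_def g_def)
      then show "S1 <= 4 * C1" "S2 <= 4 * C2"
        unfolding S1_def S2_def using S_le[OF h1f(1) f0] S_le[OF h2g(1) g0] by blast+
    qed
    then have "K * C1 * S1 <= K * C1 * (4 * C1)" "K * C2 * S2 <= K * C2 * (4 * C2)"
      using K(1) C0 by (intro mult_left_mono; simp)+
    then have "kappa * (X1 + X2) <= 4 * K * C1 * C1 + 4 * K * C2 * C2" using X by (simp add: mult_ac)
    then have Xle: "X1 + X2 <= (4 * K * C1 * C1 + 4 * K * C2 * C2) / kappa"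
      using kappa_pos by (simp add: pos_le_divide_eq mult.commute)
    define N1 where "N1 = (LINT x|Om. indicator (near rho) x * (weight x0 \<beta>1 x * exp (v x)))"
    define N2 where "N2 = (LINT x|Om. indicator (near rho) x * (weight x0 \<beta>2 x * exp (u x)))"
    define F1 where "F1 = (LINT x|Om. weight x0 \<beta>1 x * exp (v x) * phi x)"
    define F2 where "F2 = (LINT x|Om. weight x0 \<beta>2 x * exp (u x) * phi x)"
    have l1: "c1 * N1 - M1 * F1 <= X1"
      using radial_density_lower_bound(1)[OF rho x0 \<beta>(1) a(1) s1 i1] by (simp only: c1_def M1_def N1_def F1_def X1_def)
    have l2: "c2 * N2 - M2 * F2 <= X2"
      using radial_density_lower_bound(1)[OF rho x0 \<beta>(2) a(2) s2 i2] by (simp only: c2_def M2_def N2_def F2_def X2_def)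
    have F: "M1 * F1 <= \<bar>M1\<bar> * C1" "M2 * F2 <= \<bar>M2\<bar> * C2"
    proof -
      have "0 <= F1" "0 <= F2" unfolding F1_def F2_def
        by (intro integral_nonneg_AE AE_I2; simp add: phi_nonneg weight_nonneg)+
      moreover have "F1 <= C1" "F2 <= C2" using b1 b2 by (simp_all add: F1_def F2_def)
      ultimately show "M1 * F1 <= \<bar>M1\<bar> * C1" "M2 * F2 <= \<bar>M2\<bar> * C2" by (intro mult_mono; simp)+
    qed
    have "0 <= N2" unfolding N2_def by (intro integral_nonneg_AE AE_I2) (simp add: weight_nonneg)
    then have "0 <= c2 * N2" using c by simp
    then have "c1 * N1 <= \<bar>M1\<bar> * C1 + \<bar>M2\<bar> * C2 + (4 * K * C1 * C1 + 4 * K * C2 * C2) / kappa"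
      using l1 l2 F Xle by linarith
    then show "N1 <= (\<bar>M1\<bar> * C1 + \<bar>M2\<bar> * C2 + (4 * K * C1 * C1 + 4 * K * C2 * C2) / kappa) / c1"
      using c by (simp add: pos_le_divide_eq mult.commute)
  qed
qed

text \<open>The inner layer ends at \<open>x \<bullet> x = 3/8\<close> and the outer one begins at
  \<open>1/2\<close>. The closed region between them is compact and inside the open annulus, where
  \<open>phi\<close> is positive.\<close>

lemma phi_bounded_below_between:
  "\<exists>c>0. \<forall>x\<in>annulus. x \<notin> near (1/4) --> x \<notin> near 1 --> c <= phi x"
proof -
  define Z where "Z = closure annulus \<inter> ({x. 3/8 <= x \<bullet> x} \<inter> {x. x \<bullet> x <= 1/2})"
  have cZ: "compact Z" unfolding Z_def
    by (intro compact_Int_closed closed_Int closed_Collect_le continuous_intros) (simp add: annulus_facts(2))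
  have in_Z: "x \<in> Z" if "x \<in> annulus" "x \<notin> near (1/4)" "x \<notin> near 1" for x
    using that annulus_inner[OF that(1)] closure_subset[of annulus] by (auto simp: Z_def near_def abs_le_iff)
  show ?thesis
  proof (cases "Z = {}")
    case False
    have "continuous_on Z phi" using continuous_on_phi by (rule continuous_on_subset) (auto simp: Z_def)
    then obtain z0 where z0: "z0 \<in> Z" "!!z. z \<in> Z ==> phi z0 <= phi z"
      using continuous_attains_inf[OF cZ False] by blast
    have "(1/2)^2 < (norm z0)^2" "(norm z0)^2 < 1^2" using z0(1) by (auto simp: Z_def power2_norm_eq_inner power_divide)
    then have "z0 \<in> annulus" unfolding annulus_def using power_less_imp_less_base[of _ 2] by fastforce
    then show ?thesis using phi_pos[of z0] z0(2) in_Z by blast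
  next
    case True
    then have "\<forall>x\<in>annulus. x \<notin> near (1/4) --> x \<notin> near 1 --> 1 <= phi x" using in_Z by blast
    then show ?thesis using zero_less_one by blast
  qed
qed

text \<open>The two layers are covered by \<open>boundary_layer_mass_bound\<close>; between them
  \<open>phi\<close> is bounded below, and the mass weighted by \<open>phi\<close> is
  enough.\<close>

lemma mass_bound:
  fixes b1 b2 :: real
  assumes x0: "norm x0 = 1/2" and \<beta>: "\<beta>1 > -1/2" "\<beta>2 > -1/2" and a: "0 < a1" "0 < a2"
  shows "\<exists>C. \<forall>V W u v. full_system x0 \<beta>1 a1 b1 A1 \<beta>2 a2 b2 A2 V W u v -->
    (LINT x|Om. weight x0 \<beta>1 x * exp (v x)) <= C"
proof -
  have s: "side (1/4)" "side 1" by (simp_all add: side_def)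
  obtain C1 where C1: "!!V W u v. full_system x0 \<beta>1 a1 b1 A1 \<beta>2 a2 b2 A2 V W u v ==>
      (LINT x|Om. indicator (near (1/4)) x * (weight x0 \<beta>1 x * exp (v x))) <= C1"
    using boundary_layer_mass_bound[OF s(1) x0 \<beta> a, of b1 A1 b2 A2] by blast
  obtain C2 where C2: "!!V W u v. full_system x0 \<beta>1 a1 b1 A1 \<beta>2 a2 b2 A2 V W u v ==>
      (LINT x|Om. indicator (near 1) x * (weight x0 \<beta>1 x * exp (v x))) <= C2"
    using boundary_layer_mass_bound[OF s(2) x0 \<beta> a, of b1 A1 b2 A2] by blast
  obtain C3 where C3: "!!V W u v. full_system x0 \<beta>1 a1 b1 A1 \<beta>2 a2 b2 A2 V W u v ==>
      (LINT x|Om. weight x0 \<beta>1 x * exp (v x) * phi x) <= C3"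
    using full_system_weighted_bound[OF x0 a, of \<beta>1 \<beta>2] by blast
  obtain c where c: "c > 0" "!!x. x \<in> annulus ==> x \<notin> near (1/4) ==> x \<notin> near 1 ==> c <= phi x"
    using phi_bounded_below_between by blast
  show ?thesis
  proof (intro exI[of _ "C1 + C2 + C3 / c"] allI impI)
    fix V W u v assume sys: "full_system x0 \<beta>1 a1 b1 A1 \<beta>2 a2 b2 A2 V W u v"
    then have s1: "half_system x0 \<beta>1 a1 b1 A1 V u v" by (simp add: full_system_def)
    define w where "w x = weight x0 \<beta>1 x * exp (v x)" for x
    have wi: "integrable Om w" unfolding w_def[abs_def] by (rule half_systemD(6)[OF s1 a(1)])
    have w0: "0 <= w x" for x by (simp add: w_def weight_nonneg)
    have Ii: "integrable Om (\<lambda>x. indicator (near rho) x * w x)" for rho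
    proof -
      have Im: "(\<lambda>x. indicator (near rho) x :: real) \<in> borel_measurable Om"
        by (rule borel_measurable_lebesgue_on) measurable
      have "integrable Om (\<lambda>x. w x * indicator (near rho) x)"
        by (rule integrable_mult_bounded[OF wi Im, where B = 1]) (simp add: indicator_def)
      then show ?thesis by (simp add: mult.commute)
    qed
    note pi = phi_mult_integrable(1)[OF wi]
    have "(LINT x|Om. w x) <= (LINT x|Om. indicator (near (1/4)) x * w x + indicator (near 1) x * w x + w x * phi x / c)"
    proof (rule integral_mono[OF wi])
      show "integrable Om (\<lambda>x. indicator (near (1/4)) x * w x + indicator (near 1) x * w x + w x * phi x / c)"
        by (intro Bochner_Integration.integrable_add Ii integrable_divide pi)
      fix x assume "x \<in> space Om"
      then have x: "x \<in> annulus" by simp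
      have p: "0 <= w x * phi x / c" using c(1) phi_nonneg[OF x] w0 by simp
      show "w x <= indicator (near (1/4)) x * w x + indicator (near 1) x * w x + w x * phi x / c"
      proof (cases "x \<in> near (1/4) \<or> x \<in> near 1")
        case True
        then show ?thesis using p w0[of x] by (auto simp: indicator_def)
      next
        case False
        then have "w x * c <= w x * phi x" using c(2)[OF x] w0[of x] by (intro mult_left_mono) auto
        then have "w x <= w x * phi x / c" using c(1) by (simp add: pos_le_divide_eq)
        then show ?thesis using False by simp
      qed
    qed
    also have "\<dots> = (LINT x|Om. indicator (near (1/4)) x * w x) + (LINT x|Om. indicator (near 1) x * w x) + (LINT x|Om. w x * phi x) / c"
      by (simp only: Bochner_Integration.integral_add Bochner_Integration.integrable_add Ii integrable_divide pi integral_divide_zero)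
    also have "\<dots> <= C1 + C2 + C3 / c"
      using C1[OF sys] C2[OF sys] C3[OF sys] c(1) unfolding w_def by (intro add_mono divide_right_mono) auto
    finally show "(LINT x|Om. weight x0 \<beta>1 x * exp (v x)) <= C1 + C2 + C3 / c" by (simp add: w_def)
  qed
qed

theorem theorem1p3:
  fixes x0 :: "real ^ 2" and \<beta> a b c d :: real
  assumes "norm x0 = 1/2"
    and "\<beta> > - 1/2"
    and "0 < a" and "0 < b" and "0 < c" and "0 < d"
  shows "\<exists>C C' :: real. \<forall>V W u v :: real ^ 2 \<Rightarrow> real.
     (\<exists>L. L-lipschitz_on annulus V) \<and> (\<exists>L. L-lipschitz_on annulus W) \<and>
     (\<forall>x\<in>annulus. a \<le> V x \<and> V x \<le> b) \<and>
     (\<exists>G. has_weak_gradient annulus V G \<and>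
          Linfty_norm annulus G \<le> ereal ((\<beta> + 1) * a / 2)) \<and>
     (\<forall>x\<in>annulus. c \<le> W x \<and> W x \<le> d) \<and>
     (\<exists>G. has_weak_gradient annulus W G \<and>
          Linfty_norm annulus G \<le> ereal (c / 2)) \<and>
     u \<in> W11_0 annulus \<and> v \<in> W11_0 annulus \<and>
     integrable (lebesgue_on annulus) (\<lambda>x. exp (u x)) \<and>
     integrable (lebesgue_on annulus) (\<lambda>x. norm (x - x0) powr (2 * \<beta>) * exp (v x)) \<and>
     neg_laplacian_distr annulus u (\<lambda>x. norm (x - x0) powr (2 * \<beta>) * V x * exp (v x)) \<and>
     neg_laplacian_distr annulus v (\<lambda>x. W x * exp (u x))
     \<longrightarrow>
     (LINT x|lebesgue_on annulus. exp (u x)) \<le> C \<and>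
     (LINT x|lebesgue_on annulus. norm (x - x0) powr (2 * \<beta>) * exp (v x)) \<le> C'"
proof -
  note x0 = assms(1)
  define S where "S V W u v \<longleftrightarrow> full_system x0 \<beta> a b ((\<beta> + 1) * a / 2) 0 c d (c / 2) V W u v" for V W u v
  obtain C' where C': "!!V W u v. S V W u v ==> (LINT x|Om. weight x0 \<beta> x * exp (v x)) <= C'"
    unfolding S_def using mass_bound[OF x0, of \<beta> 0 a c b "(\<beta> + 1) * a / 2" d "c / 2"] assms by auto
  \<comment> \<open>The bound for \<open>u\<close> is \<open>mass_bound\<close> for the system with
    its halves exchanged.\<close>
  obtain C where C: "!!V W u v. S V W u v ==> (LINT x|Om. weight x0 0 x * exp (u x)) <= C"
    unfolding S_def
    using mass_bound[OF x0, of 0 \<beta> c a d "c / 2" b "(\<beta> + 1) * a / 2"] assms full_system_sym[of x0 \<beta>] by (auto, blast)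
  \<comment> \<open>At \<open>x0\<close> itself the weight would be \<open>0 powr 0\<close>, which
    is 0; the identity holds on the annulus because \<open>x0\<close> lies on its boundary.\<close>
  have w0: "weight x0 0 x = 1" if "x \<in> annulus" for x
    using that x0 by (auto simp: weight_def annulus_def)
  have one: "(LINT x|Om. weight x0 0 x * h x) = (LINT x|Om. h x)"
    "integrable Om (\<lambda>x. weight x0 0 x * h x) \<longleftrightarrow> integrable Om h" for h :: "real^2 => real"
    by (intro Bochner_Integration.integral_cong Bochner_Integration.integrable_cong; simp add: w0)+
  have loc: "neg_laplacian_distr annulus w (\<lambda>x. weight x0 0 x * h x)"
    if "neg_laplacian_distr annulus w h" for w h :: "real^2 => real"
  proof -
    have "locally_integrable annulus (\<lambda>x. weight x0 0 x * h x)"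
      unfolding locally_integrable_def
    proof (intro allI impI)
      fix K assume K: "compact K \<and> K \<subseteq> annulus"
      have "integrable (lebesgue_on K) h" using that K by (simp add: neg_laplacian_distr_def locally_integrable_def)
      moreover have "integrable (lebesgue_on K) (\<lambda>x. weight x0 0 x * h x) \<longleftrightarrow> integrable (lebesgue_on K) h"
        using K w0 by (intro Bochner_Integration.integrable_cong) auto
      ultimately show "integrable (lebesgue_on K) (\<lambda>x. weight x0 0 x * h x)" by simp
    qed
    then show ?thesis using that by (simp add: neg_laplacian_distr_def one mult.assoc)
  qed
  show ?thesis
  proof (rule exI[of _ C], rule exI[of _ C'], intro allI impI)
    fix V W u v :: "real ^ 2 => real"
    assume h: "(\<exists>L. L-lipschitz_on annulus V) \<and> (\<exists>L. L-lipschitz_on annulus W) \<and>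
     (\<forall>x\<in>annulus. a <= V x \<and> V x <= b) \<and>
     (\<exists>G. has_weak_gradient annulus V G \<and> Linfty_norm annulus G <= ereal ((\<beta> + 1) * a / 2)) \<and>
     (\<forall>x\<in>annulus. c <= W x \<and> W x <= d) \<and>
     (\<exists>G. has_weak_gradient annulus W G \<and> Linfty_norm annulus G <= ereal (c / 2)) \<and>
     u \<in> W11_0 annulus \<and> v \<in> W11_0 annulus \<and>
     integrable Om (\<lambda>x. exp (u x)) \<and>
     integrable Om (\<lambda>x. norm (x - x0) powr (2 * \<beta>) * exp (v x)) \<and>
     neg_laplacian_distr annulus u (\<lambda>x. norm (x - x0) powr (2 * \<beta>) * V x * exp (v x)) \<and>
     neg_laplacian_distr annulus v (\<lambda>x. W x * exp (u x))"
    have "S V W u v"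
      unfolding S_def full_system_def half_system_def one(2)
      using h loc[of v "\<lambda>x. W x * exp (u x)"] by (simp add: weight_def mult.assoc)
    from C[OF this] C'[OF this]
    show "(LINT x|Om. exp (u x)) <= C \<and> (LINT x|Om. norm (x - x0) powr (2 * \<beta>) * exp (v x)) <= C'"
      unfolding one by (simp add: weight_def)
  qed
qed

end
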